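(* There exists $\epsilon_0>0$ such that the following holds. For every $\alpha\in[0,1)$ there is a family $\{F_\epsilon\}_{0<\epsilon<\epsilon_0}$ of odd functions $F_\epsilon\in C^\infty(\mathbb{R})$ such that for every $0<\epsilon<\epsilon_0$ there is a smooth function $\psi_\epsilon$ on $\mathbb{T}^2$ which is odd-odd and satisfies $$\psi_\epsilon=\Delta^{-1}\big(F_\epsilon(\psi_\epsilon)\big)\quad\text{on }\mathbb{T}^2 .$$ Moreover, for $0<\epsilon<\epsilon_0$ one has $\|\Delta\psi_\epsilon\|_{L^\infty(\mathbb{T}^2)}\le 1$, the map $\epsilon\mapsto\psi_\epsilon$ is $C^\infty$ with respect to $\epsilon$ in the topology of $C^\infty(\mathbb{T}^2)$, and $$\lim_{\epsilon\to0}\|\psi_\epsilon-\psi_0\|_{C^{1,\alpha}(\mathbb{T}^2)}=0.$$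
   Context: $\mathbb{T}^2=[-\tfrac12,\tfrac12]^2$ with opposite sides identified (flat torus). A function $\psi(x,y)$ is odd-odd if it is odd in $x$ and odd in $y$. $\Delta^{-1}$ denotes the inverse of the Laplacian on mean-zero functions on $\mathbb{T}^2$, i.e. convolution with the torus Green's function $G(x,y)=\frac{1}{2\pi}\ln|x-y|+f(x-y)$ with $f$ smooth and $|x-y|$ the torus distance. $\mathrm{sgn}(t)=1$ for $t>0$ and $\mathrm{sgn}(t)=-1$ for $t\le0$. $\psi_0=\Delta^{-1}[\mathrm{sgn}(x)\mathrm{sgn}(y)]$ (with $(x,y)\in[-\tfrac12,\tfrac12)^2$, extended periodically) is the stream function of the Bahouri–Chemin patch; it satisfies $\Delta\psi_0=-\mathrm{sgn}(\psi_0)$. *)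

theory Defs
  imports "HOL-Analysis.Analysis"
begin

text \<open>Functions on the flat torus T^2 = [-1/2,1/2]^2 (sides identified) are represented
  as functions on R^2 = real \<times> real that are 1-periodic in each variable.\<close>

definition periodic2 :: "(real \<times> real \<Rightarrow> 'b) \<Rightarrow> bool" where
  "periodic2 f \<longleftrightarrow> (\<forall>x y. f (x + 1, y) = f (x, y) \<and> f (x, y + 1) = f (x, y))"

definition odd_odd :: "(real \<times> real \<Rightarrow> real) \<Rightarrow> bool" where
  "odd_odd f \<longleftrightarrow> (\<forall>x y. f (-x, y) = - f (x, y) \<and> f (x, -y) = - f (x, y))"

fun C_k_on :: "'a::real_normed_vector set \<Rightarrow> ('a \<Rightarrow> real) \<Rightarrow> nat \<Rightarrow> bool" where
  "C_k_on S f 0 \<longleftrightarrow> continuous_on S f"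
| "C_k_on S f (Suc n) \<longleftrightarrow> (\<forall>x\<in>S. f differentiable (at x)) \<and>
      (\<forall>v. C_k_on S (\<lambda>x. frechet_derivative f (at x) v) n)"

definition smooth_on :: "'a::real_normed_vector set \<Rightarrow> ('a \<Rightarrow> real) \<Rightarrow> bool" where
  "smooth_on S f \<longleftrightarrow> (\<forall>n. C_k_on S f n)"

definition torus_smooth :: "(real \<times> real \<Rightarrow> real) \<Rightarrow> bool" where
  "torus_smooth f \<longleftrightarrow> periodic2 f \<and> smooth_on UNIV f"

definition dx :: "(real \<times> real \<Rightarrow> real) \<Rightarrow> real \<times> real \<Rightarrow> real" where
  "dx f p = frechet_derivative f (at p) (1, 0)"

definition dy :: "(real \<times> real \<Rightarrow> real) \<Rightarrow> real \<times> real \<Rightarrow> real" where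
  "dy f p = frechet_derivative f (at p) (0, 1)"

definition laplacian :: "(real \<times> real \<Rightarrow> real) \<Rightarrow> real \<times> real \<Rightarrow> real" where
  "laplacian f p = dx (dx f) p + dy (dy f) p"

definition torus_square :: "(real \<times> real) set" where
  "torus_square = {-1/2..1/2} \<times> {-1/2..1/2}"

text \<open>psi = Delta^{-1} g on T^2 (g of mean zero): psi is the continuous periodic mean-zero
  function with Delta psi = g in the sense of distributions on T^2 (for smooth psi this is
  the classical equation; it is the same as convolution with the torus Green's function).\<close>
definition is_inv_laplacian :: "(real \<times> real \<Rightarrow> real) \<Rightarrow> (real \<times> real \<Rightarrow> real) \<Rightarrow> bool" where
  "is_inv_laplacian g \<psi> \<longleftrightarrow> periodic2 \<psi> \<and> continuous_on UNIV \<psi> \<and>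
     integral torus_square \<psi> = 0 \<and>
     (\<forall>\<phi>. torus_smooth \<phi> \<longrightarrow>
        integral torus_square (\<lambda>p. \<psi> p * laplacian \<phi> p) = integral torus_square (\<lambda>p. g p * \<phi> p))"

definition inv_laplacian :: "(real \<times> real \<Rightarrow> real) \<Rightarrow> real \<times> real \<Rightarrow> real" where
  "inv_laplacian g = (THE \<psi>. is_inv_laplacian g \<psi>)"

definition sgnm :: "real \<Rightarrow> real" where
  "sgnm t = (if t > 0 then 1 else -1)"

definition wrap :: "real \<Rightarrow> real" where
  "wrap t = t - of_int \<lfloor>t + 1/2\<rfloor>"

definition bc_vorticity :: "real \<times> real \<Rightarrow> real" where
  "bc_vorticity p = sgnm (wrap (fst p)) * sgnm (wrap (snd p))"

text \<open>Stream function of the Bahouri--Chemin patch.\<close>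
definition psi0 :: "real \<times> real \<Rightarrow> real" where
  "psi0 = inv_laplacian bc_vorticity"

text \<open>C^{1,alpha}(T^2) norm (value \<infinity> if f is not C^1). For periodic functions the Hoelder
  quotient over R^2 with Euclidean distance equals that with the torus distance.\<close>
definition holder_semi :: "real \<Rightarrow> (real \<times> real \<Rightarrow> real) \<Rightarrow> ereal" where
  "holder_semi \<alpha> g = (SUP pq \<in> {pq. fst pq \<noteq> snd pq}.
      ereal (\<bar>g (fst pq) - g (snd pq)\<bar> / dist (fst pq) (snd pq) powr \<alpha>))"

definition C1alpha_norm :: "real \<Rightarrow> (real \<times> real \<Rightarrow> real) \<Rightarrow> ereal" where
  "C1alpha_norm \<alpha> f =
    (if C_k_on UNIV f 1 then
       (SUP p. ereal \<bar>f p\<bar>) + (SUP p. ereal \<bar>dx f p\<bar>) + (SUP p. ereal \<bar>dy f p\<bar>)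
       + holder_semi \<alpha> (dx f) + holder_semi \<alpha> (dy f)
     else \<infinity>)"

end

theory Submission
  imports Defs "HOL-Probability.Probability" "HOL-Real_Asymp.Real_Asymp"
begin

text \<open>With $u = -\psi$ and $f_e(t) = t/\sqrt{e + t^2}$ (so $F_e = -f_e$), the equation reads
  $u = R(u + f_e(u))$, where $R = (1 - \Delta)^{-1}$ preserves positivity of odd-odd functions on the
  quarter $[0, 1/2]^2$. There a small multiple of $\sin(2\pi x)\sin(2\pi y)$ is a subsolution and
  $x(1/2 - x)$ a supersolution, so monotone iteration yields a solution $u_e$, decreasing in $e$.
  Since $f - t f' = f^3$, the solution is itself a strict positive supersolution of the linearised
  equation; this gives an a priori bound for the linearised problem, whence smooth dependence
  on $e$ by bootstrapping through $R$. As $e$ tends to 0 the $u_e$ increase to a limit that is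
  positive inside the quarter, so $f_e(u_e)$ tends to the Bahouri-Chemin vorticity (up to sign) and
  uniqueness of the inverse Laplacian identifies the limit as $-\psi_0$. The bound $|f_e| \le 1$
  controls the gradients in every $C^\beta$, $\beta < 1$, and interpolation gives convergence in
  $C^{1,\alpha}$.\<close>

subsection \<open>Calculus of finitely often differentiable functions\<close>

text \<open>The obstacle is the slope of \<open>fe e\<close> at 0, which equals
  \<open>1 / sqrt e\<close> and destroys contraction arguments as e tends to 0. Uniform statements
  therefore rest on order: \<open>fe e\<close> increases in t and, for t \<ge> 0, decreases in e.
  Statements about the dependence on e are proved for e \<ge> e1, with constants that may blow up
  with e1. Passing from \<Delta> to 1 - \<Delta> makes the inverse an absolutely convergent Gaussian
  average, defined without a mean condition; regularity, symmetry and Hoelder bounds are all read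
  off one formula. No spectral or Fredholm theory enters: derivatives in e are limits of difference
  quotients, which the a priori bound shows to be Cauchy. That bound compares functions with the
  solution near the sides of the quarter, where both vanish; the comparison goes through
  \<open>ss\<close>, which dominates the product of the distances to the nearest sides. The
  nonlinearity is algebraic, so its divided differences in t and e are exact rational expressions in
  \<open>qe\<close> and no Taylor remainder has to be estimated.\<close>

lemma frechet_derivative_eqI:
  "(f has_derivative f') (at x) \<Longrightarrow> frechet_derivative f (at x) = f'"
  using frechet_derivative_at by metis

lemma C_k_on_cong:
  assumes "open S" "C_k_on S f k" "\<And>x. x \<in> S \<Longrightarrow> f x = g x"
  shows "C_k_on S g k"
  using assms(2,3)
proof (induction k arbitrary: f g)
  case 0
  then show ?case by (metis C_k_on.simps(1) continuous_on_cong)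
next
  case (Suc k)
  have d: "(g has_derivative frechet_derivative f (at x)) (at x)" if "x \<in> S" for x
  proof -
    have "(f has_derivative frechet_derivative f (at x)) (at x)"
      using Suc.prems that frechet_derivative_works by auto
    then show ?thesis
      by (rule has_derivative_transform_within_open[OF _ \<open>open S\<close> that]) (use Suc.prems in auto)
  qed
  have "C_k_on S (\<lambda>x. frechet_derivative g (at x) v) k" for v
    by (rule Suc.IH[of "\<lambda>x. frechet_derivative f (at x) v"])
      (use Suc.prems d frechet_derivative_eqI in \<open>auto simp: frechet_derivative_eqI[OF d]\<close>)
  then show ?case using d by (auto simp: differentiable_def)
qed

lemma C_k_on_continuous: "C_k_on S f k \<Longrightarrow> continuous_on S f"
  by (cases k) (auto intro!: continuous_at_imp_continuous_on differentiable_imp_continuous_within)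

lemma C_k_on_SucD: "C_k_on S f (Suc k) \<Longrightarrow> C_k_on S f k"
proof (induction k arbitrary: f)
  case 0
  then show ?case using C_k_on_continuous by (metis C_k_on.simps(1))
next
  case (Suc k)
  then show ?case by (metis C_k_on.simps(2))
qed

lemma C_k_on_SucI:
  assumes "open S" "\<And>x. x \<in> S \<Longrightarrow> (f has_derivative f' x) (at x)"
    "\<And>v. C_k_on S (\<lambda>x. f' x v) k"
  shows "C_k_on S f (Suc k)"
proof -
  have "C_k_on S (\<lambda>x. frechet_derivative f (at x) v) k" for v
    by (rule C_k_on_cong[OF assms(1) assms(3)[of v]]) (simp add: frechet_derivative_eqI[OF assms(2)])
  then show ?thesis using assms(2) by (auto simp: differentiable_def)
qed

lemma C_k_on_has_derivative:
  "C_k_on S f (Suc k) \<Longrightarrow> x \<in> S \<Longrightarrow> (f has_derivative frechet_derivative f (at x)) (at x)"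
  using frechet_derivative_works by auto

lemma C_k_on_frechet_derivative:
  "C_k_on S f (Suc k) \<Longrightarrow> C_k_on S (\<lambda>x. frechet_derivative f (at x) v) k"
  by simp

lemma C_k_on_const: "open S \<Longrightarrow> C_k_on S (\<lambda>x. c) k"
  by (induction k arbitrary: c) (auto simp: frechet_derivative_const)

lemma C_k_on_add:
  assumes "open S" "C_k_on S f k" "C_k_on S g k"
  shows "C_k_on S (\<lambda>x. f x + g x) k"
  using assms(2,3)
proof (induction k arbitrary: f g)
  case 0
  then show ?case by (auto intro: continuous_intros)
next
  case (Suc k)
  note f = C_k_on_has_derivative[OF Suc.prems(1)] C_k_on_frechet_derivative[OF Suc.prems(1)]
  note g = C_k_on_has_derivative[OF Suc.prems(2)] C_k_on_frechet_derivative[OF Suc.prems(2)]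
  show ?case
    by (rule C_k_on_SucI[OF assms(1) has_derivative_add[OF f(1) g(1)]]) (auto intro: Suc.IH f g)
qed

lemma C_k_on_mult:
  assumes "open S" "C_k_on S f k" "C_k_on S g k"
  shows "C_k_on S (\<lambda>x. f x * g x) k"
  using assms(2,3)
proof (induction k arbitrary: f g)
  case 0
  then show ?case by (auto intro: continuous_intros)
next
  case (Suc k)
  note f = C_k_on_has_derivative[OF Suc.prems(1)] C_k_on_frechet_derivative[OF Suc.prems(1)]
  note g = C_k_on_has_derivative[OF Suc.prems(2)] C_k_on_frechet_derivative[OF Suc.prems(2)]
  have fg: "C_k_on S f k" "C_k_on S g k" using Suc.prems C_k_on_SucD by auto
  show ?case
    by (rule C_k_on_SucI[OF assms(1) has_derivative_mult[OF f(1) g(1)]])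
      (auto intro!: Suc.IH C_k_on_add[OF assms(1)] f g fg)
qed

lemma C_k_on_cmult: "open S \<Longrightarrow> C_k_on S f k \<Longrightarrow> C_k_on S (\<lambda>x. c * f x) k"
  by (intro C_k_on_mult C_k_on_const)

lemma C_k_on_minus: "open S \<Longrightarrow> C_k_on S f k \<Longrightarrow> C_k_on S (\<lambda>x. - f x) k"
  using C_k_on_cmult[of S f k "-1"] by simp

lemma C_k_on_diff:
  "open S \<Longrightarrow> C_k_on S f k \<Longrightarrow> C_k_on S g k \<Longrightarrow> C_k_on S (\<lambda>x. f x - g x) k"
  using C_k_on_add[of S f k "\<lambda>x. - g x"] C_k_on_minus by auto

lemma C_k_on_power: "open S \<Longrightarrow> C_k_on S f k \<Longrightarrow> C_k_on S (\<lambda>x. f x ^ n) k"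
  by (induction n) (auto intro: C_k_on_mult C_k_on_const)

text \<open>The derivative of 1/sqrt f is a constant times f' times the cube of 1/sqrt f itself. The
  induction on k thus closes under products, without a general chain rule for C^k functions.\<close>

lemma C_k_on_inverse_sqrt:
  assumes "open S" "C_k_on S f k" "\<And>x. x \<in> S \<Longrightarrow> f x > 0"
  shows "C_k_on S (\<lambda>x. 1 / sqrt (f x)) k"
  using assms(2)
proof (induction k)
  case 0
  then show ?case using assms(3) by (force intro!: continuous_intros)
next
  case (Suc k)
  note f = C_k_on_has_derivative[OF Suc.prems(1)] C_k_on_frechet_derivative[OF Suc.prems(1)]
  have d: "((\<lambda>x. 1 / sqrt (f x)) has_derivative
      (\<lambda>v. - (1/2) * (frechet_derivative f (at x) v * (1 / sqrt (f x)) ^ 3))) (at x)" if "x \<in> S" for x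
  proof -
    have "((\<lambda>t. 1 / sqrt t) has_real_derivative - (1/2) * (1 / sqrt (f x)) ^ 3) (at (f x))"
      using assms(3)[OF that]
      by (auto intro!: derivative_eq_intros simp: field_simps power3_eq_cube)
    then have "((\<lambda>t. 1 / sqrt t) has_derivative (*) (- (1/2) * (1 / sqrt (f x)) ^ 3)) (at (f x))"
      by (simp add: has_field_derivative_def)
    from has_derivative_compose[OF f(1)[OF that] this] show ?thesis by (simp add: mult_ac)
  qed
  show ?case
    by (rule C_k_on_SucI[OF assms(1) d])
     (assumption, intro C_k_on_cmult[OF assms(1)] C_k_on_mult[OF assms(1)]
        C_k_on_power[OF assms(1)] Suc.IH C_k_on_SucD[OF Suc.prems] f)
qed

text \<open>For an affine inner map the derivative in direction v is the derivative of f in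
  direction L v, composed with the same map, so the induction reproduces its own form. It serves for
  slices, for adding a dummy variable and for exchanging coordinates.\<close>

lemma C_k_on_affine:
  assumes "open T" "bounded_linear L" "\<And>x. x \<in> T \<Longrightarrow> L x + c \<in> S" "C_k_on S f k"
  shows "C_k_on T (\<lambda>x. f (L x + c)) k"
  using assms(4)
proof (induction k arbitrary: f)
  case 0
  then have "continuous_on S f" by simp
  then show ?case
    using assms(3) by (auto intro!: continuous_on_compose2[of S f] continuous_on_add continuous_on_const
      bounded_linear.continuous_on[OF assms(2)] continuous_on_id)
next
  case (Suc k)
  note f = C_k_on_has_derivative[OF Suc.prems(1)] C_k_on_frechet_derivative[OF Suc.prems(1)]
  have d: "((\<lambda>x. f (L x + c)) has_derivative (\<lambda>v. frechet_derivative f (at (L x + c)) (L v))) (at x)"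
    if "x \<in> T" for x
  proof -
    have "((\<lambda>x. L x + c) has_derivative L) (at x)"
      using bounded_linear_imp_has_derivative[OF assms(2)] by (auto intro!: derivative_eq_intros)
    from has_derivative_compose[OF this f(1)[OF assms(3)[OF that]]] show ?thesis .
  qed
  show ?case
    by (rule C_k_on_SucI[OF assms(1) d]) (auto intro!: Suc.IH f)
qed

section \<open>Joint differentiability from partial derivatives\<close>

lemma has_derivative_of_partials2:
  fixes f :: "real \<times> real \<Rightarrow> real"
  assumes x: "\<And>x y. ((\<lambda>s. f (s, y)) has_real_derivative fx (x, y)) (at x)"
    and y: "\<And>x y. ((\<lambda>s. f (x, s)) has_real_derivative fy (x, y)) (at y)"
    and c: "continuous_on UNIV fy"
  shows "(f has_derivative (\<lambda>v. fst v * fx p + snd v * fy p)) (at p)"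
proof -
  obtain a b where p: "p = (a, b)" by force
  have "((\<lambda>(x, y). f (x, y)) has_derivative
     (\<lambda>(tx, ty). fx (a, b) * tx + blinfun_apply (fy (a, b) *\<^sub>R id_blinfun) ty)) (at (a, b) within UNIV \<times> UNIV)"
  proof (rule has_derivative_partialsI)
    show "((\<lambda>x. f (x, b)) has_derivative (*) (fx (a, b))) (at a within UNIV)"
      using x[of b a] by (simp add: has_field_derivative_def)
    show "((\<lambda>y. f (x, y)) has_derivative blinfun_apply (fy (x, y) *\<^sub>R id_blinfun)) (at y within UNIV)" for x y
      using y[of x y] by (simp add: has_field_derivative_def scaleR_blinfun.rep_eq id_blinfun.rep_eq)
    have "continuous (at (a, b)) fy" using c by (simp add: continuous_on_eq_continuous_at)
    then show "continuous (at (a, b) within UNIV \<times> UNIV) (\<lambda>(x, y). fy (x, y) *\<^sub>R (id_blinfun :: real \<Rightarrow>\<^sub>L real))"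
      by (auto simp: case_prod_unfold intro!: continuous_intros)
  qed auto
  then show ?thesis
    by (simp add: p case_prod_unfold scaleR_blinfun.rep_eq id_blinfun.rep_eq mult.commute)
qed

lemma has_derivative_of_partials3:
  fixes f :: "real \<times> real \<times> real \<Rightarrow> real"
  assumes I: "open I"
    and e: "\<And>e p. e \<in> I \<Longrightarrow> ((\<lambda>s. f (s, p)) has_real_derivative fe (e, p)) (at e)"
    and x: "\<And>e x y. e \<in> I \<Longrightarrow> ((\<lambda>s. f (e, s, y)) has_real_derivative fx (e, x, y)) (at x)"
    and y: "\<And>e x y. e \<in> I \<Longrightarrow> ((\<lambda>s. f (e, x, s)) has_real_derivative fy (e, x, y)) (at y)"
    and c: "continuous_on (I \<times> UNIV) fx" "continuous_on (I \<times> UNIV) fy"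
    and X: "X \<in> I \<times> UNIV"
  shows "(f has_derivative (\<lambda>v. fst v * fe X + (fst (snd v) * fx X + snd (snd v) * fy X))) (at X)"
proof -
  obtain a p where Xp: "X = (a, p)" "a \<in> I" using X by force
  let ?F = "\<lambda>e q. fx (e, q) *\<^sub>R fst_blinfun + fy (e, q) *\<^sub>R (snd_blinfun :: (real \<times> real) \<Rightarrow>\<^sub>L real)"
  have F: "blinfun_apply (?F e q) = (\<lambda>v. fst v * fx (e, q) + snd v * fy (e, q))" for e q
    by (auto simp: plus_blinfun.rep_eq scaleR_blinfun.rep_eq)
  have "((\<lambda>(x, y). f (x, y)) has_derivative
     (\<lambda>(tx, ty). fe (a, p) * tx + blinfun_apply (?F a p) ty)) (at (a, p) within I \<times> UNIV)"
  proof (rule has_derivative_partialsI)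
    show "((\<lambda>x. f (x, p)) has_derivative (*) (fe (a, p))) (at a within I)"
      using e[OF Xp(2), of p] by (simp add: has_field_derivative_def has_derivative_at_withinI)
    show "((\<lambda>y. f (e, y)) has_derivative blinfun_apply (?F e q)) (at q within UNIV)"
      if "e \<in> I" for e q
      unfolding F
    proof (rule has_derivative_of_partials2[where f="\<lambda>q. f (e, q)"])
      show "continuous_on UNIV (\<lambda>q. fy (e, q))"
        by (rule continuous_on_compose2[OF c(2)]) (use that in \<open>auto intro!: continuous_intros\<close>)
    qed (use x y that in auto)
    have "continuous (at (a, p) within I \<times> UNIV) fx" "continuous (at (a, p) within I \<times> UNIV) fy"
      using c X unfolding Xp(1) continuous_on_eq_continuous_within by blast+
    then show "continuous (at (a, p) within I \<times> UNIV) (\<lambda>(e, q). ?F e q)"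
      by (auto simp: case_prod_unfold intro!: continuous_intros)
  qed (use Xp in auto)
  moreover have "at (a, p) within I \<times> UNIV = at (a, p)"
    using I Xp by (intro at_within_open open_Times) auto
  ultimately show ?thesis
    by (simp add: Xp F case_prod_unfold mult.commute)
qed

lemma C_k_on_of_partials3:
  fixes f :: "real \<times> real \<times> real \<Rightarrow> real"
  assumes I: "open I"
    and e: "\<And>e p. e \<in> I \<Longrightarrow> ((\<lambda>s. f (s, p)) has_real_derivative fe (e, p)) (at e)"
    and x: "\<And>e x y. e \<in> I \<Longrightarrow> ((\<lambda>s. f (e, s, y)) has_real_derivative fx (e, x, y)) (at x)"
    and y: "\<And>e x y. e \<in> I \<Longrightarrow> ((\<lambda>s. f (e, x, s)) has_real_derivative fy (e, x, y)) (at y)"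
    and c: "C_k_on (I \<times> UNIV) fe k" "C_k_on (I \<times> UNIV) fx k" "C_k_on (I \<times> UNIV) fy k"
  shows "C_k_on (I \<times> UNIV) f (Suc k)"
proof -
  have o: "open (I \<times> (UNIV :: (real \<times> real) set))" using I by (intro open_Times) auto
  show ?thesis
    by (rule C_k_on_SucI[OF o has_derivative_of_partials3[OF I e x y]])
      (auto intro!: C_k_on_add[OF o] C_k_on_cmult[OF o] c C_k_on_continuous[OF c(2)] C_k_on_continuous[OF c(3)])
qed

lemma C_k_on_of_partials2:
  fixes f :: "real \<times> real \<Rightarrow> real"
  assumes x: "\<And>x y. ((\<lambda>s. f (s, y)) has_real_derivative fx (x, y)) (at x)"
    and y: "\<And>x y. ((\<lambda>s. f (x, s)) has_real_derivative fy (x, y)) (at y)"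
    and c: "C_k_on UNIV fx k" "C_k_on UNIV fy k"
  shows "C_k_on UNIV f (Suc k)"
  by (rule C_k_on_SucI[OF open_UNIV has_derivative_of_partials2[OF x y]])
     (auto intro!: C_k_on_add C_k_on_cmult c C_k_on_continuous[OF c(2)])

lemma C_k_on_partials3:
  fixes f :: "real \<times> real \<times> real \<Rightarrow> real"
  assumes "C_k_on (I \<times> UNIV) f (Suc k)"
  obtains fe fx fy where
    "\<And>e p. e \<in> I \<Longrightarrow> ((\<lambda>s. f (s, p)) has_real_derivative fe (e, p)) (at e)"
    "\<And>e x y. e \<in> I \<Longrightarrow> ((\<lambda>s. f (e, s, y)) has_real_derivative fx (e, x, y)) (at x)"
    "\<And>e x y. e \<in> I \<Longrightarrow> ((\<lambda>s. f (e, x, s)) has_real_derivative fy (e, x, y)) (at y)"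
    "C_k_on (I \<times> UNIV) fe k" "C_k_on (I \<times> UNIV) fx k" "C_k_on (I \<times> UNIV) fy k"
proof -
  let ?D = "\<lambda>v x. frechet_derivative f (at x) v"
  have D: "(f has_derivative frechet_derivative f (at (e, p))) (at (e, p))" if "e \<in> I" for e p
    using C_k_on_has_derivative[OF assms] that by simp
  have lin: "frechet_derivative f (at (e, p)) (t *\<^sub>R v) = t * frechet_derivative f (at (e, p)) v"
    if "e \<in> I" for e p t v
    using linear_cmul[OF has_derivative_linear[OF D[OF that]]] by simp
  have *: "((\<lambda>s. f (g s)) has_real_derivative ?D v (e, p)) (at t)"
    if "e \<in> I" "(g has_derivative (\<lambda>s. s *\<^sub>R v)) (at t)" "g t = (e, p)" for e p g v t
  proof -
    have "((\<lambda>s. f (g s)) has_derivative (\<lambda>s. frechet_derivative f (at (e, p)) (s *\<^sub>R v))) (at t)"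
      using has_derivative_compose[OF that(2), of f] D[OF that(1)] that(3) by simp
    then show ?thesis
      unfolding has_field_derivative_def lin[OF that(1)] by (simp add: mult.commute[of _ "?D v (e, p)"])
  qed
  show thesis
  proof (rule that[of "?D (1, 0, 0)" "?D (0, 1, 0)" "?D (0, 0, 1)"])
    show "((\<lambda>s. f (s, p)) has_real_derivative ?D (1, 0, 0) (e, p)) (at e)" if "e \<in> I" for e p
      by (rule *[OF that]) (auto intro!: derivative_eq_intros simp: zero_prod_def)
    show "((\<lambda>s. f (e, s, y)) has_real_derivative ?D (0, 1, 0) (e, x, y)) (at x)" if "e \<in> I" for e x y
      by (rule *[OF that]) (auto intro!: derivative_eq_intros simp: zero_prod_def)
    show "((\<lambda>s. f (e, x, s)) has_real_derivative ?D (0, 0, 1) (e, x, y)) (at y)" if "e \<in> I" for e x y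
      by (rule *[OF that]) (auto intro!: derivative_eq_intros simp: zero_prod_def)
  qed (use assms in auto)
qed

section \<open>Slice derivatives of functions on the plane\<close>

lemma has_real_derivative_dx:
  assumes "f differentiable (at (x, y))"
  shows "((\<lambda>s. f (s, y)) has_real_derivative dx f (x, y)) (at x)"
proof -
  have D: "(f has_derivative frechet_derivative f (at (x, y))) (at (x, y))"
    using assms frechet_derivative_works by auto
  have "((\<lambda>s. (s, y)) has_derivative (\<lambda>s. (s, 0))) (at x)" by (auto intro!: derivative_eq_intros)
  from has_derivative_compose[OF this D] have
    "((\<lambda>s. f (s, y)) has_derivative (\<lambda>s. frechet_derivative f (at (x, y)) (s *\<^sub>R (1, 0)))) (at x)" by simp
  moreover have "(\<lambda>s. frechet_derivative f (at (x, y)) (s *\<^sub>R (1, 0))) = (*) (dx f (x, y))"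
    unfolding dx_def by (auto simp: fun_eq_iff linear_cmul[OF has_derivative_linear[OF D]] simp del: scaleR_Pair)
  ultimately show ?thesis by (simp add: has_field_derivative_def)
qed

lemma has_real_derivative_dy:
  assumes "f differentiable (at (x, y))"
  shows "((\<lambda>s. f (x, s)) has_real_derivative dy f (x, y)) (at y)"
proof -
  have D: "(f has_derivative frechet_derivative f (at (x, y))) (at (x, y))"
    using assms frechet_derivative_works by auto
  have "((\<lambda>s. (x, s)) has_derivative (\<lambda>s. (0, s))) (at y)" by (auto intro!: derivative_eq_intros)
  from has_derivative_compose[OF this D] have
    "((\<lambda>s. f (x, s)) has_derivative (\<lambda>s. frechet_derivative f (at (x, y)) (s *\<^sub>R (0, 1)))) (at y)" by simp
  moreover have "(\<lambda>s. frechet_derivative f (at (x, y)) (s *\<^sub>R (0, 1))) = (*) (dy f (x, y))"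
    unfolding dy_def by (auto simp: fun_eq_iff linear_cmul[OF has_derivative_linear[OF D]] simp del: scaleR_Pair)
  ultimately show ?thesis by (simp add: has_field_derivative_def)
qed

lemma dx_eqI:
  assumes "f differentiable (at (x, y))" "((\<lambda>s. f (s, y)) has_real_derivative d) (at x)"
  shows "dx f (x, y) = d"
  using has_real_derivative_dx[OF assms(1)] assms(2) DERIV_unique by blast

lemma dy_eqI:
  assumes "f differentiable (at (x, y))" "((\<lambda>s. f (x, s)) has_real_derivative d) (at y)"
  shows "dy f (x, y) = d"
  using has_real_derivative_dy[OF assms(1)] assms(2) DERIV_unique by blast

lemma C_k_on_slice:
  fixes f :: "real \<times> real \<times> real \<Rightarrow> real"
  assumes "C_k_on (I \<times> UNIV) f k" "e \<in> I"
  shows "C_k_on UNIV (\<lambda>p. f (e, p)) k"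
proof -
  have "bounded_linear (\<lambda>p::real \<times> real. (0::real, p))"
    by (intro bounded_linear_Pair bounded_linear_zero bounded_linear_ident)
  from C_k_on_affine[OF open_UNIV this, of "(e, 0)", OF _ assms(1)] show ?thesis using assms(2) by simp
qed

lemma C_k_on_extend:
  fixes f :: "real \<times> real \<Rightarrow> real"
  assumes "C_k_on UNIV f k"
  shows "C_k_on (UNIV \<times> UNIV) (\<lambda>X::real \<times> real \<times> real. f (snd X)) k"
  using C_k_on_affine[OF open_UNIV bounded_linear_snd, of 0 UNIV f k] assms by simp

lemma C_k_on_dx: "C_k_on UNIV f (Suc k) \<Longrightarrow> C_k_on UNIV (dx f) k"
  and C_k_on_dy: "C_k_on UNIV f (Suc k) \<Longrightarrow> C_k_on UNIV (dy f) k"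
  unfolding dx_def dy_def by auto

lemma C_k_on_differentiable: "C_k_on UNIV f (Suc k) \<Longrightarrow> f differentiable (at p)"
  by auto

subsection \<open>Gaussian representation of the resolvent\<close>

text \<open>Substituting $s = r^2/2$ in $(1 - \Delta)^{-1} = \int_0^\infty e^{-s} e^{s\Delta} ds$ gives
  $(1 - \Delta)^{-1} g(p) = \int r\, g(p + r z)$, with $r$ distributed according to $e^{-r^2/2} dr$
  and $z$ Gaussian in the plane; weight $r$ in the operator below is thus the resolvent, and by
  Gaussian integration by parts the weights $z_1$, $z_2$ are its partial derivatives.\<close>

definition radial :: "real measure" where
  "radial = density lborel (\<lambda>r. ennreal (indicator {0<..} r * exp (- r\<^sup>2 / 2)))"

abbreviation "gauss \<equiv> std_normal_distribution"

abbreviation "gauss2 \<equiv> gauss \<Otimes>\<^sub>M gauss"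

definition rmeas :: "(real \<times> real \<times> real) measure" where
  "rmeas = radial \<Otimes>\<^sub>M gauss2"

definition disp :: "real \<times> real \<times> real \<Rightarrow> real \<times> real" where
  "disp w = (fst w * fst (snd w), fst w * snd (snd w))"

definition Kop :: "(real \<times> real \<times> real \<Rightarrow> real) \<Rightarrow> (real \<times> real \<Rightarrow> real) \<Rightarrow> real \<times> real \<Rightarrow> real" where
  "Kop \<omega> g p = (\<integral>w. \<omega> w * g (p + disp w) \<partial>rmeas)"

lemma sets_radial[simp, measurable_cong]: "sets radial = sets borel"
  by (simp add: radial_def)

lemma space_radial[simp]: "space radial = UNIV"
  by (simp add: radial_def)

lemma sets_gauss2: "sets gauss2 = sets borel"
  by (subst borel_prod[symmetric]) (intro sets_pair_measure_cong, auto)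

lemma sets_rmeas[simp, measurable_cong]: "sets rmeas = sets borel"
  unfolding rmeas_def
  by (subst borel_prod[symmetric]) (intro sets_pair_measure_cong sets_radial sets_gauss2)

lemma space_rmeas[simp]: "space rmeas = UNIV"
  by (simp add: rmeas_def space_pair_measure)

interpretation gauss: prob_space gauss
  by (rule prob_space_normal_density) simp

interpretation gauss2: pair_prob_space gauss gauss ..

lemma integrable_radial_iff:
  assumes [measurable]: "f \<in> borel_measurable borel"
  shows "integrable radial f \<longleftrightarrow> integrable lborel (\<lambda>r. indicator {0<..} r * exp (- r\<^sup>2 / 2) * f r :: real)"
  unfolding radial_def by (subst integrable_density) auto

lemma integral_radial:
  assumes [measurable]: "f \<in> borel_measurable borel"
  shows "(\<integral>r. f r \<partial>radial) = (\<integral>r. indicator {0<..} r * exp (- r\<^sup>2 / 2) * f r \<partial>lborel :: real)"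
  unfolding radial_def by (subst integral_density) auto

lemma integrable_radial_power: "integrable radial (\<lambda>r. r ^ k)"
proof -
  have "integrable lborel (\<lambda>r::real. indicator {0<..} r * exp (- r\<^sup>2 / 2) * r ^ k)"
proof (rule Bochner_Integration.integrable_bound)
  \<comment> \<open>The radial weight is the standard normal density without its normalisation,
    restricted to r > 0, so Gaussian absolute moments dominate.\<close>
  show "integrable lborel (\<lambda>r. sqrt (2 * pi) * (std_normal_density r * \<bar>r\<bar> ^ k))"
    by (intro integrable_mult_right integrable_std_normal_moment_abs)
qed (auto simp: std_normal_density_def indicator_def abs_mult power_abs)
then show ?thesis by (subst integrable_radial_iff) auto
qed

lemma integrable_radial_one: "integrable radial (\<lambda>r. 1 :: real)"
  using integrable_radial_power[of 0] by simp

interpretation radial: finite_measure radial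
proof
  have "integrable radial (indicator UNIV :: real \<Rightarrow> real)"
    using integrable_radial_one by (simp add: indicator_def)
  then show "emeasure radial (space radial) \<noteq> \<infinity>"
    by (subst (asm) integrable_indicator_iff) (auto simp: less_top)
qed

interpretation rmeas: pair_sigma_finite radial gauss2 ..

lemma (in pair_sigma_finite) integrable_times:
  fixes f g :: "_ \<Rightarrow> real"
  assumes f: "integrable M1 f" and g: "integrable M2 g"
  shows "integrable (M1 \<Otimes>\<^sub>M M2) (\<lambda>w. f (fst w) * g (snd w))"
proof (rule Fubini_integrable)
  have [measurable]: "f \<in> borel_measurable M1" "g \<in> borel_measurable M2" using f g by auto
  show "(\<lambda>w. f (fst w) * g (snd w)) \<in> borel_measurable (M1 \<Otimes>\<^sub>M M2)" by measurable
  have "integrable M1 (\<lambda>x. norm (f x) * (\<integral>y. norm (g y) \<partial>M2))"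
    using f by (intro integrable_mult_left) auto
  then show "integrable M1 (\<lambda>x. \<integral>y. norm (f (fst (x, y)) * g (snd (x, y))) \<partial>M2)"
    by (simp add: abs_mult)
qed (use g in auto)

lemma integrable_gauss2_times:
  "integrable gauss f \<Longrightarrow> integrable gauss g \<Longrightarrow> integrable gauss2 (\<lambda>z. f (fst z) * g (snd z) :: real)"
  by (rule gauss2.integrable_times)

lemma integrable_rmeas_times:
  "integrable radial f \<Longrightarrow> integrable gauss2 g \<Longrightarrow> integrable rmeas (\<lambda>w. f (fst w) * g (snd w) :: real)"
  unfolding rmeas_def by (rule rmeas.integrable_times)

lemma integrable_gauss_one: "integrable gauss (\<lambda>z. 1::real)"
  using integrable_std_normal_distribution_moment[of 0] by simp

lemma integrable_gauss_id: "integrable gauss (\<lambda>z. z::real)"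
  using integrable_std_normal_distribution_moment[of 1] by simp

lemma integrable_gauss2_fst: "integrable gauss2 (\<lambda>z. fst z)"
  and integrable_gauss2_snd: "integrable gauss2 (\<lambda>z. snd z)"
  and integrable_gauss2_one: "integrable gauss2 (\<lambda>z. 1 :: real)"
  and integrable_gauss2_fst2: "integrable gauss2 (\<lambda>z. (fst z)\<^sup>2)"
  and integrable_gauss2_fst_snd: "integrable gauss2 (\<lambda>z. fst z * snd z)"
  using integrable_gauss2_times[OF integrable_gauss_id integrable_gauss_one]
    integrable_gauss2_times[OF integrable_gauss_one integrable_gauss_id]
    integrable_gauss2_times[OF integrable_gauss_one integrable_gauss_one]
    integrable_gauss2_times[OF integrable_gauss_id integrable_gauss_id]
    integrable_gauss2_times[OF integrable_std_normal_distribution_moment[of 2] integrable_gauss_one]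
  by simp_all

lemma integrable_rmeas_r: "integrable rmeas (\<lambda>w. fst w)"
  and integrable_rmeas_z1: "integrable rmeas (\<lambda>w. fst (snd w))"
  and integrable_rmeas_z2: "integrable rmeas (\<lambda>w. snd (snd w))"
  using integrable_rmeas_times[OF integrable_radial_power[of 1] integrable_gauss2_one]
    integrable_rmeas_times[OF integrable_radial_one integrable_gauss2_fst]
    integrable_rmeas_times[OF integrable_radial_one integrable_gauss2_snd]
  by simp_all

lemma disp_measurable[measurable]: "disp \<in> borel_measurable borel"
  unfolding disp_def
  by (intro borel_measurable_continuous_onI continuous_intros)

section \<open>Boundedness, linearity and dominated convergence for the averaging operator\<close>

lemma Kop_integrable:
  fixes g :: "real \<times> real \<Rightarrow> real"
  assumes "integrable rmeas \<omega>" "g \<in> borel_measurable borel" "\<And>q. \<bar>g q\<bar> \<le> B"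
  shows "integrable rmeas (\<lambda>w. \<omega> w * g (p + disp w))"
proof (rule Bochner_Integration.integrable_bound[of rmeas "\<lambda>w. B * norm (\<omega> w)"])
  show "integrable rmeas (\<lambda>w. B * norm (\<omega> w))" using assms(1) by auto
  have [measurable]: "\<omega> \<in> borel_measurable borel" "g \<in> borel_measurable borel"
    using borel_measurable_integrable[OF assms(1)] assms(2) by (simp_all cong: measurable_cong_sets)
  show "(\<lambda>w. \<omega> w * g (p + disp w)) \<in> borel_measurable rmeas" by measurable
  show "AE w in rmeas. norm (\<omega> w * g (p + disp w)) \<le> norm (B * norm (\<omega> w))"
    by (intro AE_I2)
      (auto simp: abs_mult mult.commute[of _ "\<bar>\<omega> _\<bar>"] intro!: mult_left_mono order_trans[OF assms(3) abs_ge_self])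
qed

lemma Kop_bound:
  assumes "integrable rmeas \<omega>" "g \<in> borel_measurable borel" "\<And>q. \<bar>g q\<bar> \<le> B"
  shows "\<bar>Kop \<omega> g p\<bar> \<le> (\<integral>w. \<bar>\<omega> w\<bar> \<partial>rmeas) * B"
proof -
  have "\<bar>Kop \<omega> g p\<bar> \<le> (\<integral>w. \<bar>\<omega> w * g (p + disp w)\<bar> \<partial>rmeas)"
    unfolding Kop_def by (rule integral_abs_bound)
  also have "\<dots> \<le> (\<integral>w. \<bar>\<omega> w\<bar> * B \<partial>rmeas)"
  proof (rule integral_mono)
    show "integrable rmeas (\<lambda>w. \<bar>\<omega> w * g (p + disp w)\<bar>)"
      using Kop_integrable[OF assms] by (rule integrable_abs)
    show "integrable rmeas (\<lambda>w. \<bar>\<omega> w\<bar> * B)" using assms(1) by auto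
  qed (auto simp: abs_mult intro!: mult_left_mono assms(3))
  finally show ?thesis by simp
qed

lemma Kop_add:
  assumes "integrable rmeas \<omega>" "g \<in> borel_measurable borel" "\<And>q. \<bar>g q\<bar> \<le> B"
    "h \<in> borel_measurable borel" "\<And>q. \<bar>h q\<bar> \<le> C"
  shows "Kop \<omega> (\<lambda>q. g q + h q) p = Kop \<omega> g p + Kop \<omega> h p"
  unfolding Kop_def using Kop_integrable[OF assms(1-3)] Kop_integrable[OF assms(1,4,5)]
  by (simp add: distrib_left)

lemma Kop_diff:
  assumes "integrable rmeas \<omega>" "g \<in> borel_measurable borel" "\<And>q. \<bar>g q\<bar> \<le> B"
    "h \<in> borel_measurable borel" "\<And>q. \<bar>h q\<bar> \<le> C"
  shows "Kop \<omega> (\<lambda>q. g q - h q) p = Kop \<omega> g p - Kop \<omega> h p"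
  unfolding Kop_def using Kop_integrable[OF assms(1-3)] Kop_integrable[OF assms(1,4,5)]
  by (simp add: right_diff_distrib)

lemma Kop_cmult: "Kop \<omega> (\<lambda>q. c * g q) p = c * Kop \<omega> g p"
  unfolding Kop_def by (subst integral_mult_right_zero[symmetric]) (simp add: mult_ac)

lemma Kop_dominated:
  assumes "integrable rmeas \<omega>" "\<And>n. g n \<in> borel_measurable borel" "\<And>n q. \<bar>g n q\<bar> \<le> B"
    "h \<in> borel_measurable borel" "\<And>q. (\<lambda>n. g n q) \<longlonglongrightarrow> h q"
  shows "(\<lambda>n. Kop \<omega> (g n) p) \<longlonglongrightarrow> Kop \<omega> h p"
  unfolding Kop_def
proof (rule integral_dominated_convergence)
  show "integrable rmeas (\<lambda>w. B * norm (\<omega> w))" using assms(1) by auto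
  have [measurable]: "\<omega> \<in> borel_measurable borel" "g n \<in> borel_measurable borel" "h \<in> borel_measurable borel" for n
    using borel_measurable_integrable[OF assms(1)] assms(2,4) by (simp_all cong: measurable_cong_sets)
  show "(\<lambda>w. \<omega> w * h (p + disp w)) \<in> borel_measurable rmeas"
   "(\<lambda>w. \<omega> w * g n (p + disp w)) \<in> borel_measurable rmeas" for n by measurable
  show "AE w in rmeas. (\<lambda>n. \<omega> w * g n (p + disp w)) \<longlonglongrightarrow> \<omega> w * h (p + disp w)"
    by (intro AE_I2 tendsto_intros assms(5))
  show "AE w in rmeas. norm (\<omega> w * g n (p + disp w)) \<le> B * norm (\<omega> w)" for n
    by (intro AE_I2) (auto simp: abs_mult mult.commute[of B] intro!: mult_left_mono assms(3))
qed

section \<open>Differentiation under the integral sign\<close>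

lemma has_real_derivative_integral:
  fixes f f' :: "real \<Rightarrow> 'a \<Rightarrow> real"
  assumes "d > 0"
    and der: "\<And>t w. \<bar>t - t0\<bar> < d \<Longrightarrow> w \<in> space M \<Longrightarrow> ((\<lambda>t. f t w) has_real_derivative f' t w) (at t)"
    and bnd: "\<And>t w. \<bar>t - t0\<bar> < d \<Longrightarrow> w \<in> space M \<Longrightarrow> \<bar>f' t w\<bar> \<le> h w"
    and int: "\<And>t. \<bar>t - t0\<bar> < d \<Longrightarrow> integrable M (f t)" and h: "integrable M h"
    and meas: "f' t0 \<in> borel_measurable M"
  shows "((\<lambda>t. \<integral>w. f t w \<partial>M) has_real_derivative (\<integral>w. f' t0 w \<partial>M)) (at t0)"
proof -
  have "((\<lambda>t. ((\<integral>w. f t w \<partial>M) - (\<integral>w. f t0 w \<partial>M)) / (t - t0)) \<longlongrightarrow> (\<integral>w. f' t0 w \<partial>M)) (at t0)"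
    unfolding tendsto_at_iff_sequentially comp_def
  proof (intro allI impI)
    fix X :: "nat \<Rightarrow> real" assume X: "\<forall>i. X i \<in> UNIV - {t0}" "X \<longlonglongrightarrow> t0"
    obtain N where N: "\<And>n. n \<ge> N \<Longrightarrow> \<bar>X n - t0\<bar> < d"
      using LIMSEQ_D[OF X(2) \<open>d > 0\<close>] by auto
    \<comment> \<open>Only a tail of the sequence lies where the bound on \<open>f'\<close> is
      available; the shift by N is undone at the end by \<open>LIMSEQ_offset\<close>.\<close>
    define Y where "Y n = X (n + N)" for n
    have Y: "\<bar>Y n - t0\<bar> < d" "Y n \<noteq> t0" for n using N X by (auto simp: Y_def)
    have Yl: "Y \<longlonglongrightarrow> t0" unfolding Y_def using X(2) by (rule LIMSEQ_ignore_initial_segment)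
    have t0: "\<bar>t0 - t0\<bar> < d" using \<open>d > 0\<close> by simp
    have "(\<lambda>n. \<integral>w. (f (Y n) w - f t0 w) / (Y n - t0) \<partial>M) \<longlonglongrightarrow> (\<integral>w. f' t0 w \<partial>M)"
    proof (rule integral_dominated_convergence)
      show "(\<lambda>w. (f (Y n) w - f t0 w) / (Y n - t0)) \<in> borel_measurable M" for n
        using int[OF Y(1)[of n]] int[OF t0] by (auto intro!: borel_measurable_divide borel_measurable_diff)
      show "AE w in M. (\<lambda>n. (f (Y n) w - f t0 w) / (Y n - t0)) \<longlonglongrightarrow> f' t0 w"
      proof (rule AE_I2)
        fix w assume "w \<in> space M"
        then have "((\<lambda>t. (f t w - f t0 w) / (t - t0)) \<longlongrightarrow> f' t0 w) (at t0)"
          using der[OF t0] by (simp add: has_field_derivative_iff)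
        then show "(\<lambda>n. (f (Y n) w - f t0 w) / (Y n - t0)) \<longlonglongrightarrow> f' t0 w"
          unfolding tendsto_at_iff_sequentially comp_def using Y Yl by auto
      qed
      show "AE w in M. norm ((f (Y n) w - f t0 w) / (Y n - t0)) \<le> h w" for n
      proof (rule AE_I2)
        fix w assume w: "w \<in> space M"
        \<comment> \<open>The mean value inequality turns the bound on \<open>f'\<close> into one on
          the difference quotients, so that \<open>h\<close> dominates them.\<close>
        have "norm (f (Y n) w - f t0 w) \<le> h w * norm (Y n - t0)"
        proof (rule field_differentiable_bound[where S = "{t. \<bar>t - t0\<bar> < d}"])
          have "{t. \<bar>t - t0\<bar> < d} = ball t0 d" by (auto simp: dist_real_def)
          then show "convex {t. \<bar>t - t0\<bar> < d}" by simp
        qed (use der bnd Y t0 w in \<open>auto intro: has_field_derivative_at_within\<close>)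
        then show "norm ((f (Y n) w - f t0 w) / (Y n - t0)) \<le> h w"
          using Y(2)[of n] by (simp add: divide_le_eq)
      qed
    qed (use meas h in auto)
    moreover have "(\<integral>w. (f (Y n) w - f t0 w) / (Y n - t0) \<partial>M)
        = ((\<integral>w. f (Y n) w \<partial>M) - (\<integral>w. f t0 w \<partial>M)) / (Y n - t0)" for n
      by (simp only: integral_divide_zero Bochner_Integration.integral_diff[OF int[OF Y(1)[of n]] int[OF t0]])
    ultimately have "(\<lambda>n. ((\<integral>w. f (X (n + N)) w \<partial>M) - (\<integral>w. f t0 w \<partial>M)) / (X (n + N) - t0)) \<longlonglongrightarrow> (\<integral>w. f' t0 w \<partial>M)"
      by (simp only: Y_def)
    then show "(\<lambda>n. ((\<integral>w. f (X n) w \<partial>M) - (\<integral>w. f t0 w \<partial>M)) / (X n - t0)) \<longlonglongrightarrow> (\<integral>w. f' t0 w \<partial>M)"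
      by (rule LIMSEQ_offset)
  qed
  then show ?thesis by (simp add: has_field_derivative_iff)
qed

section \<open>Gaussian integration by parts\<close>

lemma std_normal_density_decay:
  "((\<lambda>z. std_normal_density z * (1 + \<bar>z\<bar>)) \<longlongrightarrow> 0) at_top"
  "((\<lambda>z. std_normal_density z * (1 + \<bar>z\<bar>)) \<longlongrightarrow> 0) at_bot"
proof -
  have *: "((\<lambda>z::real. exp (- z\<^sup>2 / 2) * (1 + z)) \<longlongrightarrow> 0) at_top" by real_asymp
  have "((\<lambda>z. 1 / sqrt (2 * pi) * (exp (- z\<^sup>2 / 2) * (1 + z))) \<longlongrightarrow> 1 / sqrt (2 * pi) * 0) at_top"
    by (intro tendsto_intros *)
  then have 1: "((\<lambda>z. 1 / sqrt (2 * pi) * (exp (- z\<^sup>2 / 2) * (1 + z))) \<longlongrightarrow> 0) at_top" by simp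
  show 2: "((\<lambda>z. std_normal_density z * (1 + \<bar>z\<bar>)) \<longlongrightarrow> 0) at_top"
    by (rule Lim_transform_eventually[OF 1])
      (auto simp: std_normal_density_def intro!: eventually_mono[OF eventually_ge_at_top[of 0]])
  then show "((\<lambda>z. std_normal_density z * (1 + \<bar>z\<bar>)) \<longlongrightarrow> 0) at_bot"
    unfolding filterlim_at_bot_mirror by (simp add: std_normal_density_def)
qed

lemma gauss_integrable_linear_growth:
  assumes "f \<in> borel_measurable borel" "\<And>z. \<bar>f z\<bar> \<le> C * (1 + \<bar>z\<bar>)"
  shows "integrable gauss f" "integrable gauss (\<lambda>z. z * f z :: real)"
proof -
  have a: "integrable gauss (\<lambda>z. \<bar>z\<bar>)" using integrable_gauss_id by (rule integrable_abs)
  have b: "integrable gauss (\<lambda>z. z\<^sup>2)" using integrable_std_normal_distribution_moment[of 2] .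
  have C: "C \<ge> 0" using assms(2)[of 0] abs_ge_zero[of "f 0"] by simp
  show "integrable gauss f"
  proof (rule Bochner_Integration.integrable_bound)
    show "integrable gauss (\<lambda>z. C * (1 + \<bar>z\<bar>))"
      by (intro integrable_mult_right Bochner_Integration.integrable_add integrable_gauss_one a)
  qed (use assms C in \<open>auto simp: abs_mult\<close>)
  show "integrable gauss (\<lambda>z. z * f z)"
  proof (rule Bochner_Integration.integrable_bound)
    show "integrable gauss (\<lambda>z. C * (\<bar>z\<bar> + z\<^sup>2))"
      by (intro integrable_mult_right Bochner_Integration.integrable_add b a)
    have "\<bar>z\<bar> * \<bar>f z\<bar> \<le> C * (\<bar>z\<bar> + z\<^sup>2)" for z
    proof -
      have "\<bar>z\<bar> * \<bar>f z\<bar> \<le> \<bar>z\<bar> * (C * (1 + \<bar>z\<bar>))" using assms(2)[of z] by (intro mult_left_mono) auto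
      also have "\<dots> = C * (\<bar>z\<bar> + z\<^sup>2)" by (simp add: algebra_simps power2_eq_square)
      finally show ?thesis .
    qed
    then show "AE x in gauss. norm (x * f x) \<le> norm (C * (\<bar>x\<bar> + x\<^sup>2))"
      by (intro AE_I2) (use C in \<open>auto simp: abs_mult\<close>)
  qed (use assms in auto)
qed

lemma gauss_stein:
  fixes G :: "real \<Rightarrow> real"
  assumes der: "\<And>z. (G has_real_derivative G' z) (at z)" and c: "continuous_on UNIV G'"
    and b: "\<And>z. \<bar>G z\<bar> \<le> C * (1 + \<bar>z\<bar>)" "\<And>z. \<bar>G' z\<bar> \<le> C * (1 + \<bar>z\<bar>)"
  shows "(\<integral>z. z * G z \<partial>gauss) = (\<integral>z. G' z \<partial>gauss)"
proof -
  let ?n = std_normal_density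
  have cG: "continuous_on UNIV G"
    using der by (auto intro!: continuous_at_imp_continuous_on DERIV_isCont)
  have mG[measurable]: "G \<in> borel_measurable borel" "G' \<in> borel_measurable borel"
    using cG c by (auto intro: borel_measurable_continuous_onI)
  note i = gauss_integrable_linear_growth[OF mG(1) b(1)] gauss_integrable_linear_growth[OF mG(2) b(2)]
  have i1: "integrable lborel (\<lambda>z. ?n z * (z * G z))" "integrable lborel (\<lambda>z. ?n z * G' z)"
    using i(2,3) by (simp_all add: integrable_density)
  let ?f = "\<lambda>z. ?n z * (z * G z) - ?n z * G' z"
  let ?F = "\<lambda>z. - (?n z * G z)"
  have lim: "(?F \<longlongrightarrow> 0) F" if "((\<lambda>z. ?n z * (1 + \<bar>z\<bar>)) \<longlongrightarrow> 0) F" for F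
  proof (rule Lim_null_comparison)
    show "((\<lambda>z. C * (?n z * (1 + \<bar>z\<bar>))) \<longlongrightarrow> 0) F" using tendsto_mult[OF tendsto_const that] by simp
    show "\<forall>\<^sub>F x in F. norm (- (?n x * G x)) \<le> C * (?n x * (1 + \<bar>x\<bar>))"
      using b(1) by (intro always_eventually allI)
        (auto simp: abs_mult mult.left_commute[of C] intro!: mult_left_mono)
  qed
  have "(LBINT z=-\<infinity>..\<infinity>. ?f z) = 0 - 0"
  proof (rule interval_integral_FTC_integrable)
    have n: "(?n has_real_derivative - z * ?n z) (at z)" for z
      unfolding std_normal_density_def
      by (rule derivative_eq_intros refl | simp)+
    show "(?F has_vector_derivative ?f z) (at z)" for z
      unfolding has_real_derivative_iff_has_vector_derivative[symmetric]
      by (auto intro!: derivative_eq_intros der n)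
    have "isCont G z" "isCont G' z" for z
      using cG c by (auto simp: continuous_on_eq_continuous_at)
    then show "isCont ?f z" for z
      unfolding std_normal_density_def by (intro continuous_intros) auto
    show "set_integrable lborel (einterval (-\<infinity>) \<infinity>) ?f"
      unfolding set_integrable_def using i1 by simp
    show "((?F \<circ> real_of_ereal) \<longlongrightarrow> 0) (at_right (-\<infinity>))"
      unfolding at_right_MInf using lim[OF std_normal_density_decay(2)]
      by (auto simp: filterlim_filtermap comp_def)
    show "((?F \<circ> real_of_ereal) \<longlongrightarrow> 0) (at_left \<infinity>)"
      unfolding at_left_PInf using lim[OF std_normal_density_decay(1)]
      by (auto simp: filterlim_filtermap comp_def)
  qed simp
  then have "(\<integral>z. ?f z \<partial>lborel) = 0"
    by (simp add: interval_lebesgue_integral_def set_lebesgue_integral_def)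
  then have "(\<integral>z. ?n z * (z * G z) \<partial>lborel) = (\<integral>z. ?n z * G' z \<partial>lborel)"
    using i1 by simp
  then show ?thesis by (simp add: integral_density)
qed

text \<open>Stein's identity on each line with z2 fixed, followed by Fubini. The growth constant is
  used on one line at a time and may therefore depend on z2; integrability over the plane is what
  Fubini asks for.\<close>

lemma gauss2_stein_fst:
  assumes der: "\<And>z1 z2. ((\<lambda>s. G (s, z2)) has_real_derivative G' (z1, z2)) (at z1)"
    and c: "continuous_on UNIV G'"
    and b: "\<And>z1 z2. \<bar>G (z1, z2)\<bar> \<le> C z2 * (1 + \<bar>z1\<bar>)" "\<And>z1 z2. \<bar>G' (z1, z2)\<bar> \<le> C z2 * (1 + \<bar>z1\<bar>)"
    and i: "integrable gauss2 (\<lambda>z. fst z * G z)" "integrable gauss2 G'"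
  shows "(\<integral>z. fst z * G z \<partial>gauss2) = (\<integral>z. G' z \<partial>gauss2)"
proof -
  have "(\<integral>z1. z1 * G (z1, z2) \<partial>gauss) = (\<integral>z1. G' (z1, z2) \<partial>gauss)" for z2
    by (rule gauss_stein[where C="C z2", OF der _ b])
      (auto intro!: continuous_on_compose2[OF c] continuous_intros)
  then show ?thesis
    using gauss2.integral_snd[of "\<lambda>z1 z2. z1 * G (z1, z2)"] gauss2.integral_snd[of "\<lambda>z1 z2. G' (z1, z2)"] i
    by (simp add: case_prod_unfold)
qed

lemma gauss2_stein_snd:
  assumes der: "\<And>z1 z2. ((\<lambda>s. G (z1, s)) has_real_derivative G' (z1, z2)) (at z2)"
    and c: "continuous_on UNIV G'"
    and b: "\<And>z1 z2. \<bar>G (z1, z2)\<bar> \<le> C z1 * (1 + \<bar>z2\<bar>)" "\<And>z1 z2. \<bar>G' (z1, z2)\<bar> \<le> C z1 * (1 + \<bar>z2\<bar>)"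
    and i: "integrable gauss2 (\<lambda>z. snd z * G z)" "integrable gauss2 G'"
  shows "(\<integral>z. snd z * G z \<partial>gauss2) = (\<integral>z. G' z \<partial>gauss2)"
proof -
  have "(\<integral>z2. z2 * G (z1, z2) \<partial>gauss) = (\<integral>z2. G' (z1, z2) \<partial>gauss)" for z1
    by (rule gauss_stein[where C="C z1", OF der _ b])
      (auto intro!: continuous_on_compose2[OF c] continuous_intros)
  then show ?thesis
    using gauss2.integral_fst'[OF i(1)] gauss2.integral_fst'[OF i(2)] by simp
qed

section \<open>Periodic functions and compactness of the period cell\<close>

lemma periodic2_int:
  assumes "periodic2 f"
  shows "f (x + of_int m, y + of_int n) = f (x, y)"
proof -
  have a: "f (x + of_nat k, y) = f (x, y)" for k x y
    by (induction k) (use assms in \<open>auto simp: periodic2_def add.assoc[symmetric] add.commute[of 1]\<close>)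
  have b: "f (x, y + of_nat k) = f (x, y)" for k x y
    by (induction k) (use assms in \<open>auto simp: periodic2_def add.assoc[symmetric] add.commute[of 1]\<close>)
  have c: "f (x + of_int k, y) = f (x, y)" for k x y
    using a[of x "nat k" y] a[of "x + of_int k" "nat (- k)" y] by (cases "k \<ge> 0") auto
  have d: "f (x, y + of_int k) = f (x, y)" for k x y
    using b[of x y "nat k"] b[of x "y + of_int k" "nat (- k)"] by (cases "k \<ge> 0") auto
  show ?thesis by (simp add: c d)
qed

definition unit_square :: "(real \<times> real) set" where
  "unit_square = {0..1} \<times> {0..1}"

lemma compact_unit_square: "compact unit_square"
  unfolding unit_square_def by (intro compact_Times) auto

definition frac2 :: "real \<times> real \<Rightarrow> real \<times> real" where
  "frac2 p = (frac (fst p), frac (snd p))"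

lemma frac2_in: "frac2 p \<in> unit_square"
  by (simp add: frac2_def unit_square_def less_imp_le[OF frac_lt_1])

lemma periodic2_frac2: "periodic2 f \<Longrightarrow> f (frac2 p) = f p"
  using periodic2_int[of f "frac (fst p)" "\<lfloor>fst p\<rfloor>" "frac (snd p)" "\<lfloor>snd p\<rfloor>"]
  by (simp add: frac2_def frac_def)

lemma param_bounded:
  fixes G :: "real \<times> real \<times> real \<Rightarrow> real"
  assumes "continuous_on (I \<times> UNIV) G" "\<And>e. e \<in> I \<Longrightarrow> periodic2 (\<lambda>p. G (e, p))"
    "compact J" "J \<subseteq> I"
  obtains B where "B \<ge> 0" "\<And>e p. e \<in> J \<Longrightarrow> \<bar>G (e, p)\<bar> \<le> B"
proof -
  have "compact (G ` (J \<times> unit_square))"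
    by (rule compact_continuous_image) (auto intro!: compact_Times assms compact_unit_square
      intro: continuous_on_subset[OF assms(1)] subsetD[OF assms(4)])
  then have "bounded (G ` (J \<times> unit_square))" by (rule compact_imp_bounded)
  then obtain B where B: "\<And>X. X \<in> J \<times> unit_square \<Longrightarrow> \<bar>G X\<bar> \<le> B"
    unfolding bounded_iff by auto
  have "\<bar>G (e, p)\<bar> \<le> max B 0" if "e \<in> J" for e p
    using B[of "(e, frac2 p)"] that frac2_in[of p] periodic2_frac2[OF assms(2)[of e], of p] assms(4)
    by auto
  then show thesis using that[of "max B 0"] by simp
qed

text \<open>Periodicity replaces the plane by a compact cell, on which Heine-Cantor gives a modulus
  in e that is uniform in p. Sup norms can thus be followed while the parameter moves.\<close>

lemma param_uniform:
  fixes G :: "real \<times> real \<times> real \<Rightarrow> real"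
  assumes "continuous_on (I \<times> UNIV) G" "\<And>e. e \<in> I \<Longrightarrow> periodic2 (\<lambda>p. G (e, p))"
    "open I" "e \<in> I" "\<eta> > 0"
  obtains d where "d > 0" "\<And>e' p. \<bar>e' - e\<bar> < d \<Longrightarrow> e' \<in> I \<and> \<bar>G (e', p) - G (e, p)\<bar> < \<eta>"
proof -
  obtain d1 where d1: "d1 > 0" "cball e d1 \<subseteq> I" using assms(3,4) open_contains_cball by blast
  have "uniformly_continuous_on (cball e d1 \<times> unit_square) G"
    by (rule compact_uniformly_continuous)
      (auto intro!: compact_Times compact_unit_square intro: continuous_on_subset[OF assms(1)] subsetD[OF d1(2)])
  then obtain d2 where d2: "d2 > 0" "\<And>X Y. X \<in> cball e d1 \<times> unit_square \<Longrightarrow> Y \<in> cball e d1 \<times> unit_square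
      \<Longrightarrow> dist X Y < d2 \<Longrightarrow> dist (G X) (G Y) < \<eta>"
    using \<open>\<eta> > 0\<close> unfolding uniformly_continuous_on_def by metis
  show thesis
  proof (rule that[of "min d1 d2"])
    fix e' p assume *: "\<bar>e' - e\<bar> < min d1 d2"
    then have e': "e' \<in> I" "e' \<in> cball e d1" using d1 by (auto simp: dist_real_def abs_minus_commute)
    have "dist (G (e', frac2 p)) (G (e, frac2 p)) < \<eta>"
      by (rule d2(2)) (use e' d1 * frac2_in[of p] in \<open>auto simp: dist_Pair_Pair dist_real_def\<close>)
    then show "e' \<in> I \<and> \<bar>G (e', p) - G (e, p)\<bar> < \<eta>"
      using periodic2_frac2[OF assms(2)[of e], of p] periodic2_frac2[OF assms(2)[of e'], of p] e'(1) assms(4)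
      by (simp add: dist_real_def)
  qed (use d1 d2 in auto)
qed

lemma periodic2_bounded:
  assumes "continuous_on UNIV g" "periodic2 g"
  obtains B :: real where "B \<ge> 0" "\<And>p. \<bar>g p\<bar> \<le> B"
proof -
  have c: "continuous_on (UNIV \<times> UNIV) (\<lambda>X::real \<times> real \<times> real. g (snd X))"
    by (intro continuous_on_compose2[OF assms(1)] continuous_intros) auto
  show thesis
  proof (rule param_bounded[OF c, of "{0}"])
    show "periodic2 (\<lambda>p. g (snd (e, p)))" for e :: real using assms(2) by simp
    fix B assume "B \<ge> 0" and B: "\<And>e p. e \<in> {0::real} \<Longrightarrow> \<bar>g (snd (e, p))\<bar> \<le> B"
    show thesis using \<open>B \<ge> 0\<close> B[of 0] by (intro that[of B]) simp_all
  qed simp_all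
qed

subsection \<open>Density of trigonometric polynomials\<close>

text \<open>The phase \<theta> lets a single constructor cover cosines and sines; products and
  derivatives of waves are then again combinations of waves.\<close>

inductive_set trig_poly :: "(real \<times> real \<Rightarrow> real) set" where
  wave: "(\<lambda>p. cos (2 * pi * (of_int m * fst p + of_int n * snd p) + \<theta>)) \<in> trig_poly"
| add: "f \<in> trig_poly \<Longrightarrow> g \<in> trig_poly \<Longrightarrow> (\<lambda>p. f p + g p) \<in> trig_poly"
| scale: "f \<in> trig_poly \<Longrightarrow> (\<lambda>p. c * f p) \<in> trig_poly"

lemma trig_poly_times_wave:
  "g \<in> trig_poly \<Longrightarrow> (\<lambda>p. cos (2 * pi * (of_int m * fst p + of_int n * snd p) + \<theta>) * g p) \<in> trig_poly"
proof (induction rule: trig_poly.induct)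
  case (wave m' n' \<theta>')
  have "(\<lambda>p. (1/2) * cos (2 * pi * (of_int (m - m') * fst p + of_int (n - n') * snd p) + (\<theta> - \<theta>'))
     + (1/2) * cos (2 * pi * (of_int (m + m') * fst p + of_int (n + n') * snd p) + (\<theta> + \<theta>'))) \<in> trig_poly"
    by (intro trig_poly.intros)
  moreover have "(1/2) * cos (2 * pi * (of_int (m - m') * fst p + of_int (n - n') * snd p) + (\<theta> - \<theta>'))
     + (1/2) * cos (2 * pi * (of_int (m + m') * fst p + of_int (n + n') * snd p) + (\<theta> + \<theta>'))
    = cos (2 * pi * (of_int m * fst p + of_int n * snd p) + \<theta>) *
         cos (2 * pi * (of_int m' * fst p + of_int n' * snd p) + \<theta>')" for p
    by (simp add: cos_times_cos algebra_simps add_divide_distrib)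
  ultimately show ?case by simp
next
  case (add f g)
  then show ?case using trig_poly.add by (fastforce simp: distrib_left)
next
  case (scale f c)
  then show ?case using trig_poly.scale[OF scale.IH, of c] by (simp add: mult.left_commute)
qed

lemma trig_poly_times: "f \<in> trig_poly \<Longrightarrow> g \<in> trig_poly \<Longrightarrow> (\<lambda>p. f p * g p) \<in> trig_poly"
proof (induction rule: trig_poly.induct)
  case (wave m n \<theta>)
  then show ?case by (rule trig_poly_times_wave)
next
  case (add f g)
  then show ?case using trig_poly.add by (fastforce simp: distrib_right)
next
  case (scale f c)
  then show ?case using trig_poly.scale[OF scale.IH[OF scale.prems], of c] by (simp add: mult.assoc)
qed

lemma trig_poly_const: "(\<lambda>p. c) \<in> trig_poly"
  using trig_poly.scale[OF trig_poly.wave[of 0 0 0], of c] by simp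

text \<open>Differentiation shifts the phase by pi/2 and multiplies by a constant, hence the
  induction over all \<theta> at once.\<close>

lemma C_k_on_cos:
  fixes A :: "'a::real_normed_vector \<Rightarrow> real"
  assumes "open S" "\<And>x. (A has_derivative L) (at x)"
  shows "C_k_on S (\<lambda>x. cos (A x + \<theta>)) k"
proof (induction k arbitrary: \<theta>)
  case 0
  have "continuous_on S A"
    using assms(2) by (auto intro!: continuous_at_imp_continuous_on has_derivative_continuous)
  then show ?case by (auto intro!: continuous_intros)
next
  case (Suc k)
  show ?case
  proof (rule C_k_on_SucI[OF assms(1)])
    show "((\<lambda>x. cos (A x + \<theta>)) has_derivative (\<lambda>v. L v * cos (A x + (\<theta> + pi / 2)))) (at x)" for x
      by (auto intro!: derivative_eq_intros assms(2) simp: cos_add sin_add algebra_simps)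
  qed (intro C_k_on_cmult Suc.IH assms(1))
qed

lemma C_k_on_wave: "C_k_on UNIV (\<lambda>p. cos (2 * pi * (of_int m * fst p + of_int n * snd p) + \<theta>)) k"
  by (rule C_k_on_cos[where L="\<lambda>p. 2 * pi * (of_int m * fst p + of_int n * snd p)"])
    (auto intro!: derivative_eq_intros)

lemma trig_poly_C_k: "f \<in> trig_poly \<Longrightarrow> C_k_on UNIV f k"
  by (induction rule: trig_poly.induct) (auto intro: C_k_on_add C_k_on_cmult C_k_on_wave)

lemma trig_poly_periodic: "f \<in> trig_poly \<Longrightarrow> periodic2 f"
proof (induction rule: trig_poly.induct)
  case (wave m n \<theta>)
  have a: "cos (2 * pi * (of_int m * (x + 1) + of_int n * y) + \<theta>)
      = cos ((2 * pi * (of_int m * x + of_int n * y) + \<theta>) + of_int m * (2 * pi))" for x y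
    by (simp add: algebra_simps)
  have b: "cos (2 * pi * (of_int m * x + of_int n * (y + 1)) + \<theta>)
      = cos ((2 * pi * (of_int m * x + of_int n * y) + \<theta>) + of_int n * (2 * pi))" for x y
    by (simp add: algebra_simps)
  have c: "cos (t + of_int k * (2 * pi)) = cos t" for t k
    by (simp add: cos_add mult.commute[of _ "2 * pi"] cos_int_2pin sin_int_2pin)
  show ?case unfolding periodic2_def fst_conv snd_conv a b c by simp
qed (auto simp: periodic2_def)

text \<open>Embedding of the torus in four-space. A periodic function descends to the compact image,
  where Stone-Weierstrass for polynomials applies, and polynomials in these coordinates pull back to
  trigonometric polynomials.\<close>

definition torus_embed :: "real \<times> real \<Rightarrow> (real \<times> real) \<times> real \<times> real" where
  "torus_embed p = ((cos (2 * pi * fst p), sin (2 * pi * fst p)), (cos (2 * pi * snd p), sin (2 * pi * snd p)))"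

lemma trig_poly_polynomial:
  "real_polynomial_function P \<Longrightarrow> (\<lambda>p. P (torus_embed p)) \<in> trig_poly"
proof (induction rule: real_polynomial_function.induct)
  case (linear f)
  have "(\<lambda>p. (f ((1, 0), 0) * cos (2 * pi * (of_int 1 * fst p + of_int 0 * snd p) + 0)
      + f ((0, 1), 0) * cos (2 * pi * (of_int 1 * fst p + of_int 0 * snd p) + (- pi / 2)))
      + (f (0, (1, 0)) * cos (2 * pi * (of_int 0 * fst p + of_int 1 * snd p) + 0)
      + f (0, (0, 1)) * cos (2 * pi * (of_int 0 * fst p + of_int 1 * snd p) + (- pi / 2)))) \<in> trig_poly"
    by (intro trig_poly.intros)
  moreover have "f (torus_embed p) = (f ((1, 0), 0) * cos (2 * pi * fst p) + f ((0, 1), 0) * sin (2 * pi * fst p))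
      + (f (0, (1, 0)) * cos (2 * pi * snd p) + f (0, (0, 1)) * sin (2 * pi * snd p))" for p
  proof -
    have "torus_embed p = (cos (2 * pi * fst p) *\<^sub>R ((1, 0), 0) + sin (2 * pi * fst p) *\<^sub>R ((0, 1), 0))
      + (cos (2 * pi * snd p) *\<^sub>R (0, (1, 0)) + sin (2 * pi * snd p) *\<^sub>R (0, (0, 1)))"
      by (simp add: torus_embed_def zero_prod_def)
    then show ?thesis
      using bounded_linear.linear[OF linear] by (simp only: linear_add linear_cmul real_scaleR_def mult.commute)
  qed
  moreover have "cos (t + - pi / 2) = sin t" for t using cos_diff[of t "pi / 2"] by simp
  ultimately show ?case by simp
next
  case (const c)
  then show ?case by (rule trig_poly_const)
qed (auto intro: trig_poly.add trig_poly_times)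

lemma torus_embed_eq:
  assumes "periodic2 g" "torus_embed p = torus_embed q"
  shows "g p = g q"
proof -
  have *: "sin (2 * pi * fst p) = sin (2 * pi * fst q) \<and> cos (2 * pi * fst p) = cos (2 * pi * fst q)"
    "sin (2 * pi * snd p) = sin (2 * pi * snd q) \<and> cos (2 * pi * snd p) = cos (2 * pi * snd q)"
    using assms(2) by (auto simp: torus_embed_def)
  obtain m n where "2 * pi * fst p = 2 * pi * fst q + 2 * pi * of_int m"
    "2 * pi * snd p = 2 * pi * snd q + 2 * pi * of_int n"
    using * unfolding sin_cos_eq_iff by metis
  then have "2 * pi * fst p = 2 * pi * (fst q + of_int m)" "2 * pi * snd p = 2 * pi * (snd q + of_int n)"
    by (simp_all add: distrib_left)
  then have "fst p = fst q + of_int m" "snd p = snd q + of_int n" by simp_all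
  then show ?thesis using periodic2_int[OF assms(1), of "fst q" m "snd q" n] by (metis prod.collapse)
qed

lemma trig_poly_dense:
  assumes "continuous_on UNIV g" "periodic2 g" "\<eta> > 0"
  obtains t where "t \<in> trig_poly" "\<And>p. \<bar>g p - t p\<bar> < \<eta>"
proof -
  define D where "D q = g (inv_into unit_square torus_embed q)" for q
  have cE: "continuous_on A torus_embed" for A unfolding torus_embed_def by (intro continuous_intros)
  have D: "D (torus_embed p) = g p" if "p \<in> unit_square" for p
    unfolding D_def by (rule torus_embed_eq[OF assms(2)]) (use that in \<open>auto intro: f_inv_into_f\<close>)
  \<comment> \<open>The descended function is continuous because the embedding of a compact cell is
    a closed map: the preimage of a closed set under \<open>D\<close> is the image of a compact
    set.\<close>
  have cD: "continuous_on (torus_embed ` unit_square) D"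
    unfolding continuous_on_closed_vimage[OF compact_imp_closed[OF compact_continuous_image[OF cE compact_unit_square]]]
  proof (intro allI impI)
    fix B :: "real set" assume "closed B"
    have "D -` B \<inter> torus_embed ` unit_square = torus_embed ` (unit_square \<inter> g -` B)"
      using D by auto
    moreover have "compact (torus_embed ` (unit_square \<inter> g -` B))"
      using assms(1) \<open>closed B\<close> by (intro compact_continuous_image cE compact_Int_closed compact_unit_square)
        (simp add: continuous_on_closed_vimage)
    ultimately show "closed (D -` B \<inter> torus_embed ` unit_square)" using compact_imp_closed by simp
  qed
  obtain P where P: "real_polynomial_function P" "\<And>q. q \<in> torus_embed ` unit_square \<Longrightarrow> \<bar>D q - P q\<bar> < \<eta>"
    using Stone_Weierstrass_real_polynomial_function[OF compact_continuous_image[OF cE compact_unit_square] cD \<open>\<eta> > 0\<close>]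
    by metis
  have t: "(\<lambda>p. P (torus_embed p)) \<in> trig_poly" by (rule trig_poly_polynomial[OF P(1)])
  have "\<bar>g p - P (torus_embed p)\<bar> < \<eta>" for p
    using P(2)[of "torus_embed (frac2 p)"] D[OF frac2_in, of p] frac2_in[of p]
      periodic2_frac2[OF assms(2), of p] periodic2_frac2[OF trig_poly_periodic[OF t], of p] by auto
  then show thesis using that t by blast
qed

subsection \<open>The resolvent kernel\<close>

abbreviation "RR \<equiv> Kop (\<lambda>w. fst w)"
abbreviation "RX \<equiv> Kop (\<lambda>w. fst (snd w))"
abbreviation "RY \<equiv> Kop (\<lambda>w. snd (snd w))"

lemma Kop_has_real_derivative:
  assumes "integrable rmeas \<omega>" "d > 0"
    "\<And>t q. \<bar>t - t0\<bar> < d \<Longrightarrow> ((\<lambda>t. F t q) has_real_derivative F' t q) (at t)"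
    "\<And>t. \<bar>t - t0\<bar> < d \<Longrightarrow> continuous_on UNIV (F t)" "\<And>t q. \<bar>t - t0\<bar> < d \<Longrightarrow> \<bar>F t q\<bar> \<le> B"
    "F' t0 \<in> borel_measurable borel" "\<And>t q. \<bar>t - t0\<bar> < d \<Longrightarrow> \<bar>F' t q\<bar> \<le> B'"
  shows "((\<lambda>t. Kop \<omega> (F t) p) has_real_derivative Kop \<omega> (F' t0) p) (at t0)"
  unfolding Kop_def
proof (rule has_real_derivative_integral[OF assms(2), where h="\<lambda>w. \<bar>\<omega> w\<bar> * B'"])
  have [measurable]: "\<omega> \<in> borel_measurable borel" "F' t0 \<in> borel_measurable borel"
    using borel_measurable_integrable[OF assms(1)] assms(6) by (simp_all cong: measurable_cong_sets)
  show "(\<lambda>w. \<omega> w * F' t0 (p + disp w)) \<in> borel_measurable rmeas" by measurable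
  show "integrable rmeas (\<lambda>w. \<omega> w * F t (p + disp w))" if "\<bar>t - t0\<bar> < d" for t
    using that by (intro Kop_integrable[where B=B] assms borel_measurable_continuous_onI)
  show "integrable rmeas (\<lambda>w. \<bar>\<omega> w\<bar> * B')" using assms(1) by auto
  show "((\<lambda>t. \<omega> w * F t (p + disp w)) has_real_derivative \<omega> w * F' t (p + disp w)) (at t)"
    if "\<bar>t - t0\<bar> < d" for t w
    by (intro DERIV_cmult assms(3) that)
  show "\<bar>\<omega> w * F' t (p + disp w)\<bar> \<le> \<bar>\<omega> w\<bar> * B'" if "\<bar>t - t0\<bar> < d" for t w
    unfolding abs_mult by (intro mult_left_mono assms(7) that) simp
qed

lemma Kop_translate: "Kop \<omega> g (p + q) = Kop \<omega> (\<lambda>p. g (p + q)) p"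
  by (simp add: Kop_def add_ac)

text \<open>Translating the argument of g instead of the base point moves the derivative onto g,
  where it can be taken under the integral.\<close>

lemma Kop_dx:
  assumes \<omega>: "integrable rmeas \<omega>"
    and der: "\<And>x y. ((\<lambda>s. g (s, y)) has_real_derivative gx (x, y)) (at x)"
    and c: "continuous_on UNIV g" "continuous_on UNIV gx"
    and b: "\<And>q. \<bar>g q\<bar> \<le> B" "\<And>q. \<bar>gx q\<bar> \<le> B'"
  shows "((\<lambda>s. Kop \<omega> g (s, y)) has_real_derivative Kop \<omega> gx (x, y)) (at x)"
proof -
  have "((\<lambda>t. Kop \<omega> (\<lambda>q. g (q + (t, 0))) (0, y)) has_real_derivative Kop \<omega> (\<lambda>q. gx (q + (x, 0))) (0, y)) (at x)"
  proof (rule Kop_has_real_derivative[OF \<omega> zero_less_one, where F'="\<lambda>t q. gx (q + (t, 0))"])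
    show "((\<lambda>t. g (q + (t, 0))) has_real_derivative gx (q + (t, 0))) (at t)" for q t
      using DERIV_shift[of "\<lambda>s. g (s, snd q)" "gx (fst q + t, snd q)" t "fst q"] der[of "snd q" "t + fst q"]
      by (cases q) (simp add: add.commute)
    show "(\<lambda>q. gx (q + (x, 0))) \<in> borel_measurable borel"
      by (intro borel_measurable_continuous_onI continuous_on_compose2[OF c(2)] continuous_intros) auto
    show "continuous_on UNIV (\<lambda>q. g (q + (t, 0)))" for t
      by (intro continuous_on_compose2[OF c(1)] continuous_intros) auto
  qed (rule b)+
  then show ?thesis by (simp flip: Kop_translate)
qed

lemma Kop_continuous:
  assumes \<omega>: "integrable rmeas \<omega>" and c: "continuous_on UNIV g" and b: "\<And>q. \<bar>g q\<bar> \<le> B"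
  shows "continuous_on UNIV (Kop \<omega> g)"
  unfolding continuous_on_sequentially comp_def
proof (intro allI ballI impI)
  fix X and p :: "real \<times> real" assume X: "(\<forall>n. X n \<in> UNIV) \<and> X \<longlonglongrightarrow> p"
  have "(\<lambda>n. Kop \<omega> (\<lambda>q. g (q + X n)) 0) \<longlonglongrightarrow> Kop \<omega> (\<lambda>q. g (q + p)) 0"
  proof (rule Kop_dominated[OF \<omega>])
    show "(\<lambda>q. g (q + X n)) \<in> borel_measurable borel" "(\<lambda>q. g (q + p)) \<in> borel_measurable borel" for n
      by (intro borel_measurable_continuous_onI continuous_on_compose2[OF c(1)] continuous_intros, auto)+
    show "(\<lambda>n. g (q + X n)) \<longlonglongrightarrow> g (q + p)" for q
      using X by (intro continuous_on_tendsto_compose[OF c]) (auto intro!: tendsto_intros)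
  qed (rule b)
  then show "(\<lambda>n. Kop \<omega> g (X n)) \<longlonglongrightarrow> Kop \<omega> g p"
    by (simp flip: Kop_translate)
qed

lemma integral_rmeas:
  fixes f :: "real \<times> real \<times> real \<Rightarrow> real"
  assumes "integrable rmeas f"
  shows "(\<integral>w. f w \<partial>rmeas) = (\<integral>r. \<integral>z. f (r, z) \<partial>gauss2 \<partial>radial)"
  using rmeas.integral_fst'[of f] assms by (simp add: rmeas_def)

lemma gauss2_integrable_mult_bounded:
  fixes f g :: "real \<times> real \<Rightarrow> real"
  assumes "integrable gauss2 f" "continuous_on UNIV g" "\<And>z. \<bar>g z\<bar> \<le> B"
  shows "integrable gauss2 (\<lambda>z. f z * g z)"
proof (rule Bochner_Integration.integrable_bound[of gauss2 "\<lambda>z. \<bar>f z\<bar> * B"])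
  have g: "g \<in> borel_measurable gauss2"
    using borel_measurable_continuous_onI[OF assms(2)] measurable_cong_sets[OF sets_gauss2 refl] by blast
  show "(\<lambda>z. f z * g z) \<in> borel_measurable gauss2" using assms(1) g by auto
  show "AE z in gauss2. norm (f z * g z) \<le> norm (\<bar>f z\<bar> * B)"
    by (intro AE_I2) (auto simp: abs_mult intro!: mult_left_mono order_trans[OF assms(3) abs_ge_self])
qed (use assms(1) in auto)

text \<open>For fixed r the map z \<mapsto> g(p + r z) has z1-derivative r times the x-derivative of
  g, so Stein's identity trades the factor z1 for exactly the weight r of the resolvent.\<close>

lemma RX_eq_RR_dx:
  assumes der: "\<And>x y. ((\<lambda>s. g (s, y)) has_real_derivative gx (x, y)) (at x)"
    and c: "continuous_on UNIV g" "continuous_on UNIV gx"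
    and b: "\<And>q. \<bar>g q\<bar> \<le> B" "\<And>q. \<bar>gx q\<bar> \<le> B'"
  shows "RX g p = RR gx p"
proof -
  have "(\<integral>z. fst z * g (p + disp (r, z)) \<partial>gauss2) = (\<integral>z. r * gx (p + disp (r, z)) \<partial>gauss2)" for r
  proof (rule gauss2_stein_fst[where C="\<lambda>_. max B (\<bar>r\<bar> * B')"])
    show "((\<lambda>s. g (p + disp (r, s, z2))) has_real_derivative r * gx (p + disp (r, z1, z2))) (at z1)" for z1 z2
    proof -
      have "((\<lambda>s. g ((\<lambda>t. fst p + r * t) s, snd p + r * z2)) has_real_derivative
        gx (fst p + r * z1, snd p + r * z2) * r) (at z1)"
        by (rule DERIV_chain2[OF der]) (auto intro!: derivative_eq_intros)
      then show ?thesis by (cases p) (simp add: disp_def mult.commute)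
    qed
    have d: "continuous_on UNIV (\<lambda>z. p + disp (r, z))" unfolding disp_def by (intro continuous_intros)
    show "continuous_on UNIV (\<lambda>z. r * gx (p + disp (r, z)))"
      by (intro continuous_intros continuous_on_compose2[OF c(2) d]) auto
    have p1: "1 \<le> 1 + \<bar>z\<bar>" for z :: real by simp
    have *: "a \<le> M * (1 + \<bar>z\<bar>)" if "a \<le> M" "0 \<le> a" for a M z :: real
      using mult_mono[OF that(1) p1[of z]] that by simp
    show "\<bar>g (p + disp (r, z1, z2))\<bar> \<le> max B (\<bar>r\<bar> * B') * (1 + \<bar>z1\<bar>)" for z1 z2
      using b(1) by (intro *) (auto simp: le_max_iff_disj)
    show "\<bar>r * gx (p + disp (r, z1, z2))\<bar> \<le> max B (\<bar>r\<bar> * B') * (1 + \<bar>z1\<bar>)" for z1 z2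
      unfolding abs_mult by (intro * max.coboundedI2 mult_left_mono b(2)) auto
    show "integrable gauss2 (\<lambda>z. fst z * g (p + disp (r, z)))"
      by (rule gauss2_integrable_mult_bounded[OF integrable_gauss2_fst _ b(1)])
        (intro continuous_on_compose2[OF c(1) d], auto)
    show "integrable gauss2 (\<lambda>z. r * gx (p + disp (r, z)))"
      using gauss2_integrable_mult_bounded[OF integrable_gauss2_one continuous_on_compose2[OF c(2) d] b(2)]
      by simp
  qed
  moreover have "RX g p = (\<integral>r. \<integral>z. fst z * g (p + disp (r, z)) \<partial>gauss2 \<partial>radial)"
    unfolding Kop_def using Kop_integrable[OF integrable_rmeas_z1 borel_measurable_continuous_onI[OF c(1)] b(1)]
    by (subst integral_rmeas) simp_all
  moreover have "RR gx p = (\<integral>r. \<integral>z. r * gx (p + disp (r, z)) \<partial>gauss2 \<partial>radial)"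
    unfolding Kop_def using Kop_integrable[OF integrable_rmeas_r borel_measurable_continuous_onI[OF c(2)] b(2)]
    by (subst integral_rmeas) simp_all
  ultimately show ?thesis by simp
qed

lemma has_real_derivative_limit:
  fixes F :: "nat \<Rightarrow> real \<Rightarrow> real"
  assumes "\<And>n t. (F n has_real_derivative F' n t) (at t)" "\<And>t. (\<lambda>n. F n t) \<longlonglongrightarrow> f t"
    "\<And>e. e > 0 \<Longrightarrow> \<forall>\<^sub>F n in sequentially. \<forall>t. \<bar>F' n t - f' t\<bar> \<le> e"
  shows "(f has_real_derivative f' t) (at t)"
proof -
  have "\<exists>g. \<forall>x\<in>UNIV. (\<lambda>n. F n x) \<longlonglongrightarrow> g x \<and> (g has_derivative (*) (f' x)) (at x within UNIV)"
  proof (rule has_derivative_sequence[OF convex_UNIV, where f'="\<lambda>n x. (*) (F' n x)"])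
    show "(F n has_derivative (*) (F' n x)) (at x within UNIV)" for n x
      using assms(1)[of n x] by (simp add: has_field_derivative_def)
    show "\<forall>\<^sub>F n in sequentially. \<forall>x\<in>UNIV. \<forall>h. norm (F' n x * h - f' x * h) \<le> e * norm h" if "e > 0" for e
      using assms(3)[OF that]
      by eventually_elim (auto simp: abs_mult simp flip: left_diff_distrib intro!: mult_right_mono)
  qed (use assms(2)[of 0] in auto)
  then obtain g where g: "\<And>x. (\<lambda>n. F n x) \<longlonglongrightarrow> g x" "\<And>x. (g has_derivative (*) (f' x)) (at x)" by auto
  have "g = f" using LIMSEQ_unique[OF g(1) assms(2)] by auto
  then show ?thesis using g(2)[of t] by (simp add: has_field_derivative_def)
qed

lemma periodic2_dx:
  assumes d: "\<And>p. g differentiable (at p)" and g: "periodic2 g"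
  shows "periodic2 (dx g)"
proof -
  note D = has_real_derivative_dx[OF d]
  have "dx g (x + 1, y) = dx g (x, y)" for x y
    using g D[of y x] DERIV_shift[of "\<lambda>s. g (s, y)" "dx g (x + 1, y)" x 1] D[of y "x + 1"]
    by (intro DERIV_unique[of "\<lambda>s. g (s, y)" _ x]) (auto simp: periodic2_def)
  moreover have "dx g (x, y + 1) = dx g (x, y)" for x y
    using g D[of y x] D[of "y + 1" x]
    by (intro DERIV_unique[of "\<lambda>s. g (s, y)" _ x]) (auto simp: periodic2_def)
  ultimately show ?thesis by (simp add: periodic2_def)
qed

lemma periodic2_dy:
  assumes d: "\<And>p. g differentiable (at p)" and g: "periodic2 g"
  shows "periodic2 (dy g)"
proof -
  note D = has_real_derivative_dy[OF d]
  have "dy g (x, y + 1) = dy g (x, y)" for x y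
    using g D[of x y] DERIV_shift[of "\<lambda>s. g (x, s)" "dy g (x, y + 1)" y 1] D[of x "y + 1"]
    by (intro DERIV_unique[of "\<lambda>s. g (x, s)" _ y]) (auto simp: periodic2_def)
  moreover have "dy g (x + 1, y) = dy g (x, y)" for x y
    using g D[of x y] D[of "x + 1" y]
    by (intro DERIV_unique[of "\<lambda>s. g (x, s)" _ y]) (auto simp: periodic2_def)
  ultimately show ?thesis by (simp add: periodic2_def)
qed

lemma Kop_diff_bound:
  assumes \<omega>: "integrable rmeas \<omega>"
    and g: "continuous_on UNIV g" "\<And>q. \<bar>g q\<bar> \<le> B" and h: "continuous_on UNIV h" "\<And>q. \<bar>h q\<bar> \<le> C"
    and d: "\<And>q. \<bar>g q - h q\<bar> \<le> \<eta>"
  shows "\<bar>Kop \<omega> g p - Kop \<omega> h p\<bar> \<le> (\<integral>w. \<bar>\<omega> w\<bar> \<partial>rmeas) * \<eta>"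
proof -
  note m = borel_measurable_continuous_onI[OF g(1)] borel_measurable_continuous_onI[OF h(1)]
  have "\<bar>Kop \<omega> (\<lambda>q. g q - h q) p\<bar> \<le> (\<integral>w. \<bar>\<omega> w\<bar> \<partial>rmeas) * \<eta>"
    by (rule Kop_bound[OF \<omega> _ d]) (use m in auto)
  then show ?thesis by (simp add: Kop_diff[OF \<omega> m(1) g(2) m(2) h(2)])
qed

text \<open>Convolution with the resolvent kernel gains one derivative: the derivative is moved onto
  the Gaussian, for trigonometric polynomials first and then by density.\<close>
lemma RR_has_real_derivative_x:
  assumes "continuous_on UNIV g" "periodic2 g"
  shows "((\<lambda>s. RR g (s, y)) has_real_derivative RX g (x, y)) (at x)"
proof -
  obtain B where B: "B \<ge> 0" "\<And>q. \<bar>g q\<bar> \<le> B" by (rule periodic2_bounded[OF assms]) blast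
  have "\<exists>t. t \<in> trig_poly \<and> (\<forall>p. \<bar>t p - g p\<bar> \<le> 1 / real (Suc n))" for n
    by (rule trig_poly_dense[OF assms, of "1 / real (Suc n)"])
      (auto simp: abs_minus_commute intro: less_imp_le)
  then obtain t where t: "\<And>n. t n \<in> trig_poly" "\<And>n p. \<bar>t n p - g p\<bar> \<le> 1 / real (Suc n)" by metis
  have tc: "continuous_on UNIV (t n)" for n using C_k_on_continuous[OF trig_poly_C_k[OF t(1), of _ 0]] .
  have tb: "\<bar>t n q\<bar> \<le> B + 1" for n q
  proof -
    have "1 / real (Suc n) \<le> 1" by simp
    then show ?thesis using B(2)[of q] t(2)[of n q] by linarith
  qed
  have conv: "\<forall>\<^sub>F n in sequentially. \<forall>p. \<bar>Kop \<omega> (t n) p - Kop \<omega> g p\<bar> \<le> e" if \<omega>: "integrable rmeas \<omega>" and "e > 0" for \<omega> e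
  proof -
    have "(\<lambda>n. (\<integral>w. \<bar>\<omega> w\<bar> \<partial>rmeas) * (1 / real (Suc n))) \<longlonglongrightarrow> (\<integral>w. \<bar>\<omega> w\<bar> \<partial>rmeas) * 0"
      by (intro tendsto_intros LIMSEQ_Suc[OF lim_1_over_n])
    then have "\<forall>\<^sub>F n in sequentially. (\<integral>w. \<bar>\<omega> w\<bar> \<partial>rmeas) * (1 / real (Suc n)) < e"
      using order_tendstoD(2)[of _ "(\<integral>w. \<bar>\<omega> w\<bar> \<partial>rmeas) * 0" sequentially e] \<open>e > 0\<close> by simp
    then show ?thesis
    proof eventually_elim
      case (elim n)
      then show ?case using Kop_diff_bound[OF \<omega> tc tb assms(1) B(2) t(2), of n] by (meson less_imp_le order_trans)
    qed
  qed
  show ?thesis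
  proof (rule has_real_derivative_limit[where F="\<lambda>n s. RR (t n) (s, y)" and F'="\<lambda>n s. RX (t n) (s, y)"])
    show "((\<lambda>s. RR (t n) (s, y)) has_real_derivative RX (t n) (x, y)) (at x)" for n x
    proof -
      have c1: "C_k_on UNIV (t n) (Suc 0)" by (rule trig_poly_C_k[OF t(1)])
      have d: "((\<lambda>s. t n (s, y)) has_real_derivative dx (t n) (x, y)) (at x)" for x y
        by (rule has_real_derivative_dx[OF C_k_on_differentiable[OF c1]])
      have cd: "continuous_on UNIV (dx (t n))" using C_k_on_dx[OF c1] by simp
      have per: "periodic2 (dx (t n))"
        by (rule periodic2_dx[OF C_k_on_differentiable[OF c1] trig_poly_periodic[OF t(1)]])
      obtain B' where B': "\<And>q. \<bar>dx (t n) q\<bar> \<le> B'" by (rule periodic2_bounded[OF cd per]) blast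
      show ?thesis
        unfolding RX_eq_RR_dx[OF d tc cd tb B'] by (rule Kop_dx[OF integrable_rmeas_r d tc cd tb B'])
    qed
    show "(\<lambda>n. RR (t n) (s, y)) \<longlonglongrightarrow> RR g (s, y)" for s
    proof (rule Kop_dominated[OF integrable_rmeas_r _ tb])
      show "(\<lambda>n. t n q) \<longlonglongrightarrow> g q" for q
      proof (rule LIM_zero_cancel, rule Lim_null_comparison)
        show "\<forall>\<^sub>F n in sequentially. norm (t n q - g q) \<le> 1 / real (Suc n)" using t(2) by simp
        show "(\<lambda>n. 1 / real (Suc n)) \<longlonglongrightarrow> 0" by (rule LIMSEQ_Suc[OF lim_1_over_n])
      qed
    qed (auto intro!: borel_measurable_continuous_onI tc assms)
    show "\<forall>\<^sub>F n in sequentially. \<forall>s. \<bar>RX (t n) (s, y) - RX g (s, y)\<bar> \<le> e" if "e > 0" for e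
      using conv[OF integrable_rmeas_z1 that] by eventually_elim blast
  qed
qed

subsection \<open>Symmetries\<close>

lemma distr_gauss_uminus: "distr gauss gauss uminus = gauss"
proof -
  have "distributed gauss lborel (\<lambda>x. x) (normal_density 0 1)"
    by (auto simp: distributed_def distr_id2)
  from gauss.normal_density_affine[OF this, of "-1" 0]
  have "distr gauss lborel (\<lambda>x. - x) = density lborel (normal_density 0 1)"
    by (simp add: distributed_def)
  moreover have "distr gauss gauss uminus = distr gauss lborel (\<lambda>x. - x)"
    by (rule distr_cong) auto
  ultimately show ?thesis by simp
qed

lemma distr_gauss2_flip: "distr gauss2 gauss2 (\<lambda>(x, y). (- x, y)) = gauss2"
proof -
  have "distr gauss gauss uminus \<Otimes>\<^sub>M distr gauss gauss (\<lambda>x. x) = distr gauss2 gauss2 (\<lambda>(x, y). (- x, y))"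
    by (rule pair_measure_distr) (auto simp: distr_id2 gauss.sigma_finite_measure_axioms)
  then show ?thesis by (simp add: distr_gauss_uminus distr_id2)
qed

lemma distr_gauss2_swap: "distr gauss2 gauss2 (\<lambda>(x, y). (y, x)) = gauss2"
  using gauss2.distr_pair_swap by simp

text \<open>Invariance of the Gaussian under measure-preserving maps of the plane. The swap carries
  the x-derivative formula to y, and the reflection of z1, combined with the swap, makes the
  resolvent preserve odd-odd functions.\<close>

lemma integral_rmeas_transform:
  fixes f :: "real \<times> real \<times> real \<Rightarrow> real"
  assumes T: "distr gauss2 gauss2 T = gauss2" "T \<in> gauss2 \<rightarrow>\<^sub>M gauss2" and f: "f \<in> borel_measurable borel"
  shows "(\<integral>w. f (fst w, T (snd w)) \<partial>rmeas) = (\<integral>w. f w \<partial>rmeas)"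
proof -
  have "distr radial radial (\<lambda>x. x) \<Otimes>\<^sub>M distr gauss2 gauss2 T = distr (radial \<Otimes>\<^sub>M gauss2) (radial \<Otimes>\<^sub>M gauss2) (\<lambda>(x, y). (x, T y))"
    by (rule pair_measure_distr) (auto simp: T gauss2.P.sigma_finite_measure_axioms)
  then have "distr rmeas rmeas (\<lambda>w. (fst w, T (snd w))) = rmeas"
    by (simp add: distr_id2 T rmeas_def case_prod_unfold)
  moreover have "(\<lambda>w. (fst w, T (snd w))) \<in> rmeas \<rightarrow>\<^sub>M rmeas"
    unfolding rmeas_def using T(2) by measurable
  moreover have "f \<in> borel_measurable rmeas" using f by (simp cong: measurable_cong_sets)
  ultimately show ?thesis using integral_distr[of "\<lambda>w. (fst w, T (snd w))" rmeas rmeas f] by simp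
qed

lemma measurable_gauss2_flip: "(\<lambda>(x, y). (- x, y)) \<in> gauss2 \<rightarrow>\<^sub>M gauss2"
  and measurable_gauss2_swap: "(\<lambda>(x, y). (y, x)) \<in> gauss2 \<rightarrow>\<^sub>M gauss2"
  by measurable

lemma Kop_integrand_measurable:
  fixes g :: "real \<times> real \<Rightarrow> real"
  assumes "integrable rmeas \<omega>" "continuous_on UNIV g"
  shows "(\<lambda>w. \<omega> w * g (p + disp w)) \<in> borel_measurable borel"
proof -
  have [measurable]: "\<omega> \<in> borel_measurable borel" "g \<in> borel_measurable borel"
    using borel_measurable_integrable[OF assms(1)] borel_measurable_continuous_onI[OF assms(2)]
    by (simp_all cong: measurable_cong_sets)
  show ?thesis by measurable
qed

lemma RR_swap:
  assumes "continuous_on UNIV g"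
  shows "RR (\<lambda>q. g (snd q, fst q)) (y, x) = RR g (x, y)"
  using integral_rmeas_transform[OF distr_gauss2_swap measurable_gauss2_swap
      Kop_integrand_measurable[OF integrable_rmeas_r assms, of "(x, y)"]]
  by (simp add: Kop_def disp_def case_prod_unfold)

lemma RX_swap:
  assumes "continuous_on UNIV g"
  shows "RX (\<lambda>q. g (snd q, fst q)) (y, x) = RY g (x, y)"
  using integral_rmeas_transform[OF distr_gauss2_swap measurable_gauss2_swap
      Kop_integrand_measurable[OF integrable_rmeas_z2 assms, of "(x, y)"]]
  by (simp add: Kop_def disp_def case_prod_unfold)

lemma RR_flip:
  assumes "continuous_on UNIV g"
  shows "RR (\<lambda>q. g (- fst q, snd q)) (x, y) = RR g (- x, y)"
  using integral_rmeas_transform[OF distr_gauss2_flip measurable_gauss2_flip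
      Kop_integrand_measurable[OF integrable_rmeas_r assms, of "(- x, y)"]]
  by (simp add: Kop_def disp_def case_prod_unfold)

lemma continuous_on_swap_args: "continuous_on UNIV g \<Longrightarrow> continuous_on UNIV (\<lambda>q::real \<times> real. g (snd q, fst q))"
  by (rule continuous_on_compose2[of UNIV g UNIV "\<lambda>q. (snd q, fst q)"]) (auto intro!: continuous_on_Pair continuous_on_snd continuous_on_fst continuous_on_id)

lemma RR_has_real_derivative_y:
  assumes "continuous_on UNIV g" "periodic2 g"
  shows "((\<lambda>s. RR g (x, s)) has_real_derivative RY g (x, y)) (at y)"
proof -
  have "periodic2 (\<lambda>q. g (snd q, fst q))" using assms(2) by (simp add: periodic2_def)
  from RR_has_real_derivative_x[OF continuous_on_swap_args[OF assms(1)] this, of x y]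
  show ?thesis by (simp add: RR_swap[OF assms(1)] RX_swap[OF assms(1)])
qed

lemma Kop_periodic: "periodic2 g \<Longrightarrow> periodic2 (Kop \<omega> g)"
proof -
  assume g: "periodic2 g"
  have "g ((x + 1, y) + d) = g ((x, y) + d)" "g ((x, y + 1) + d) = g ((x, y) + d)" for x y d
    using g[unfolded periodic2_def, rule_format, of "x + fst d" "y + snd d"]
    by (cases d; simp add: add_ac)+
  then show "periodic2 (Kop \<omega> g)" unfolding periodic2_def Kop_def by simp
qed

lemma RR_odd_odd:
  assumes "continuous_on UNIV g" "odd_odd g"
  shows "odd_odd (RR g)"
proof -
  have a: "RR g (- x, y) = - RR g (x, y)" if "continuous_on UNIV g" "\<And>x y. g (- x, y) = - g (x, y)" for g x y
    using RR_flip[OF that(1), of x y] that(2) Kop_cmult[of "\<lambda>w. fst w" "-1" g "(x, y)"] by simp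
  have "RR g (x, - y) = - RR g (x, y)" for x y
    using a[OF continuous_on_swap_args[OF assms(1)], of y x] assms(2) by (simp add: RR_swap[OF assms(1)] odd_odd_def)
  then show ?thesis using a[OF assms(1)] assms(2) by (simp add: odd_odd_def)
qed

subsection \<open>Smooth families of periodic functions\<close>

text \<open>Joint regularity in parameter and position. The class loses one order under partial
  derivatives and none under the averaging operators, which is what a bootstrap in the parameter
  requires.\<close>

definition PC :: "real set \<Rightarrow> nat \<Rightarrow> (real \<times> real \<times> real \<Rightarrow> real) \<Rightarrow> bool" where
  "PC I k g \<longleftrightarrow> C_k_on (I \<times> UNIV) g k \<and> (\<forall>e\<in>I. periodic2 (\<lambda>p. g (e, p)))"

lemma open_param: "open I \<Longrightarrow> open (I \<times> (UNIV :: (real \<times> real) set))"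
  by (intro open_Times) auto

lemma PC_partials:
  assumes I: "open I" and g: "PC I (Suc k) g"
  obtains ge gx gy where
    "\<And>e p. e \<in> I \<Longrightarrow> ((\<lambda>s. g (s, p)) has_real_derivative ge (e, p)) (at e)"
    "\<And>e x y. e \<in> I \<Longrightarrow> ((\<lambda>s. g (e, s, y)) has_real_derivative gx (e, x, y)) (at x)"
    "\<And>e x y. e \<in> I \<Longrightarrow> ((\<lambda>s. g (e, x, s)) has_real_derivative gy (e, x, y)) (at y)"
    "PC I k ge" "PC I k gx" "PC I k gy"
proof -
  have gp: "g (e, x + 1, y) = g (e, x, y)" "g (e, x, y + 1) = g (e, x, y)" if "e \<in> I" for e x y
    using g that by (auto simp: PC_def periodic2_def)
  obtain ge gx gy where
    e: "\<And>e p. e \<in> I \<Longrightarrow> ((\<lambda>s. g (s, p)) has_real_derivative ge (e, p)) (at e)" and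
    x: "\<And>e x y. e \<in> I \<Longrightarrow> ((\<lambda>s. g (e, s, y)) has_real_derivative gx (e, x, y)) (at x)" and
    y: "\<And>e x y. e \<in> I \<Longrightarrow> ((\<lambda>s. g (e, x, s)) has_real_derivative gy (e, x, y)) (at y)" and
    c: "C_k_on (I \<times> UNIV) ge k" "C_k_on (I \<times> UNIV) gx k" "C_k_on (I \<times> UNIV) gy k"
    by (rule C_k_on_partials3[of I g k]) (use g in \<open>auto simp: PC_def\<close>)
  \<comment> \<open>A parameter derivative depends only on nearby parameter values, so an identity
    between the values at p and q valid for all s in I passes to it.\<close>
  have tr: "ge (e, p) = ge (e, q)" if "e \<in> I" "\<And>s. s \<in> I \<Longrightarrow> g (s, p) = g (s, q)" for e p q
  proof (rule DERIV_unique)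
    show "((\<lambda>s. g (s, q)) has_real_derivative ge (e, p)) (at e)"
      by (rule has_field_derivative_transform_within_open[OF e[OF that(1)] I that(1)]) (use that in auto)
  qed (rule e[OF that(1)])
  have "periodic2 (\<lambda>p. ge (e, p))" if "e \<in> I" for e
    unfolding periodic2_def using that gp by (auto intro!: tr)
  moreover have "periodic2 (\<lambda>p. gx (e, p))" if "e \<in> I" for e
  proof -
    have "gx (e, x + 1, y) = gx (e, x, y)" for x y
      using x[OF that, of y x] DERIV_shift[of "\<lambda>s. g (e, s, y)" "gx (e, x + 1, y)" x 1] x[OF that, of y "x + 1"] gp[OF that]
      by (intro DERIV_unique[of "\<lambda>s. g (e, s, y)" _ x]) auto
    moreover have "gx (e, x, y + 1) = gx (e, x, y)" for x y
      using x[OF that, of y x] x[OF that, of "y + 1" x] gp[OF that]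
      by (intro DERIV_unique[of "\<lambda>s. g (e, s, y)" _ x]) auto
    ultimately show ?thesis by (simp add: periodic2_def)
  qed
  moreover have "periodic2 (\<lambda>p. gy (e, p))" if "e \<in> I" for e
  proof -
    have "gy (e, x, y + 1) = gy (e, x, y)" for x y
      using y[OF that, of x y] DERIV_shift[of "\<lambda>s. g (e, x, s)" "gy (e, x, y + 1)" y 1] y[OF that, of x "y + 1"] gp[OF that]
      by (intro DERIV_unique[of "\<lambda>s. g (e, x, s)" _ y]) auto
    moreover have "gy (e, x + 1, y) = gy (e, x, y)" for x y
      using y[OF that, of x y] y[OF that, of "x + 1" y] gp[OF that]
      by (intro DERIV_unique[of "\<lambda>s. g (e, x, s)" _ y]) auto
    ultimately show ?thesis by (simp add: periodic2_def)
  qed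
  ultimately show thesis using e x y c by (intro that[of ge gx gy]) (auto simp: PC_def)
qed

lemma Kop_dy:
  assumes \<omega>: "integrable rmeas \<omega>"
    and der: "\<And>x y. ((\<lambda>s. g (x, s)) has_real_derivative gy (x, y)) (at y)"
    and c: "continuous_on UNIV g" "continuous_on UNIV gy"
    and b: "\<And>q. \<bar>g q\<bar> \<le> B" "\<And>q. \<bar>gy q\<bar> \<le> B'"
  shows "((\<lambda>s. Kop \<omega> g (x, s)) has_real_derivative Kop \<omega> gy (x, y)) (at y)"
proof -
  have "((\<lambda>t. Kop \<omega> (\<lambda>q. g (q + (0, t))) (x, 0)) has_real_derivative Kop \<omega> (\<lambda>q. gy (q + (0, y))) (x, 0)) (at y)"
  proof (rule Kop_has_real_derivative[OF \<omega> zero_less_one, where F'="\<lambda>t q. gy (q + (0, t))"])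
    show "((\<lambda>t. g (q + (0, t))) has_real_derivative gy (q + (0, t))) (at t)" for q t
      using DERIV_shift[of "\<lambda>s. g (fst q, s)" "gy (fst q, snd q + t)" t "snd q"] der[of "fst q" "t + snd q"]
      by (cases q) (simp add: add.commute)
    show "(\<lambda>q. gy (q + (0, y))) \<in> borel_measurable borel"
      by (intro borel_measurable_continuous_onI continuous_on_compose2[OF c(2)] continuous_intros) auto
    show "continuous_on UNIV (\<lambda>q. g (q + (0, t)))" for t
      by (intro continuous_on_compose2[OF c(1)] continuous_intros) auto
  qed (rule b)+
  then show ?thesis by (simp flip: Kop_translate)
qed

definition Kpar :: "(real \<times> real \<times> real \<Rightarrow> real) \<Rightarrow> (real \<times> real \<times> real \<Rightarrow> real) \<Rightarrow> real \<times> real \<times> real \<Rightarrow> real" where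
  "Kpar \<omega> g X = Kop \<omega> (\<lambda>q. g (fst X, q)) (snd X)"

lemma Kpar_slice: "(\<lambda>p. Kpar \<omega> g (e, p)) = Kop \<omega> (\<lambda>q. g (e, q))"
  by (simp add: Kpar_def fun_eq_iff)

lemma PC_slice:
  assumes "PC I k g" "e \<in> I"
  shows "C_k_on UNIV (\<lambda>p. g (e, p)) k" "continuous_on UNIV (\<lambda>p. g (e, p))" "periodic2 (\<lambda>p. g (e, p))"
  using assms C_k_on_slice[of I g k e] C_k_on_continuous by (auto simp: PC_def)

lemma PC_continuous: "PC I k g \<Longrightarrow> continuous_on (I \<times> UNIV) g"
  using C_k_on_continuous by (auto simp: PC_def)

lemma PC_bounded:
  assumes "PC I k g" "compact J" "J \<subseteq> I"
  obtains B where "B \<ge> 0" "\<And>e p. e \<in> J \<Longrightarrow> \<bar>g (e, p)\<bar> \<le> B"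
proof -
  have "\<And>e. e \<in> I \<Longrightarrow> periodic2 (\<lambda>p. g (e, p))" using assms(1) by (simp add: PC_def)
  from param_bounded[OF PC_continuous[OF assms(1)] this assms(2,3)] that show thesis by blast
qed

lemma PC_uniform:
  assumes "PC I k g" "open I" "e \<in> I" "\<eta> > 0"
  obtains d where "d > 0" "\<And>e' p. \<bar>e' - e\<bar> < d \<Longrightarrow> e' \<in> I \<and> \<bar>g (e', p) - g (e, p)\<bar> < \<eta>"
proof -
  have "\<And>e. e \<in> I \<Longrightarrow> periodic2 (\<lambda>p. g (e, p))" using assms(1) by (simp add: PC_def)
  from param_uniform[OF PC_continuous[OF assms(1)] this assms(2-4)] that show thesis by blast
qed

lemma Kpar_PC0:
  assumes I: "open I" and \<omega>: "integrable rmeas \<omega>" and g: "PC I 0 g"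
  shows "PC I 0 (Kpar \<omega> g)"
proof -
  define C where "C = (\<integral>w. \<bar>\<omega> w\<bar> \<partial>rmeas)"
  have C0: "C \<ge> 0" by (simp add: C_def)
  have "continuous_on (I \<times> UNIV) (Kpar \<omega> g)"
    unfolding continuous_on_iff
  proof (intro ballI allI impI)
    fix X :: "real \<times> real \<times> real" and \<eta> :: real assume X: "X \<in> I \<times> UNIV" and "\<eta> > 0"
    obtain e p where Xp: "X = (e, p)" "e \<in> I" using X by auto
    \<comment> \<open>Half of \<eta> is reserved for moving the point at fixed e; the operator norm
      C times \<open>\<eta>1\<close> stays below the other half, and C + 1 avoids a zero
      denominator.\<close>
    define \<eta>1 where "\<eta>1 = \<eta> / (2 * (C + 1))"
    have \<eta>1: "\<eta>1 > 0" using \<open>\<eta> > 0\<close> C0 by (auto simp: \<eta>1_def intro!: divide_pos_pos mult_pos_pos add_nonneg_pos)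
    obtain d where d: "d > 0" "\<And>e' p. \<bar>e' - e\<bar> < d \<Longrightarrow> e' \<in> I \<and> \<bar>g (e', p) - g (e, p)\<bar> < \<eta>1"
      by (rule PC_uniform[OF g I Xp(2) \<eta>1]) blast
    note sl = PC_slice[OF g Xp(2)]
    obtain B where B: "\<And>q. \<bar>g (e, q)\<bar> \<le> B" by (rule periodic2_bounded[OF sl(2,3)]) blast
    have "isCont (Kop \<omega> (\<lambda>q. g (e, q))) p"
      using Kop_continuous[OF \<omega> sl(2) B] unfolding continuous_on_eq_continuous_at[OF open_UNIV] by blast
    then obtain d' where d': "d' > 0" "\<And>p'. dist p' p < d' \<Longrightarrow> dist (Kop \<omega> (\<lambda>q. g (e, q)) p') (Kop \<omega> (\<lambda>q. g (e, q)) p) < \<eta> / 2"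
      using \<open>\<eta> > 0\<close> unfolding continuous_at_eps_delta by (metis half_gt_zero)
    have "dist (Kpar \<omega> g Y) (Kpar \<omega> g X) < \<eta>" if "dist Y X < min d d'" for Y
    proof -
      obtain e' p' where Y: "Y = (e', p')" by (rule prod.exhaust)
      have l: "\<bar>e' - e\<bar> < d" "dist p' p < d'"
        using that dist_fst_le[of Y X] dist_snd_le[of Y X] by (auto simp: Y Xp dist_real_def)
      note sl' = PC_slice[OF g conjunct1[OF d(2)[OF l(1)]]]
      obtain B' where B': "\<And>q. \<bar>g (e', q)\<bar> \<le> B'" by (rule periodic2_bounded[OF sl'(2,3)]) blast
      have "\<bar>Kop \<omega> (\<lambda>q. g (e', q)) p' - Kop \<omega> (\<lambda>q. g (e, q)) p'\<bar> \<le> C * \<eta>1"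
        unfolding C_def by (rule Kop_diff_bound[OF \<omega> sl'(2) B' sl(2) B]) (use d(2)[OF l(1)] less_imp_le in blast)
      moreover have "C * \<eta>1 < \<eta> / 2"
        unfolding \<eta>1_def using \<open>\<eta> > 0\<close> C0 by (simp add: field_simps)
      ultimately show ?thesis using d'(2)[OF l(2)]
        unfolding Kpar_def Y Xp dist_real_def fst_conv snd_conv by linarith
    qed
    then show "\<exists>d>0. \<forall>x'\<in>I \<times> UNIV. dist x' X < d \<longrightarrow> dist (Kpar \<omega> g x') (Kpar \<omega> g X) < \<eta>"
      using d(1) d'(1) by (intro exI[of _ "min d d'"]) auto
  qed
  then show ?thesis using g by (auto simp: PC_def Kpar_slice intro: Kop_periodic)
qed

text \<open>Averaging commutes with all three partial derivatives, so each order is obtained by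
  applying the previous one to the partials of g.\<close>

lemma Kpar_PC:
  assumes I: "open I" and \<omega>: "integrable rmeas \<omega>"
  shows "PC I k g \<Longrightarrow> PC I k (Kpar \<omega> g)"
proof (induction k arbitrary: g)
  case 0
  then show ?case by (rule Kpar_PC0[OF I \<omega>])
next
  case (Suc k)
  obtain ge gx gy where
    e: "\<And>e p. e \<in> I \<Longrightarrow> ((\<lambda>s. g (s, p)) has_real_derivative ge (e, p)) (at e)" and
    x: "\<And>e x y. e \<in> I \<Longrightarrow> ((\<lambda>s. g (e, s, y)) has_real_derivative gx (e, x, y)) (at x)" and
    y: "\<And>e x y. e \<in> I \<Longrightarrow> ((\<lambda>s. g (e, x, s)) has_real_derivative gy (e, x, y)) (at y)" and
    P: "PC I k ge" "PC I k gx" "PC I k gy"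
    by (rule PC_partials[OF I Suc.prems]) blast
  have bd: "\<exists>B. \<forall>q. \<bar>h (e, q)\<bar> \<le> B" if "PC I j h" "e \<in> I" for h j e
    by (rule periodic2_bounded[OF PC_slice(2,3)[OF that]]) blast
  have "C_k_on (I \<times> UNIV) (Kpar \<omega> g) (Suc k)"
  proof (rule C_k_on_of_partials3[OF I, where fe="Kpar \<omega> ge" and fx="Kpar \<omega> gx" and fy="Kpar \<omega> gy"])
    fix e :: real assume eI: "e \<in> I"
    show "((\<lambda>s. Kpar \<omega> g (s, p)) has_real_derivative Kpar \<omega> ge (e, p)) (at e)" for p
    proof -
      obtain d where d: "d > 0" "cball e d \<subseteq> I" using I eI open_contains_cball by blast
      obtain B where B: "\<And>e' p. e' \<in> cball e d \<Longrightarrow> \<bar>g (e', p)\<bar> \<le> B"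
        by (rule PC_bounded[OF Suc.prems _ d(2)]) auto
      obtain B' where B': "\<And>e' p. e' \<in> cball e d \<Longrightarrow> \<bar>ge (e', p)\<bar> \<le> B'"
        by (rule PC_bounded[OF P(1) _ d(2)]) auto
      have m: "t \<in> cball e d" "t \<in> I" if "\<bar>t - e\<bar> < d" for t
        using that d by (auto simp: dist_real_def abs_minus_commute)
      have "((\<lambda>s. Kop \<omega> (\<lambda>q. g (s, q)) p) has_real_derivative Kop \<omega> (\<lambda>q. ge (e, q)) p) (at e)"
      proof (rule Kop_has_real_derivative[OF \<omega> d(1), where F="\<lambda>t q. g (t, q)" and F'="\<lambda>t q. ge (t, q)"])
        show "(\<lambda>q. ge (e, q)) \<in> borel_measurable borel"
          by (rule borel_measurable_continuous_onI[OF PC_slice(2)[OF P(1) eI]])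
      qed (use m e B B' PC_slice(2)[OF Suc.prems] in blast)+
      then show ?thesis by (simp add: Kpar_def)
    qed
    obtain B B1 B2 where B: "\<And>q. \<bar>g (e, q)\<bar> \<le> B" "\<And>q. \<bar>gx (e, q)\<bar> \<le> B1" "\<And>q. \<bar>gy (e, q)\<bar> \<le> B2"
      using bd[OF Suc.prems eI] bd[OF P(2) eI] bd[OF P(3) eI] by blast
    show "((\<lambda>s. Kpar \<omega> g (e, s, y)) has_real_derivative Kpar \<omega> gx (e, x, y)) (at x)" for x y
      unfolding Kpar_def fst_conv snd_conv
      by (rule Kop_dx[OF \<omega> x[OF eI] PC_slice(2)[OF Suc.prems eI] PC_slice(2)[OF P(2) eI] B(1,2)])
    show "((\<lambda>s. Kpar \<omega> g (e, x, s)) has_real_derivative Kpar \<omega> gy (e, x, y)) (at y)" for x y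
      unfolding Kpar_def fst_conv snd_conv
      by (rule Kop_dy[OF \<omega> y[OF eI] PC_slice(2)[OF Suc.prems eI] PC_slice(2)[OF P(3) eI] B(1,3)])
  qed (use Suc.IH P in \<open>auto simp: PC_def\<close>)
  then show ?case using Suc.prems unfolding PC_def Kpar_slice by (blast intro: Kop_periodic)
qed

section \<open>From the Gaussian formula to the resolvent equation\<close>

lemma C1_has_derivative:
  assumes "C_k_on UNIV g (Suc 0)"
  shows "(g has_derivative (\<lambda>v. fst v * dx g p + snd v * dy g p)) (at p)"
  using C_k_on_dy[OF assms] has_real_derivative_dx[OF C_k_on_differentiable[OF assms]]
    has_real_derivative_dy[OF C_k_on_differentiable[OF assms]]
  by (intro has_derivative_of_partials2) auto

lemma C1_periodic:
  assumes "C_k_on UNIV g (Suc 0)" "periodic2 g"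
  obtains B where "B \<ge> 0" "\<And>q. \<bar>g q\<bar> \<le> B" "\<And>q. \<bar>dx g q\<bar> \<le> B" "\<And>q. \<bar>dy g q\<bar> \<le> B"
    "continuous_on UNIV g" "continuous_on UNIV (dx g)" "continuous_on UNIV (dy g)"
    "periodic2 (dx g)" "periodic2 (dy g)"
proof -
  have c: "continuous_on UNIV g" "continuous_on UNIV (dx g)" "continuous_on UNIV (dy g)"
    using C_k_on_continuous[OF assms(1)] C_k_on_dx[OF assms(1)] C_k_on_dy[OF assms(1)] by simp_all
  have p: "periodic2 (dx g)" "periodic2 (dy g)"
    using periodic2_dx[OF C_k_on_differentiable[OF assms(1)] assms(2)]
      periodic2_dy[OF C_k_on_differentiable[OF assms(1)] assms(2)] .
  obtain B0 where B0: "B0 \<ge> 0" "\<And>q. \<bar>g q\<bar> \<le> B0" by (rule periodic2_bounded[OF c(1) assms(2)]) blast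
  obtain B1 where B1: "B1 \<ge> 0" "\<And>q. \<bar>dx g q\<bar> \<le> B1" by (rule periodic2_bounded[OF c(2) p(1)]) blast
  obtain B2 where B2: "B2 \<ge> 0" "\<And>q. \<bar>dy g q\<bar> \<le> B2" by (rule periodic2_bounded[OF c(3) p(2)]) blast
  show thesis
  proof (rule that[of "B0 + B1 + B2"])
    show "\<bar>g q\<bar> \<le> B0 + B1 + B2" "\<bar>dx g q\<bar> \<le> B0 + B1 + B2" "\<bar>dy g q\<bar> \<le> B0 + B1 + B2" for q
      using B0(1) B0(2)[of q] B1(1) B1(2)[of q] B2(1) B2(2)[of q] by linarith+
  qed (use c p B0 B1 B2 in auto)
qed

text \<open>With the radial density the integrand is the derivative of exp(-r^2/2) G(r). The
  boundary value at r = 0 becomes the identity term of the resolvent equation.\<close>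

lemma radial_ftc:
  fixes G :: "real \<Rightarrow> real"
  assumes der: "\<And>r. (G has_real_derivative G' r) (at r)" and c: "continuous_on UNIV G'"
    and b: "\<And>r. \<bar>G r\<bar> \<le> B" "\<And>r. \<bar>G' r\<bar> \<le> B'"
  shows "(\<integral>r. G' r - r * G r \<partial>radial) = - G 0"
proof -
  have cG: "continuous_on UNIV G"
    using der by (auto intro!: continuous_at_imp_continuous_on DERIV_isCont)
  have m[measurable]: "G \<in> borel_measurable borel" "G' \<in> borel_measurable borel"
    using cG c by (auto intro: borel_measurable_continuous_onI)
  let ?f = "\<lambda>r. exp (- r\<^sup>2 / 2) * (G' r - r * G r)"
  have i1: "integrable radial G'"
    by (rule Bochner_Integration.integrable_bound[OF integrable_mult_right[OF integrable_radial_one, of B']])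
      (use order_trans[OF b(2) abs_ge_self] in auto)
  have i2: "integrable radial (\<lambda>r. r * G r)"
  proof (rule Bochner_Integration.integrable_bound[OF integrable_mult_right[OF integrable_radial_power[of 1], of B]])
    show "AE x in radial. norm (x * G x) \<le> norm (B * x ^ 1)"
      by (intro AE_I2) (auto simp: abs_mult mult.commute[of "\<bar>B\<bar>"] intro!: mult_left_mono order_trans[OF b(1) abs_ge_self])
  qed auto
  have i: "set_integrable lborel {0<..} ?f"
    using Bochner_Integration.integrable_diff[OF i1 i2]
    by (subst (asm) integrable_radial_iff) (auto simp: set_integrable_def mult.assoc)
  have "(LBINT r=0..\<infinity>. ?f r) = 0 - G 0"
  proof (rule interval_integral_FTC_integrable)
    show "((\<lambda>r. exp (- r\<^sup>2 / 2) * G r) has_vector_derivative ?f r) (at r)" for r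
      unfolding has_real_derivative_iff_has_vector_derivative[symmetric]
      by (auto intro!: derivative_eq_intros der simp: algebra_simps)
    have cont: "isCont G r" "isCont G' r" for r using cG c by (auto simp: continuous_on_eq_continuous_at)
    then show "isCont ?f r" for r by (intro continuous_intros) auto
    show "set_integrable lborel (einterval 0 \<infinity>) ?f" using i by (simp add: zero_ereal_def)
    have "isCont (\<lambda>r. exp (- r\<^sup>2 / 2) * G r) 0" using cont by (intro continuous_intros) auto
    then have "((\<lambda>r. exp (- r\<^sup>2 / 2) * G r) \<longlongrightarrow> G 0) (at 0)" unfolding isCont_def by simp
    then have "((\<lambda>r. exp (- r\<^sup>2 / 2) * G r) \<longlongrightarrow> G 0) (at_right 0)" by (rule filterlim_at_split[THEN iffD1, THEN conjunct2])
    then show "(((\<lambda>r. exp (- r\<^sup>2 / 2) * G r) \<circ> real_of_ereal) \<longlongrightarrow> G 0) (at_right 0)"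
      unfolding zero_ereal_def at_right_ereal by (auto simp: filterlim_filtermap comp_def)
    have "((\<lambda>r. exp (- r\<^sup>2 / 2) * G r) \<longlongrightarrow> 0) at_top"
    proof (rule Lim_null_comparison)
      have "((\<lambda>r::real. exp (- r\<^sup>2 / 2)) \<longlongrightarrow> 0) at_top" by real_asymp
      then show "((\<lambda>r. exp (- r\<^sup>2 / 2) * B) \<longlongrightarrow> 0) at_top" using tendsto_mult_left_zero by blast
      show "\<forall>\<^sub>F x in at_top. norm (exp (- x\<^sup>2 / 2) * G x) \<le> exp (- x\<^sup>2 / 2) * B"
        by (intro always_eventually allI) (auto simp: abs_mult b(1))
    qed
    then show "(((\<lambda>r. exp (- r\<^sup>2 / 2) * G r) \<circ> real_of_ereal) \<longlongrightarrow> 0) (at_left \<infinity>)"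
      unfolding at_left_PInf by (auto simp: filterlim_filtermap comp_def)
  qed simp
  then have "(LBINT r:{0<..}. ?f r) = - G 0"
    by (simp add: interval_lebesgue_integral_0_infty)
  then show ?thesis
    by (subst integral_radial) (auto simp: set_lebesgue_integral_def mult.assoc)
qed

text \<open>Along the ray r \<mapsto> p + r z the derivative of g is z times its gradient, so
  integrating in r first gives -g(p) for every z. As the left-hand side is the Laplacian of
  \<open>RR g\<close>, this says that 1 - \<Delta> maps \<open>RR g\<close> to g.\<close>

lemma resolvent_identity:
  assumes "C_k_on UNIV g (Suc 0)" "periodic2 g"
  shows "RX (dx g) p + RY (dy g) p = RR g p - g p"
proof -
  obtain B where B: "B \<ge> 0" "\<And>q. \<bar>g q\<bar> \<le> B" "\<And>q. \<bar>dx g q\<bar> \<le> B" "\<And>q. \<bar>dy g q\<bar> \<le> B"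
    and c: "continuous_on UNIV g" "continuous_on UNIV (dx g)" "continuous_on UNIV (dy g)"
    by (rule C1_periodic[OF assms]) blast
  note m = c[THEN borel_measurable_continuous_onI]
  note i = Kop_integrable[OF integrable_rmeas_z1 m(2) B(3), of p] Kop_integrable[OF integrable_rmeas_z2 m(3) B(4), of p]
    Kop_integrable[OF integrable_rmeas_r m(1) B(2), of p]
  let ?T = "\<lambda>r z. (fst z * dx g (p + disp (r, z)) + snd z * dy g (p + disp (r, z))) - r * g (p + disp (r, z))"
  have "integrable rmeas (case_prod ?T)"
    using Bochner_Integration.integrable_diff[OF Bochner_Integration.integrable_add[OF i(1,2)] i(3)]
    by (simp add: case_prod_unfold)
  then have iT: "integrable (radial \<Otimes>\<^sub>M gauss2) (case_prod ?T)" by (simp add: rmeas_def)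
  have inner: "(\<integral>r. ?T r z \<partial>radial) = - g p" for z
  proof -
    have d: "((\<lambda>r. p + disp (r, z)) has_derivative (\<lambda>h. (h * fst z, h * snd z))) (at r)" for r
      unfolding disp_def by (auto intro!: derivative_eq_intros)
    have cd: "continuous_on UNIV (\<lambda>r. p + disp (r, z))" unfolding disp_def by (intro continuous_intros)
    have "(\<integral>r. (fst z * dx g (p + disp (r, z)) + snd z * dy g (p + disp (r, z))) - r * g (p + disp (r, z)) \<partial>radial)
      = - g (p + disp (0, z))"
    proof (rule radial_ftc[where B=B and B'="\<bar>fst z\<bar> * B + \<bar>snd z\<bar> * B"])
      show "((\<lambda>r. g (p + disp (r, z))) has_real_derivative
        (fst z * dx g (p + disp (r, z)) + snd z * dy g (p + disp (r, z)))) (at r)" for r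
        unfolding has_field_derivative_def
        by (rule has_derivative_eq_rhs[OF has_derivative_compose[OF d C1_has_derivative[OF assms(1)]]])
          (auto simp: algebra_simps)
      show "continuous_on UNIV (\<lambda>r. fst z * dx g (p + disp (r, z)) + snd z * dy g (p + disp (r, z)))"
        by (intro continuous_intros continuous_on_compose2[OF c(2) cd] continuous_on_compose2[OF c(3) cd]) auto
      show "\<bar>fst z * dx g (p + disp (r, z)) + snd z * dy g (p + disp (r, z))\<bar> \<le> \<bar>fst z\<bar> * B + \<bar>snd z\<bar> * B" for r
        by (rule order_trans[OF abs_triangle_ineq])
          (auto simp: abs_mult intro!: add_mono mult_left_mono B)
    qed (rule B)
    then show ?thesis by (simp add: disp_def zero_prod_def[symmetric])
  qed
  have "(\<integral>w. case_prod ?T w \<partial>(radial \<Otimes>\<^sub>M gauss2)) = - g p"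
    using rmeas.integral_snd[OF iT] by (simp add: inner gauss2.P.prob_space)
  then have "(\<integral>w. (fst (snd w) * dx g (p + disp w) + snd (snd w) * dy g (p + disp w)) - fst w * g (p + disp w) \<partial>rmeas) = - g p"
    by (simp add: rmeas_def case_prod_unfold)
  then show ?thesis
    unfolding Kop_def using i by simp
qed

subsection \<open>Hoelder estimate\<close>

lemma integrable_radial_powr:
  assumes "0 \<le> \<beta>" "\<beta> < 1"
  shows "integrable radial (\<lambda>r. r powr (- \<beta>))"
proof -
  have "integrable lborel (\<lambda>r::real. indicator {0<..} r * exp (- r\<^sup>2 / 2) * r powr (- \<beta>))"
  proof (rule Bochner_Integration.integrable_bound)
    show "integrable lborel (\<lambda>t. exp (1/2) * (indicator {0..} t * t powr ((1 - \<beta>) - 1) / exp t))"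
    proof (intro integrable_mult_right integrableI_bounded)
      have "(\<integral>\<^sup>+ t. ennreal (norm (indicator {0..} t * t powr (1 - \<beta> - 1) / exp t)) \<partial>lborel)
        = ennreal (Gamma (1 - \<beta>))"
        unfolding Gamma_conv_nn_integral_real[of "1 - \<beta>", simplified, OF assms(2)] by (simp add: abs_mult)
      then show "(\<integral>\<^sup>+ t. ennreal (norm (indicator {0..} t * t powr (1 - \<beta> - 1) / exp t)) \<partial>lborel) < \<infinity>" by simp
    qed simp
    \<comment> \<open>Completing the square replaces the Gaussian tail by an exponential one, so
      that the Gamma integral at 1 - \<beta> is the majorant.\<close>
    have "exp (- r\<^sup>2 / 2) \<le> exp (1/2) / exp r" for r :: real
    proof -
      have "0 \<le> (r - 1)\<^sup>2" by simp
      then have "- r\<^sup>2 / 2 \<le> 1/2 - r" by (simp add: power2_eq_square algebra_simps)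
      then show ?thesis by (simp flip: exp_diff)
    qed
    from mult_right_mono[OF this] have "exp (- r\<^sup>2 / 2) * r powr (- \<beta>) \<le> exp (1/2) / exp r * r powr (- \<beta>)" for r :: real
      by simp
    then show "AE x in lborel. norm (indicator {0<..} x * exp (- x\<^sup>2 / 2) * x powr - \<beta>)
         \<le> norm (exp (1 / 2) * (indicator {0..} x * x powr (1 - \<beta> - 1) / exp x))"
      by (intro AE_I2) (auto simp: indicator_def mult_ac)
  qed simp
  then show ?thesis by (subst integrable_radial_iff) auto
qed

text \<open>At a fixed scale r the derivative of a Gaussian average can be shifted to the weight at
  the price of a factor 1/r. The resulting expressions contain g but none of its derivatives, so
  only the sup norm of g enters later.\<close>

lemma gauss2_average_dx:
  assumes "C_k_on UNIV g (Suc 0)" "periodic2 g" "\<And>q. \<bar>g q\<bar> \<le> B" "r > 0"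
  shows "((\<lambda>s. \<integral>z. fst z * g ((s, y) + disp (r, z)) \<partial>gauss2) has_real_derivative
     (\<integral>z. ((fst z)\<^sup>2 - 1) * g ((x, y) + disp (r, z)) \<partial>gauss2) / r) (at x)"
    "((\<lambda>s. \<integral>z. fst z * g ((x, s) + disp (r, z)) \<partial>gauss2) has_real_derivative
     (\<integral>z. (fst z * snd z) * g ((x, y) + disp (r, z)) \<partial>gauss2) / r) (at y)"
proof -
  obtain B' where B': "B' \<ge> 0" "\<And>q. \<bar>g q\<bar> \<le> B'" "\<And>q. \<bar>dx g q\<bar> \<le> B'" "\<And>q. \<bar>dy g q\<bar> \<le> B'"
    and c: "continuous_on UNIV g" "continuous_on UNIV (dx g)" "continuous_on UNIV (dy g)"
    by (rule C1_periodic[OF assms(1,2)]) blast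
  have cd: "continuous_on UNIV (\<lambda>z. p + disp (r, z))" for p unfolding disp_def by (intro continuous_intros)
  have c': "continuous_on UNIV (\<lambda>z. g (p + disp (r, z)))" "continuous_on UNIV (\<lambda>z. dx g (p + disp (r, z)))"
     "continuous_on UNIV (\<lambda>z. dy g (p + disp (r, z)))" for p
    by (intro continuous_on_compose2[OF c(1) cd] continuous_on_compose2[OF c(2) cd] continuous_on_compose2[OF c(3) cd], simp)+
  have meas: "h \<in> borel_measurable gauss2" if "continuous_on UNIV h" for h :: "real \<times> real \<Rightarrow> real"
    using borel_measurable_continuous_onI[OF that] measurable_cong_sets[OF sets_gauss2 refl] by blast
  note D = C_k_on_differentiable[OF assms(1)]
  have sx: "((\<lambda>s. g ((s, b) + q)) has_real_derivative dx g ((a, b) + q)) (at a)" for a b q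
    using DERIV_shift[of "\<lambda>s. g (s, b + snd q)" "dx g (a + fst q, b + snd q)" a "fst q"]
      has_real_derivative_dx[OF D, of "b + snd q" "a + fst q"] by (cases q) simp
  have sy: "((\<lambda>s. g ((a, s) + q)) has_real_derivative dy g ((a, b) + q)) (at b)" for a b q
    using DERIV_shift[of "\<lambda>s. g (a + fst q, s)" "dy g (a + fst q, b + snd q)" b "snd q"]
      has_real_derivative_dy[OF D, of "a + fst q" "b + snd q"] by (cases q) simp
  have zx: "((\<lambda>s. g (p + disp (r, s, b))) has_real_derivative r * dx g (p + disp (r, a, b))) (at a)" for p a b
  proof -
    have "((\<lambda>s. fst p + r * s) has_real_derivative r) (at a)" by (auto intro!: derivative_eq_intros)
    from DERIV_chain2[of "\<lambda>s. g (s, snd p + r * b)", OF has_real_derivative_dx[OF D] this]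
    show ?thesis by (cases p) (simp add: disp_def mult.commute)
  qed
  have zy: "((\<lambda>s. g (p + disp (r, a, s))) has_real_derivative r * dy g (p + disp (r, a, b))) (at b)" for p a b
  proof -
    have "((\<lambda>s. snd p + r * s) has_real_derivative r) (at b)" by (auto intro!: derivative_eq_intros)
    from DERIV_chain2[of "\<lambda>s. g (fst p + r * a, s)", OF has_real_derivative_dy[OF D] this]
    show ?thesis by (cases p) (simp add: disp_def mult.commute)
  qed
  note ifst = gauss2_integrable_mult_bounded[OF integrable_gauss2_fst]
  note ione = gauss2_integrable_mult_bounded[OF integrable_gauss2_one]
  have ig: "integrable gauss2 (\<lambda>z. fst z * g (p + disp (r, z)))" "integrable gauss2 (\<lambda>z. g (p + disp (r, z)))"
      "integrable gauss2 (\<lambda>z. fst z * dx g (p + disp (r, z)))" "integrable gauss2 (\<lambda>z. fst z * dy g (p + disp (r, z)))"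
      "integrable gauss2 (\<lambda>z. (fst z)\<^sup>2 * g (p + disp (r, z)))"
      "integrable gauss2 (\<lambda>z. (fst z * snd z) * g (p + disp (r, z)))" for p
    using ifst[OF c'(1) B'(2), of p] ione[OF c'(1) B'(2), of p] ifst[OF c'(2) B'(3), of p] ifst[OF c'(3) B'(4), of p]
      gauss2_integrable_mult_bounded[OF integrable_gauss2_fst2 c'(1) B'(2), of p]
      gauss2_integrable_mult_bounded[OF integrable_gauss2_fst_snd c'(1) B'(2), of p] by simp_all
  have ifst1: "integrable gauss2 (\<lambda>z. \<bar>fst z\<bar> * B')" using integrable_gauss2_fst by auto
  have one: "1 \<le> 1 + \<bar>z\<bar>" for z :: real by simp
  have "((\<lambda>s. \<integral>z. fst z * g ((s, y) + disp (r, z)) \<partial>gauss2) has_real_derivative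
     (\<integral>z. fst z * dx g ((x, y) + disp (r, z)) \<partial>gauss2)) (at x)"
    by (rule has_real_derivative_integral[OF zero_less_one, where h="\<lambda>z. \<bar>fst z\<bar> * B'"];
      ((unfold abs_mult)?; intro DERIV_cmult sx B' mult_left_mono abs_ge_zero ig ifst1 borel_measurable_integrable))
  moreover have "(\<integral>z. fst z * dx g ((x, y) + disp (r, z)) \<partial>gauss2)
     = (\<integral>z. ((fst z)\<^sup>2 - 1) * g ((x, y) + disp (r, z)) \<partial>gauss2) / r"
  proof -
    let ?p = "(x, y)"
    \<comment> \<open>Stein's identity for z1 g(p + r z): the derivative that falls on the factor z1
      produces the -1 in the weight z1^2 - 1.\<close>
    have "(\<integral>z. fst z * (fst z * g (?p + disp (r, z))) \<partial>gauss2)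
      = (\<integral>z. g (?p + disp (r, z)) + fst z * (r * dx g (?p + disp (r, z))) \<partial>gauss2)"
    proof (rule gauss2_stein_fst[where C="\<lambda>_. B' + r * B'"])
      show "((\<lambda>s. fst (s, z2) * g (?p + disp (r, s, z2))) has_real_derivative
           g (?p + disp (r, z1, z2)) + fst (z1, z2) * (r * dx g (?p + disp (r, z1, z2)))) (at z1)" for z1 z2
        by (auto intro!: derivative_eq_intros zx simp: algebra_simps)
      show "continuous_on UNIV (\<lambda>z. g (?p + disp (r, z)) + fst z * (r * dx g (?p + disp (r, z))))"
        by (intro continuous_intros c')
      have rB: "0 \<le> r * B'" using assms(4) B'(1) by simp
      show "\<bar>fst (z1, z2) * g (?p + disp (r, z1, z2))\<bar> \<le> (B' + r * B') * (1 + \<bar>z1\<bar>)" for z1 z2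
      proof -
        have "\<bar>fst (z1, z2) * g (?p + disp (r, z1, z2))\<bar> \<le> \<bar>z1\<bar> * B'"
          unfolding abs_mult fst_conv by (intro mult_left_mono B') simp
        also have "\<dots> \<le> (1 + \<bar>z1\<bar>) * (B' + r * B')" using rB B'(1) by (intro mult_mono) auto
        finally show ?thesis by (simp add: mult.commute)
      qed
      show "\<bar>g (?p + disp (r, z1, z2)) + fst (z1, z2) * (r * dx g (?p + disp (r, z1, z2)))\<bar> \<le> (B' + r * B') * (1 + \<bar>z1\<bar>)" for z1 z2
      proof -
        have "\<bar>g (?p + disp (r, z1, z2)) + fst (z1, z2) * (r * dx g (?p + disp (r, z1, z2)))\<bar>
          \<le> B' + \<bar>z1\<bar> * (r * B')"
          using assms(4) by (intro order_trans[OF abs_triangle_ineq] add_mono B')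
            (auto simp: abs_mult intro!: mult_left_mono B')
        also have "\<dots> \<le> (B' + r * B') * (1 + \<bar>z1\<bar>)"
          using rB B'(1) by (simp add: algebra_simps)
        finally show ?thesis .
      qed
      show "integrable gauss2 (\<lambda>z. fst z * (fst z * g (?p + disp (r, z))))"
        using ig(5)[of ?p] by (simp add: power2_eq_square mult.assoc)
      show "integrable gauss2 (\<lambda>z. g (?p + disp (r, z)) + fst z * (r * dx g (?p + disp (r, z))))"
        using Bochner_Integration.integrable_add[OF ig(2) integrable_mult_right[OF ig(3), of r], of ?p ?p]
        by (simp add: mult.left_commute)
    qed
    then have "(\<integral>z. (fst z)\<^sup>2 * g (?p + disp (r, z)) \<partial>gauss2) =
       (\<integral>z. g (?p + disp (r, z)) \<partial>gauss2) + r * (\<integral>z. fst z * dx g (?p + disp (r, z)) \<partial>gauss2)"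
      using ig(2,3)[of ?p] by (simp add: power2_eq_square mult.assoc mult.left_commute[of _ r])
    then show ?thesis using assms(4) ig(2,5)[of ?p] by (simp add: field_simps left_diff_distrib)
  qed
  ultimately show "((\<lambda>s. \<integral>z. fst z * g ((s, y) + disp (r, z)) \<partial>gauss2) has_real_derivative
     (\<integral>z. ((fst z)\<^sup>2 - 1) * g ((x, y) + disp (r, z)) \<partial>gauss2) / r) (at x)" by simp
  have "((\<lambda>s. \<integral>z. fst z * g ((x, s) + disp (r, z)) \<partial>gauss2) has_real_derivative
     (\<integral>z. fst z * dy g ((x, y) + disp (r, z)) \<partial>gauss2)) (at y)"
    by (rule has_real_derivative_integral[OF zero_less_one, where h="\<lambda>z. \<bar>fst z\<bar> * B'"];
      ((unfold abs_mult)?; intro DERIV_cmult sy B' mult_left_mono abs_ge_zero ig ifst1 borel_measurable_integrable))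
  moreover have "(\<integral>z. fst z * dy g ((x, y) + disp (r, z)) \<partial>gauss2)
     = (\<integral>z. (fst z * snd z) * g ((x, y) + disp (r, z)) \<partial>gauss2) / r"
  proof -
    let ?p = "(x, y)"
    have "(\<integral>z. snd z * (fst z * g (?p + disp (r, z))) \<partial>gauss2)
      = (\<integral>z. fst z * (r * dy g (?p + disp (r, z))) \<partial>gauss2)"
    proof (rule gauss2_stein_snd[where C="\<lambda>z1. \<bar>z1\<bar> * B' + \<bar>z1\<bar> * (r * B')"])
      show "((\<lambda>s. fst (z1, s) * g (?p + disp (r, z1, s))) has_real_derivative
           fst (z1, z2) * (r * dy g (?p + disp (r, z1, z2)))) (at z2)" for z1 z2
        by (auto intro!: derivative_eq_intros zy simp: algebra_simps)
      show "continuous_on UNIV (\<lambda>z. fst z * (r * dy g (?p + disp (r, z))))"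
        by (intro continuous_intros c')
      have rB: "0 \<le> r * B'" using assms(4) B'(1) by simp
      have fin: "(\<bar>a\<bar> * B' + \<bar>a\<bar> * (r * B')) * 1 \<le> (\<bar>a\<bar> * B' + \<bar>a\<bar> * (r * B')) * (1 + \<bar>b\<bar>)" for a b :: real
        using rB B'(1) by (intro mult_left_mono) auto
      show "\<bar>fst (z1, z2) * g (?p + disp (r, z1, z2))\<bar> \<le> (\<bar>z1\<bar> * B' + \<bar>z1\<bar> * (r * B')) * (1 + \<bar>z2\<bar>)" for z1 z2
      proof -
        have "\<bar>fst (z1, z2) * g (?p + disp (r, z1, z2))\<bar> \<le> \<bar>z1\<bar> * B'"
          unfolding abs_mult fst_conv by (intro mult_left_mono B') simp
        also have "\<dots> \<le> (\<bar>z1\<bar> * B' + \<bar>z1\<bar> * (r * B')) * 1" 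
          unfolding mult_1_right le_add_same_cancel1 by (rule mult_nonneg_nonneg[OF abs_ge_zero rB])
        also note fin[of z1 z2]
        finally show ?thesis .
      qed
      show "\<bar>fst (z1, z2) * (r * dy g (?p + disp (r, z1, z2)))\<bar> \<le> (\<bar>z1\<bar> * B' + \<bar>z1\<bar> * (r * B')) * (1 + \<bar>z2\<bar>)" for z1 z2
      proof -
        have "\<bar>fst (z1, z2) * (r * dy g (?p + disp (r, z1, z2)))\<bar> \<le> \<bar>z1\<bar> * (r * B')"
          unfolding abs_mult fst_conv using assms(4) by (intro mult_left_mono mult_mono B') auto
        also have "\<dots> \<le> (\<bar>z1\<bar> * B' + \<bar>z1\<bar> * (r * B')) * 1" 
          unfolding mult_1_right le_add_same_cancel2 by (rule mult_nonneg_nonneg[OF abs_ge_zero B'(1)])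
        also note fin[of z1 z2]
        finally show ?thesis .
      qed
      show "integrable gauss2 (\<lambda>z. snd z * (fst z * g (?p + disp (r, z))))"
        using ig(6)[of ?p] by (simp add: mult_ac)
      show "integrable gauss2 (\<lambda>z. fst z * (r * dy g (?p + disp (r, z))))"
        using integrable_mult_right[OF ig(4), of r ?p] by (simp add: mult.left_commute)
    qed
    then have "(\<integral>z. (fst z * snd z) * g (?p + disp (r, z)) \<partial>gauss2) =
        r * (\<integral>z. fst z * dy g (?p + disp (r, z)) \<partial>gauss2)"
      by (simp add: mult_ac)
    then show ?thesis using assms(4) by simp
  qed
  ultimately show "((\<lambda>s. \<integral>z. fst z * g ((x, s) + disp (r, z)) \<partial>gauss2) has_real_derivative
     (\<integral>z. (fst z * snd z) * g ((x, y) + disp (r, z)) \<partial>gauss2) / r) (at y)" by simp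
qed

lemma gauss2_abs_bound:
  fixes f g :: "real \<times> real \<Rightarrow> real"
  assumes "integrable gauss2 f" "continuous_on UNIV g" "\<And>z. \<bar>g z\<bar> \<le> B"
  shows "\<bar>\<integral>z. f z * g z \<partial>gauss2\<bar> \<le> (\<integral>z. \<bar>f z\<bar> \<partial>gauss2) * B"
proof -
  have "\<bar>\<integral>z. f z * g z \<partial>gauss2\<bar> \<le> (\<integral>z. \<bar>f z * g z\<bar> \<partial>gauss2)" by (rule integral_abs_bound)
  also have "\<dots> \<le> (\<integral>z. \<bar>f z\<bar> * B \<partial>gauss2)"
  proof (rule integral_mono)
    show "integrable gauss2 (\<lambda>z. \<bar>f z * g z\<bar>)" using gauss2_integrable_mult_bounded[OF assms] by (rule integrable_abs)
    show "integrable gauss2 (\<lambda>z. \<bar>f z\<bar> * B)" using assms(1) by auto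
  qed (auto simp: abs_mult intro!: mult_left_mono assms(3))
  finally show ?thesis by simp
qed

text \<open>At scale r the inner average \<open>H r\<close> is bounded by a multiple of B and
  Lipschitz with constant of order B/r. Interpolating costs r^(-\<beta>), integrable against
  \<open>radial\<close> because \<beta> < 1. The constant involves g only through its sup norm,
  which makes the estimate uniform over all regularised solutions.\<close>

lemma RX_holder:
  assumes "0 \<le> \<beta>" "\<beta> < 1"
  obtains C where "C \<ge> 0" "\<And>g B p q. C_k_on UNIV g (Suc 0) \<Longrightarrow> periodic2 g \<Longrightarrow> (\<And>q. \<bar>g q\<bar> \<le> B) \<Longrightarrow>
     \<bar>RX g p - RX g q\<bar> \<le> C * B * dist p q powr \<beta>"
proof -
  define c1 where "c1 = (\<integral>z. \<bar>(fst z)\<^sup>2 - 1\<bar> \<partial>gauss2)"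
  define c2 where "c2 = (\<integral>z. \<bar>fst z * snd z\<bar> \<partial>gauss2)"
  define c0 where "c0 = (\<integral>z. \<bar>fst z\<bar> \<partial>gauss2)"
  define c where "c = 2 * c0 + (c1 + c2)"
  have c_nn: "c0 \<ge> 0" "c1 \<ge> 0" "c2 \<ge> 0" by (auto simp: c0_def c1_def c2_def)
  define J where "J = (\<integral>r. r powr (- \<beta>) \<partial>radial)"
  have J: "J \<ge> 0" by (simp add: J_def)
  have if1: "integrable gauss2 (\<lambda>z. (fst z)\<^sup>2 - 1)"
    using integrable_gauss2_fst2 integrable_gauss2_one by auto
  show thesis
  proof (rule that[of "c * J"])
    show "0 \<le> c * J" using c_nn J by (simp add: c_def)
    fix g B p q assume g: "C_k_on UNIV g (Suc 0)" "periodic2 g" "\<And>q. \<bar>g q\<bar> \<le> B"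
    have B0: "B \<ge> 0" using g(3)[of 0] abs_ge_zero[of "g 0"] by linarith
    have cg: "continuous_on UNIV g" using C_k_on_continuous[OF g(1)] .
    have cd: "continuous_on UNIV (\<lambda>z. p + disp (r, z))" for p r unfolding disp_def by (intro continuous_intros)
    have cz: "continuous_on UNIV (\<lambda>z. g (p + disp (r, z)))" for p r
      by (intro continuous_on_compose2[OF cg cd]) auto
    define H where "H r p = (\<integral>z. fst z * g (p + disp (r, z)) \<partial>gauss2)" for r p
    have H0: "\<bar>H r p\<bar> \<le> c0 * B" for r p
      unfolding H_def c0_def by (rule gauss2_abs_bound[OF integrable_gauss2_fst cz g(3)])
    have Hx: "\<bar>H r (a, y) - H r (b, y)\<bar> \<le> c1 * B / r * \<bar>a - b\<bar>" if "r > 0" for r a b y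
    proof -
      have "norm (H r (a, y) - H r (b, y)) \<le> c1 * B / r * norm (a - b)"
      proof (rule field_differentiable_bound[OF convex_UNIV])
        show "((\<lambda>s. H r (s, y)) has_field_derivative (\<integral>z. ((fst z)\<^sup>2 - 1) * g ((x, y) + disp (r, z)) \<partial>gauss2) / r) (at x within UNIV)" for x
          unfolding H_def using gauss2_average_dx(1)[OF g that] by simp
        show "norm ((\<integral>z. ((fst z)\<^sup>2 - 1) * g ((x, y) + disp (r, z)) \<partial>gauss2) / r) \<le> c1 * B / r" for x
          using gauss2_abs_bound[OF if1 cz g(3), of "(x, y)" r] that by (simp add: c1_def divide_right_mono)
      qed auto
      then show ?thesis by simp
    qed
    have Hy: "\<bar>H r (x, a) - H r (x, b)\<bar> \<le> c2 * B / r * \<bar>a - b\<bar>" if "r > 0" for r a b x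
    proof -
      have "norm (H r (x, a) - H r (x, b)) \<le> c2 * B / r * norm (a - b)"
      proof (rule field_differentiable_bound[OF convex_UNIV])
        show "((\<lambda>s. H r (x, s)) has_field_derivative (\<integral>z. (fst z * snd z) * g ((x, y) + disp (r, z)) \<partial>gauss2) / r) (at y within UNIV)" for y
          unfolding H_def using gauss2_average_dx(2)[OF g that] by simp
        show "norm ((\<integral>z. (fst z * snd z) * g ((x, y) + disp (r, z)) \<partial>gauss2) / r) \<le> c2 * B / r" for y
          using gauss2_abs_bound[OF integrable_gauss2_fst_snd cz g(3), of "(x, y)" r] that by (simp add: c2_def divide_right_mono)
      qed auto
      then show ?thesis by simp
    qed
    have key: "\<bar>H r p - H r q\<bar> \<le> c * B * dist p q powr \<beta> * r powr (- \<beta>)" if r: "r > 0" for r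
    proof (cases "p = q")
      case False
      define t where "t = dist p q / r"
      have t: "t > 0" using False r by (simp add: t_def)
      have d: "\<bar>fst p - fst q\<bar> \<le> dist p q" "\<bar>snd p - snd q\<bar> \<le> dist p q"
        using dist_fst_le[of p q] dist_snd_le[of p q] by (auto simp: dist_real_def)
      have "\<bar>H r (fst p, snd p) - H r (fst q, snd p)\<bar> \<le> c1 * B / r * dist p q"
        using c_nn B0 r d by (intro order_trans[OF Hx[OF r] mult_left_mono]) auto
      moreover have "\<bar>H r (fst q, snd p) - H r (fst q, snd q)\<bar> \<le> c2 * B / r * dist p q"
        using c_nn B0 r d by (intro order_trans[OF Hy[OF r] mult_left_mono]) auto
      ultimately have l1: "\<bar>H r p - H r q\<bar> \<le> (c1 + c2) * B * t"
        by (simp add: t_def algebra_simps add_divide_distrib)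
      have l2: "\<bar>H r p - H r q\<bar> \<le> 2 * c0 * B" using H0[of r p] H0[of r q] by linarith
      \<comment> \<open>With t the distance in units of r, the sup bound serves for t \<ge> 1 and
        the Lipschitz bound for t < 1; both are below t^\<beta>.\<close>
      have "\<bar>H r p - H r q\<bar> \<le> c * B * t powr \<beta>"
      proof (cases "t \<ge> 1")
        case True
        have "\<bar>H r p - H r q\<bar> \<le> c * B * 1"
          using l2 mult_nonneg_nonneg[OF c_nn(2) B0] mult_nonneg_nonneg[OF c_nn(3) B0] by (simp add: c_def distrib_right)
        also have "\<dots> \<le> c * B * t powr \<beta>"
          using c_nn B0 True assms by (intro mult_left_mono ge_one_powr_ge_zero) (auto simp: c_def)
        finally show ?thesis .
      next
        case False
        have "\<bar>H r p - H r q\<bar> \<le> c * B * t"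
          using l1 mult_nonneg_nonneg[OF mult_nonneg_nonneg[OF c_nn(1) B0] less_imp_le[OF t]] by (simp add: c_def distrib_right)
        also have "t = t powr 1" using t by simp
        also have "c * B * t powr 1 \<le> c * B * t powr \<beta>"
          using c_nn B0 False t assms by (intro mult_left_mono powr_mono') (auto simp: c_def)
        finally show ?thesis .
      qed
      also have "t powr \<beta> = dist p q powr \<beta> * r powr (- \<beta>)"
        using r by (simp add: t_def powr_divide powr_minus_divide)
      finally show ?thesis by (simp add: mult.assoc)
    qed simp
    have int: "integrable (radial \<Otimes>\<^sub>M gauss2) (\<lambda>w. fst (snd w) * g (p + disp w))" for p
      using Kop_integrable[OF integrable_rmeas_z1 borel_measurable_continuous_onI[OF cg] g(3), of p]
      by (simp add: rmeas_def)
    have iH: "integrable radial (\<lambda>r. H r p)" for p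
      unfolding H_def using rmeas.integrable_fst'[OF int[of p]] by simp
    have RXH: "RX g p = (\<integral>r. H r p \<partial>radial)" for p
      unfolding Kop_def H_def using rmeas.integral_fst'[OF int[of p]] by (simp add: rmeas_def)
    have "\<bar>RX g p - RX g q\<bar> = \<bar>\<integral>r. H r p - H r q \<partial>radial\<bar>"
      unfolding RXH using iH by simp
    also have "\<dots> \<le> (\<integral>r. \<bar>H r p - H r q\<bar> \<partial>radial)" by (rule integral_abs_bound)
    also have "\<dots> \<le> (\<integral>r. c * B * dist p q powr \<beta> * r powr (- \<beta>) \<partial>radial)"
    proof (rule integral_mono_AE)
      show "integrable radial (\<lambda>r. \<bar>H r p - H r q\<bar>)" using iH by auto
      show "integrable radial (\<lambda>r. c * B * dist p q powr \<beta> * r powr (- \<beta>))"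
        by (intro integrable_mult_right integrable_radial_powr assms)
      show "AE r in radial. \<bar>H r p - H r q\<bar> \<le> c * B * dist p q powr \<beta> * r powr (- \<beta>)"
        unfolding radial_def by (subst AE_density) (auto intro!: AE_I2 key simp: indicator_def split: if_splits)
    qed
    also have "\<dots> = c * J * B * dist p q powr \<beta>" by (simp add: J_def)
    finally show "\<bar>RX g p - RX g q\<bar> \<le> c * J * B * dist p q powr \<beta>" .
  qed
qed

subsection \<open>Maximum principle\<close>

text \<open>A fundamental domain for odd-odd periodic functions: its four sides are symmetry lines
  on which they vanish, so every comparison there has zero boundary data.\<close>

definition quarter :: "(real \<times> real) set" where
  "quarter = {0..1/2} \<times> {0..1/2}"

lemma second_derivative_at_min:
  fixes f f' :: "real \<Rightarrow> real"
  assumes "a < x" "x < b" and der: "\<And>s. a < s \<Longrightarrow> s < b \<Longrightarrow> (f has_real_derivative f' s) (at s)"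
    and d: "(f' has_real_derivative d) (at x)" and m: "\<And>s. a < s \<Longrightarrow> s < b \<Longrightarrow> f x \<le> f s"
  shows "d \<ge> 0"
proof (rule ccontr)
  assume "\<not> d \<ge> 0"
  then obtain e where e: "e > 0" "\<And>h. h > 0 \<Longrightarrow> h < e \<Longrightarrow> f' (x + h) < f' x"
    using DERIV_neg_dec_right[OF d] by auto
  have "f' x = 0"
    by (rule DERIV_local_min[OF der[OF assms(1,2)], of "min (x - a) (b - x)"]) (use assms(1,2) in \<open>auto intro!: m\<close>)
  define h where "h = min e (b - x) / 2"
  have h: "h > 0" "h < e" "x + h < b" using e(1) assms(2) by (auto simp: h_def min_def field_simps)
  have "\<exists>z>x. z < x + h \<and> f (x + h) - f x = (x + h - x) * f' z"
    by (rule MVT2) (use h assms(1) der in auto)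
  then obtain z where z: "z > x" "z < x + h" "f (x + h) - f x = h * f' z" by auto
  have "f' z < 0" using e(2)[of "z - x"] z h \<open>f' x = 0\<close> by auto
  then have "f (x + h) < f x" using z(3) h(1) mult_pos_neg[of h "f' z"] by linarith
  then show False using m[of "x + h"] h assms(1) by simp
qed

text \<open>At a negative interior minimum both pure second derivatives are nonnegative, so \<phi>
  minus its Laplacian would be negative. The zeroth-order term gives the contradiction directly,
  without an auxiliary strict perturbation.\<close>

lemma max_principle_quarter:
  assumes c: "continuous_on quarter \<phi>"
    and bd: "\<And>x y. (x, y) \<in> quarter \<Longrightarrow> x = 0 \<or> x = 1/2 \<or> y = 0 \<or> y = 1/2 \<Longrightarrow> \<phi> (x, y) \<ge> 0"
    and x: "\<And>x y. ((\<lambda>s. \<phi> (s, y)) has_real_derivative \<phi>x (x, y)) (at x)"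
    and y: "\<And>x y. ((\<lambda>s. \<phi> (x, s)) has_real_derivative \<phi>y (x, y)) (at y)"
    and xx: "\<And>x y. ((\<lambda>s. \<phi>x (s, y)) has_real_derivative \<phi>xx (x, y)) (at x)"
    and yy: "\<And>x y. ((\<lambda>s. \<phi>y (x, s)) has_real_derivative \<phi>yy (x, y)) (at y)"
    and pos: "\<And>p. p \<in> quarter \<Longrightarrow> \<phi> p - (\<phi>xx p + \<phi>yy p) \<ge> 0"
    and "p \<in> quarter"
  shows "\<phi> p \<ge> (0::real)"
proof (rule ccontr)
  assume neg: "\<not> \<phi> p \<ge> 0"
  have "compact quarter" unfolding quarter_def by (intro compact_Times) auto
  from continuous_attains_inf[OF this _ c] obtain q where q: "q \<in> quarter" "\<And>r. r \<in> quarter \<Longrightarrow> \<phi> q \<le> \<phi> r"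
    using assms(8) by blast
  obtain a b where ab: "q = (a, b)" by (rule prod.exhaust)
  have qn: "\<phi> q < 0" using q(2)[OF assms(8)] neg by linarith
  then have i: "0 < a" "a < 1/2" "0 < b" "b < 1/2"
    using bd[of a b] q(1) by (auto simp: ab quarter_def less_le)
  have "\<phi>xx q \<ge> 0" unfolding ab
    by (rule second_derivative_at_min[OF i(1,2) x xx]) (use q(2) i in \<open>auto simp: ab quarter_def\<close>)
  moreover have "\<phi>yy q \<ge> 0" unfolding ab
    by (rule second_derivative_at_min[OF i(3,4) y yy]) (use q(2) i in \<open>auto simp: ab quarter_def\<close>)
  ultimately show False using pos[OF q(1)] qn by linarith
qed

lemma odd_odd_periodic_boundary:
  assumes "odd_odd f" "periodic2 f" "x = 0 \<or> x = 1/2 \<or> y = 0 \<or> y = 1/2"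
  shows "f (x, y) = 0"
proof -
  have "f (- (1/2) + 1, y) = f (- (1/2), y)" "f (x, - (1/2) + 1) = f (x, - (1/2))"
    using assms(2) unfolding periodic2_def by blast+
  moreover have "f (- 0, y) = - f (0, y)" "f (x, - 0) = - f (x, 0)"
    "f (- (1/2), y) = - f (1/2, y)" "f (x, - (1/2)) = - f (x, 1/2)"
    using assms(1) unfolding odd_odd_def by blast+
  ultimately have "f (0, y) = 0" "f (1/2, y) = 0" "f (x, 0) = 0" "f (x, 1/2) = 0" by simp_all
  then show ?thesis using assms(3) by metis
qed

definition OO1 :: "(real \<times> real \<Rightarrow> real) \<Rightarrow> bool" where
  "OO1 g \<longleftrightarrow> C_k_on UNIV g (Suc 0) \<and> periodic2 g \<and> odd_odd g"

text \<open>For g of class C^1 the two derivatives are shared: one falls on the Gaussian, the other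
  on g.\<close>

lemma resolvent_second_derivatives:
  assumes "C_k_on UNIV g (Suc 0)" "periodic2 g"
  shows "((\<lambda>s. RR g (s, y)) has_real_derivative RX g (x, y)) (at x)"
    "((\<lambda>s. RR g (x, s)) has_real_derivative RY g (x, y)) (at y)"
    "((\<lambda>s. RX g (s, y)) has_real_derivative RX (dx g) (x, y)) (at x)"
    "((\<lambda>s. RY g (x, s)) has_real_derivative RY (dy g) (x, y)) (at y)"
    "RX g p = RR (dx g) p" "RY g p = RR (dy g) p"
proof -
  obtain B where B: "\<And>q. \<bar>g q\<bar> \<le> B" "\<And>q. \<bar>dx g q\<bar> \<le> B" "\<And>q. \<bar>dy g q\<bar> \<le> B"
    and c: "continuous_on UNIV g" "continuous_on UNIV (dx g)" "continuous_on UNIV (dy g)"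
    and per: "periodic2 (dx g)" "periodic2 (dy g)"
    by (rule C1_periodic[OF assms]) blast
  note D = C_k_on_differentiable[OF assms(1)]
  show "((\<lambda>s. RR g (s, y)) has_real_derivative RX g (x, y)) (at x)"
    "((\<lambda>s. RR g (x, s)) has_real_derivative RY g (x, y)) (at y)" for x y
    using RR_has_real_derivative_x[OF c(1) assms(2)] RR_has_real_derivative_y[OF c(1) assms(2)] .
  have X: "RX g p = RR (dx g) p" for p
    by (rule RX_eq_RR_dx[OF has_real_derivative_dx[OF D] c(1,2) B(1,2)])
  have Y: "RY g p = RR (dy g) p" for p
  proof -
    have "((\<lambda>s. RR g (fst p, s)) has_real_derivative RR (dy g) (fst p, snd p)) (at (snd p))"
      by (rule Kop_dy[OF integrable_rmeas_r has_real_derivative_dy[OF D] c(1,3) B(1,3)])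
    from DERIV_unique[OF this RR_has_real_derivative_y[OF c(1) assms(2)]] show ?thesis by simp
  qed
  show "RX g p = RR (dx g) p" "RY g p = RR (dy g) p" using X Y .
  show "((\<lambda>s. RX g (s, y)) has_real_derivative RX (dx g) (x, y)) (at x)"
    "((\<lambda>s. RY g (x, s)) has_real_derivative RY (dy g) (x, y)) (at y)"
    unfolding X Y using RR_has_real_derivative_x[OF c(2) per(1)] RR_has_real_derivative_y[OF c(3) per(2)] .
qed

text \<open>The gained order comes from the weights z1 and z2, which express the gradient as
  averages of g itself. A dummy parameter reduces their regularity to the parametric
  statement.\<close>

lemma RR_C_k:
  assumes "C_k_on UNIV g k" "periodic2 g"
  shows "C_k_on UNIV (RR g) (Suc k)"
proof -
  have "PC UNIV k (\<lambda>X. g (snd X))" using C_k_on_extend[OF assms(1)] assms(2) by (simp add: PC_def)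
  from Kpar_PC[OF open_UNIV integrable_rmeas_z1 this] Kpar_PC[OF open_UNIV integrable_rmeas_z2 this]
  have "C_k_on UNIV (RX g) k" "C_k_on UNIV (RY g) k"
    using PC_slice(1)[of UNIV k _ 0] by (fastforce simp: Kpar_slice)+
  then show ?thesis
    by (rule C_k_on_of_partials2[OF RR_has_real_derivative_x RR_has_real_derivative_y, rotated 4])
      (use C_k_on_continuous[OF assms(1)] assms(2) in auto)
qed

lemma RR_OO1:
  assumes "continuous_on UNIV g" "periodic2 g" "odd_odd g"
  shows "OO1 (RR g)"
  using RR_C_k[of g 0] assms RR_odd_odd Kop_periodic by (auto simp: OO1_def simp del: C_k_on.simps(2))

text \<open>Positivity of the kernel is no help for a function that changes sign on the torus. On
  the quarter, oddness supplies zero boundary values and the maximum principle applies.\<close>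

lemma RR_nonneg:
  assumes "OO1 g" "\<And>p. p \<in> quarter \<Longrightarrow> g p \<ge> 0" "p \<in> quarter"
  shows "RR g p \<ge> 0"
proof (rule max_principle_quarter[where \<phi>="RR g"])
  have g: "C_k_on UNIV g (Suc 0)" "periodic2 g" "odd_odd g" using assms(1) by (auto simp: OO1_def)
  note c = C_k_on_continuous[OF g(1)]
  show "continuous_on quarter (RR g)"
    using C_k_on_continuous[OF RR_C_k[OF g(1,2)]] continuous_on_subset by blast
  show "((\<lambda>s. RR g (s, y)) has_real_derivative RX g (x, y)) (at x)"
    "((\<lambda>s. RR g (x, s)) has_real_derivative RY g (x, y)) (at y)"
    "((\<lambda>s. RX g (s, y)) has_real_derivative RX (dx g) (x, y)) (at x)"
    "((\<lambda>s. RY g (x, s)) has_real_derivative RY (dy g) (x, y)) (at y)" for x y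
    by (rule resolvent_second_derivatives[OF g(1,2)])+
  show "RR g (x, y) \<ge> 0" if "x = 0 \<or> x = 1 / 2 \<or> y = 0 \<or> y = 1 / 2" for x y
    using odd_odd_periodic_boundary[OF RR_odd_odd[OF c g(3)] Kop_periodic[OF g(2)] that] by simp
  show "0 \<le> RR g p - (RX (dx g) p + RY (dy g) p)" if "p \<in> quarter" for p
    using resolvent_identity[OF g(1,2), of p] assms(2)[OF that] by simp
qed (rule assms(3))

section \<open>First odd-odd eigenfunction and boundary-weighted estimates\<close>

definition ss :: "real \<times> real \<Rightarrow> real" where
  "ss p = sin (2 * pi * fst p) * sin (2 * pi * snd p)"

definition cX :: real where
  "cX = (\<integral>w. \<bar>fst (snd w)\<bar> \<partial>rmeas) + (\<integral>w. \<bar>snd (snd w)\<bar> \<partial>rmeas)"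

lemma cX_nonneg: "cX \<ge> 0"
  by (simp add: cX_def)

lemma RX_bound: "continuous_on UNIV g \<Longrightarrow> (\<And>q. \<bar>g q\<bar> \<le> B) \<Longrightarrow> \<bar>RX g p\<bar> \<le> cX * B"
  and RY_bound: "continuous_on UNIV g \<Longrightarrow> (\<And>q. \<bar>g q\<bar> \<le> B) \<Longrightarrow> \<bar>RY g p\<bar> \<le> cX * B"
proof -
  assume g: "continuous_on UNIV g" "\<And>q. \<bar>g q\<bar> \<le> B"
  have B: "B \<ge> 0" using g(2)[of 0] abs_ge_zero[of "g 0"] by linarith
  note m = borel_measurable_continuous_onI[OF g(1)]
  have "(\<integral>w. \<bar>fst (snd w)\<bar> \<partial>rmeas) * B \<le> cX * B" "(\<integral>w. \<bar>snd (snd w)\<bar> \<partial>rmeas) * B \<le> cX * B"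
    using B by (intro mult_right_mono, auto simp: cX_def)+
  then show "\<bar>RX g p\<bar> \<le> cX * B" "\<bar>RY g p\<bar> \<le> cX * B"
    using Kop_bound[OF integrable_rmeas_z1 m g(2), of p] Kop_bound[OF integrable_rmeas_z2 m g(2), of p] by linarith+
qed

lemma sin_ge_dist:
  assumes "0 \<le> x" "x \<le> 1/2"
  shows "\<exists>x0\<in>{0, 1/2}. \<bar>x - x0\<bar> \<le> sin (2 * pi * x)"
proof -
  have *: "x \<le> sin (2 * pi * x)" if x: "0 \<le> x" "x \<le> 1/4" for x
  proof -
    define t where "t = 2 * pi * x"
    \<comment> \<open>The crude bounds 2 \<le> pi < 4 suffice: t \<le> 2 makes the cubic Taylor
      error at most 2t/3, so sin t \<ge> t/3, and t/3 \<ge> x.\<close>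
    have t: "0 \<le> t" "t \<le> 2"
      using x mult_mono[OF less_imp_le[OF pi_less_4] x(2)] by (auto simp: t_def)
    have "\<bar>sin t - (\<Sum>m<3. sin_coeff m * t ^ m)\<bar> \<le> inverse (fact 3) * \<bar>t\<bar> ^ 3"
      by (rule Maclaurin_sin_bound)
    then have "\<bar>sin t - t\<bar> \<le> t ^ 3 / 6"
      using t(1) by (simp add: numeral_3_eq_3 sin_coeff_def field_simps)
    also have "t ^ 3 / 6 = t * (t * t) / 6" by (simp add: power3_eq_cube)
    also have "\<dots> \<le> t * (2 * 2) / 6" using t by (intro divide_right_mono mult_left_mono mult_mono) auto
    also have "\<dots> = 2 * t / 3" by simp
    finally have "sin t \<ge> t / 3" unfolding abs_le_iff by linarith
    moreover have "t / 3 \<ge> x" using x mult_right_mono[OF pi_ge_two, of x] by (simp add: t_def)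
    ultimately show ?thesis by (simp add: t_def)
  qed
  show ?thesis
  proof (cases "x \<le> 1/4")
    case True
    then show ?thesis using *[of x] assms by (intro bexI[of _ 0]) auto
  next
    case False
    have "sin (2 * pi * (1/2 - x)) = sin (2 * pi * x)" by (simp add: right_diff_distrib)
    then show ?thesis using *[of "1/2 - x"] False assms by (intro bexI[of _ "1/2"]) auto
  qed
qed

lemma ss_nonneg: "p \<in> quarter \<Longrightarrow> ss p \<ge> 0"
  unfolding ss_def quarter_def
proof -
  have "sin (2 * pi * x) \<ge> 0" if "0 \<le> x" "x \<le> 1/2" for x
    using sin_ge_dist[OF that] abs_ge_zero order_trans by blast
  then show "sin (2 * pi * fst p) * sin (2 * pi * snd p) \<ge> 0" if "p \<in> {0..1/2} \<times> {0..1/2}"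
    using that by (intro mult_nonneg_nonneg) (auto simp: mem_Times_iff)
qed

text \<open>\<open>RR g\<close> vanishes on the sides and its mixed derivative is
  \<open>RX (dy g)\<close>, bounded by \<open>cX * L\<close>. Integrating from the nearest vertical
  and horizontal sides gives the product of the two distances, which \<open>ss\<close>
  dominates.\<close>

lemma RR_weighted_bound:
  assumes "OO1 g" "\<And>q. \<bar>dy g q\<bar> \<le> L" "p \<in> quarter"
  shows "\<bar>RR g p\<bar> \<le> cX * L * ss p"
proof -
  have g: "C_k_on UNIV g (Suc 0)" "periodic2 g" "odd_odd g" using assms(1) by (auto simp: OO1_def)
  note c = C_k_on_continuous[OF g(1)]
  have L: "L \<ge> 0" using assms(2)[of 0] abs_ge_zero[of "dy g 0"] by linarith
  have cdy: "continuous_on UNIV (dy g)" using C_k_on_dy[OF g(1)] by simp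
  have pdy: "periodic2 (dy g)" by (rule periodic2_dy[OF C_k_on_differentiable[OF g(1)] g(2)])
  obtain x y where p: "p = (x, y)" "0 \<le> x" "x \<le> 1/2" "0 \<le> y" "y \<le> 1/2"
    using assms(3) by (auto simp: quarter_def)
  obtain x0 where x0: "x0 \<in> {0, 1/2}" "\<bar>x - x0\<bar> \<le> sin (2 * pi * x)" using sin_ge_dist[OF p(2,3)] by blast
  obtain y0 where y0: "y0 \<in> {0, 1/2}" "\<bar>y - y0\<bar> \<le> sin (2 * pi * y)" using sin_ge_dist[OF p(4,5)] by blast
  note dY = resolvent_second_derivatives(2)[OF g(1,2), unfolded resolvent_second_derivatives(6)[OF g(1,2)]]
  have z: "RR g (x0, s) = 0" "RR g (s, y0) = 0" for s
    using x0(1) y0(1) by (intro odd_odd_periodic_boundary RR_odd_odd c g Kop_periodic; blast)+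
  \<comment> \<open>\<open>RR g\<close> is zero along the whole side, hence so is its derivative in
    the direction of that side.\<close>
  have z': "RR (dy g) (x0, s) = 0" for s
    using DERIV_unique[OF dY[of x0 s]] by (simp add: z)
  have "norm (RR (dy g) (x, s) - RR (dy g) (x0, s)) \<le> (cX * L) * norm (x - x0)" for s
    by (rule field_differentiable_bound[OF convex_UNIV])
      (use RR_has_real_derivative_x[OF cdy pdy] in \<open>auto intro!: RX_bound[OF cdy assms(2)]\<close>)
  then have b1: "\<bar>RR (dy g) (x, s)\<bar> \<le> (cX * L) * \<bar>x - x0\<bar>" for s by (simp add: z')
  have "norm (RR g (x, y) - RR g (x, y0)) \<le> ((cX * L) * \<bar>x - x0\<bar>) * norm (y - y0)"
    by (rule field_differentiable_bound[OF convex_UNIV]) (use dY in \<open>auto intro!: b1\<close>)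
  then have "\<bar>RR g p\<bar> \<le> (cX * L) * (\<bar>x - x0\<bar> * \<bar>y - y0\<bar>)" by (simp add: z p mult.assoc)
  also have "\<dots> \<le> (cX * L) * (sin (2 * pi * x) * sin (2 * pi * y))"
    using x0(2) y0(2) L cX_nonneg by (intro mult_left_mono mult_mono order_trans[OF abs_ge_zero x0(2)]) auto
  finally show ?thesis by (simp add: ss_def p)
qed

lemma OO1_add: "OO1 f \<Longrightarrow> OO1 g \<Longrightarrow> OO1 (\<lambda>p. f p + g p)"
  and OO1_diff: "OO1 f \<Longrightarrow> OO1 g \<Longrightarrow> OO1 (\<lambda>p. f p - g p)"
  and OO1_cmult: "OO1 f \<Longrightarrow> OO1 (\<lambda>p. c * f p)"
  unfolding OO1_def using C_k_on_add[of UNIV f] C_k_on_diff[of UNIV f] C_k_on_cmult[of UNIV f]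
  by (auto simp: periodic2_def odd_odd_def simp del: C_k_on.simps)

text \<open>Even coefficients: multiplication by them keeps odd-odd functions odd-odd, which is the
  symmetry type of the linearised coefficient.\<close>

definition EE1 :: "(real \<times> real \<Rightarrow> real) \<Rightarrow> bool" where
  "EE1 a \<longleftrightarrow> C_k_on UNIV a (Suc 0) \<and> periodic2 a \<and> (\<forall>x y. a (- x, y) = a (x, y) \<and> a (x, - y) = a (x, y))"

lemma EE1_mult_OO1: "EE1 a \<Longrightarrow> OO1 g \<Longrightarrow> OO1 (\<lambda>p. a p * g p)"
  unfolding OO1_def EE1_def using C_k_on_mult[of UNIV a "Suc 0" g]
  by (auto simp: periodic2_def odd_odd_def simp del: C_k_on.simps)

lemma OO1D:
  assumes "OO1 g"
  shows "C_k_on UNIV g (Suc 0)" "continuous_on UNIV g" "periodic2 g" "odd_odd g" "g \<in> borel_measurable borel"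
  using assms C_k_on_continuous borel_measurable_continuous_onI by (auto simp: OO1_def simp del: C_k_on.simps)

lemma OO1_bounded:
  assumes "OO1 g"
  obtains B where "B \<ge> 0" "\<And>q. \<bar>g q\<bar> \<le> B"
  by (rule periodic2_bounded[OF OO1D(2,3)[OF assms]]) (use that in blast)

lemma RR_add:
  assumes "OO1 g" "OO1 h"
  shows "RR (\<lambda>q. g q + h q) p = RR g p + RR h p" "RR (\<lambda>q. g q - h q) p = RR g p - RR h p"
proof -
  obtain B where B: "\<And>q. \<bar>g q\<bar> \<le> B" by (rule OO1_bounded[OF assms(1)]) blast
  obtain C where C: "\<And>q. \<bar>h q\<bar> \<le> C" by (rule OO1_bounded[OF assms(2)]) blast
  show "RR (\<lambda>q. g q + h q) p = RR g p + RR h p" "RR (\<lambda>q. g q - h q) p = RR g p - RR h p"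
    using Kop_add[OF integrable_rmeas_r OO1D(5)[OF assms(1)] B OO1D(5)[OF assms(2)] C]
      Kop_diff[OF integrable_rmeas_r OO1D(5)[OF assms(1)] B OO1D(5)[OF assms(2)] C] by auto
qed

lemma RR_mono:
  assumes "OO1 g" "OO1 h" "\<And>p. p \<in> quarter \<Longrightarrow> g p \<le> h p" "p \<in> quarter"
  shows "RR g p \<le> RR h p"
  using RR_nonneg[OF OO1_diff[OF assms(2,1)] _ assms(4)] assms(3) RR_add(2)[OF assms(2,1), of p] by simp

text \<open>Makes the resolvent a left inverse of 1 - \<Delta> on periodic C^2 functions, so an
  explicit solution is certified by differentiating it instead of computing Gaussian
  integrals.\<close>

lemma RR_inverse:
  assumes c: "C_k_on UNIV \<phi> 2" "periodic2 \<phi>"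
    and x: "\<And>x y. ((\<lambda>s. \<phi> (s, y)) has_real_derivative \<phi>x (x, y)) (at x)"
    and y: "\<And>x y. ((\<lambda>s. \<phi> (x, s)) has_real_derivative \<phi>y (x, y)) (at y)"
    and xx: "\<And>x y. ((\<lambda>s. \<phi>x (s, y)) has_real_derivative \<phi>xx (x, y)) (at x)"
    and yy: "\<And>x y. ((\<lambda>s. \<phi>y (x, s)) has_real_derivative \<phi>yy (x, y)) (at y)"
  shows "RR (\<lambda>q. \<phi> q - (\<phi>xx q + \<phi>yy q)) p = \<phi> p"
proof -
  have c2: "C_k_on UNIV \<phi> (Suc (Suc 0))" using c(1) by (simp add: numeral_2_eq_2)
  note c1 = C_k_on_SucD[OF c2]
  have ex: "dx \<phi> = \<phi>x" "dy \<phi> = \<phi>y"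
    using dx_eqI[OF C_k_on_differentiable[OF c1] x] dy_eqI[OF C_k_on_differentiable[OF c1] y] by auto
  have cx: "C_k_on UNIV \<phi>x (Suc 0)" "C_k_on UNIV \<phi>y (Suc 0)"
    using C_k_on_dx[OF c2] C_k_on_dy[OF c2] by (simp_all only: ex)
  have exx: "dx \<phi>x = \<phi>xx" "dy \<phi>y = \<phi>yy"
    using dx_eqI[OF C_k_on_differentiable[OF cx(1)] xx] dy_eqI[OF C_k_on_differentiable[OF cx(2)] yy] by auto
  have per: "periodic2 \<phi>x" "periodic2 \<phi>y"
    using periodic2_dx[OF C_k_on_differentiable[OF c1] c(2)] periodic2_dy[OF C_k_on_differentiable[OF c1] c(2)]
    by (simp_all only: ex)
  obtain B where B: "\<And>q. \<bar>\<phi> q\<bar> \<le> B" "continuous_on UNIV \<phi>" by (rule C1_periodic[OF c1 c(2)]) blast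
  obtain B1 where B1: "\<And>q. \<bar>\<phi>xx q\<bar> \<le> B1" "continuous_on UNIV \<phi>xx" by (rule C1_periodic[OF cx(1) per(1), unfolded exx]) blast
  obtain B2 where B2: "\<And>q. \<bar>\<phi>yy q\<bar> \<le> B2" "continuous_on UNIV \<phi>yy" by (rule C1_periodic[OF cx(2) per(2), unfolded exx]) blast
  note m = borel_measurable_continuous_onI[OF B(2)] borel_measurable_continuous_onI[OF B1(2)] borel_measurable_continuous_onI[OF B2(2)]
  have b12: "\<bar>\<phi>xx q + \<phi>yy q\<bar> \<le> B1 + B2" for q
    by (rule order_trans[OF abs_triangle_ineq]) (intro add_mono B1 B2)
  have "RR (\<lambda>q. \<phi> q - (\<phi>xx q + \<phi>yy q)) p = RR \<phi> p - (RR \<phi>xx p + RR \<phi>yy p)"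
    using Kop_diff[OF integrable_rmeas_r m(1) B(1) borel_measurable_add[OF m(2,3)] b12]
      Kop_add[OF integrable_rmeas_r m(2) B1(1) m(3) B2(1)] by simp
  also have "RR \<phi>xx p = RX (dx \<phi>) p"
    using resolvent_second_derivatives(5)[OF cx(1) per(1), of p] by (simp add: ex exx)
  also have "RR \<phi>yy p = RY (dy \<phi>) p"
    using resolvent_second_derivatives(6)[OF cx(2) per(2), of p] by (simp add: ex exx)
  finally show ?thesis using resolvent_identity[OF c1 c(2), of p] by simp
qed

lemma sin_x_trig_poly: "(\<lambda>p. sin (2 * pi * fst p)) \<in> trig_poly"
  and sin_y_trig_poly: "(\<lambda>p. sin (2 * pi * snd p)) \<in> trig_poly"
proof -
  have *: "cos (t + - pi / 2) = sin t" for t using cos_diff[of t "pi / 2"] by simp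
  show "(\<lambda>p. sin (2 * pi * fst p)) \<in> trig_poly" "(\<lambda>p. sin (2 * pi * snd p)) \<in> trig_poly"
    using trig_poly.wave[of 1 0 "- pi / 2"] trig_poly.wave[of 0 1 "- pi / 2"] unfolding * by simp_all
qed

lemma trig_poly_power: "f \<in> trig_poly \<Longrightarrow> (\<lambda>p. f p ^ n) \<in> trig_poly"
  by (induction n) (use trig_poly_const[of 1] in \<open>auto intro: trig_poly_times\<close>)

lemma ss_trig_poly: "ss \<in> trig_poly"
  unfolding ss_def[abs_def] by (intro trig_poly_times sin_x_trig_poly sin_y_trig_poly)

lemma ss_OO1: "OO1 ss"
  unfolding OO1_def using trig_poly_C_k[OF ss_trig_poly] trig_poly_periodic[OF ss_trig_poly]
  by (auto simp: odd_odd_def ss_def simp del: C_k_on.simps)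

lemma RR_ss: "RR (\<lambda>q. (1 + 8 * pi\<^sup>2) * ss q) p = ss p"
proof -
  let ?m = "2 * pi"
  have "RR (\<lambda>q. ss q - (- ?m\<^sup>2 * ss q + - ?m\<^sup>2 * ss q)) p = ss p"
  proof (rule RR_inverse[where \<phi>x="\<lambda>q. ?m * cos (?m * fst q) * sin (?m * snd q)"
        and \<phi>y="\<lambda>q. ?m * sin (?m * fst q) * cos (?m * snd q)"])
    show "C_k_on UNIV ss 2" "periodic2 ss" by (intro trig_poly_C_k trig_poly_periodic ss_trig_poly)+
  qed (auto simp: ss_def power2_eq_square intro!: derivative_eq_intros)
  then show ?thesis by (simp add: algebra_simps power2_eq_square)
qed

text \<open>With m = 4 pi^2, A = sin(2 pi x) and K its cube, this is d / (1 + 18 m), where d is the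
  coefficient of the product of the two A factors in the explicit preimage built in
  \<open>RR_ss_cubed\<close>.\<close>

definition cub :: real where
  "cub = (let m = 4 * pi\<^sup>2 in 12 * m * (6 * m / (1 + 10 * m)) / (1 + 2 * m) / (1 + 18 * m))"

lemma cub_pos: "cub > 0"
  unfolding cub_def Let_def by (intro divide_pos_pos mult_pos_pos) (auto simp: add_pos_nonneg)

text \<open>Hopf's boundary lemma is replaced by an explicit solution of the equation with right-hand
  side a multiple of the cube of the first eigenfunction.\<close>
lemma RR_ss_cubed:
  assumes "p \<in> quarter"
  shows "RR (\<lambda>q. ss q ^ 3) p \<ge> cub * ss p"
proof -
  define m where "m = 4 * pi\<^sup>2"
  \<comment> \<open>As K'' = m (6A - 9K), applying 1 - \<Delta> to the product of two K factors
    leaves mixed K-A terms, and correcting these leaves the product of two A factors. The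
    coefficients b and d are the solutions of the two cancellation conditions \<open>bm\<close> and
    \<open>dm\<close>.\<close>
  define b where "b = 6 * m / (1 + 10 * m)"
  define d where "d = 12 * m * b / (1 + 2 * m)"
  have m: "m > 0" by (simp add: m_def)
  have b: "b > 0" using m by (simp add: b_def)
  have bm: "b * (1 + 10 * m) = 6 * m" using m by (simp add: b_def)
  have dm: "d * (1 + 2 * m) = 12 * m * b" using m by (simp add: d_def)
  have d0: "d > 0" using m b by (simp add: d_def)
  define A where "A x = sin (2 * pi * x)" for x
  define A' where "A' x = 2 * pi * cos (2 * pi * x)" for x
  define K where "K x = A x ^ 3" for x
  define K' where "K' x = 3 * A x ^ 2 * A' x" for x
  have cs: "A' x * A' x = m * (1 - A x * A x)" for x
  proof -
    have "A' x * A' x = m * (cos (2 * pi * x))\<^sup>2" by (simp add: A'_def m_def power2_eq_square)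
    then show ?thesis unfolding cos_squared_eq by (simp add: A_def power2_eq_square)
  qed
  have dA[derivative_intros]: "(A has_real_derivative A' x) (at x)" for x
    unfolding A_def A'_def by (auto intro!: derivative_eq_intros)
  have dA'[derivative_intros]: "(A' has_real_derivative - m * A x) (at x)" for x
    unfolding A_def A'_def m_def by (auto intro!: derivative_eq_intros simp: power2_eq_square)
  have dK: "(K has_real_derivative K' x) (at x)" for x
    unfolding K_def K'_def by (auto intro!: derivative_eq_intros dA simp: power2_eq_square)
  have dK': "(K' has_real_derivative m * (6 * A x - 9 * K x)) (at x)" for x
  proof -
    have "(K' has_real_derivative 3 * (2 * A x * A' x) * A' x + 3 * A x ^ 2 * (- m * A x)) (at x)"
      unfolding K'_def by (auto intro!: derivative_eq_intros dA dA')
    moreover have "3 * (2 * A x * A' x) * A' x + 3 * A x ^ 2 * (- m * A x) = m * (6 * A x - 9 * K x)"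
    proof -
      have "3 * (2 * A x * A' x) * A' x + 3 * A x ^ 2 * (- m * A x) = 6 * A x * (A' x * A' x) - 3 * m * A x ^ 3"
        by (simp add: power2_eq_square power3_eq_cube)
      then show ?thesis unfolding cs K_def by (simp add: algebra_simps power3_eq_cube)
    qed
    ultimately show ?thesis by simp
  qed
  define \<phi> where "\<phi> q = (K (fst q) * K (snd q) + b * (K (fst q) * A (snd q) + A (fst q) * K (snd q))) + d * (A (fst q) * A (snd q))" for q
  let ?dd = "\<lambda>f g q. (f (fst q) * K (snd q) + b * (f (fst q) * A (snd q) + g (fst q) * K (snd q))) + d * (g (fst q) * A (snd q))"
  let ?ee = "\<lambda>f g q. (K (fst q) * f (snd q) + b * (K (fst q) * g (snd q) + A (fst q) * f (snd q))) + d * (A (fst q) * g (snd q))"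
  have tp: "\<phi> \<in> trig_poly"
    unfolding \<phi>_def[abs_def] K_def A_def
    by (intro trig_poly.add trig_poly.scale trig_poly_times trig_poly_power sin_x_trig_poly sin_y_trig_poly)
  have "RR (\<lambda>q. \<phi> q - (?dd (\<lambda>x. m * (6 * A x - 9 * K x)) (\<lambda>x. - m * A x) q + ?ee (\<lambda>x. m * (6 * A x - 9 * K x)) (\<lambda>x. - m * A x) q)) p = \<phi> p"
  proof (rule RR_inverse[where \<phi>x="?dd K' A'" and \<phi>y="?ee K' A'"])
    show "C_k_on UNIV \<phi> 2" "periodic2 \<phi>" by (intro trig_poly_C_k trig_poly_periodic tp)+
  qed (auto simp: \<phi>_def intro!: derivative_eq_intros dK dK' dA dA')
  moreover have "\<phi> q - (?dd (\<lambda>x. m * (6 * A x - 9 * K x)) (\<lambda>x. - m * A x) q + ?ee (\<lambda>x. m * (6 * A x - 9 * K x)) (\<lambda>x. - m * A x) q)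
     = (1 + 18 * m) * (ss q ^ 3)" for q
  proof -
    have "\<phi> q - (?dd (\<lambda>x. m * (6 * A x - 9 * K x)) (\<lambda>x. - m * A x) q + ?ee (\<lambda>x. m * (6 * A x - 9 * K x)) (\<lambda>x. - m * A x) q)
      = (1 + 18 * m) * (K (fst q) * K (snd q)) + (b * (1 + 10 * m) - 6 * m) * (K (fst q) * A (snd q) + A (fst q) * K (snd q))
        + (d * (1 + 2 * m) - 12 * m * b) * (A (fst q) * A (snd q))"
      unfolding \<phi>_def by (simp add: algebra_simps)
    then show ?thesis unfolding bm dm by (simp add: K_def A_def ss_def power_mult_distrib)
  qed
  ultimately have "(1 + 18 * m) * RR (\<lambda>q. ss q ^ 3) p = \<phi> p" by (simp add: Kop_cmult)
  moreover have "\<phi> p \<ge> d * ss p"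
  proof -
    have "A (fst p) \<ge> 0" "A (snd p) \<ge> 0"
      using sin_ge_dist[of "fst p"] sin_ge_dist[of "snd p"] assms
      by (auto simp: A_def quarter_def mem_Times_iff intro: order_trans[OF abs_ge_zero])
    \<comment> \<open>All terms of \<phi> are nonnegative on the quarter, so the last one alone is a
      lower bound and it is linear in \<open>ss\<close>.\<close>
    then have "0 \<le> K (fst p) * K (snd p) + b * (K (fst p) * A (snd p) + A (fst p) * K (snd p))"
      using b by (auto simp: K_def intro!: add_nonneg_nonneg mult_nonneg_nonneg)
    then show ?thesis by (simp add: \<phi>_def ss_def A_def)
  qed
  ultimately have le: "d * ss p \<le> (1 + 18 * m) * RR (\<lambda>q. ss q ^ 3) p" by simp
  have pos: "0 < 1 + 18 * m" using m by simp
  have "cub = d / (1 + 18 * m)" by (simp add: cub_def d_def b_def m_def Let_def)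
  moreover have "1 + 18 * m \<noteq> 0" using pos by (rule less_imp_neq[symmetric])
  ultimately have e: "(1 + 18 * m) * cub = d" by (metis nonzero_eq_divide_eq mult.commute)
  have "(1 + 18 * m) * (cub * ss p) \<le> (1 + 18 * m) * RR (\<lambda>q. ss q ^ 3) p"
    unfolding mult.assoc[symmetric] e by (rule le)
  then show ?thesis using pos by (rule mult_left_le_imp_le)
qed

text \<open>For the parabola w the operator 1 - \<Delta> gives w + 2, which leaves room for u + f
  because f \<le> 1. Since w is neither periodic nor odd, the maximum principle is applied to the
  difference on the quarter rather than through monotonicity of \<open>RR\<close>.\<close>

lemma RR_upper_bound:
  assumes g: "OO1 g" and b: "\<And>p. p \<in> quarter \<Longrightarrow> g p \<le> fst p * (1/2 - fst p) + 2" and "p \<in> quarter"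
  shows "RR g p \<le> fst p * (1/2 - fst p)"
proof -
  note g' = OO1D(1,3)[OF g]
  have "0 \<le> fst p * (1/2 - fst p) - RR g p"
  proof (rule max_principle_quarter[where \<phi>="\<lambda>p. fst p * (1/2 - fst p) - RR g p" and p=p
        and \<phi>x="\<lambda>p. 1/2 - 2 * fst p - RX g p" and \<phi>y="\<lambda>p. - RY g p" and \<phi>xx="\<lambda>p. - 2 - RX (dx g) p"
        and \<phi>yy="\<lambda>p. - RY (dy g) p"])
    show "continuous_on quarter (\<lambda>p. fst p * (1/2 - fst p) - RR g p)"
      using continuous_on_subset[OF OO1D(2)[OF RR_OO1[OF OO1D(2,3,4)[OF g]]], of quarter]
      by (intro continuous_intros) auto
    show "0 \<le> fst (x, y) * (1/2 - fst (x, y)) - RR g (x, y)"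
      if "(x, y) \<in> quarter" "x = 0 \<or> x = 1/2 \<or> y = 0 \<or> y = 1/2" for x y
      using odd_odd_periodic_boundary[OF OO1D(4,3)[OF RR_OO1[OF OO1D(2,3,4)[OF g]]] that(2)] that(1)
      by (simp add: quarter_def)
    show "0 \<le> fst p * (1/2 - fst p) - RR g p - (- 2 - RX (dx g) p + - RY (dy g) p)" if "p \<in> quarter" for p
      using resolvent_identity[OF g', of p] b[OF that] by linarith
  qed (auto intro!: derivative_eq_intros resolvent_second_derivatives[OF g'] assms(3))
  then show ?thesis by simp
qed

section \<open>The regularised sign function\<close>

definition fe :: "real \<Rightarrow> real \<Rightarrow> real" where
  "fe e t = t / sqrt (e + t\<^sup>2)"

text \<open>The common factor of all derivatives: \<open>fe\<close> is t q, its t-derivative is e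
  q^3 and its e-derivative is -(1/2) t q^3. Hence every coefficient below is polynomial in e, t and
  q.\<close>

definition qe :: "real \<Rightarrow> real \<Rightarrow> real" where
  "qe e t = 1 / sqrt (e + t\<^sup>2)"

lemma arg_pos: "e > 0 \<Longrightarrow> e + t\<^sup>2 > (0::real)"
  by (simp add: add_pos_nonneg)

lemma fe_eq: "fe e t = t * qe e t"
  by (simp add: fe_def qe_def)

lemma qe_pos: "e > 0 \<Longrightarrow> qe e t > 0"
  using arg_pos[of e t] by (simp add: qe_def)

lemma qe_sq: "e > 0 \<Longrightarrow> (e + t\<^sup>2) * (qe e t)\<^sup>2 = 1"
  using arg_pos[of e t] by (simp add: qe_def power_divide)

lemma fe_minus: "fe e (- t) = - fe e t"
  by (simp add: fe_def)

lemma fe_abs_le: "e > 0 \<Longrightarrow> \<bar>fe e t\<bar> \<le> 1"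
  using arg_pos[of e t] real_sqrt_le_mono[of "t\<^sup>2" "e + t\<^sup>2"] by (simp add: fe_def)

lemma fe_deriv: "e > 0 \<Longrightarrow> (fe e has_real_derivative e * qe e t ^ 3) (at t)"
proof -
  assume e: "e > 0"
  let ?w = "sqrt (e + t\<^sup>2)"
  have w: "?w > 0" "?w\<^sup>2 = e + t\<^sup>2" using arg_pos[OF e, of t] by auto
  have "(fe e has_real_derivative (?w - t * (t / ?w)) / (?w * ?w)) (at t)"
    unfolding fe_def[abs_def] using arg_pos[OF e, of t]
    by (auto intro!: derivative_eq_intros simp: field_simps power2_eq_square)
  moreover have "(?w - t * (t / ?w)) / (?w * ?w) = (?w\<^sup>2 - t\<^sup>2) / ?w ^ 3"
    using w(1) by (simp add: field_simps power2_eq_square power3_eq_cube)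
  ultimately show ?thesis by (simp add: w(2) qe_def power_divide)
qed

lemma fe_mono: "e > 0 \<Longrightarrow> t \<le> s \<Longrightarrow> fe e t \<le> fe e s"
  by (rule DERIV_nonneg_imp_nondecreasing[of t s "fe e"])
    (use fe_deriv[of e] qe_pos[of e] in \<open>auto intro!: exI[of _ "e * qe e _ ^ 3"] mult_nonneg_nonneg less_imp_le\<close>)

lemma qe_antimono: "e > 0 \<Longrightarrow> e \<le> e' \<Longrightarrow> 0 \<le> t \<Longrightarrow> t \<le> s \<Longrightarrow> qe e' s \<le> qe e t"
  unfolding qe_def using arg_pos[of e t]
  by (intro divide_left_mono real_sqrt_le_mono add_mono power_mono mult_pos_pos)
    (auto intro: add_pos_nonneg)

lemma fe_antimono_eps: "e > 0 \<Longrightarrow> e \<le> e' \<Longrightarrow> t \<ge> 0 \<Longrightarrow> fe e' t \<le> fe e t"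
  unfolding fe_eq by (intro mult_left_mono qe_antimono) auto

text \<open>The slope e q^3 decreases on the positive axis, so the tangent at the smaller point lies
  above. This turns the difference of two ordered solutions into a subsolution of a linear
  equation.\<close>

lemma fe_concave:
  assumes "e > 0" "0 \<le> t" "t \<le> s"
  shows "fe e s - fe e t \<le> e * qe e t ^ 3 * (s - t)"
proof (cases "t = s")
  case False
  then have "t < s" using assms by simp
  from MVT2[OF this, of "fe e" "\<lambda>x. e * qe e x ^ 3"] fe_deriv[OF assms(1)]
  obtain z where z: "t < z" "fe e s - fe e t = (s - t) * (e * qe e z ^ 3)" by blast
  have "e * qe e z ^ 3 \<le> e * qe e t ^ 3"
    using assms z qe_pos[OF assms(1), of z] by (intro mult_left_mono power_mono qe_antimono) auto
  then show ?thesis using z(2) \<open>t < s\<close> by (simp add: mult.commute mult_left_mono)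
qed simp

lemma fe_C_k:
  assumes "open S" "C_k_on S u k" "e > 0"
  shows "C_k_on S (\<lambda>x. qe e (u x)) k" "C_k_on S (\<lambda>x. fe e (u x)) k"
proof -
  show "C_k_on S (\<lambda>x. qe e (u x)) k"
    unfolding qe_def by (intro C_k_on_inverse_sqrt C_k_on_add C_k_on_const C_k_on_power assms arg_pos)
  then show "C_k_on S (\<lambda>x. fe e (u x)) k"
    unfolding fe_eq by (intro C_k_on_mult assms)
qed

lemma fe_OO1: "e > 0 \<Longrightarrow> OO1 u \<Longrightarrow> OO1 (\<lambda>p. fe e (u p))"
  using fe_C_k(2)[of UNIV u "Suc 0" e] unfolding OO1_def
  by (auto simp: periodic2_def odd_odd_def fe_minus simp del: C_k_on.simps)

subsection \<open>Monotone iteration\<close>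

text \<open>The threshold is the square of the amplitude 1/200 of the subsolution. For t \<le> 1/200
  it gives e + t^2 \<le> 1/20000 \<le> (1/128)^2, so the factor 1/sqrt(e + t^2) is at least 128,
  which exceeds 8 pi^2.\<close>

definition I0 :: "real set" where "I0 = {0<..<1/40000}"

primrec iter :: "real \<Rightarrow> nat \<Rightarrow> real \<times> real \<Rightarrow> real" where
  "iter e 0 = (\<lambda>p. (1/200) * ss p)"
| "iter e (Suc n) = RR (\<lambda>p. iter e n p + fe e (iter e n p))"

lemma I0D: "e \<in> I0 \<Longrightarrow> e > 0" "e \<in> I0 \<Longrightarrow> e < 1/40000"
  by (auto simp: I0_def)

lemma iter_OO1: "e > 0 \<Longrightarrow> OO1 (iter e n)"
proof (induction n)
  case 0
  then show ?case unfolding iter.simps by (intro OO1_cmult ss_OO1)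
next
  case (Suc n)
  have "OO1 (\<lambda>p. iter e n p + fe e (iter e n p))" using Suc by (intro OO1_add fe_OO1) auto
  then show ?case using RR_OO1 OO1D by simp
qed

lemma iter_rhs_OO1: "e > 0 \<Longrightarrow> OO1 (\<lambda>p. iter e n p + fe e (iter e n p))"
  by (intro OO1_add fe_OO1 iter_OO1)

lemma ss_le_1: "\<bar>ss p\<bar> \<le> 1"
  unfolding ss_def abs_mult by (rule mult_le_one) auto

lemma pi_sq_less: "8 * pi\<^sup>2 \<le> 128"
  using mult_mono[OF less_imp_le[OF pi_less_4] less_imp_le[OF pi_less_4]] by (simp add: power2_eq_square)

text \<open>With t the scaled eigenfunction this is 8 pi^2 t \<le> f(t): near zero the slope f(t)/t
  of the nonlinearity beats the eigenvalue. The amplitude 1/200 and the range of e are chosen for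
  this.\<close>

lemma iter_subsolution:
  assumes "e \<in> I0" "p \<in> quarter"
  shows "(1 + 8 * pi\<^sup>2) * ((1/200) * ss p) \<le> (1/200) * ss p + fe e ((1/200) * ss p)"
proof -
  define t where "t = (1/200) * ss p"
  have t: "0 \<le> t" "t \<le> 1/200" using ss_nonneg[OF assms(2)] ss_le_1[of p] by (auto simp: t_def)
  have "t\<^sup>2 \<le> (1/200)\<^sup>2" using t by (intro power_mono)
  then have "e + t\<^sup>2 \<le> (1/128)\<^sup>2" using I0D(2)[OF assms(1)] by (simp add: power2_eq_square)
  then have s: "sqrt (e + t\<^sup>2) \<le> 1/128" by (intro real_le_lsqrt) auto
  have sp: "sqrt (e + t\<^sup>2) > 0" using arg_pos[OF I0D(1)[OF assms(1)]] by simp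
  have "8 * pi\<^sup>2 * sqrt (e + t\<^sup>2) \<le> 128 * (1/128)" using pi_sq_less s sp by (intro mult_mono) auto
  then have "8 * pi\<^sup>2 \<le> 1 / sqrt (e + t\<^sup>2)" using sp by (simp add: field_simps)
  from mult_left_mono[OF this t(1)] have "8 * pi\<^sup>2 * t \<le> fe e t" by (simp add: fe_def mult.commute)
  then show ?thesis unfolding t_def[symmetric] by (simp add: algebra_simps)
qed

lemma RR_ss_scaled: "RR (\<lambda>q. (1 + 8 * pi\<^sup>2) * (c * ss q)) p = c * ss p"
proof -
  have "RR (\<lambda>q. (1 + 8 * pi\<^sup>2) * (c * ss q)) p = c * RR (\<lambda>q. (1 + 8 * pi\<^sup>2) * ss q) p"
    unfolding Kop_cmult by simp
  then show ?thesis unfolding RR_ss .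
qed

lemma iter_incr:
  assumes e: "e \<in> I0"
  shows "p \<in> quarter \<Longrightarrow> iter e n p \<le> iter e (Suc n) p"
proof (induction n arbitrary: p)
  case 0
  have "RR (\<lambda>q. (1 + 8 * pi\<^sup>2) * ((1/200) * ss q)) p \<le> iter e (Suc 0) p"
    unfolding iter.simps
    by (rule RR_mono[OF OO1_cmult[OF OO1_cmult[OF ss_OO1]] iter_rhs_OO1[OF I0D(1)[OF e], of 0, unfolded iter.simps]
      iter_subsolution[OF e] 0])
  moreover have "RR (\<lambda>q. (1 + 8 * pi\<^sup>2) * ((1/200) * ss q)) p = (1/200) * ss p"
    by (rule RR_ss_scaled)
  ultimately show ?case by simp
next
  case (Suc n)
  have "RR (\<lambda>p. iter e n p + fe e (iter e n p)) p \<le> RR (\<lambda>p. iter e (Suc n) p + fe e (iter e (Suc n) p)) p"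
    by (rule RR_mono[OF iter_rhs_OO1[OF I0D(1)[OF e]] iter_rhs_OO1[OF I0D(1)[OF e]] _ Suc.prems])
      (intro add_mono Suc.IH fe_mono I0D(1)[OF e])
  then show ?case by (simp only: iter.simps)
qed

lemma iter_lower:
  assumes "e \<in> I0" "p \<in> quarter"
  shows "(1/200) * ss p \<le> iter e n p"
proof (induction n)
  case (Suc n)
  then show ?case using iter_incr[OF assms, of n] by linarith
qed simp

lemma iter_upper:
  assumes e: "e \<in> I0"
  shows "p \<in> quarter \<Longrightarrow> iter e n p \<le> fst p * (1/2 - fst p)"
proof (induction n arbitrary: p)
  case 0
  have "RR (\<lambda>q. (1 + 8 * pi\<^sup>2) * ((1/200) * ss q)) p \<le> fst p * (1/2 - fst p)"
  proof (rule RR_upper_bound[OF OO1_cmult[OF OO1_cmult[OF ss_OO1]] _ 0])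
    fix q assume q: "q \<in> quarter"
    \<comment> \<open>From 8 pi^2 \<le> 128; the bound 129/200 is already below the constant 2 of
      the supersolution.\<close>
    have "(1 + 8 * pi\<^sup>2) * ((1/200) * ss q) \<le> 129 * ((1/200) * 1)"
      using pi_sq_less ss_nonneg[OF q] ss_le_1[of q] by (intro mult_mono) auto
    also have "\<dots> \<le> fst q * (1/2 - fst q) + 2"
      using q mult_nonneg_nonneg[of "fst q" "1/2 - fst q"] by (auto simp: quarter_def)
    finally show "(1 + 8 * pi\<^sup>2) * ((1/200) * ss q) \<le> fst q * (1/2 - fst q) + 2" .
  qed
  moreover have "RR (\<lambda>q. (1 + 8 * pi\<^sup>2) * ((1/200) * ss q)) p = (1/200) * ss p"
    by (rule RR_ss_scaled)
  ultimately show ?case by simp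
next
  case (Suc n)
  show ?case unfolding iter.simps
  proof (rule RR_upper_bound[OF iter_rhs_OO1[OF I0D(1)[OF e]] _ Suc.prems])
    show "iter e n q + fe e (iter e n q) \<le> fst q * (1/2 - fst q) + 2" if "q \<in> quarter" for q
      using Suc.IH[OF that] fe_abs_le[OF I0D(1)[OF e], of "iter e n q"] by linarith
  qed
qed

text \<open>On nonnegative values \<open>fe\<close> decreases in e, and the resolvent is monotone on
  the quarter, so the ordering survives each iteration. It is the source of the monotone limit as e
  tends to 0.\<close>

lemma iter_antimono:
  assumes e: "e \<in> I0" "e' \<in> I0" "e \<le> e'"
  shows "p \<in> quarter \<Longrightarrow> iter e' n p \<le> iter e n p"
proof (induction n arbitrary: p)
  case (Suc n)
  show ?case unfolding iter.simps
  proof (rule RR_mono[OF iter_rhs_OO1[OF I0D(1)[OF e(2)]] iter_rhs_OO1[OF I0D(1)[OF e(1)]] _ Suc.prems])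
    fix q assume q: "q \<in> quarter"
    have nn: "0 \<le> iter e' n q" using iter_lower[OF e(2) q, of n] ss_nonneg[OF q] by linarith
    have "fe e' (iter e' n q) \<le> fe e (iter e' n q)" using e nn I0D by (intro fe_antimono_eps) auto
    also have "\<dots> \<le> fe e (iter e n q)" using Suc.IH[OF q] e I0D by (intro fe_mono) auto
    finally show "iter e' n q + fe e' (iter e' n q) \<le> iter e n q + fe e (iter e n q)"
      using Suc.IH[OF q] by linarith
  qed
qed simp

text \<open>The representative q and the sign \<sigma> are fixed before f, so one choice serves a
  whole sequence of functions at once, and limits on the quarter transfer to every point.\<close>

lemma fold_quarter:
  obtains q \<sigma> where "q \<in> quarter" "\<bar>\<sigma>\<bar> = (1::real)" "\<And>f. odd_odd f \<Longrightarrow> periodic2 f \<Longrightarrow> f p = \<sigma> * f q"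
proof -
  have fr: "h (frac t) = h t" if h: "\<forall>s. h (s + 1) = h s" for h :: "real \<Rightarrow> real" and t
    using periodic2_frac2[of "\<lambda>p. h (fst p)" "(t, 0)"] h by (simp add: periodic2_def frac2_def)
  have red: "\<exists>a \<sigma>. 0 \<le> a \<and> a \<le> 1/2 \<and> \<bar>\<sigma>\<bar> = (1::real) \<and> (\<forall>h::real \<Rightarrow> real. (\<forall>s. h (- s) = - h s) \<longrightarrow> (\<forall>s. h (s + 1) = h s) \<longrightarrow> h t = \<sigma> * h a)"
    for t :: real
  proof (cases "frac t \<le> 1/2")
    case True
    show ?thesis
      by (rule exI[of _ "frac t"], rule exI[of _ 1]) (use True in \<open>auto simp: frac_ge_0 fr\<close>)
  next
    case False
    have "h t = - 1 * h (1 - frac t)" if h: "\<forall>s. h (- s) = - h s" "\<forall>s. h (s + 1) = h s" for h :: "real \<Rightarrow> real"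
    proof -
      have "h t = h (- (1 - frac t) + 1)" using fr[OF h(2)] by simp
      also have "\<dots> = - h (1 - frac t)" using h by metis
      finally show ?thesis by simp
    qed
    then show ?thesis
      by - (rule exI[of _ "1 - frac t"], rule exI[of _ "-1"], use False frac_lt_1[of t] in \<open>auto simp: less_imp_le\<close>)
  qed
  obtain a \<sigma> where a: "0 \<le> a" "a \<le> 1/2" "\<bar>\<sigma>\<bar> = 1"
    "\<And>h::real \<Rightarrow> real. (\<forall>s. h (- s) = - h s) \<Longrightarrow> (\<forall>s. h (s + 1) = h s) \<Longrightarrow> h (fst p) = \<sigma> * h a"
    using red[of "fst p"] by blast
  obtain b \<tau> where b: "0 \<le> b" "b \<le> 1/2" "\<bar>\<tau>\<bar> = 1"
    "\<And>h::real \<Rightarrow> real. (\<forall>s. h (- s) = - h s) \<Longrightarrow> (\<forall>s. h (s + 1) = h s) \<Longrightarrow> h (snd p) = \<tau> * h b"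
    using red[of "snd p"] by blast
  show thesis
  proof (rule that[of "(a, b)" "\<sigma> * \<tau>"])
    fix f :: "real \<times> real \<Rightarrow> real" assume f: "odd_odd f" "periodic2 f"
    have "f (fst p, snd p) = \<sigma> * f (a, snd p)"
      using a(4)[of "\<lambda>s. f (s, snd p)"] f by (simp add: odd_odd_def periodic2_def)
    also have "f (a, snd p) = \<tau> * f (a, b)"
      using b(4)[of "\<lambda>s. f (a, s)"] f by (simp add: odd_odd_def periodic2_def)
    finally show "f p = \<sigma> * \<tau> * f (a, b)" by simp
  qed (use a b in \<open>auto simp: quarter_def abs_mult\<close>)
qed

lemma abs_le_from_quarter:
  assumes "odd_odd f" "periodic2 f" "\<And>q. q \<in> quarter \<Longrightarrow> \<bar>f q\<bar> \<le> B"
  shows "\<bar>f p\<bar> \<le> B"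
proof -
  obtain q \<sigma> where "q \<in> quarter" "\<bar>\<sigma>\<bar> = (1::real)" "f p = \<sigma> * f q"
    by (rule fold_quarter[of p]) (use assms(1,2) in blast)
  then show ?thesis using assms(3)[of q] by (simp add: abs_mult)
qed

lemma quarter_parabola: "q \<in> quarter \<Longrightarrow> fst q * (1/2 - fst q) \<le> 1/16"
  using zero_le_power2[of "fst q - 1/4"] by (simp add: power2_eq_square algebra_simps)

lemma iter_abs_le: "e \<in> I0 \<Longrightarrow> \<bar>iter e n p\<bar> \<le> 1/16"
proof (rule abs_le_from_quarter)
  assume e: "e \<in> I0"
  show "odd_odd (iter e n)" "periodic2 (iter e n)" using OO1D(4,3)[OF iter_OO1[OF I0D(1)[OF e]]] .
  show "\<bar>iter e n q\<bar> \<le> 1/16" if "q \<in> quarter" for q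
    using iter_lower[OF e that, of n] iter_upper[OF e that, of n] ss_nonneg[OF that] quarter_parabola[OF that] by linarith
qed

section \<open>The limit of the iteration and its gradient\<close>

definition usol :: "real \<Rightarrow> real \<times> real \<Rightarrow> real" where
  "usol e p = lim (\<lambda>n. iter e n p)"

lemma iter_tendsto:
  assumes e: "e \<in> I0"
  shows "(\<lambda>n. iter e n p) \<longlonglongrightarrow> usol e p"
proof -
  obtain q \<sigma> where q: "q \<in> quarter" "\<And>f. odd_odd f \<Longrightarrow> periodic2 f \<Longrightarrow> f p = \<sigma> * f q"
    by (rule fold_quarter[of p]) blast
  have "incseq (\<lambda>n. iter e n q)" by (rule incseq_SucI) (rule iter_incr[OF e q(1)])
  moreover have "iter e n q \<le> 1/16" for n using iter_abs_le[OF e, of n q] by linarith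
  ultimately obtain L where "(\<lambda>n. iter e n q) \<longlonglongrightarrow> L" using incseq_convergent[of "\<lambda>n. iter e n q" "1/16"] by metis
  then have "(\<lambda>n. \<sigma> * iter e n q) \<longlonglongrightarrow> \<sigma> * L" by (intro tendsto_intros)
  then have "(\<lambda>n. iter e n p) \<longlonglongrightarrow> \<sigma> * L"
    using q(2)[OF OO1D(4,3)[OF iter_OO1[OF I0D(1)[OF e]]]] by simp
  then show ?thesis unfolding usol_def using limI by metis
qed

lemma RR_lipschitz:
  assumes "continuous_on UNIV g" "periodic2 g" "\<And>q. \<bar>g q\<bar> \<le> B"
  shows "\<bar>RR g p - RR g q\<bar> \<le> 2 * cX * B * dist p q"
proof -
  have B: "0 \<le> cX * B" using assms(3)[of 0] abs_ge_zero[of "g 0"] cX_nonneg by simp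
  have "norm (RR g (fst p, snd p) - RR g (fst q, snd p)) \<le> (cX * B) * norm (fst p - fst q)"
    by (rule field_differentiable_bound[OF convex_UNIV])
      (use RR_has_real_derivative_x[OF assms(1,2)] in \<open>auto intro!: RX_bound[OF assms(1,3)]\<close>)
  moreover have "norm (RR g (fst q, snd p) - RR g (fst q, snd q)) \<le> (cX * B) * norm (snd p - snd q)"
    by (rule field_differentiable_bound[OF convex_UNIV])
      (use RR_has_real_derivative_y[OF assms(1,2)] in \<open>auto intro!: RY_bound[OF assms(1,3)]\<close>)
  moreover have "(cX * B) * norm (fst p - fst q) \<le> (cX * B) * dist p q" "(cX * B) * norm (snd p - snd q) \<le> (cX * B) * dist p q"
    using dist_fst_le[of p q] dist_snd_le[of p q] B by (auto simp: dist_norm intro!: mult_left_mono)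
  ultimately have "\<bar>RR g p - RR g q\<bar> \<le> (cX * B) * dist p q + (cX * B) * dist p q"
    unfolding real_norm_def prod.collapse by linarith
  then show ?thesis by (simp add: algebra_simps)
qed

lemma usol_basic:
  assumes e: "e \<in> I0"
  shows "periodic2 (usol e)" "odd_odd (usol e)" "\<bar>usol e p\<bar> \<le> 1/16"
    "q \<in> quarter \<Longrightarrow> (1/200) * ss q \<le> usol e q"
proof -
  note i = OO1D(3,4)[OF iter_OO1[OF I0D(1)[OF e]]]
  have "usol e (x + 1, y) = usol e (x, y)" "usol e (x, y + 1) = usol e (x, y)" for x y
    unfolding usol_def using i(1) by (simp_all add: periodic2_def)
  then show "periodic2 (usol e)" by (simp add: periodic2_def)
  have "usol e (- x, y) = - usol e (x, y)" "usol e (x, - y) = - usol e (x, y)" for x y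
    using i(2) LIMSEQ_unique[OF iter_tendsto[OF e, of "(- x, y)"]] LIMSEQ_unique[OF iter_tendsto[OF e, of "(x, - y)"]]
      tendsto_minus[OF iter_tendsto[OF e, of "(x, y)"]] by (simp_all add: odd_odd_def)
  then show "odd_odd (usol e)" by (simp add: odd_odd_def)
  show "\<bar>usol e p\<bar> \<le> 1/16"
    by (rule LIMSEQ_le_const2[OF tendsto_rabs[OF iter_tendsto[OF e]]]) (use iter_abs_le[OF e] in auto)
  show "q \<in> quarter \<Longrightarrow> (1/200) * ss q \<le> usol e q"
    by (rule LIMSEQ_le_const[OF iter_tendsto[OF e]]) (use iter_lower[OF e] in auto)
qed

text \<open>Each iterate is the resolvent of a function bounded by 2, whatever e and n. The
  Lipschitz constant is therefore uniform, which makes the pointwise limit continuous and serves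
  again as e tends to 0.\<close>

lemma usol_lipschitz:
  assumes e: "e \<in> I0"
  shows "\<bar>usol e p - usol e q\<bar> \<le> 4 * cX * dist p q"
proof (rule LIMSEQ_le_const2)
  show "(\<lambda>n. \<bar>iter e (Suc n) p - iter e (Suc n) q\<bar>) \<longlonglongrightarrow> \<bar>usol e p - usol e q\<bar>"
    by (intro tendsto_intros LIMSEQ_Suc[OF iter_tendsto[OF e]])
  have "\<bar>iter e (Suc n) p - iter e (Suc n) q\<bar> \<le> 2 * cX * 2 * dist p q" for n
    unfolding iter.simps
  proof (rule RR_lipschitz)
    show "\<bar>iter e n x + fe e (iter e n x)\<bar> \<le> 2" for x
      using iter_abs_le[OF e, of n x] fe_abs_le[OF I0D(1)[OF e], of "iter e n x"] by linarith
  qed (use OO1D[OF iter_rhs_OO1[OF I0D(1)[OF e]]] in auto)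
  then show "\<exists>N. \<forall>n\<ge>N. \<bar>iter e (Suc n) p - iter e (Suc n) q\<bar> \<le> 4 * cX * dist p q" by simp
qed

lemma usol_continuous:
  assumes e: "e \<in> I0"
  shows "continuous_on UNIV (usol e)"
proof -
  have "(4 * cX)-lipschitz_on UNIV (usol e)"
    by (rule lipschitz_onI) (use usol_lipschitz[OF e] cX_nonneg in \<open>auto simp: dist_real_def\<close>)
  then show ?thesis by (rule lipschitz_on_continuous_on)
qed

lemma continuous_on_fe:
  assumes "e > 0" "continuous_on S u"
  shows "continuous_on S (\<lambda>p. fe e (u p))"
  unfolding fe_def by (intro continuous_intros assms) (use arg_pos[OF assms(1)] in \<open>auto simp: less_imp_neq[symmetric]\<close>)

lemma usol_fixpoint:
  assumes e: "e \<in> I0"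
  shows "usol e p = RR (\<lambda>q. usol e q + fe e (usol e q)) p"
proof (rule LIMSEQ_unique)
  show "(\<lambda>n. iter e (Suc n) p) \<longlonglongrightarrow> usol e p" by (rule LIMSEQ_Suc[OF iter_tendsto[OF e]])
  show "(\<lambda>n. iter e (Suc n) p) \<longlonglongrightarrow> RR (\<lambda>q. usol e q + fe e (usol e q)) p"
    unfolding iter.simps
  proof (rule Kop_dominated[OF integrable_rmeas_r])
    show "\<bar>iter e n x + fe e (iter e n x)\<bar> \<le> 2" for n x
      using iter_abs_le[OF e, of n x] fe_abs_le[OF I0D(1)[OF e], of "iter e n x"] by linarith
    show "(\<lambda>n. iter e n q + fe e (iter e n q)) \<longlonglongrightarrow> usol e q + fe e (usol e q)" for q
      unfolding fe_def using arg_pos[OF I0D(1)[OF e]]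
      by (intro tendsto_intros iter_tendsto e) (auto simp: less_imp_neq[symmetric])
    show "(\<lambda>q. usol e q + fe e (usol e q)) \<in> borel_measurable borel"
      by (intro borel_measurable_continuous_onI continuous_intros usol_continuous[OF e] continuous_on_fe I0D(1)[OF e])
  qed (use OO1D[OF iter_rhs_OO1[OF I0D(1)[OF e]]] in auto)
qed

lemma usol_eq_RR:
  assumes e: "e \<in> I0"
  shows "usol e = RR (\<lambda>q. usol e q + fe e (usol e q))"
  using usol_fixpoint[OF e] by (rule ext)

lemma usol_OO1:
  assumes e: "e \<in> I0"
  shows "OO1 (usol e)"
proof -
  have "OO1 (RR (\<lambda>q. usol e q + fe e (usol e q)))"
  proof (rule RR_OO1)
    show "continuous_on UNIV (\<lambda>q. usol e q + fe e (usol e q))"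
      by (intro continuous_intros usol_continuous[OF e] continuous_on_fe I0D(1)[OF e])
    show "periodic2 (\<lambda>q. usol e q + fe e (usol e q))" "odd_odd (\<lambda>q. usol e q + fe e (usol e q))"
      using usol_basic(1,2)[OF e] by (auto simp: periodic2_def odd_odd_def fe_minus)
  qed
  then show ?thesis using usol_eq_RR[OF e] by metis
qed

lemma usol_rhs_OO1: "e \<in> I0 \<Longrightarrow> OO1 (\<lambda>q. usol e q + fe e (usol e q))"
  using I0D(1) by (intro OO1_add fe_OO1 usol_OO1)

lemma usol_rhs_le: "e \<in> I0 \<Longrightarrow> \<bar>usol e q + fe e (usol e q)\<bar> \<le> 2"
  using usol_basic(3)[of e q] fe_abs_le[OF I0D(1), of e "usol e q"] by linarith

lemma usol_antimono:
  assumes "e \<in> I0" "e' \<in> I0" "e \<le> e'" "p \<in> quarter"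
  shows "usol e' p \<le> usol e p"
  by (rule LIMSEQ_le[OF iter_tendsto[OF assms(2)] iter_tendsto[OF assms(1)]])
    (use iter_antimono[OF assms(1-3) assms(4)] in auto)

lemma usol_dx: "e \<in> I0 \<Longrightarrow> dx (usol e) p = RX (\<lambda>q. usol e q + fe e (usol e q)) p"
  and usol_dy: "e \<in> I0 \<Longrightarrow> dy (usol e) p = RY (\<lambda>q. usol e q + fe e (usol e q)) p"
proof -
  assume e: "e \<in> I0"
  note o = OO1D[OF usol_rhs_OO1[OF e]]
  have d: "usol e differentiable (at p)" for p by (rule C_k_on_differentiable[OF OO1D(1)[OF usol_OO1[OF e]]])
  note D = RR_has_real_derivative_x[OF o(2,3), of "snd p" "fst p", unfolded usol_eq_RR[OF e, symmetric]]
    RR_has_real_derivative_y[OF o(2,3), of "fst p" "snd p", unfolded usol_eq_RR[OF e, symmetric]]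
  show "dx (usol e) p = RX (\<lambda>q. usol e q + fe e (usol e q)) p"
    "dy (usol e) p = RY (\<lambda>q. usol e q + fe e (usol e q)) p"
    using dx_eqI[OF d D(1)] dy_eqI[OF d D(2)] by simp_all
qed

lemma usol_dx_le: "e \<in> I0 \<Longrightarrow> \<bar>dx (usol e) p\<bar> \<le> cX * 2"
  and usol_dy_le: "e \<in> I0 \<Longrightarrow> \<bar>dy (usol e) p\<bar> \<le> cX * 2"
proof -
  assume e: "e \<in> I0"
  note o = OO1D(2)[OF usol_rhs_OO1[OF e]] usol_rhs_le[OF e]
  show "\<bar>dx (usol e) p\<bar> \<le> cX * 2" "\<bar>dy (usol e) p\<bar> \<le> cX * 2"
    unfolding usol_dx[OF e] usol_dy[OF e] by (rule RX_bound[OF o] RY_bound[OF o])+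
qed

section \<open>The linearised operator and its a priori bound\<close>

definition OO0 :: "(real \<times> real \<Rightarrow> real) \<Rightarrow> bool" where
  "OO0 g \<longleftrightarrow> continuous_on UNIV g \<and> periodic2 g \<and> odd_odd g"

lemma OO1_imp_OO0: "OO1 g \<Longrightarrow> OO0 g"
  using OO1D by (simp add: OO0_def)

text \<open>Uniform limits of solutions of linear equations are at first only continuous; one
  application of the resolvent returns them to the C^1 class in which the maximum principle
  works.\<close>

lemma RR_OO0: "OO0 g \<Longrightarrow> OO1 (RR g)"
  using RR_OO1 by (simp add: OO0_def)

lemma OO0_bounded:
  assumes "OO0 g"
  obtains B where "B \<ge> 0" "\<And>q. \<bar>g q\<bar> \<le> B"
  by (rule periodic2_bounded[of g]) (use assms that in \<open>auto simp: OO0_def\<close>)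

lemma OO0_add: "OO0 f \<Longrightarrow> OO0 g \<Longrightarrow> OO0 (\<lambda>p. f p + g p)"
  and OO0_diff: "OO0 f \<Longrightarrow> OO0 g \<Longrightarrow> OO0 (\<lambda>p. f p - g p)"
  and OO0_cmult: "OO0 f \<Longrightarrow> OO0 (\<lambda>p. c * f p)"
  by (auto simp: OO0_def periodic2_def odd_odd_def intro!: continuous_intros)

definition cR :: real where "cR = (\<integral>w. \<bar>fst w\<bar> \<partial>rmeas)"

lemma cR_nonneg: "cR \<ge> 0"
  by (simp add: cR_def)

lemma RR_bound: "continuous_on UNIV g \<Longrightarrow> (\<And>q. \<bar>g q\<bar> \<le> B) \<Longrightarrow> \<bar>RR g p\<bar> \<le> cR * B"
  unfolding cR_def by (rule Kop_bound[OF integrable_rmeas_r borel_measurable_continuous_onI])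

lemma RR_add0:
  assumes "OO0 g" "OO0 h"
  shows "RR (\<lambda>q. g q + h q) p = RR g p + RR h p" "RR (\<lambda>q. g q - h q) p = RR g p - RR h p"
proof -
  obtain B where B: "\<And>q. \<bar>g q\<bar> \<le> B" by (rule OO0_bounded[OF assms(1)]) blast
  obtain C where C: "\<And>q. \<bar>h q\<bar> \<le> C" by (rule OO0_bounded[OF assms(2)]) blast
  have m: "g \<in> borel_measurable borel" "h \<in> borel_measurable borel"
    using assms by (auto simp: OO0_def intro: borel_measurable_continuous_onI)
  show "RR (\<lambda>q. g q + h q) p = RR g p + RR h p" "RR (\<lambda>q. g q - h q) p = RR g p - RR h p"
    using Kop_add[OF integrable_rmeas_r m(1) B m(2) C] Kop_diff[OF integrable_rmeas_r m(1) B m(2) C] by auto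
qed

text \<open>The derivative of t + \<open>fe e t\<close> at the solution, so that the linearised
  equation is the fixed point equation of the resolvent applied to \<open>ae e\<close> times the
  unknown.\<close>

definition ae :: "real \<Rightarrow> real \<times> real \<Rightarrow> real" where
  "ae e p = 1 + e * qe e (usol e p) ^ 3"

lemma qe_minus: "qe e (- t) = qe e t"
  by (simp add: qe_def)

lemma qe_EE1: "e > 0 \<Longrightarrow> OO1 u \<Longrightarrow> EE1 (\<lambda>p. qe e (u p))"
  using fe_C_k(1)[of UNIV u "Suc 0" e] unfolding OO1_def EE1_def
  by (auto simp: periodic2_def odd_odd_def qe_minus simp del: C_k_on.simps)

lemma EE1_const: "EE1 (\<lambda>p. c)"
  unfolding EE1_def by (auto simp: periodic2_def C_k_on_const simp del: C_k_on.simps)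

lemma EE1_add: "EE1 a \<Longrightarrow> EE1 b \<Longrightarrow> EE1 (\<lambda>p. a p + b p)"
  and EE1_diff: "EE1 a \<Longrightarrow> EE1 b \<Longrightarrow> EE1 (\<lambda>p. a p - b p)"
  and EE1_mult: "EE1 a \<Longrightarrow> EE1 b \<Longrightarrow> EE1 (\<lambda>p. a p * b p)"
  unfolding EE1_def using C_k_on_add[of UNIV a] C_k_on_mult[of UNIV a] C_k_on_diff[of UNIV a]
  by (auto simp: periodic2_def simp del: C_k_on.simps)

lemma EE1_power: "EE1 a \<Longrightarrow> EE1 (\<lambda>p. a p ^ n)"
  by (induction n) (auto intro: EE1_mult EE1_const)

lemma ae_EE1: "e \<in> I0 \<Longrightarrow> EE1 (ae e)"
  unfolding ae_def[abs_def] using I0D(1) usol_OO1 by (intro EE1_add EE1_mult EE1_const EE1_power qe_EE1)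

lemma ae_differentiable: "e \<in> I0 \<Longrightarrow> ae e differentiable (at p)"
  using ae_EE1[of e] C_k_on_differentiable[of "ae e" 0] unfolding EE1_def by blast

lemma qe_le: "0 < e1 \<Longrightarrow> e1 \<le> e \<Longrightarrow> qe e t \<le> 1 / sqrt e1"
  unfolding qe_def by (intro divide_left_mono real_sqrt_le_mono mult_pos_pos) (auto simp: add_pos_nonneg add_increasing2)

lemma ae_bounds:
  assumes "e \<in> I0" "0 < e1" "e1 \<le> e"
  shows "1 \<le> ae e p" "ae e p \<le> 1 + (1 / sqrt e1) ^ 3"
proof -
  have q: "0 \<le> qe e (usol e p)" using qe_pos[OF I0D(1)[OF assms(1)]] less_imp_le by blast
  show "1 \<le> ae e p" using q I0D(1)[OF assms(1)] by (simp add: ae_def)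
  have "e * qe e (usol e p) ^ 3 \<le> 1 * (1 / sqrt e1) ^ 3"
    using q I0D[OF assms(1)] qe_le[OF assms(2,3)] by (intro mult_mono power_mono) auto
  then show "ae e p \<le> 1 + (1 / sqrt e1) ^ 3" by (simp add: ae_def)
qed

lemma qe_deriv: "e > 0 \<Longrightarrow> (qe e has_real_derivative - t * qe e t ^ 3) (at t)"
proof -
  assume e: "e > 0"
  show ?thesis unfolding qe_def[abs_def] using arg_pos[OF e, of t]
    by (auto intro!: derivative_eq_intros simp: field_simps power3_eq_cube)
qed

lemma qe_deriv_eps: "e > 0 \<Longrightarrow> ((\<lambda>e. qe e t) has_real_derivative - (1/2) * qe e t ^ 3) (at e)"
proof -
  assume e: "e > 0"
  show ?thesis unfolding qe_def[abs_def] using arg_pos[OF e, of t]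
    by (auto intro!: derivative_eq_intros simp: field_simps power3_eq_cube)
qed

lemma usol_has_dy: "e \<in> I0 \<Longrightarrow> ((\<lambda>s. usol e (x, s)) has_real_derivative dy (usol e) (x, y)) (at y)"
  by (rule has_real_derivative_dy[OF C_k_on_differentiable[OF OO1D(1)[OF usol_OO1]]])

lemma ae_dy:
  assumes "e \<in> I0"
  shows "((\<lambda>s. ae e (x, s)) has_real_derivative
    - 3 * e * qe e (usol e (x, y)) ^ 5 * usol e (x, y) * dy (usol e) (x, y)) (at y)"
proof -
  note d = DERIV_chain2[OF qe_deriv[OF I0D(1)[OF assms]] usol_has_dy[OF assms]]
  show ?thesis unfolding ae_def
    by (auto intro!: derivative_eq_intros d simp: power_numeral_reduce)
qed

lemma ae_dy_le:
  assumes "e \<in> I0" "0 < e1" "e1 \<le> e"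
  shows "\<bar>dy (ae e) p\<bar> \<le> cX * (1 / sqrt e1) ^ 5"
proof -
  obtain x y where p: "p = (x, y)" by (rule prod.exhaust)
  let ?q = "qe e (usol e (x, y))"
  have "dy (ae e) p = - 3 * e * ?q ^ 5 * usol e (x, y) * dy (usol e) (x, y)"
    unfolding p by (rule dy_eqI[OF ae_differentiable[OF assms(1)] ae_dy[OF assms(1)]])
  then have "\<bar>dy (ae e) p\<bar> = (3 * e) * ?q ^ 5 * (\<bar>usol e (x, y)\<bar> * \<bar>dy (usol e) (x, y)\<bar>)"
    using I0D(1)[OF assms(1)] qe_pos[OF I0D(1)[OF assms(1)], of "usol e (x, y)"] by (simp add: abs_mult)
  also have "\<dots> \<le> 1 * (1 / sqrt e1) ^ 5 * ((1/2) * (cX * 2))"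
  proof (intro mult_mono power_mono)
    show "\<bar>usol e (x, y)\<bar> \<le> 1/2" using usol_basic(3)[OF assms(1), of "(x, y)"] by linarith
    show "\<bar>dy (usol e) (x, y)\<bar> \<le> cX * 2" by (rule usol_dy_le[OF assms(1)])
  qed (use I0D[OF assms(1)] qe_le[OF assms(2,3)] qe_pos[OF I0D(1)[OF assms(1)], of "usol e (x, y)"] cX_nonneg assms(2)
      in \<open>auto intro!: mult_nonneg_nonneg less_imp_le\<close>)
  finally show ?thesis by (simp add: mult.commute)
qed

definition Kop1 :: "real \<Rightarrow> (real \<times> real \<Rightarrow> real) \<Rightarrow> real \<times> real \<Rightarrow> real" where
  "Kop1 e z = RR (\<lambda>q. ae e q * z q)"

lemma ae_mult_OO1: "e \<in> I0 \<Longrightarrow> OO1 z \<Longrightarrow> OO1 (\<lambda>q. ae e q * z q)"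
  by (intro EE1_mult_OO1 ae_EE1)

lemma ae_mult_OO0: "e \<in> I0 \<Longrightarrow> OO0 z \<Longrightarrow> OO0 (\<lambda>q. ae e q * z q)"
  using ae_EE1[of e] C_k_on_continuous[of UNIV "ae e"] unfolding OO0_def EE1_def
  by (auto simp: periodic2_def odd_odd_def intro!: continuous_intros simp del: C_k_on.simps)

lemma Kop1_OO1: "e \<in> I0 \<Longrightarrow> OO1 z \<Longrightarrow> OO1 (Kop1 e z)"
  unfolding Kop1_def by (intro RR_OO0 OO1_imp_OO0 ae_mult_OO1)

lemma Kop1_add:
  assumes "e \<in> I0" "OO1 z" "OO1 w"
  shows "Kop1 e (\<lambda>q. z q + w q) p = Kop1 e z p + Kop1 e w p" "Kop1 e (\<lambda>q. z q - w q) p = Kop1 e z p - Kop1 e w p"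
  unfolding Kop1_def distrib_left right_diff_distrib
  using RR_add[OF ae_mult_OO1[OF assms(1,2)] ae_mult_OO1[OF assms(1,3)]] by auto

lemma Kop1_cmult: "Kop1 e (\<lambda>q. c * z q) p = c * Kop1 e z p"
  unfolding Kop1_def mult.left_commute[of _ c] by (rule Kop_cmult)

lemma Kop1_mono:
  assumes "e \<in> I0" "OO1 z" "OO1 w" "\<And>p. p \<in> quarter \<Longrightarrow> z p \<le> w p" "p \<in> quarter"
  shows "Kop1 e z p \<le> Kop1 e w p"
  unfolding Kop1_def
proof (rule RR_mono[OF ae_mult_OO1[OF assms(1,2)] ae_mult_OO1[OF assms(1,3)] _ assms(5)])
  show "ae e q * z q \<le> ae e q * w q" if "q \<in> quarter" for q
    using ae_bounds(1)[OF assms(1) I0D(1)[OF assms(1)] order_refl, of q] assms(4)[OF that] by (intro mult_left_mono) auto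
qed

lemma ae_mult_le:
  assumes "e \<in> I0" "0 < e1" "e1 \<le> e" "\<And>q. \<bar>z q\<bar> \<le> B"
  shows "\<bar>ae e q * z q\<bar> \<le> (1 + (1 / sqrt e1) ^ 3) * B"
  unfolding abs_mult using ae_bounds[OF assms(1-3), of q] assms(4) by (intro mult_mono) auto

lemma Kop1_bound:
  assumes "e \<in> I0" "0 < e1" "e1 \<le> e" "OO1 z" "\<And>q. \<bar>z q\<bar> \<le> B"
  shows "\<bar>Kop1 e z p\<bar> \<le> cR * ((1 + (1 / sqrt e1) ^ 3) * B)"
  unfolding Kop1_def
  by (rule RR_bound[OF OO1D(2)[OF ae_mult_OO1[OF assms(1,4)]]]) (rule ae_mult_le[OF assms(1-3,5)])

text \<open>Two applications are required: the first converts a sup bound on z into a derivative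
  bound on \<open>Kop1 e z\<close>, and only then does the weighted estimate make the second vanish
  at the sides like \<open>ss\<close>.\<close>

lemma Kop1_twice:
  assumes "0 < e1"
  obtains C where "C \<ge> 0" "\<And>e z B p. e \<in> I0 \<Longrightarrow> e1 \<le> e \<Longrightarrow> OO1 z \<Longrightarrow> (\<And>q. \<bar>z q\<bar> \<le> B) \<Longrightarrow> p \<in> quarter \<Longrightarrow>
    \<bar>Kop1 e (Kop1 e z) p\<bar> \<le> C * B * ss p"
proof -
  define A1 where "A1 = 1 + (1 / sqrt e1) ^ 3"
  define A2 where "A2 = cX * (1 / sqrt e1) ^ 5"
  have A: "A1 \<ge> 0" "A2 \<ge> 0" using assms cX_nonneg by (auto simp: A1_def A2_def)
  show thesis
  proof (rule that[of "cX * (A2 * (cR * A1) + A1 * (cX * A1))"])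
    show "0 \<le> cX * (A2 * (cR * A1) + A1 * (cX * A1))" using A cX_nonneg cR_nonneg by simp
    fix e z B p assume e: "e \<in> I0" "e1 \<le> e" and z: "OO1 z" "\<And>q. \<bar>z q\<bar> \<le> B" and p: "p \<in> quarter"
    let ?w = "Kop1 e z"
    note w = Kop1_OO1[OF e(1) z(1)]
    have dw: "((\<lambda>s. ?w (x, s)) has_real_derivative RY (\<lambda>q. ae e q * z q) (x, y)) (at y)" for x y
      unfolding Kop1_def by (rule RR_has_real_derivative_y[OF OO1D(2,3)[OF ae_mult_OO1[OF e(1) z(1)]]])
    have da: "((\<lambda>s. ae e (x, s)) has_real_derivative dy (ae e) (x, y)) (at y)" for x y
      by (rule has_real_derivative_dy[OF ae_differentiable[OF e(1)]])
    have "dy (\<lambda>q. ae e q * ?w q) (x, y) = ae e (x, y) * RY (\<lambda>q. ae e q * z q) (x, y) + dy (ae e) (x, y) * ?w (x, y)" for x y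
      by (rule dy_eqI[OF C_k_on_differentiable[OF OO1D(1)[OF ae_mult_OO1[OF e(1) w]]] DERIV_mult'[OF da dw]])
    moreover have "\<bar>ae e q * RY (\<lambda>q. ae e q * z q) q + dy (ae e) q * ?w q\<bar> \<le> (A2 * (cR * A1) + A1 * (cX * A1)) * B" for q
    proof -
      have "\<bar>ae e q * RY (\<lambda>q. ae e q * z q) q\<bar> \<le> A1 * (cX * (A1 * B))"
        unfolding abs_mult
      proof (intro mult_mono)
        show "\<bar>ae e q\<bar> \<le> A1" using ae_bounds[OF e(1) assms e(2), of q] by (simp add: A1_def)
        show "\<bar>RY (\<lambda>q. ae e q * z q) q\<bar> \<le> cX * (A1 * B)"
          unfolding A1_def 
          by (rule RY_bound[OF OO1D(2)[OF ae_mult_OO1[OF e(1) z(1)]]]) (rule ae_mult_le[OF e(1) assms e(2) z(2)])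
      qed (use A in auto)
      moreover have "\<bar>dy (ae e) q * ?w q\<bar> \<le> A2 * (cR * (A1 * B))"
        unfolding abs_mult
      proof (intro mult_mono)
        show "\<bar>dy (ae e) q\<bar> \<le> A2" unfolding A2_def by (rule ae_dy_le[OF e(1) assms e(2)])
        show "\<bar>?w q\<bar> \<le> cR * (A1 * B)" unfolding A1_def by (rule Kop1_bound[OF e(1) assms e(2) z])
      qed (use A in auto)
      ultimately have "\<bar>ae e q * RY (\<lambda>q. ae e q * z q) q + dy (ae e) q * ?w q\<bar> \<le> A1 * (cX * (A1 * B)) + A2 * (cR * (A1 * B))"
        by (intro order_trans[OF abs_triangle_ineq add_mono])
      then show ?thesis by (simp add: algebra_simps)
    qed
    ultimately have "\<bar>dy (\<lambda>q. ae e q * ?w q) q\<bar> \<le> (A2 * (cR * A1) + A1 * (cX * A1)) * B" for q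
      by (metis prod.collapse)
    from RR_weighted_bound[OF ae_mult_OO1[OF e(1) w] this p]
    show "\<bar>Kop1 e ?w p\<bar> \<le> cX * (A2 * (cR * A1) + A1 * (cX * A1)) * B * ss p"
      unfolding Kop1_def by (simp add: mult.assoc)
  qed
qed

text \<open>The weighted estimate applied to the fixed point equation. Together with the lower bound
  by \<open>ss\<close> divided by 200 it makes the solution and \<open>ss\<close> comparable up to
  the sides, which is what a Hopf lemma would provide.\<close>

lemma usol_le_ss:
  assumes "e \<in> I0" "0 < e1" "e1 \<le> e" "p \<in> quarter"
  shows "usol e p \<le> cX * ((1 + (1 / sqrt e1) ^ 3) * (cX * 2)) * ss p"
proof -
  let ?g = "\<lambda>q. usol e q + fe e (usol e q)"
  have "dy ?g (x, y) = dy (usol e) (x, y) + (e * qe e (usol e (x, y)) ^ 3) * dy (usol e) (x, y)" for x y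
    by (rule dy_eqI[OF C_k_on_differentiable[OF OO1D(1)[OF usol_rhs_OO1[OF assms(1)]]]])
      (intro DERIV_add usol_has_dy[OF assms(1)] DERIV_chain2[OF fe_deriv[OF I0D(1)[OF assms(1)]]])
  then have "dy ?g q = ae e q * dy (usol e) q" for q by (cases q) (simp add: ae_def algebra_simps)
  then have "\<bar>dy ?g q\<bar> \<le> (1 + (1 / sqrt e1) ^ 3) * (cX * 2)" for q
    using ae_mult_le[OF assms(1-3) usol_dy_le[OF assms(1)]] by simp
  from RR_weighted_bound[OF usol_rhs_OO1[OF assms(1)] this assms(4)] show ?thesis
    unfolding usol_fixpoint[OF assms(1), symmetric] by linarith
qed

text \<open>The identity $f - t f' = f^3$ for $f(t) = t/\sqrt{e + t^2}$ makes the solution itself a strict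
  supersolution of the linearised equation.\<close>
lemma Kop1_usol:
  assumes "0 < e1"
  obtains d where "0 < d" "d < 1" "\<And>e p. e \<in> I0 \<Longrightarrow> e1 \<le> e \<Longrightarrow> p \<in> quarter \<Longrightarrow> Kop1 e (usol e) p \<le> (1 - d) * usol e p"
proof -
  define C where "C = cX * ((1 + (1 / sqrt e1) ^ 3) * (cX * 2)) + 1"
  have C: "C > 0" using assms cX_nonneg by (auto simp: C_def intro!: add_nonneg_pos mult_nonneg_nonneg)
  \<comment> \<open>The factor (1/200)^3 times \<open>cub\<close> bounds the resolvent of f^3 from
    below by a multiple of \<open>ss\<close>; dividing by C passes from \<open>ss\<close> to the
    solution, and the minimum with 1/2 keeps d below 1.\<close>
  define d where "d = min ((1/200) ^ 3 * cub / C) (1/2)"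
  have d: "0 < d" "d < 1" using C cub_pos by (auto simp: d_def)
  show thesis
  proof (rule that[OF d])
    fix e p assume e: "e \<in> I0" "e1 \<le> e" and p: "p \<in> quarter"
    have e0: "e > 0" using I0D(1)[OF e(1)] .
    note u = usol_OO1[OF e(1)]
    have fO: "OO1 (\<lambda>q. fe e (usol e q))" by (rule fe_OO1[OF e0 u])
    have f3: "OO1 (\<lambda>q. fe e (usol e q) ^ 3)"
      unfolding OO1_def using C_k_on_power[OF open_UNIV OO1D(1)[OF fO], of 3] OO1D(3,4)[OF fO]
      by (auto simp: periodic2_def odd_odd_def simp del: C_k_on.simps)
    have "ae e q * usol e q = (usol e q + fe e (usol e q)) - fe e (usol e q) ^ 3" for q
    proof -
      let ?t = "usol e q" and ?Q = "qe e (usol e q)"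
      \<comment> \<open>Multiplying f = t q by (e + t^2) q^2 = 1 splits it into t f' = e q^3 t and
        f^3.\<close>
      have "?t * ?Q * ((e + ?t\<^sup>2) * ?Q\<^sup>2) = e * ?Q ^ 3 * ?t + (?t * ?Q) ^ 3"
        by (simp add: algebra_simps power2_eq_square power3_eq_cube)
      then have "?t * ?Q = e * ?Q ^ 3 * ?t + (?t * ?Q) ^ 3" unfolding qe_sq[OF e0] by simp
      moreover have "ae e q * ?t = ?t + e * ?Q ^ 3 * ?t" by (simp add: ae_def distrib_right)
      ultimately show ?thesis unfolding fe_eq by linarith
    qed
    then have "Kop1 e (usol e) p = RR (\<lambda>q. usol e q + fe e (usol e q)) p - RR (\<lambda>q. fe e (usol e q) ^ 3) p"
      unfolding Kop1_def using RR_add(2)[OF usol_rhs_OO1[OF e(1)] f3] by simp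
    then have 1: "Kop1 e (usol e) p = usol e p - RR (\<lambda>q. fe e (usol e q) ^ 3) p"
      unfolding usol_fixpoint[OF e(1), symmetric] .
    have s3: "OO1 (\<lambda>q. ((1/200) * ss q) ^ 3)"
      unfolding OO1_def using C_k_on_power[OF open_UNIV OO1D(1)[OF OO1_cmult[OF ss_OO1, of "1/200"]], of 3]
        OO1D(3,4)[OF OO1_cmult[OF ss_OO1, of "1/200"]]
      by (auto simp: periodic2_def odd_odd_def simp del: C_k_on.simps)
    have mono: "RR (\<lambda>q. ((1/200) * ss q) ^ 3) p \<le> RR (\<lambda>q. fe e (usol e q) ^ 3) p"
    proof (rule RR_mono[OF s3 f3 _ p])
      fix q assume q: "q \<in> quarter"
      let ?t = "(1/200) * ss q"
      have t: "0 \<le> ?t" "?t \<le> 1/200" using ss_nonneg[OF q] ss_le_1[of q] by auto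
      have "?t\<^sup>2 \<le> (1/200)\<^sup>2" using t by (intro power_mono)
      \<comment> \<open>For such small arguments q \<ge> 1, hence f(t) \<ge> t; the cube of f at the
        solution therefore dominates the cube of the subsolution.\<close>
      then have "e + ?t\<^sup>2 \<le> 1" using I0D(2)[OF e(1)] by (simp add: power2_eq_square)
      then have "sqrt (e + ?t\<^sup>2) \<le> 1" by simp
      moreover have "sqrt (e + ?t\<^sup>2) > 0" using arg_pos[OF e0, of ?t] by (simp only: real_sqrt_gt_0_iff)
      ultimately have "1 \<le> qe e ?t" unfolding qe_def by (simp only: le_divide_eq_1_pos)
      then have "?t * 1 \<le> ?t * qe e ?t" using t by (intro mult_left_mono)
      also have "\<dots> = fe e ?t" by (simp only: fe_eq)
      also have "\<dots> \<le> fe e (usol e q)" by (rule fe_mono[OF e0 usol_basic(4)[OF e(1) q]])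
      finally show "?t ^ 3 \<le> fe e (usol e q) ^ 3" using t by (intro power_mono) auto
    qed
    have "(1/200) ^ 3 * (cub * ss p) \<le> (1/200) ^ 3 * RR (\<lambda>q. ss q ^ 3) p"
      by (rule mult_left_mono[OF RR_ss_cubed[OF p]]) simp
    also have "\<dots> = RR (\<lambda>q. ((1/200) * ss q) ^ 3) p"
      unfolding power_mult_distrib by (rule Kop_cmult[symmetric])
    also note mono
    finally have "(1/200) ^ 3 * (cub * ss p) \<le> RR (\<lambda>q. fe e (usol e q) ^ 3) p" .
    moreover have "d * usol e p \<le> (1/200) ^ 3 * (cub * ss p)"
    proof -
      have "usol e p \<le> C * ss p"
        using usol_le_ss[OF e(1) assms e(2) p] ss_nonneg[OF p] by (simp add: C_def distrib_right)
      then have "d * usol e p \<le> ((1/200) ^ 3 * cub / C) * (C * ss p)"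
        using d C usol_basic(4)[OF e(1) p] ss_nonneg[OF p] cub_pos by (intro mult_mono) (auto simp: d_def)
      also have "\<dots> = (1/200) ^ 3 * (cub * ss p)" using C by simp
      finally show ?thesis .
    qed
    ultimately show "Kop1 e (usol e) p \<le> (1 - d) * usol e p" unfolding 1 by (simp add: left_diff_distrib)
  qed
qed

text \<open>On functions dominated by a multiple of the solution, the linearised operator shrinks
  that multiple by 1 - d, so iterating the inequality forgets the initial size of z. The hypothesis
  is one-sided because concavity supplies only an inequality for differences of solutions.\<close>

lemma apriori:
  assumes "0 < e1"
  obtains C where "C \<ge> 0" "\<And>e z r \<rho> p. e \<in> I0 \<Longrightarrow> e1 \<le> e \<Longrightarrow> OO1 z \<Longrightarrow> OO1 r \<Longrightarrow>
    (\<And>p. p \<in> quarter \<Longrightarrow> z p \<le> Kop1 e z p + r p) \<Longrightarrow> (\<And>p. \<bar>r p\<bar> \<le> \<rho>) \<Longrightarrow> p \<in> quarter \<Longrightarrow> z p \<le> C * \<rho>"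
proof -
  obtain C2 where C2: "C2 \<ge> 0" "\<And>e z B p. e \<in> I0 \<Longrightarrow> e1 \<le> e \<Longrightarrow> OO1 z \<Longrightarrow> (\<And>q. \<bar>z q\<bar> \<le> B) \<Longrightarrow> p \<in> quarter \<Longrightarrow>
    \<bar>Kop1 e (Kop1 e z) p\<bar> \<le> C2 * B * ss p" by (rule Kop1_twice[OF assms]) blast
  obtain d where d: "0 < d" "d < 1" "\<And>e p. e \<in> I0 \<Longrightarrow> e1 \<le> e \<Longrightarrow> p \<in> quarter \<Longrightarrow> Kop1 e (usol e) p \<le> (1 - d) * usol e p"
    by (rule Kop1_usol[OF assms]) blast
  define A1 where "A1 = 1 + (1 / sqrt e1) ^ 3"
  have A1: "A1 \<ge> 0" using assms by (auto simp: A1_def)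
  define C where "C = 200 * C2 / d * (1/16) + 1 + cR * A1"
  show thesis
  proof (rule that[of C])
    show "C \<ge> 0" using C2(1) d A1 cR_nonneg by (auto simp: C_def)
    fix e z r \<rho> p
    assume e: "e \<in> I0" "e1 \<le> e" and z: "OO1 z" and r: "OO1 r"
      and le: "\<And>p. p \<in> quarter \<Longrightarrow> z p \<le> Kop1 e z p + r p" and \<rho>: "\<And>p. \<bar>r p\<bar> \<le> \<rho>" and p: "p \<in> quarter"
    have \<rho>0: "\<rho> \<ge> 0" using \<rho>[of 0] abs_ge_zero[of "r 0"] by linarith
    obtain B where B: "B \<ge> 0" "\<And>q. \<bar>z q\<bar> \<le> B" by (rule OO1_bounded[OF z]) blast
    note u = usol_OO1[OF e(1)]
    note Kr = Kop1_OO1[OF e(1) r] and Kz = Kop1_OO1[OF e(1) z]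
    have zr: "OO1 (\<lambda>q. z q - r q)" by (intro OO1_diff z r)
    \<comment> \<open>r need not vanish at the sides like the solution. Removing r and its first
      image leaves a part bounded by what has passed through the operator twice, and that part is
      comparable with \<open>ss\<close>.\<close>
    define y where "y q = (z q - r q) - Kop1 e r q" for q
    have y: "OO1 y" unfolding y_def[abs_def] by (intro OO1_diff zr Kr)
    have us: "ss q \<le> 200 * usol e q" if "q \<in> quarter" for q using usol_basic(4)[OF e(1) that] by simp
    have y1: "y q \<le> Kop1 e (\<lambda>q. z q - r q) q" if "q \<in> quarter" for q
      using le[OF that] Kop1_add(2)[OF e(1) z r, of q] by (simp add: y_def)
    define N where "N = 200 * C2 * \<rho>"
    have y0: "y q \<le> (200 * C2 * B) * usol e q" if q: "q \<in> quarter" for q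
    proof -
      have "y q \<le> Kop1 e (Kop1 e z) q"
        using y1[OF q] Kop1_mono[OF e(1) zr Kz _ q] le by (smt (verit))
      also have "\<dots> \<le> C2 * B * ss q" using C2(2)[OF e z B(2) q] by linarith
      also have "\<dots> \<le> C2 * B * (200 * usol e q)" using us[OF q] C2(1) B(1) by (intro mult_left_mono) auto
      finally show ?thesis by simp
    qed
    have step: "y q \<le> ((1 - d) * M + N) * usol e q" if M: "M \<ge> 0" "\<And>q. q \<in> quarter \<Longrightarrow> y q \<le> M * usol e q" and q: "q \<in> quarter" for M q
    proof -
      have "(\<lambda>q. z q - r q) = (\<lambda>q. y q + Kop1 e r q)" by (simp add: y_def)
      then have "y q \<le> Kop1 e y q + Kop1 e (Kop1 e r) q"
        using y1[OF q] Kop1_add(1)[OF e(1) y Kr, of q] by simp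
      also have "Kop1 e y q \<le> M * Kop1 e (usol e) q"
        using Kop1_mono[OF e(1) y OO1_cmult[OF u] M(2) q] by (simp add: Kop1_cmult)
      also have "M * Kop1 e (usol e) q \<le> M * ((1 - d) * usol e q)"
        using d(3)[OF e q] M(1) by (rule mult_left_mono)
      also have "Kop1 e (Kop1 e r) q \<le> C2 * \<rho> * ss q" using C2(2)[OF e r \<rho> q] by linarith
      also have "\<dots> \<le> C2 * \<rho> * (200 * usol e q)" using us[OF q] C2(1) \<rho>0 by (intro mult_left_mono) auto
      finally show ?thesis by (simp add: N_def algebra_simps)
    qed
    \<comment> \<open>Closed form of the recursion M \<mapsto> (1 - d) M + N: the term carrying the
      unknown bound B dies geometrically and the fixed point N/d remains.\<close>
    define M where "M n = (1 - d) ^ n * (200 * C2 * B) + N / d" for n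
    have N: "N \<ge> 0" using C2(1) \<rho>0 by (simp add: N_def)
    have M0: "M n \<ge> 0" for n using N d C2(1) B(1) by (auto simp: M_def)
    have yM: "q \<in> quarter \<Longrightarrow> y q \<le> M n * usol e q" for n q
    proof (induction n arbitrary: q)
      case 0
      have "0 \<le> N / d * usol e q"
        using N d(1) us[OF 0] ss_nonneg[OF 0] by (intro mult_nonneg_nonneg divide_nonneg_pos) auto
      then show ?case using y0[OF 0] by (simp add: M_def distrib_right)
    next
      case (Suc n)
      have "(1 - d) * M n + N = M (Suc n)" using d(1) by (simp add: M_def field_simps)
      then show ?case using step[OF M0[of n] Suc.IH Suc.prems] by simp
    qed
    have "(\<lambda>n. M n * usol e p) \<longlonglongrightarrow> (0 * (200 * C2 * B) + N / d) * usol e p"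
      unfolding M_def using d by (intro tendsto_intros LIMSEQ_realpow_zero) auto
    then have "y p \<le> N / d * usol e p" using LIMSEQ_le_const[of _ _ "y p"] yM[OF p] by fastforce
    also have "\<dots> \<le> N / d * (1/16)" using usol_basic(3)[OF e(1), of p] N d by (intro mult_left_mono) auto
    finally have "y p \<le> N / d * (1/16)" .
    moreover have "\<bar>Kop1 e r p\<bar> \<le> cR * (A1 * \<rho>)" unfolding A1_def by (rule Kop1_bound[OF e(1) assms e(2) r \<rho>])
    ultimately have "z p \<le> N / d * (1/16) + \<rho> + cR * (A1 * \<rho>)" using \<rho>[of p] by (simp add: y_def)
    then show "z p \<le> C * \<rho>" by (simp add: C_def N_def algebra_simps)
  qed
qed

lemma apriori_eq:
  assumes "0 < e1"
  obtains C where "C \<ge> 0" "\<And>e z r \<rho> p. e \<in> I0 \<Longrightarrow> e1 \<le> e \<Longrightarrow> OO1 z \<Longrightarrow> OO1 r \<Longrightarrow>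
    (\<And>p. z p = Kop1 e z p + r p) \<Longrightarrow> (\<And>p. \<bar>r p\<bar> \<le> \<rho>) \<Longrightarrow> \<bar>z p\<bar> \<le> C * \<rho>"
proof -
  obtain C where C: "C \<ge> 0" "\<And>e z r \<rho> p. e \<in> I0 \<Longrightarrow> e1 \<le> e \<Longrightarrow> OO1 z \<Longrightarrow> OO1 r \<Longrightarrow>
    (\<And>p. p \<in> quarter \<Longrightarrow> z p \<le> Kop1 e z p + r p) \<Longrightarrow> (\<And>p. \<bar>r p\<bar> \<le> \<rho>) \<Longrightarrow> p \<in> quarter \<Longrightarrow> z p \<le> C * \<rho>"
    by (rule apriori[OF assms]) blast
  show thesis
  proof (rule that[OF C(1)])
    fix e z r \<rho> p
    assume e: "e \<in> I0" "e1 \<le> e" and z: "OO1 z" and r: "OO1 r"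
      and eq: "\<And>p. z p = Kop1 e z p + r p" and \<rho>: "\<And>p. \<bar>r p\<bar> \<le> \<rho>"
    show "\<bar>z p\<bar> \<le> C * \<rho>"
    proof (rule abs_le_from_quarter[OF OO1D(4,3)[OF z]])
      fix q assume q: "q \<in> quarter"
      have "z q \<le> C * \<rho>" by (rule C(2)[OF e z r _ \<rho> q]) (metis eq order_refl)
      moreover have "- 1 * z q \<le> C * \<rho>"
      proof (rule C(2)[OF e OO1_cmult[OF z] OO1_cmult[OF r] _ _ q])
        show "- 1 * z p \<le> Kop1 e (\<lambda>p. - 1 * z p) p + - 1 * r p" for p
          unfolding Kop1_cmult using eq[of p] by linarith
        show "\<bar>- 1 * r p\<bar> \<le> \<rho>" for p using \<rho>[of p] by simp
      qed
      ultimately show "\<bar>z q\<bar> \<le> C * \<rho>" by (simp add: abs_le_iff)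
    qed
  qed
qed

subsection \<open>Continuous dependence on the parameter\<close>

lemma fe_eps_lipschitz:
  assumes "0 < e1" "e1 \<le> e" "e1 \<le> e'" "e \<le> 1" "e' \<le> 1" "\<bar>t\<bar> \<le> 1"
  shows "\<bar>e * qe e t ^ 3 - e' * qe e' t ^ 3\<bar> \<le> ((1 / sqrt e1) ^ 3 + 2 * (1 / sqrt e1) ^ 5) * \<bar>e - e'\<bar>"
    "\<bar>fe e t - fe e' t\<bar> \<le> (1 / sqrt e1) ^ 3 * \<bar>e - e'\<bar>"
proof -
  define M where "M = 1 / sqrt e1"
  have M: "M > 0" using assms(1) by (simp add: M_def)
  have q: "0 < qe s t" "qe s t \<le> M" if "s \<in> {e1..1}" for s
    using that assms(1) qe_pos[of s t] qe_le[of e1 s t] by (auto simp: M_def)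
  have "norm (e * qe e t ^ 3 - e' * qe e' t ^ 3) \<le> (M ^ 3 + 2 * M ^ 5) * norm (e - e')"
  proof (rule field_differentiable_bound[of "{e1..1}"])
    fix s assume s: "s \<in> {e1..1}"
    then have s0: "s > 0" using assms(1) by simp
    show "((\<lambda>s. s * qe s t ^ 3) has_field_derivative qe s t ^ 3 - (3/2) * s * qe s t ^ 5) (at s within {e1..1})"
      by (rule has_field_derivative_at_within)
        (auto intro!: derivative_eq_intros qe_deriv_eps[OF s0] simp: power_numeral_reduce)
    have "\<bar>qe s t ^ 3 - (3/2) * s * qe s t ^ 5\<bar> \<le> \<bar>qe s t ^ 3\<bar> + \<bar>(3/2) * s * qe s t ^ 5\<bar>"
      by (rule abs_triangle_ineq4)
    also have "\<dots> \<le> M ^ 3 + 2 * M ^ 5"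
    proof (rule add_mono)
      show "\<bar>qe s t ^ 3\<bar> \<le> M ^ 3" using q[OF s] by (auto intro!: power_mono)
      have "(3/2) * s * qe s t ^ 5 \<le> 2 * M ^ 5" using q[OF s] s s0 by (intro mult_mono power_mono) auto
      then show "\<bar>(3/2) * s * qe s t ^ 5\<bar> \<le> 2 * M ^ 5" using q[OF s] s0 by simp
    qed
    finally show "norm (qe s t ^ 3 - (3/2) * s * qe s t ^ 5) \<le> M ^ 3 + 2 * M ^ 5" by simp
  qed (use assms in auto)
  then show "\<bar>e * qe e t ^ 3 - e' * qe e' t ^ 3\<bar> \<le> ((1 / sqrt e1) ^ 3 + 2 * (1 / sqrt e1) ^ 5) * \<bar>e - e'\<bar>"
    by (simp add: M_def)
  have "norm (t * qe e t - t * qe e' t) \<le> M ^ 3 * norm (e - e')"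
  proof (rule field_differentiable_bound[of "{e1..1}"])
    fix s assume s: "s \<in> {e1..1}"
    then have s0: "s > 0" using assms(1) by simp
    show "((\<lambda>s. t * qe s t) has_field_derivative t * (- (1/2) * qe s t ^ 3)) (at s within {e1..1})"
      by (rule has_field_derivative_at_within[OF DERIV_cmult[OF qe_deriv_eps[OF s0]]])
    have "\<bar>t\<bar> * ((1/2) * qe s t ^ 3) \<le> 1 * (1 * M ^ 3)"
      using assms(6) q[OF s] by (intro mult_mono power_mono) auto
    then show "norm (t * (- (1/2) * qe s t ^ 3)) \<le> M ^ 3" using q[OF s] by (simp add: abs_mult)
  qed (use assms in auto)
  then show "\<bar>fe e t - fe e' t\<bar> \<le> (1 / sqrt e1) ^ 3 * \<bar>e - e'\<bar>" by (simp add: M_def fe_eq)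
qed

text \<open>For e \<le> e' the solutions are ordered, and concavity makes their difference a
  subsolution of the equation linearised at e', with an error of order e' - e. The one-sided a
  priori bound applies, and the sign of the difference turns it into a two-sided estimate.\<close>

lemma usol_lipschitz_eps:
  assumes "0 < e1"
  obtains L where "L \<ge> 0" "\<And>e e' p. e \<in> I0 \<Longrightarrow> e' \<in> I0 \<Longrightarrow> e1 \<le> e \<Longrightarrow> e1 \<le> e' \<Longrightarrow> \<bar>usol e p - usol e' p\<bar> \<le> L * \<bar>e - e'\<bar>"
proof -
  obtain C where C: "C \<ge> 0" "\<And>e z r \<rho> p. e \<in> I0 \<Longrightarrow> e1 \<le> e \<Longrightarrow> OO1 z \<Longrightarrow> OO1 r \<Longrightarrow>
    (\<And>p. p \<in> quarter \<Longrightarrow> z p \<le> Kop1 e z p + r p) \<Longrightarrow> (\<And>p. \<bar>r p\<bar> \<le> \<rho>) \<Longrightarrow> p \<in> quarter \<Longrightarrow> z p \<le> C * \<rho>"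
    by (rule apriori[OF assms]) blast
  define M where "M = 1 / sqrt e1"
  define c3 where "c3 = M ^ 3 + 2 * M ^ 5"
  define c4 where "c4 = c3 + M ^ 3"
  have M: "M > 0" using assms by (simp add: M_def)
  have c: "c3 \<ge> 0" "c4 \<ge> 0" using M by (auto simp: c3_def c4_def)
  have ord: "\<bar>usol e p - usol e' p\<bar> \<le> C * (cR * c4) * \<bar>e - e'\<bar>"
    if e: "e \<in> I0" "e' \<in> I0" "e1 \<le> e" "e1 \<le> e'" "e \<le> e'" for e e' p
  proof -
    note e0 = I0D(1)[OF e(1)] I0D(1)[OF e(2)]
    note u = usol_OO1[OF e(1)] and u' = usol_OO1[OF e(2)]
    define z where "z q = usol e q - usol e' q" for q
    have z: "OO1 z" unfolding z_def[abs_def] by (intro OO1_diff u u')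
    \<comment> \<open>Collects the change of the slope and of the nonlinearity when only the
      parameter moves, both evaluated at the solution for e'.\<close>
    define \<rho> where "\<rho> q = (e * qe e (usol e' q) ^ 3 - e' * qe e' (usol e' q) ^ 3) * z q
      + (fe e (usol e' q) - fe e' (usol e' q))" for q
    have \<rho>: "OO1 \<rho>" unfolding \<rho>_def[abs_def]
      by (intro OO1_add OO1_diff EE1_mult_OO1 EE1_diff EE1_mult EE1_const EE1_power qe_EE1 fe_OO1 u' z e0)
    have small: "\<bar>usol s q\<bar> \<le> 1/16" if "s \<in> I0" for s q using usol_basic(3)[OF that] .
    have \<rho>le: "\<bar>\<rho> q\<bar> \<le> c4 * \<bar>e - e'\<bar>" for q
    proof -
      have t: "\<bar>usol e' q\<bar> \<le> 1" using small[OF e(2), of q] by linarith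
      have le1: "e \<le> 1" "e' \<le> 1" using I0D(2)[OF e(1)] I0D(2)[OF e(2)] by auto
      have z1: "\<bar>z q\<bar> \<le> 1" using small[OF e(1), of q] small[OF e(2), of q] unfolding z_def by linarith
      have "\<bar>(e * qe e (usol e' q) ^ 3 - e' * qe e' (usol e' q) ^ 3) * z q\<bar> \<le> (c3 * \<bar>e - e'\<bar>) * 1"
        unfolding abs_mult
        using fe_eps_lipschitz(1)[OF assms e(3,4) le1 t] z1 c by (intro mult_mono) (auto simp: c3_def M_def)
      moreover have "\<bar>fe e (usol e' q) - fe e' (usol e' q)\<bar> \<le> M ^ 3 * \<bar>e - e'\<bar>"
        using fe_eps_lipschitz(2)[OF assms e(3,4) le1 t] by (simp add: M_def)
      ultimately have "\<bar>\<rho> q\<bar> \<le> (c3 * \<bar>e - e'\<bar>) * 1 + M ^ 3 * \<bar>e - e'\<bar>"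
        unfolding \<rho>_def by (intro order_trans[OF abs_triangle_ineq add_mono])
      then show ?thesis by (simp add: c4_def algebra_simps)
    qed
    have zeq: "z q = RR (\<lambda>q. (usol e q + fe e (usol e q)) - (usol e' q + fe e' (usol e' q))) q" for q
      unfolding z_def RR_add(2)[OF usol_rhs_OO1[OF e(1)] usol_rhs_OO1[OF e(2)]]
      using usol_fixpoint[OF e(1)] usol_fixpoint[OF e(2)] by (rule arg_cong2)
    have nn: "0 \<le> usol e' q" "0 \<le> z q" if "q \<in> quarter" for q
      using usol_basic(4)[OF e(2) that] ss_nonneg[OF that] usol_antimono[OF e(1,2,5) that] by (auto simp: z_def)
    have "z q \<le> Kop1 e' z q + RR \<rho> q" if q: "q \<in> quarter" for q
    proof -
      have "z q \<le> RR (\<lambda>q. ae e' q * z q + \<rho> q) q"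
        unfolding zeq[of q]
      proof (rule RR_mono[OF OO1_diff[OF usol_rhs_OO1[OF e(1)] usol_rhs_OO1[OF e(2)]] OO1_add[OF ae_mult_OO1[OF e(2) z] \<rho>] _ q])
        fix x assume x: "x \<in> quarter"
        have "fe e (usol e x) - fe e (usol e' x) \<le> e * qe e (usol e' x) ^ 3 * z x"
          unfolding z_def by (rule fe_concave[OF e0(1) nn(1)[OF x] usol_antimono[OF e(1,2,5) x]])
        then show "usol e x + fe e (usol e x) - (usol e' x + fe e' (usol e' x)) \<le> ae e' x * z x + \<rho> x"
          unfolding \<rho>_def ae_def by (simp add: z_def algebra_simps)
      qed
      also have "\<dots> = Kop1 e' z q + RR \<rho> q"
        unfolding Kop1_def by (rule RR_add(1)[OF ae_mult_OO1[OF e(2) z] \<rho>])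
      finally show ?thesis .
    qed
    from C(2)[OF e(2,4) z RR_OO0[OF OO1_imp_OO0[OF \<rho>]] this RR_bound[OF OO1D(2)[OF \<rho>] \<rho>le]]
    have "z q \<le> C * (cR * (c4 * \<bar>e - e'\<bar>))" if "q \<in> quarter" for q using that by blast
    then have "\<bar>z q\<bar> \<le> C * (cR * (c4 * \<bar>e - e'\<bar>))" if "q \<in> quarter" for q
      using nn(2)[OF that] that by simp
    then have "\<bar>z p\<bar> \<le> C * (cR * (c4 * \<bar>e - e'\<bar>))" by (rule abs_le_from_quarter[OF OO1D(4,3)[OF z]])
    then show ?thesis by (simp add: z_def mult.assoc)
  qed
  show thesis
  proof (rule that[of "C * (cR * c4)"])
    show "0 \<le> C * (cR * c4)" using C(1) cR_nonneg c by simp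
    show "\<bar>usol e p - usol e' p\<bar> \<le> C * (cR * c4) * \<bar>e - e'\<bar>"
      if "e \<in> I0" "e' \<in> I0" "e1 \<le> e" "e1 \<le> e'" for e e' p
      using ord[OF that] ord[OF that(2,1,4,3)] by (cases "e \<le> e'") (auto simp: abs_minus_commute)
  qed
qed

lemma open_I0: "open I0"
  by (simp add: I0_def)

section \<open>The solution as a function of parameter and position\<close>

definition Upar :: "real \<times> real \<times> real \<Rightarrow> real" where
  "Upar X = usol (fst X) (snd X)"

lemma Upar_continuous: "continuous_on (I0 \<times> UNIV) Upar"
  unfolding continuous_on_iff
proof (intro ballI allI impI)
  fix X :: "real \<times> real \<times> real" and \<eta> :: real assume X: "X \<in> I0 \<times> UNIV" and "\<eta> > 0"
  have X0: "fst X \<in> I0" using X by auto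
  note e0 = I0D(1)[OF X0]
  obtain L where L: "L \<ge> 0" "\<And>e e' p. e \<in> I0 \<Longrightarrow> e' \<in> I0 \<Longrightarrow> fst X / 2 \<le> e \<Longrightarrow> fst X / 2 \<le> e' \<Longrightarrow> \<bar>usol e p - usol e' p\<bar> \<le> L * \<bar>e - e'\<bar>"
    by (rule usol_lipschitz_eps[of "fst X / 2"]) (use e0 in auto)
  define d where "d = min (fst X / 2) (\<eta> / (2 * (L + 4 * cX + 1)))"
  have den: "L + 4 * cX + 1 > 0" using L(1) cX_nonneg by linarith
  have d: "d > 0" using e0 \<open>\<eta> > 0\<close> den by (auto simp: d_def)
  have "dist (Upar Y) (Upar X) < \<eta>" if Y: "Y \<in> I0 \<times> UNIV" "dist Y X < d" for Y
  proof -
    have Y0: "fst Y \<in> I0" using Y by auto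
    have l: "\<bar>fst Y - fst X\<bar> < d" "dist (snd Y) (snd X) < d"
      using Y(2) dist_fst_le[of Y X] dist_snd_le[of Y X] by (auto simp: dist_real_def)
    have "\<bar>fst Y - fst X\<bar> < fst X / 2" using l(1) by (simp add: d_def)
    then have "fst X / 2 \<le> fst Y" by linarith
    then have "\<bar>usol (fst Y) (snd Y) - usol (fst X) (snd Y)\<bar> \<le> L * \<bar>fst Y - fst X\<bar>"
      using e0 by (intro L(2) Y0 X0) auto
    also have "\<dots> \<le> L * d" using l(1) L(1) by (intro mult_left_mono) auto
    finally have 1: "\<bar>usol (fst Y) (snd Y) - usol (fst X) (snd Y)\<bar> \<le> L * d" .
    have "\<bar>usol (fst X) (snd Y) - usol (fst X) (snd X)\<bar> \<le> 4 * cX * dist (snd Y) (snd X)"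
      by (rule usol_lipschitz[OF X0])
    also have "\<dots> \<le> 4 * cX * d" using l(2) cX_nonneg by (intro mult_left_mono) auto
    finally have 2: "\<bar>usol (fst X) (snd Y) - usol (fst X) (snd X)\<bar> \<le> 4 * cX * d" .
    have "dist (Upar Y) (Upar X) \<le> L * d + 4 * cX * d"
      using 1 2 unfolding Upar_def dist_real_def by linarith
    also have "\<dots> \<le> (L + 4 * cX + 1) * d" using d by (simp add: algebra_simps)
    also have "\<dots> \<le> (L + 4 * cX + 1) * (\<eta> / (2 * (L + 4 * cX + 1)))"
      using den by (intro mult_left_mono) (auto simp: d_def)
    also have "\<dots> = \<eta> / 2"
    proof -
      have "x * (\<eta> / (2 * x)) = \<eta> / 2" if "x > 0" for x :: real using that by simp
      then show ?thesis using den by blast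
    qed
    finally show ?thesis using \<open>\<eta> > 0\<close> by simp
  qed
  then show "\<exists>d>0. \<forall>x'\<in>I0 \<times> UNIV. dist x' X < d \<longrightarrow> dist (Upar x') (Upar X) < \<eta>" using d by blast
qed

lemma Upar_PC0: "PC I0 0 Upar"
  using Upar_continuous usol_basic(1) by (auto simp: PC_def Upar_def)

lemma PC_add: "open I \<Longrightarrow> PC I k f \<Longrightarrow> PC I k g \<Longrightarrow> PC I k (\<lambda>X. f X + g X)"
  and PC_mult: "open I \<Longrightarrow> PC I k f \<Longrightarrow> PC I k g \<Longrightarrow> PC I k (\<lambda>X. f X * g X)"
  and PC_cmult: "open I \<Longrightarrow> PC I k f \<Longrightarrow> PC I k (\<lambda>X. c * f X)"
  and PC_power: "open I \<Longrightarrow> PC I k f \<Longrightarrow> PC I k (\<lambda>X. f X ^ n)"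
  and PC_const: "open I \<Longrightarrow> PC I k (\<lambda>X. c)"
  unfolding PC_def
  using C_k_on_add[OF open_param] C_k_on_mult[OF open_param] C_k_on_cmult[OF open_param]
    C_k_on_power[OF open_param] C_k_on_const[OF open_param]
  by (auto simp: periodic2_def)

lemma C_k_on_ident: "C_k_on UNIV (\<lambda>t::real. t) k"
proof (cases k)
  case (Suc n)
  show ?thesis unfolding Suc
    by (rule C_k_on_SucI[OF open_UNIV has_derivative_ident]) (rule C_k_on_const[OF open_UNIV])
qed simp

lemma PC_fst: "open I \<Longrightarrow> PC I k (\<lambda>X. fst X)"
  unfolding PC_def using C_k_on_affine[OF open_param bounded_linear_fst, of I 0 UNIV "\<lambda>t. t" k] C_k_on_ident
  by (auto simp: periodic2_def)

lemma PC_SucD: "PC I (Suc k) g \<Longrightarrow> PC I k g"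
  unfolding PC_def using C_k_on_SucD by blast

lemma PC_qe:
  assumes "PC I0 k g"
  shows "PC I0 k (\<lambda>X. qe (fst X) (g X))"
proof -
  have "C_k_on (I0 \<times> UNIV) (\<lambda>X. 1 / sqrt (fst X + (g X)\<^sup>2)) k"
    using assms PC_fst[OF open_I0, of k] unfolding PC_def
    by (intro C_k_on_inverse_sqrt C_k_on_add C_k_on_power open_param open_I0) (use I0D(1) in \<open>auto intro!: arg_pos\<close>)
  then show ?thesis using assms unfolding PC_def qe_def by (auto simp: periodic2_def)
qed

subsection \<open>Perturbation of the linearised equation\<close>

text \<open>Feeding the supremum into its own estimate absorbs half of it. The preliminary bound B
  guarantees that this supremum is a finite number.\<close>

lemma sup_absorb:
  fixes w :: "real \<times> real \<Rightarrow> real"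
  assumes "\<And>p. \<bar>w p\<bar> \<le> B" "\<And>S p. (\<And>q. \<bar>w q\<bar> \<le> S) \<Longrightarrow> \<bar>w p\<bar> \<le> S / 2 + K"
  shows "\<bar>w p\<bar> \<le> 2 * K"
proof -
  define S where "S = (SUP p. \<bar>w p\<bar>)"
  have bdd: "bdd_above (range (\<lambda>p. \<bar>w p\<bar>))" using assms(1) by (auto simp: bdd_above_def)
  have le: "\<bar>w q\<bar> \<le> S" for q unfolding S_def by (rule cSUP_upper[OF _ bdd]) simp
  have "S \<le> S / 2 + K" unfolding S_def by (rule cSUP_least) (use assms(2)[OF le] in \<open>auto simp: S_def\<close>)
  then show ?thesis using le[of p] by linarith
qed

text \<open>Solvability of the linearised equation without Fredholm theory: solutions w h of nearby
  equations are given, the a priori bound keeps them bounded and makes them uniformly Cauchy as h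
  tends to 0, and their limit solves the equation. With shifted solutions for w h it yields
  continuity in the parameter, with difference quotients differentiability.\<close>

lemma perturb:
  fixes w a b :: "real \<Rightarrow> real \<times> real \<Rightarrow> real"
  assumes e: "e \<in> I0" and d: "d > 0"
    and w: "\<And>h. 0 < \<bar>h\<bar> \<Longrightarrow> \<bar>h\<bar> < d \<Longrightarrow> OO0 (w h)"
    and G: "\<And>h. 0 < \<bar>h\<bar> \<Longrightarrow> \<bar>h\<bar> < d \<Longrightarrow> OO0 (\<lambda>q. a h q * w h q + b h q)"
    and R: "\<And>h p. 0 < \<bar>h\<bar> \<Longrightarrow> \<bar>h\<bar> < d \<Longrightarrow> w h p = RR (\<lambda>q. a h q * w h q + b h q) p"
    and A: "\<And>\<eta>. \<eta> > 0 \<Longrightarrow> \<exists>\<delta>>0. \<forall>h p. 0 < \<bar>h\<bar> \<and> \<bar>h\<bar> < \<delta> \<longrightarrow> \<bar>a h p - ae e p\<bar> \<le> \<eta>"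
    and B: "\<And>\<eta>. \<eta> > 0 \<Longrightarrow> \<exists>\<delta>>0. \<forall>h p. 0 < \<bar>h\<bar> \<and> \<bar>h\<bar> < \<delta> \<longrightarrow> \<bar>b h p - b0 p\<bar> \<le> \<eta>"
    and b0: "continuous_on UNIV b0" "periodic2 b0"
  shows "\<exists>v. OO1 v \<and> (\<forall>p. v p = RR (\<lambda>q. ae e q * v q + b0 q) p) \<and>
    (\<forall>\<eta>>0. \<exists>\<delta>>0. \<forall>h p. 0 < \<bar>h\<bar> \<and> \<bar>h\<bar> < \<delta> \<longrightarrow> \<bar>w h p - v p\<bar> \<le> \<eta>)"
proof -
  obtain C where C: "C \<ge> 0" "\<And>e' z r \<rho> p. e' \<in> I0 \<Longrightarrow> e \<le> e' \<Longrightarrow> OO1 z \<Longrightarrow> OO1 r \<Longrightarrow>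
    (\<And>p. z p = Kop1 e' z p + r p) \<Longrightarrow> (\<And>p. \<bar>r p\<bar> \<le> \<rho>) \<Longrightarrow> \<bar>z p\<bar> \<le> C * \<rho>"
    by (rule apriori_eq[OF I0D(1)[OF e]]) blast
  define K where "K = C * cR"
  have K: "K \<ge> 0" using C(1) cR_nonneg by (simp add: K_def)
  obtain B0 where B0: "B0 \<ge> 0" "\<And>q. \<bar>b0 q\<bar> \<le> B0" by (rule periodic2_bounded[OF b0]) blast
  \<comment> \<open>The coefficient error is treated as part of the right-hand side, so every w h
    solves an equation with the same operator \<open>Kop1 e\<close>.\<close>
  define g where "g h q = (a h q * w h q + b h q) - ae e q * w h q" for h q
  have g: "OO0 (g h)" if "0 < \<bar>h\<bar>" "\<bar>h\<bar> < d" for h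
    unfolding g_def[abs_def] by (intro OO0_diff G w ae_mult_OO0 e that)
  have gle: "\<bar>g h q\<bar> \<le> \<alpha> * S + \<beta>" if "\<And>q. \<bar>a h q - ae e q\<bar> \<le> \<alpha>" "\<And>q. \<bar>w h q\<bar> \<le> S" "\<And>q. \<bar>b h q\<bar> \<le> \<beta>" for h q \<alpha> S \<beta>
  proof -
    have "g h q = (a h q - ae e q) * w h q + b h q" by (simp add: g_def algebra_simps)
    also have "\<bar>\<dots>\<bar> \<le> \<bar>a h q - ae e q\<bar> * \<bar>w h q\<bar> + \<bar>b h q\<bar>" using abs_triangle_ineq by (metis abs_mult)
    also have "\<dots> \<le> \<alpha> * S + \<beta>"
      by (intro add_mono mult_mono that abs_ge_zero order_trans[OF abs_ge_zero that(1)])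
    finally show ?thesis .
  qed
  have wK: "w h p = Kop1 e (w h) p + RR (g h) p" if h: "0 < \<bar>h\<bar>" "\<bar>h\<bar> < d" for h p
  proof -
    have "(\<lambda>q. a h q * w h q + b h q) = (\<lambda>q. ae e q * w h q + g h q)" by (simp add: g_def)
    then have "RR (\<lambda>q. a h q * w h q + b h q) p = Kop1 e (w h) p + RR (g h) p"
      using RR_add0(1)[OF ae_mult_OO0[OF e w[OF h]] g[OF h], of p] by (simp add: Kop1_def)
    with R[OF h, of p] show ?thesis by (rule trans)
  qed
  have w1: "OO1 (w h)" if "0 < \<bar>h\<bar>" "\<bar>h\<bar> < d" for h
  proof -
    have "RR (\<lambda>q. a h q * w h q + b h q) = w h" using R[OF that, symmetric] by (rule ext)
    then show ?thesis using RR_OO0[OF G[OF that]] by simp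
  qed
  \<comment> \<open>With this tolerance the coefficient error, amplified by K, contributes at most
    half of the supremum of w h, as the absorption requires.\<close>
  obtain d1 where d1: "d1 > 0" "\<And>h p. 0 < \<bar>h\<bar> \<Longrightarrow> \<bar>h\<bar> < d1 \<Longrightarrow> \<bar>a h p - ae e p\<bar> \<le> 1 / (2 * (K + 1))"
    using A[of "1 / (2 * (K + 1))"] K by force
  obtain d2 where d2: "d2 > 0" "\<And>h p. 0 < \<bar>h\<bar> \<Longrightarrow> \<bar>h\<bar> < d2 \<Longrightarrow> \<bar>b h p - b0 p\<bar> \<le> 1"
    using B[of 1] by force
  define D where "D = min d (min d1 d2)"
  have D: "D > 0" using d d1(1) d2(1) by (simp add: D_def)
  define W where "W = 2 * (K * (B0 + 1))"
  have bb: "\<bar>b h q\<bar> \<le> B0 + 1" if "0 < \<bar>h\<bar>" "\<bar>h\<bar> < D" for h q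
    using d2(2)[of h q] that B0(2)[of q] by (simp add: D_def)
  have wW: "\<bar>w h p\<bar> \<le> W" if h: "0 < \<bar>h\<bar>" "\<bar>h\<bar> < D" for h p
  proof -
    have hd: "\<bar>h\<bar> < d" "\<bar>h\<bar> < d1" using h by (auto simp: D_def)
    obtain B1 where B1: "\<And>q. \<bar>w h q\<bar> \<le> B1" by (rule OO0_bounded[OF w[OF h(1) hd(1)]]) blast
    show ?thesis unfolding W_def
    proof (rule sup_absorb[OF B1])
      fix S p assume S: "\<And>q. \<bar>w h q\<bar> \<le> S"
      have S0: "S \<ge> 0" using order_trans[OF abs_ge_zero S] by blast
      have gl: "\<bar>g h q\<bar> \<le> 1 / (2 * (K + 1)) * S + (B0 + 1)" for q
        by (rule gle[OF d1(2)[OF h(1) hd(2)] S bb[OF h]])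
      have "\<bar>w h p\<bar> \<le> C * (cR * (1 / (2 * (K + 1)) * S + (B0 + 1)))"
        by (rule C(2)[OF e order_refl w1[OF h(1) hd(1)] RR_OO0[OF g[OF h(1) hd(1)]] wK[OF h(1) hd(1)]])
          (rule RR_bound[OF _ gl], use g[OF h(1) hd(1)] in \<open>simp add: OO0_def\<close>)
      also have "\<dots> = (K / (2 * (K + 1))) * S + K * (B0 + 1)" by (simp add: K_def algebra_simps add_divide_distrib)
      also have "\<dots> \<le> (1/2) * S + K * (B0 + 1)"
        using K S0 by (intro add_right_mono mult_right_mono) (auto simp: divide_simps)
      finally show "\<bar>w h p\<bar> \<le> S / 2 + K * (B0 + 1)" by simp
    qed
  qed
  have W0: "W \<ge> 0" using K B0(1) by (simp add: W_def)
  have cauchy: "\<exists>\<delta>>0. \<forall>h h' p. 0 < \<bar>h\<bar> \<and> \<bar>h\<bar> < \<delta> \<and> 0 < \<bar>h'\<bar> \<and> \<bar>h'\<bar> < \<delta> \<longrightarrow> \<bar>w h p - w h' p\<bar> \<le> \<eta>"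
    if "\<eta> > 0" for \<eta>
  proof -
    \<comment> \<open>The two right-hand sides will differ by at most 2 \<theta> (W + 1), which K
      amplifies; the added 1 keeps the denominator positive.\<close>
    define \<theta> where "\<theta> = \<eta> / (2 * (K * (W + 1) + 1))"
    have KW: "K * (W + 1) \<ge> 0" using K W0 by simp
    have \<theta>: "\<theta> > 0" using that KW by (simp add: \<theta>_def)
    obtain \<delta>1 where \<delta>1: "\<delta>1 > 0" "\<And>h p. 0 < \<bar>h\<bar> \<Longrightarrow> \<bar>h\<bar> < \<delta>1 \<Longrightarrow> \<bar>a h p - ae e p\<bar> \<le> \<theta>" using A[OF \<theta>] by blast
    obtain \<delta>2 where \<delta>2: "\<delta>2 > 0" "\<And>h p. 0 < \<bar>h\<bar> \<Longrightarrow> \<bar>h\<bar> < \<delta>2 \<Longrightarrow> \<bar>b h p - b0 p\<bar> \<le> \<theta>" using B[OF \<theta>] by blast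
    have "\<bar>w h p - w h' p\<bar> \<le> \<eta>"
      if h: "0 < \<bar>h\<bar>" "\<bar>h\<bar> < min D (min \<delta>1 \<delta>2)" and h': "0 < \<bar>h'\<bar>" "\<bar>h'\<bar> < min D (min \<delta>1 \<delta>2)" for h h' p
    proof -
      have hd: "\<bar>h\<bar> < d" "\<bar>h\<bar> < D" "\<bar>h'\<bar> < d" "\<bar>h'\<bar> < D" using h h' by (auto simp: D_def)
      note o = w1[OF h(1) hd(1)] w1[OF h'(1) hd(3)]
      note og = g[OF h(1) hd(1)] g[OF h'(1) hd(3)]
      have gd: "\<bar>g h q - g h' q\<bar> \<le> 2 * \<theta> * (W + 1)" for q
      proof -
        have *: "\<bar>g k q - b k q\<bar> \<le> \<theta> * W" if "0 < \<bar>k\<bar>" "\<bar>k\<bar> < min D (min \<delta>1 \<delta>2)" for k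
        proof -
          have "g k q - b k q = (a k q - ae e q) * w k q" by (simp add: g_def algebra_simps)
          moreover have "\<bar>a k q - ae e q\<bar> * \<bar>w k q\<bar> \<le> \<theta> * W"
            using that \<delta>1(2)[of k q] wW[of k q] \<theta> by (intro mult_mono) auto
          ultimately show ?thesis by (simp add: abs_mult)
        qed
        have "\<bar>b h q - b0 q\<bar> \<le> \<theta>" "\<bar>b h' q - b0 q\<bar> \<le> \<theta>" using h h' \<delta>2(2) by auto
        then have "\<bar>g h q - g h' q\<bar> \<le> (\<theta> * W + \<theta> * W) + (\<theta> + \<theta>)" using *[OF h] *[OF h'] by linarith
        then show ?thesis by (simp add: algebra_simps)
      qed
      have "\<bar>w h p - w h' p\<bar> \<le> C * (cR * (2 * \<theta> * (W + 1)))"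
      proof (rule C(2)[OF e order_refl OO1_diff[OF o] RR_OO0[OF OO0_diff[OF og]]])
        show "w h p - w h' p = Kop1 e (\<lambda>p. w h p - w h' p) p + RR (\<lambda>q. g h q - g h' q) p" for p
          unfolding Kop1_add(2)[OF e o] RR_add0(2)[OF og] using wK[OF h(1) hd(1)] wK[OF h'(1) hd(3)]
          by (metis add_diff_add)
        show "\<bar>RR (\<lambda>q. g h q - g h' q) p\<bar> \<le> cR * (2 * \<theta> * (W + 1))" for p
          by (rule RR_bound[OF _ gd]) (use OO0_diff[OF og] in \<open>simp add: OO0_def\<close>)
      qed
      also have "\<dots> = 2 * \<theta> * (K * (W + 1))" by (simp add: K_def)
      also have "\<dots> \<le> 2 * \<theta> * (K * (W + 1) + 1)" using \<theta> by simp
      also have "\<dots> = \<eta>"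
      proof -
        have "2 * (\<eta> / (2 * x)) * x = \<eta>" if "x > 0" for x :: real using that by simp
        moreover have "K * (W + 1) + 1 > 0" using KW by linarith
        ultimately show ?thesis unfolding \<theta>_def by blast
      qed
      finally show ?thesis .
    qed
    then show ?thesis using D \<delta>1(1) \<delta>2(1) by (intro exI[of _ "min D (min \<delta>1 \<delta>2)"]) auto
  qed
  \<comment> \<open>The offset 2 puts already the first term strictly inside the interval of length
    D; no term is zero, as w is specified only for nonzero h.\<close>
  define X where "X n = D / real (n + 2)" for n
  have X: "0 < \<bar>X n\<bar>" "\<bar>X n\<bar> < D" for n using D by (auto simp: X_def divide_less_eq)
  have X': "\<bar>X n\<bar> < d" for n using X(2)[of n] by (simp add: D_def)
  have Xlim: "X \<longlonglongrightarrow> 0"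
    unfolding X_def by (rule LIMSEQ_ignore_initial_segment[OF lim_const_over_n])
  have Xev: "\<forall>\<^sub>F n in sequentially. \<bar>X n\<bar> < \<delta>" if "\<delta> > 0" for \<delta>
    using tendstoD[OF Xlim that] by (simp add: dist_real_def)
  define v where "v p = lim (\<lambda>n. w (X n) p)" for p
  have "convergent (\<lambda>n. w (X n) p)" for p
  proof (rule real_Cauchy_convergent, rule metric_CauchyI)
    fix \<eta> :: real assume "\<eta> > 0"
    then obtain \<delta> where \<delta>: "\<delta> > 0" "\<And>h h' p. 0 < \<bar>h\<bar> \<Longrightarrow> \<bar>h\<bar> < \<delta> \<Longrightarrow> 0 < \<bar>h'\<bar> \<Longrightarrow> \<bar>h'\<bar> < \<delta> \<Longrightarrow> \<bar>w h p - w h' p\<bar> \<le> \<eta> / 2"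
      using cauchy[of "\<eta> / 2"] by force
    obtain N where N: "\<And>n. n \<ge> N \<Longrightarrow> \<bar>X n\<bar> < \<delta>" using Xev[OF \<delta>(1)] by (auto simp: eventually_sequentially)
    have "dist (w (X m) p) (w (X n) p) < \<eta>" if "m \<ge> N" "n \<ge> N" for m n
      using \<delta>(2)[OF X(1) N[OF that(1)] X(1) N[OF that(2)], of p] \<open>\<eta> > 0\<close> by (simp add: dist_real_def)
    then show "\<exists>M. \<forall>m\<ge>M. \<forall>n\<ge>M. dist (w (X m) p) (w (X n) p) < \<eta>" by blast
  qed
  then have vlim: "(\<lambda>n. w (X n) p) \<longlonglongrightarrow> v p" for p unfolding v_def by (simp add: convergent_LIMSEQ_iff)
  have unif: "\<exists>\<delta>>0. \<forall>h p. 0 < \<bar>h\<bar> \<and> \<bar>h\<bar> < \<delta> \<longrightarrow> \<bar>w h p - v p\<bar> \<le> \<eta>" if pos: "\<eta> > 0" for \<eta>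
  proof -
    obtain \<delta> where \<delta>: "\<delta> > 0" "\<And>h h' p. 0 < \<bar>h\<bar> \<Longrightarrow> \<bar>h\<bar> < \<delta> \<Longrightarrow> 0 < \<bar>h'\<bar> \<Longrightarrow> \<bar>h'\<bar> < \<delta> \<Longrightarrow> \<bar>w h p - w h' p\<bar> \<le> \<eta>"
      using cauchy[OF pos] by force
    obtain N where N: "\<And>n. n \<ge> N \<Longrightarrow> \<bar>X n\<bar> < \<delta>" using Xev[OF \<delta>(1)] by (auto simp: eventually_sequentially)
    have "\<bar>w h p - v p\<bar> \<le> \<eta>" if h: "0 < \<bar>h\<bar>" "\<bar>h\<bar> < \<delta>" for h p
    proof (rule LIMSEQ_le_const2)
      show "(\<lambda>n. \<bar>w h p - w (X n) p\<bar>) \<longlonglongrightarrow> \<bar>w h p - v p\<bar>" by (intro tendsto_intros vlim)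
      show "\<exists>N. \<forall>n\<ge>N. \<bar>w h p - w (X n) p\<bar> \<le> \<eta>" using \<delta>(2)[OF h X(1) N] by blast
    qed
    then show ?thesis using \<delta>(1) by blast
  qed
  have vc: "continuous_on UNIV v"
  proof (rule uniform_limit_theorem)
    show "\<forall>\<^sub>F n in sequentially. continuous_on UNIV (w (X n))" using w[OF X(1) X'] by (simp add: OO0_def)
    show "uniform_limit UNIV (\<lambda>n. w (X n)) v sequentially"
      unfolding uniform_limit_iff
    proof (intro allI impI)
      fix \<eta> :: real assume "\<eta> > 0"
      then obtain \<delta> where \<delta>: "\<delta> > 0" "\<And>h p. 0 < \<bar>h\<bar> \<Longrightarrow> \<bar>h\<bar> < \<delta> \<Longrightarrow> \<bar>w h p - v p\<bar> \<le> \<eta> / 2"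
        using unif[of "\<eta> / 2"] by force
      show "\<forall>\<^sub>F n in sequentially. \<forall>x\<in>UNIV. dist (w (X n) x) (v x) < \<eta>"
        using Xev[OF \<delta>(1)]
      proof eventually_elim
        case (elim n)
        have "\<bar>w (X n) x - v x\<bar> < \<eta>" for x using \<delta>(2)[OF X(1) elim, of x] \<open>\<eta> > 0\<close> by linarith
        then show ?case by (simp add: dist_real_def)
      qed
    qed
  qed simp
  have vo: "odd_odd v" "periodic2 v"
  proof -
    have o: "odd_odd (w (X n))" "periodic2 (w (X n))" for n using w[OF X(1) X'] by (auto simp: OO0_def)
    have "v (- x, y) = - v (x, y)" "v (x, - y) = - v (x, y)" for x y
      using o(1) LIMSEQ_unique[OF vlim[of "(- x, y)"]] LIMSEQ_unique[OF vlim[of "(x, - y)"]]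
        tendsto_minus[OF vlim[of "(x, y)"]] by (simp_all add: odd_odd_def)
    then show "odd_odd v" by (simp add: odd_odd_def)
    have "v (x + 1, y) = v (x, y)" "v (x, y + 1) = v (x, y)" for x y
      unfolding v_def using o(2) by (simp_all add: periodic2_def)
    then show "periodic2 v" by (simp add: periodic2_def)
  qed
  have v0: "OO0 v" using vc vo by (simp add: OO0_def)
  have rc: "continuous_on UNIV (\<lambda>q. ae e q * v q + b0 q)" "periodic2 (\<lambda>q. ae e q * v q + b0 q)"
    using ae_mult_OO0[OF e v0] b0 by (auto simp: OO0_def periodic2_def intro!: continuous_intros)
  have fixpt: "v p = RR (\<lambda>q. ae e q * v q + b0 q) p" for p
  proof (rule LIMSEQ_unique[OF vlim])
    have "(\<lambda>n. RR (\<lambda>q. a (X n) q * w (X n) q + b (X n) q) p) \<longlonglongrightarrow> RR (\<lambda>q. ae e q * v q + b0 q) p"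
    proof (rule Kop_dominated[OF integrable_rmeas_r])
      show "(\<lambda>q. a (X n) q * w (X n) q + b (X n) q) \<in> borel_measurable borel" for n
        using G[OF X(1) X'] by (intro borel_measurable_continuous_onI) (simp add: OO0_def)
      show "(\<lambda>q. ae e q * v q + b0 q) \<in> borel_measurable borel"
        by (rule borel_measurable_continuous_onI[OF rc(1)])
      show "(\<lambda>n. a (X n) q * w (X n) q + b (X n) q) \<longlonglongrightarrow> ae e q * v q + b0 q" for q
      proof (intro tendsto_intros vlim)
        have *: "(\<lambda>n. f (X n) q) \<longlonglongrightarrow> f0 q"
          if f: "\<And>\<eta>. \<eta> > 0 \<Longrightarrow> \<exists>\<delta>>0. \<forall>h p. 0 < \<bar>h\<bar> \<and> \<bar>h\<bar> < \<delta> \<longrightarrow> \<bar>f h p - f0 p\<bar> \<le> \<eta>" for f and f0 :: "real \<times> real \<Rightarrow> real"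
        proof (rule tendstoI)
          fix \<eta> :: real assume "\<eta> > 0"
          then obtain \<delta> where \<delta>: "\<delta> > 0" "\<And>h p. 0 < \<bar>h\<bar> \<Longrightarrow> \<bar>h\<bar> < \<delta> \<Longrightarrow> \<bar>f h p - f0 p\<bar> \<le> \<eta> / 2"
            using f[of "\<eta> / 2"] by force
          show "\<forall>\<^sub>F n in sequentially. dist (f (X n) q) (f0 q) < \<eta>"
            using Xev[OF \<delta>(1)]
          proof eventually_elim
            case (elim n)
            then show ?case using \<delta>(2)[OF X(1), of n q] \<open>\<eta> > 0\<close> by (simp add: dist_real_def)
          qed
        qed
        show "(\<lambda>n. a (X n) q) \<longlonglongrightarrow> ae e q" using A by (rule *)
        show "(\<lambda>n. b (X n) q) \<longlonglongrightarrow> b0 q" using B by (rule *)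
      qed
      show "\<bar>a (X n) q * w (X n) q + b (X n) q\<bar> \<le> (1 + (1 / sqrt e) ^ 3) * W + (1 / (2 * (K + 1)) * W + (B0 + 1))" for n q
      proof -
        have "a (X n) q * w (X n) q + b (X n) q = ae e q * w (X n) q + g (X n) q" by (simp add: g_def)
        moreover have "\<bar>ae e q * w (X n) q\<bar> \<le> (1 + (1 / sqrt e) ^ 3) * W"
          by (rule ae_mult_le[OF e I0D(1)[OF e] order_refl wW[OF X]])
        moreover have "\<bar>g (X n) q\<bar> \<le> 1 / (2 * (K + 1)) * W + (B0 + 1)"
        proof (rule gle[OF _ wW[OF X] bb[OF X]])
          show "\<bar>a (X n) q - ae e q\<bar> \<le> 1 / (2 * (K + 1))" for q
            by (rule d1(2)[OF X(1)]) (use X(2)[of n] in \<open>simp add: D_def\<close>)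
        qed
        ultimately show ?thesis by (metis abs_triangle_ineq add_mono order_trans)
      qed
    qed
    then show "(\<lambda>n. w (X n) p) \<longlonglongrightarrow> RR (\<lambda>q. ae e q * v q + b0 q) p"
      unfolding R[OF X(1) X', symmetric] .
  qed
  have "v = RR (\<lambda>q. ae e q * v q + b0 q)" using fixpt by (rule ext)
  then have "C_k_on UNIV v (Suc 0)" using RR_C_k[of "\<lambda>q. ae e q * v q + b0 q" 0] rc by (metis C_k_on.simps(1))
  then have "OO1 v" using vo by (simp add: OO1_def del: C_k_on.simps)
  then show ?thesis using fixpt unif by blast
qed

lemma linearised_unique:
  assumes e: "e \<in> I0" and v: "OO1 v" "OO1 v'" and b: "continuous_on UNIV b" "periodic2 b"
    and "\<And>p. v p = RR (\<lambda>q. ae e q * v q + b q) p" "\<And>p. v' p = RR (\<lambda>q. ae e q * v' q + b q) p"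
  shows "v p = v' p"
proof -
  obtain C where C: "C \<ge> 0" "\<And>e' z r \<rho> p. e' \<in> I0 \<Longrightarrow> e \<le> e' \<Longrightarrow> OO1 z \<Longrightarrow> OO1 r \<Longrightarrow>
    (\<And>p. z p = Kop1 e' z p + r p) \<Longrightarrow> (\<And>p. \<bar>r p\<bar> \<le> \<rho>) \<Longrightarrow> \<bar>z p\<bar> \<le> C * \<rho>"
    by (rule apriori_eq[OF I0D(1)[OF e]]) blast
  obtain B where B: "\<And>q. \<bar>b q\<bar> \<le> B" by (rule periodic2_bounded[OF b]) blast
  have *: "RR (\<lambda>q. ae e q * z q + b q) p = Kop1 e z p + RR b p" if z: "OO1 z" for z p
  proof -
    obtain B' where B': "\<And>q. \<bar>ae e q * z q\<bar> \<le> B'" by (rule OO1_bounded[OF ae_mult_OO1[OF e z]]) blast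
    show ?thesis unfolding Kop1_def
      by (rule Kop_add[OF integrable_rmeas_r OO1D(5)[OF ae_mult_OO1[OF e z]] B' borel_measurable_continuous_onI[OF b(1)] B])
  qed
  have z0: "OO1 (\<lambda>p. 0)" using OO1_cmult[OF v(1), of 0] by simp
  have "\<bar>v p - v' p\<bar> \<le> C * 0"
  proof (rule C(2)[OF e order_refl OO1_diff[OF v] z0])
    show "v p - v' p = Kop1 e (\<lambda>p. v p - v' p) p + 0" for p
      unfolding Kop1_add(2)[OF e v] using assms(6)[of p] assms(7)[of p] *[OF v(1), of p] *[OF v(2), of p] by simp
  qed simp
  then show ?thesis by simp
qed

lemma PC_deriv_symmetry:
  assumes "e \<in> I0" "\<And>e. e \<in> I0 \<Longrightarrow> ((\<lambda>s. g (s, p)) has_real_derivative ge (e, p)) (at e)"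
    "\<And>e. e \<in> I0 \<Longrightarrow> ((\<lambda>s. g (s, q)) has_real_derivative ge (e, q)) (at e)"
    "\<And>s. s \<in> I0 \<Longrightarrow> g (s, p) = c * g (s, q)"
  shows "ge (e, p) = c * ge (e, q)"
proof (rule DERIV_unique[OF assms(2)[OF assms(1)]])
  show "((\<lambda>s. g (s, p)) has_real_derivative c * ge (e, q)) (at e)"
    by (rule has_field_derivative_transform_within_open[OF DERIV_cmult[OF assms(3)[OF assms(1)]] open_I0 assms(1)])
      (simp add: assms(4))
qed

text \<open>The mean value inequality for g minus its tangent in s bounds the error by the
  oscillation of \<open>ge\<close> in the parameter, which is uniform in p.\<close>

lemma quotient_uniform:
  assumes "e \<in> I0" "\<And>e p. e \<in> I0 \<Longrightarrow> ((\<lambda>s. g (s, p)) has_real_derivative ge (e, p)) (at e)" "PC I0 k ge" "\<eta> > 0"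
  shows "\<exists>\<delta>>0. \<forall>h p. 0 < \<bar>h\<bar> \<and> \<bar>h\<bar> < \<delta> \<longrightarrow> \<bar>(g (e + h, p) - g (e, p)) / h - ge (e, p)\<bar> \<le> \<eta>"
proof -
  obtain d where d: "d > 0" "\<And>e' p. \<bar>e' - e\<bar> < d \<Longrightarrow> e' \<in> I0 \<and> \<bar>ge (e', p) - ge (e, p)\<bar> < \<eta>"
    by (rule PC_uniform[OF assms(3) open_I0 assms(1,4)]) blast
  have "\<bar>(g (e + h, p) - g (e, p)) / h - ge (e, p)\<bar> \<le> \<eta>" if h: "0 < \<bar>h\<bar>" "\<bar>h\<bar> < d" for h p
  proof -
    let ?f = "\<lambda>s. g (s, p) - s * ge (e, p)"
    have "norm (?f (e + h) - ?f e) \<le> \<eta> * norm (e + h - e)"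
    proof (rule field_differentiable_bound[of "ball e d"])
      show "(?f has_field_derivative ge (s, p) - ge (e, p)) (at s within ball e d)" if "s \<in> ball e d" for s
      proof -
        have s: "\<bar>s - e\<bar> < d" using that by (simp add: dist_real_def abs_minus_commute)
        have "s \<in> I0" using d(2)[OF s] by blast
        then show ?thesis
          by - (rule has_field_derivative_at_within, auto intro!: derivative_eq_intros assms(2))
      qed
      show "norm (ge (s, p) - ge (e, p)) \<le> \<eta>" if "s \<in> ball e d" for s
        using d(2)[of s p] that by (simp add: dist_real_def abs_minus_commute)
    qed (use h d in \<open>auto simp: dist_real_def\<close>)
    then have "\<bar>(g (e + h, p) - g (e, p)) - h * ge (e, p)\<bar> \<le> \<eta> * \<bar>h\<bar>" by (simp add: algebra_simps)
    moreover have "(g (e + h, p) - g (e, p)) / h - ge (e, p) = ((g (e + h, p) - g (e, p)) - h * ge (e, p)) / h"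
      using h by (simp add: field_simps)
    ultimately show ?thesis using h by (simp add: divide_le_eq)
  qed
  then show ?thesis using d(1) by blast
qed

lemma has_derivative_from_quotients:
  fixes f :: "real \<Rightarrow> real"
  assumes "\<And>\<eta>. \<eta> > 0 \<Longrightarrow> \<exists>\<delta>>0. \<forall>h. 0 < \<bar>h\<bar> \<and> \<bar>h\<bar> < \<delta> \<longrightarrow> \<bar>(f (e + h) - f e) / h - D\<bar> \<le> \<eta>"
  shows "(f has_real_derivative D) (at e)"
  unfolding DERIV_def
proof (rule LIM_I)
  fix \<eta> :: real assume "\<eta> > 0"
  then obtain \<delta> where "\<delta> > 0" "\<And>h. 0 < \<bar>h\<bar> \<Longrightarrow> \<bar>h\<bar> < \<delta> \<Longrightarrow> \<bar>(f (e + h) - f e) / h - D\<bar> \<le> \<eta> / 2"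
    using assms[of "\<eta> / 2"] by force
  then show "\<exists>s>0. \<forall>x. x \<noteq> 0 \<and> norm (x - 0) < s \<longrightarrow> norm ((f (e + x) - f e) / x - D) < \<eta>"
    using \<open>\<eta> > 0\<close> by (intro exI[of _ \<delta>]) force
qed

section \<open>Linear equations depending on a parameter\<close>

definition Acoef :: "real \<times> real \<times> real \<Rightarrow> real" where
  "Acoef X = ae (fst X) (snd X)"

lemma ae_even: "e \<in> I0 \<Longrightarrow> ae e (- x, y) = ae e (x, y)" "e \<in> I0 \<Longrightarrow> ae e (x, - y) = ae e (x, y)"
  using ae_EE1[of e] by (auto simp: EE1_def)

lemma I0_ball:
  assumes "e \<in> I0"
  obtains d where "d > 0" "\<And>h. \<bar>h\<bar> < d \<Longrightarrow> e + h \<in> I0"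
proof -
  obtain d where d: "d > 0" "ball e d \<subseteq> I0" using open_I0 assms open_contains_ball by blast
  have "e + h \<in> I0" if "\<bar>h\<bar> < d" for h using d(2) that by (auto simp: dist_real_def)
  then show thesis using that d(1) by blast
qed

text \<open>The values at e + h solve equations whose coefficients converge uniformly, so they
  converge to some solution at e; uniqueness identifies it with V(e).\<close>

lemma linearised_PC0:
  assumes Acoef: "PC I0 0 Acoef" and b: "PC I0 0 b"
    and V: "\<And>e. e \<in> I0 \<Longrightarrow> OO0 (\<lambda>p. b (e, p))" "\<And>e. e \<in> I0 \<Longrightarrow> OO0 (\<lambda>p. V (e, p))"
    and R: "\<And>e p. e \<in> I0 \<Longrightarrow> V (e, p) = RR (\<lambda>q. ae e q * V (e, q) + b (e, q)) p"
  shows "PC I0 0 V"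
proof -
  have G: "OO0 (\<lambda>q. ae e q * V (e, q) + b (e, q))" if "e \<in> I0" for e
    by (intro OO0_add ae_mult_OO0 V that)
  have V1: "OO1 (\<lambda>p. V (e, p))" if "e \<in> I0" for e
  proof -
    have "RR (\<lambda>q. ae e q * V (e, q) + b (e, q)) = (\<lambda>p. V (e, p))" using R[OF that, symmetric] by (rule ext)
    then show ?thesis using RR_OO0[OF G[OF that]] by simp
  qed
  have key: "\<exists>\<delta>>0. \<forall>h p. 0 < \<bar>h\<bar> \<and> \<bar>h\<bar> < \<delta> \<longrightarrow> \<bar>V (e + h, p) - V (e, p)\<bar> \<le> \<eta>" if e: "e \<in> I0" and "\<eta> > 0" for e \<eta>
  proof -
    obtain d where d: "d > 0" "\<And>h. \<bar>h\<bar> < d \<Longrightarrow> e + h \<in> I0" by (rule I0_ball[OF e]) blast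
    have unif: "\<exists>\<delta>>0. \<forall>h p. 0 < \<bar>h\<bar> \<and> \<bar>h\<bar> < \<delta> \<longrightarrow> \<bar>g (e + h, p) - g (e, p)\<bar> \<le> \<eta>" if g: "PC I0 0 g" "\<eta> > 0" for g \<eta>
    proof -
      obtain d where d: "d > 0" "\<And>e' p. \<bar>e' - e\<bar> < d \<Longrightarrow> e' \<in> I0 \<and> \<bar>g (e', p) - g (e, p)\<bar> < \<eta>"
        by (rule PC_uniform[OF g(1) open_I0 e g(2)]) blast
      have "\<bar>g (e + h, p) - g (e, p)\<bar> \<le> \<eta>" if "\<bar>h\<bar> < d" for h p using d(2)[of "e + h" p] that by simp
      then show ?thesis using d(1) by blast
    qed
    have "\<exists>v. OO1 v \<and> (\<forall>p. v p = RR (\<lambda>q. ae e q * v q + b (e, q)) p) \<and>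
      (\<forall>\<eta>>0. \<exists>\<delta>>0. \<forall>h p. 0 < \<bar>h\<bar> \<and> \<bar>h\<bar> < \<delta> \<longrightarrow> \<bar>V (e + h, p) - v p\<bar> \<le> \<eta>)"
    proof (rule perturb[OF e d(1), where w="\<lambda>h p. V (e + h, p)" and a="\<lambda>h. ae (e + h)" and b="\<lambda>h q. b (e + h, q)" and ?b0.0="\<lambda>q. b (e, q)"])
      show "\<exists>\<delta>>0. \<forall>h p. 0 < \<bar>h\<bar> \<and> \<bar>h\<bar> < \<delta> \<longrightarrow> \<bar>ae (e + h) p - ae e p\<bar> \<le> \<eta>" if "\<eta> > 0" for \<eta>
        using unif[OF Acoef that] by (simp add: Acoef_def)
      show "\<exists>\<delta>>0. \<forall>h p. 0 < \<bar>h\<bar> \<and> \<bar>h\<bar> < \<delta> \<longrightarrow> \<bar>b (e + h, p) - b (e, p)\<bar> \<le> \<eta>" if "\<eta> > 0" for \<eta>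
        by (rule unif[OF b that])
      show "continuous_on UNIV (\<lambda>q. b (e, q))" "periodic2 (\<lambda>q. b (e, q))" using V(1)[OF e] by (auto simp: OO0_def)
      fix h :: real assume h: "0 < \<bar>h\<bar>" "\<bar>h\<bar> < d"
      show "OO0 (\<lambda>p. V (e + h, p))" "OO0 (\<lambda>q. ae (e + h) q * V (e + h, q) + b (e + h, q))"
        "V (e + h, p) = RR (\<lambda>q. ae (e + h) q * V (e + h, q) + b (e + h, q)) p" for p
        by (rule V(2) G R, rule d(2)[OF h(2)])+
    qed
    then obtain v where v: "OO1 v" "\<And>p. v p = RR (\<lambda>q. ae e q * v q + b (e, q)) p"
      "\<And>\<eta>. \<eta> > 0 \<Longrightarrow> \<exists>\<delta>>0. \<forall>h p. 0 < \<bar>h\<bar> \<and> \<bar>h\<bar> < \<delta> \<longrightarrow> \<bar>V (e + h, p) - v p\<bar> \<le> \<eta>" by blast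
    have "v p = V (e, p)" for p
      by (rule linearised_unique[OF e v(1) V1[OF e] _ _ v(2) R[OF e]]) (use V(1)[OF e] in \<open>auto simp: OO0_def\<close>)
    then show ?thesis using v(3)[OF \<open>\<eta> > 0\<close>] by simp
  qed
  have "continuous_on (I0 \<times> UNIV) V"
    unfolding continuous_on_iff
  proof (intro ballI allI impI)
    fix X :: "real \<times> real \<times> real" and \<eta> :: real assume X: "X \<in> I0 \<times> UNIV" and \<eta>: "\<eta> > 0"
    obtain e p where Xp: "X = (e, p)" "e \<in> I0" using X by auto
    obtain d where d: "d > 0" "\<And>h p. 0 < \<bar>h\<bar> \<Longrightarrow> \<bar>h\<bar> < d \<Longrightarrow> \<bar>V (e + h, p) - V (e, p)\<bar> \<le> \<eta> / 2"
      using key[OF Xp(2), of "\<eta> / 2"] \<eta> by force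
    have "isCont (\<lambda>p. V (e, p)) p"
      using V(2)[OF Xp(2)] unfolding OO0_def continuous_on_eq_continuous_at[OF open_UNIV] by blast
    then obtain d' where d': "d' > 0" "\<And>p'. dist p' p < d' \<Longrightarrow> dist (V (e, p')) (V (e, p)) < \<eta> / 2"
      using \<eta> unfolding continuous_at_eps_delta by (metis half_gt_zero)
    have "dist (V Y) (V X) < \<eta>" if "dist Y X < min d d'" for Y
    proof -
      obtain e' p' where Y: "Y = (e', p')" by (rule prod.exhaust)
      have l: "\<bar>e' - e\<bar> < d" "dist p' p < d'"
        using that dist_fst_le[of Y X] dist_snd_le[of Y X] by (auto simp: Y Xp dist_real_def)
      have "\<bar>V (e', p') - V (e, p')\<bar> \<le> \<eta> / 2"
        using d(2)[of "e' - e" p'] l(1) \<eta> by (cases "e' = e") auto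
      then show ?thesis using d'(2)[OF l(2)] unfolding Y Xp dist_real_def by linarith
    qed
    then show "\<exists>d>0. \<forall>x'\<in>I0 \<times> UNIV. dist x' X < d \<longrightarrow> dist (V x') (V X) < \<eta>"
      using d(1) d'(1) by (intro exI[of _ "min d d'"]) auto
  qed
  then show ?thesis using V(2) by (auto simp: PC_def OO0_def)
qed

text \<open>The difference quotients of V converge to a function that solves the same linear
  equation with right-hand side a_e V + b_e, of order k once V is. The induction hypothesis
  therefore applies to the parameter derivative, while the spatial derivatives are averages of a
  function of order k.\<close>

lemma linearised_PC:
  "PC I0 k Acoef \<Longrightarrow> PC I0 k b \<Longrightarrow> (\<And>e. e \<in> I0 \<Longrightarrow> OO0 (\<lambda>p. b (e, p))) \<Longrightarrow> (\<And>e. e \<in> I0 \<Longrightarrow> OO0 (\<lambda>p. V (e, p))) \<Longrightarrow>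
    (\<And>e p. e \<in> I0 \<Longrightarrow> V (e, p) = RR (\<lambda>q. ae e q * V (e, q) + b (e, q)) p) \<Longrightarrow> PC I0 k V"
proof (induction k arbitrary: V b)
  case 0
  then show ?case by (rule linearised_PC0)
next
  case (Suc k)
  note R = Suc.prems(5) and bO = Suc.prems(3) and VO = Suc.prems(4)
  have Vk: "PC I0 k V" by (rule Suc.IH[OF PC_SucD[OF Suc.prems(1)] PC_SucD[OF Suc.prems(2)] bO VO R])
  obtain ag where ag: "\<And>e p. e \<in> I0 \<Longrightarrow> ((\<lambda>s. Acoef (s, p)) has_real_derivative ag (e, p)) (at e)" "PC I0 k ag"
    by (rule PC_partials[OF open_I0 Suc.prems(1)]) blast
  obtain bg where bg: "\<And>e p. e \<in> I0 \<Longrightarrow> ((\<lambda>s. b (s, p)) has_real_derivative bg (e, p)) (at e)" "PC I0 k bg"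
    by (rule PC_partials[OF open_I0 Suc.prems(2)]) blast
  define b' where "b' X = ag X * V X + bg X" for X
  have b'k: "PC I0 k b'" unfolding b'_def by (intro PC_add PC_mult open_I0 ag bg Vk)
  have agE: "ag (e, - x, y) = ag (e, x, y)" "ag (e, x, - y) = ag (e, x, y)" if "e \<in> I0" for e x y
    using PC_deriv_symmetry[where g=Acoef and ge=ag and p="(- x, y)" and q="(x, y)" and c="1", OF that ag(1) ag(1)] PC_deriv_symmetry[where g=Acoef and ge=ag and p="(x, - y)" and q="(x, y)" and c="1", OF that ag(1) ag(1)]
    by (auto simp: Acoef_def ae_even)
  have bgO: "bg (e, - x, y) = - bg (e, x, y)" "bg (e, x, - y) = - bg (e, x, y)" if "e \<in> I0" for e x y
    using PC_deriv_symmetry[where g=b and ge=bg and p="(- x, y)" and q="(x, y)" and c="-1", OF that bg(1) bg(1)] PC_deriv_symmetry[where g=b and ge=bg and p="(x, - y)" and q="(x, y)" and c="-1", OF that bg(1) bg(1)] bO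
    by (auto simp: OO0_def odd_odd_def)
  have b'O: "OO0 (\<lambda>p. b' (e, p))" if "e \<in> I0" for e
    using PC_slice(2,3)[OF b'k that] VO[OF that] agE[OF that] bgO[OF that]
    by (auto simp: OO0_def odd_odd_def b'_def)
  have G: "OO0 (\<lambda>q. ae e q * V (e, q) + b (e, q))" if "e \<in> I0" for e
    by (intro OO0_add ae_mult_OO0 VO bO that)
  have "\<exists>v. OO1 v \<and> (\<forall>p. v p = RR (\<lambda>q. ae e q * v q + b' (e, q)) p) \<and>
      (\<forall>p. ((\<lambda>s. V (s, p)) has_real_derivative v p) (at e))" if e: "e \<in> I0" for e
  proof -
    obtain d where d: "d > 0" "\<And>h. \<bar>h\<bar> < d \<Longrightarrow> e + h \<in> I0" by (rule I0_ball[OF e]) blast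
    define w where "w h p = (1 / h) * (V (e + h, p) - V (e, p))" for h p
    \<comment> \<open>Discrete product rule: the increment of the coefficient multiplies the old
      V(e), so that the quotient w keeps the coefficient at e + h and the error stays
      explicit.\<close>
    define bh where "bh h p = ((ae (e + h) p - ae e p) / h) * V (e, p) + (b (e + h, p) - b (e, p)) / h" for h p
    have eqG: "ae (e + h) q * w h q + bh h q = (1 / h) * ((ae (e + h) q * V (e + h, q) + b (e + h, q)) - (ae e q * V (e, q) + b (e, q)))"
      if "0 < \<bar>h\<bar>" for h q using that by (simp add: w_def bh_def field_simps)
    obtain MV where MV: "\<And>q. \<bar>V (e, q)\<bar> \<le> MV" by (rule OO0_bounded[OF VO[OF e]]) blast
    have MV0: "MV \<ge> 0" using order_trans[OF abs_ge_zero MV] by blast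
    have "\<exists>v. OO1 v \<and> (\<forall>p. v p = RR (\<lambda>q. ae e q * v q + b' (e, q)) p) \<and>
      (\<forall>\<eta>>0. \<exists>\<delta>>0. \<forall>h p. 0 < \<bar>h\<bar> \<and> \<bar>h\<bar> < \<delta> \<longrightarrow> \<bar>w h p - v p\<bar> \<le> \<eta>)"
    proof (rule perturb[OF e d(1), where a="\<lambda>h. ae (e + h)" and b=bh])
      fix h :: real assume h: "0 < \<bar>h\<bar>" "\<bar>h\<bar> < d"
      note eh = d(2)[OF h(2)]
      show "OO0 (w h)" unfolding w_def[abs_def] by (intro OO0_cmult OO0_diff VO eh e)
      show "OO0 (\<lambda>q. ae (e + h) q * w h q + bh h q)"
        unfolding eqG[OF h(1)] by (intro OO0_cmult OO0_diff G eh e)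
      show "w h p = RR (\<lambda>q. ae (e + h) q * w h q + bh h q) p" for p
      proof -
        have "RR (\<lambda>q. ae (e + h) q * w h q + bh h q) p
          = (1 / h) * (RR (\<lambda>q. ae (e + h) q * V (e + h, q) + b (e + h, q)) p - RR (\<lambda>q. ae e q * V (e, q) + b (e, q)) p)"
          unfolding eqG[OF h(1)] Kop_cmult RR_add0(2)[OF G[OF eh] G[OF e]] ..
        then show ?thesis unfolding R[OF eh, symmetric] R[OF e, symmetric] w_def by (rule sym)
      qed
    next
      fix \<eta> :: real assume \<eta>: "\<eta> > 0"
      obtain \<delta> where \<delta>: "\<delta> > 0" "\<And>e' p. \<bar>e' - e\<bar> < \<delta> \<Longrightarrow> e' \<in> I0 \<and> \<bar>Acoef (e', p) - Acoef (e, p)\<bar> < \<eta>"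
        by (rule PC_uniform[OF Suc.prems(1) open_I0 e \<eta>]) blast
      have "\<bar>ae (e + h) p - ae e p\<bar> \<le> \<eta>" if "\<bar>h\<bar> < \<delta>" for h p
        using \<delta>(2)[of "e + h" p] that by (simp add: Acoef_def)
      then show "\<exists>\<delta>>0. \<forall>h p. 0 < \<bar>h\<bar> \<and> \<bar>h\<bar> < \<delta> \<longrightarrow> \<bar>ae (e + h) p - ae e p\<bar> \<le> \<eta>" using \<delta>(1) by blast
      define \<theta> where "\<theta> = \<eta> / (MV + 1)"
      have \<theta>: "\<theta> > 0" using \<eta> MV0 by (simp add: \<theta>_def)
      obtain \<delta>1 where \<delta>1: "\<delta>1 > 0" "\<And>h p. 0 < \<bar>h\<bar> \<Longrightarrow> \<bar>h\<bar> < \<delta>1 \<Longrightarrow> \<bar>(Acoef (e + h, p) - Acoef (e, p)) / h - ag (e, p)\<bar> \<le> \<theta>"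
        using quotient_uniform[OF e ag(1) ag(2) \<theta>] by blast
      obtain \<delta>2 where \<delta>2: "\<delta>2 > 0" "\<And>h p. 0 < \<bar>h\<bar> \<Longrightarrow> \<bar>h\<bar> < \<delta>2 \<Longrightarrow> \<bar>(b (e + h, p) - b (e, p)) / h - bg (e, p)\<bar> \<le> \<theta>"
        using quotient_uniform[OF e bg(1) bg(2) \<theta>] by blast
      have "\<bar>bh h p - b' (e, p)\<bar> \<le> \<eta>" if h: "0 < \<bar>h\<bar>" "\<bar>h\<bar> < min \<delta>1 \<delta>2" for h p
      proof -
        let ?A = "(Acoef (e + h, p) - Acoef (e, p)) / h - ag (e, p)" and ?B = "(b (e + h, p) - b (e, p)) / h - bg (e, p)"
        have "bh h p - b' (e, p) = ?A * V (e, p) + ?B" by (simp add: bh_def b'_def Acoef_def algebra_simps)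
        also have "\<bar>\<dots>\<bar> \<le> \<bar>?A\<bar> * \<bar>V (e, p)\<bar> + \<bar>?B\<bar>" using abs_triangle_ineq by (metis abs_mult)
        also have "\<dots> \<le> \<theta> * MV + \<theta>"
          using \<delta>1(2)[of h p] \<delta>2(2)[of h p] h MV \<theta> by (intro add_mono mult_mono) auto
        also have "\<dots> = \<theta> * (MV + 1)" by (simp add: algebra_simps)
        also have "\<dots> = \<eta>" using MV0 by (simp add: \<theta>_def)
        finally show ?thesis .
      qed
      then show "\<exists>\<delta>>0. \<forall>h p. 0 < \<bar>h\<bar> \<and> \<bar>h\<bar> < \<delta> \<longrightarrow> \<bar>bh h p - b' (e, p)\<bar> \<le> \<eta>"
        using \<delta>1(1) \<delta>2(1) by (intro exI[of _ "min \<delta>1 \<delta>2"]) auto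
    qed (rule PC_slice[OF b'k e])+
    then obtain v where v: "OO1 v" "\<And>p. v p = RR (\<lambda>q. ae e q * v q + b' (e, q)) p"
      "\<And>\<eta>. \<eta> > 0 \<Longrightarrow> \<exists>\<delta>>0. \<forall>h p. 0 < \<bar>h\<bar> \<and> \<bar>h\<bar> < \<delta> \<longrightarrow> \<bar>w h p - v p\<bar> \<le> \<eta>" by blast
    have "((\<lambda>s. V (s, p)) has_real_derivative v p) (at e)" for p
    proof (rule has_derivative_from_quotients)
      show "\<exists>\<delta>>0. \<forall>h. 0 < \<bar>h\<bar> \<and> \<bar>h\<bar> < \<delta> \<longrightarrow> \<bar>(V (e + h, p) - V (e, p)) / h - v p\<bar> \<le> \<eta>" if "\<eta> > 0" for \<eta>
        using v(3)[OF that] unfolding w_def by (metis mult.left_neutral times_divide_eq_left)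
    qed
    then show ?thesis using v(1,2) by blast
  qed
  then have "\<exists>vv. \<forall>e\<in>I0. OO1 (vv e) \<and>
    (\<forall>p. vv e p = RR (\<lambda>q. ae e q * vv e q + b' (e, q)) p) \<and> (\<forall>p. ((\<lambda>s. V (s, p)) has_real_derivative vv e p) (at e))"
    by (intro bchoice ballI)
  then obtain vv where vv0: "\<forall>e\<in>I0. OO1 (vv e) \<and>
    (\<forall>p. vv e p = RR (\<lambda>q. ae e q * vv e q + b' (e, q)) p) \<and> (\<forall>p. ((\<lambda>s. V (s, p)) has_real_derivative vv e p) (at e))"
    by (elim exE)
  note vv = conjunct1[OF bspec[OF vv0]] spec[OF conjunct1[OF conjunct2[OF bspec[OF vv0]]]]
    spec[OF conjunct2[OF conjunct2[OF bspec[OF vv0]]]]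
  define V' where "V' X = vv (fst X) (snd X)" for X
  have V'k: "PC I0 k V'"
  proof (rule Suc.IH[OF PC_SucD[OF Suc.prems(1)] b'k b'O])
    show "OO0 (\<lambda>p. V' (e, p))" if "e \<in> I0" for e using OO1_imp_OO0[OF vv(1)[OF that]] by (simp add: V'_def)
    show "V' (e, p) = RR (\<lambda>q. ae e q * V' (e, q) + b' (e, q)) p" if "e \<in> I0" for e p
      unfolding V'_def fst_conv snd_conv by (rule vv(2)[OF that])
  qed
  define g where "g X = Acoef X * V X + b X" for X
  have gk: "PC I0 k g" unfolding g_def
    by (intro PC_add PC_mult open_I0 Vk PC_SucD[OF Suc.prems(1)] PC_SucD[OF Suc.prems(2)])
  have Vg: "(\<lambda>p. V (e, p)) = RR (\<lambda>q. g (e, q))" if "e \<in> I0" for e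
    unfolding g_def Acoef_def fst_conv snd_conv using R[OF that] by (rule ext)
  have "C_k_on (I0 \<times> UNIV) V (Suc k)"
  proof (rule C_k_on_of_partials3[OF open_I0, where fe=V' and fx="Kpar (\<lambda>w. fst (snd w)) g" and fy="Kpar (\<lambda>w. snd (snd w)) g"])
    fix e :: real assume e: "e \<in> I0"
    show "((\<lambda>s. V (s, p)) has_real_derivative V' (e, p)) (at e)" for p using vv(3)[OF e] by (simp add: V'_def)
    note s = PC_slice(2,3)[OF gk e]
    show "((\<lambda>s. V (e, s, y)) has_real_derivative Kpar (\<lambda>w. fst (snd w)) g (e, x, y)) (at x)" for x y
      using RR_has_real_derivative_x[OF s, of y x] unfolding Vg[OF e, symmetric] by (simp add: Kpar_def)
    show "((\<lambda>s. V (e, x, s)) has_real_derivative Kpar (\<lambda>w. snd (snd w)) g (e, x, y)) (at y)" for x y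
      using RR_has_real_derivative_y[OF s, of x y] unfolding Vg[OF e, symmetric] by (simp add: Kpar_def)
  qed (use V'k Kpar_PC[OF open_I0 integrable_rmeas_z1 gk] Kpar_PC[OF open_I0 integrable_rmeas_z2 gk] in \<open>auto simp: PC_def\<close>)
  then show ?case using Vk by (simp add: PC_def del: C_k_on.simps)
qed

section \<open>Smoothness of the solution in the parameter\<close>

lemma Acoef_eq: "Acoef X = 1 + fst X * qe (fst X) (Upar X) ^ 3"
  by (simp add: Acoef_def ae_def Upar_def)

lemma Acoef_PC: "PC I0 k Upar \<Longrightarrow> PC I0 k Acoef"
  unfolding Acoef_eq[abs_def] by (intro PC_add PC_mult PC_const PC_fst PC_power PC_qe open_I0)

text \<open>An exact linearisation in s - t and h, from Q - P = (Q^2 - P^2)/(Q + P) and the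
  relations (e + t^2) q^2 = 1. Its coefficients stay continuous at h = 0, so the difference quotient
  of solutions solves a genuinely linear equation.\<close>

lemma divided_difference:
  assumes "e > 0" "e + h > 0"
  shows "fe (e + h) s - fe e t =
    (qe (e + h) s - t * (s + t) * ((qe (e + h) s)\<^sup>2 * (qe e t)\<^sup>2 / (qe (e + h) s + qe e t))) * (s - t)
     - t * ((qe (e + h) s)\<^sup>2 * (qe e t)\<^sup>2 / (qe (e + h) s + qe e t)) * h"
proof -
  define Q P where "Q = qe (e + h) s" and "P = qe e t"
  have pos: "Q > 0" "P > 0" using assms qe_pos by (auto simp: Q_def P_def)
  have Q2: "(e + h + s\<^sup>2) * Q\<^sup>2 = 1" and P2: "(e + t\<^sup>2) * P\<^sup>2 = 1" using qe_sq assms by (auto simp: Q_def P_def)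
  define D where "D = Q\<^sup>2 * P\<^sup>2 / (Q + P)"
  have D: "D * (Q + P) = Q\<^sup>2 * P\<^sup>2" using pos by (simp add: D_def)
  have "(Q - P) * (Q + P) = Q\<^sup>2 * ((e + t\<^sup>2) * P\<^sup>2) - P\<^sup>2 * ((e + h + s\<^sup>2) * Q\<^sup>2)"
    unfolding Q2 P2 by (simp add: algebra_simps power2_eq_square)
  also have "\<dots> = - (h + (s - t) * (s + t)) * (Q\<^sup>2 * P\<^sup>2)" by (simp add: algebra_simps power2_eq_square)
  also have "\<dots> = (- (h + (s - t) * (s + t)) * D) * (Q + P)" unfolding D[symmetric] by (simp add: mult.assoc)
  finally have QP: "Q - P = - (h + (s - t) * (s + t)) * D" using pos by simp
  have "s * Q - t * P = Q * (s - t) + t * (Q - P)" by (simp add: algebra_simps)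
  also have "\<dots> = (Q - t * (s + t) * D) * (s - t) - t * D * h" unfolding QP by (simp add: algebra_simps)
  finally show ?thesis unfolding fe_eq Q_def[symmetric] P_def[symmetric] D_def[symmetric] .
qed

lemma usol_deriv_eps:
  assumes e: "e \<in> I0"
  shows "\<exists>v. OO1 v \<and> (\<forall>p. v p = RR (\<lambda>q. ae e q * v q + (- (1/2)) * (usol e q * qe e (usol e q) ^ 3)) p) \<and>
      (\<forall>p. ((\<lambda>s. usol s p) has_real_derivative v p) (at e))"
proof -
  have e0: "e > 0" using I0D(1)[OF e] .
  obtain d where d: "d > 0" "\<And>h. \<bar>h\<bar> < d \<Longrightarrow> e + h \<in> I0" by (rule I0_ball[OF e]) blast
  define t where "t p = usol e p" for p
  define Dq where "Dq X = (qe (fst X) (Upar X))\<^sup>2 * (qe e (t (snd X)))\<^sup>2 / (qe (fst X) (Upar X) + qe e (t (snd X)))" for X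
  \<comment> \<open>\<open>aa\<close> and \<open>bb\<close> are the coefficients of that exact
    linearisation. On the slice of parameter e they reduce to \<open>ae e\<close> and to the
    e-derivative -(1/2) t q^3 of the nonlinearity.\<close>
  define aa where "aa X = 1 + (qe (fst X) (Upar X) - t (snd X) * (Upar X + t (snd X)) * Dq X)" for X
  define bb where "bb X = - (t (snd X) * Dq X)" for X
  have tc: "continuous_on (I0 \<times> UNIV) (\<lambda>X::real \<times> real \<times> real. t (snd X))"
    unfolding t_def by (intro continuous_on_compose2[OF usol_continuous[OF e]] continuous_intros) auto
  have qc: "continuous_on (I0 \<times> UNIV) (\<lambda>X. qe (fst X) (Upar X))" using PC_continuous[OF PC_qe[OF Upar_PC0]] .
  have qtc: "continuous_on (I0 \<times> UNIV) (\<lambda>X::real \<times> real \<times> real. qe e (t (snd X)))"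
    unfolding qe_def by (intro continuous_intros tc) (use arg_pos[OF e0] in \<open>auto simp: less_imp_neq[symmetric]\<close>)
  have qp: "qe (fst X) (Upar X) + qe e (t (snd X)) > 0" if "X \<in> I0 \<times> UNIV" for X
    using qe_pos[OF I0D(1)[of "fst X"]] qe_pos[OF e0] that by (auto intro!: add_pos_pos)
  have Dc: "continuous_on (I0 \<times> UNIV) Dq"
    unfolding Dq_def by (intro continuous_intros qc qtc ballI) (rule less_imp_neq[OF qp, symmetric])
  have per: "usol s (x + 1, y) = usol s (x, y)" "usol s (x, y + 1) = usol s (x, y)" if "s \<in> I0" for s x y
    using usol_basic(1)[OF that] by (auto simp: periodic2_def)
  have "continuous_on (I0 \<times> UNIV) aa" "continuous_on (I0 \<times> UNIV) bb"
    unfolding aa_def bb_def by (intro continuous_intros qc tc Dc Upar_continuous)+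
  moreover have "periodic2 (\<lambda>p. aa (s, p))" "periodic2 (\<lambda>p. bb (s, p))" if "s \<in> I0" for s
    using that e by (simp_all add: periodic2_def aa_def bb_def Dq_def Upar_def t_def per)
  ultimately have aP: "PC I0 0 aa" and bP: "PC I0 0 bb" by (simp_all add: PC_def)
  have a0: "aa (e, p) = ae e p" and b0: "bb (e, p) = (- (1/2)) * (usol e p * qe e (usol e p) ^ 3)" for p
  proof -
    let ?Q = "qe e (usol e p)"
    have Q: "?Q > 0" by (rule qe_pos[OF e0])
    have D: "Dq (e, p) = ?Q ^ 3 / 2" using Q by (simp add: Dq_def Upar_def t_def field_simps power_numeral_reduce)
    then show "bb (e, p) = (- (1/2)) * (usol e p * ?Q ^ 3)" by (simp add: bb_def t_def)
    have "?Q * ((e + (usol e p)\<^sup>2) * ?Q\<^sup>2) = ?Q" unfolding qe_sq[OF e0] by simp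
    then have "?Q - usol e p * (usol e p + usol e p) * (?Q ^ 3 / 2) = e * ?Q ^ 3"
      by (simp add: algebra_simps power2_eq_square power3_eq_cube)
    then show "aa (e, p) = ae e p" unfolding aa_def D ae_def by (simp add: Upar_def t_def)
  qed
  define w where "w h p = (1 / h) * (usol (e + h) p - usol e p)" for h p
  have eqG: "aa (e + h, q) * w h q + bb (e + h, q) = (1 / h) * ((usol (e + h) q + fe (e + h) (usol (e + h) q)) - (usol e q + fe e (usol e q)))"
    if h: "0 < \<bar>h\<bar>" "\<bar>h\<bar> < d" for h q
  proof -
    have eh: "e + h > 0" using I0D(1)[OF d(2)[OF h(2)]] .
    have "h * (aa (e + h, q) * w h q + bb (e + h, q)) = aa (e + h, q) * (usol (e + h) q - usol e q) + bb (e + h, q) * h"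
      using h(1) by (simp add: w_def algebra_simps)
    also have "\<dots> = (usol (e + h) q - usol e q) + (fe (e + h) (usol (e + h) q) - fe e (usol e q))"
      unfolding divided_difference[OF e0 eh] aa_def bb_def Dq_def Upar_def t_def fst_conv snd_conv by (simp add: algebra_simps)
    finally show ?thesis using h(1) by (simp add: field_simps)
  qed
  have unif: "\<exists>\<delta>>0. \<forall>h p. 0 < \<bar>h\<bar> \<and> \<bar>h\<bar> < \<delta> \<longrightarrow> \<bar>g (e + h, p) - g (e, p)\<bar> \<le> \<eta>" if g: "PC I0 0 g" "\<eta> > 0" for g \<eta>
  proof -
    obtain d where d: "d > 0" "\<And>e' p. \<bar>e' - e\<bar> < d \<Longrightarrow> e' \<in> I0 \<and> \<bar>g (e', p) - g (e, p)\<bar> < \<eta>"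
      by (rule PC_uniform[OF g(1) open_I0 e g(2)]) blast
    have "\<bar>g (e + h, p) - g (e, p)\<bar> \<le> \<eta>" if "\<bar>h\<bar> < d" for h p using d(2)[of "e + h" p] that by simp
    then show ?thesis using d(1) by blast
  qed
  have "\<exists>v. OO1 v \<and> (\<forall>p. v p = RR (\<lambda>q. ae e q * v q + (- (1/2)) * (usol e q * qe e (usol e q) ^ 3)) p) \<and>
    (\<forall>\<eta>>0. \<exists>\<delta>>0. \<forall>h p. 0 < \<bar>h\<bar> \<and> \<bar>h\<bar> < \<delta> \<longrightarrow> \<bar>w h p - v p\<bar> \<le> \<eta>)"
  proof (rule perturb[OF e d(1), where a="\<lambda>h q. aa (e + h, q)" and b="\<lambda>h q. bb (e + h, q)"])
    fix h :: real assume h: "0 < \<bar>h\<bar>" "\<bar>h\<bar> < d"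
    note eh = d(2)[OF h(2)]
    note O = OO1_imp_OO0[OF usol_rhs_OO1[OF eh]] OO1_imp_OO0[OF usol_rhs_OO1[OF e]]
    show "OO0 (w h)" unfolding w_def[abs_def] by (intro OO0_cmult OO0_diff OO1_imp_OO0 usol_OO1 eh e)
    show "OO0 (\<lambda>q. aa (e + h, q) * w h q + bb (e + h, q))"
      unfolding eqG[OF h] by (intro OO0_cmult OO0_diff O)
    show "w h p = RR (\<lambda>q. aa (e + h, q) * w h q + bb (e + h, q)) p" for p
    proof -
      have "RR (\<lambda>q. aa (e + h, q) * w h q + bb (e + h, q)) p
        = (1 / h) * (RR (\<lambda>q. usol (e + h) q + fe (e + h) (usol (e + h) q)) p - RR (\<lambda>q. usol e q + fe e (usol e q)) p)"
        unfolding eqG[OF h] Kop_cmult RR_add0(2)[OF O] ..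
      then show ?thesis unfolding usol_fixpoint[OF eh, symmetric] usol_fixpoint[OF e, symmetric] w_def by (rule sym)
    qed
  next
    fix \<eta> :: real assume \<eta>: "\<eta> > 0"
    show "\<exists>\<delta>>0. \<forall>h p. 0 < \<bar>h\<bar> \<and> \<bar>h\<bar> < \<delta> \<longrightarrow> \<bar>aa (e + h, p) - ae e p\<bar> \<le> \<eta>" using unif[OF aP \<eta>] by (simp add: a0)
    show "\<exists>\<delta>>0. \<forall>h p. 0 < \<bar>h\<bar> \<and> \<bar>h\<bar> < \<delta> \<longrightarrow> \<bar>bb (e + h, p) - (- (1/2)) * (usol e p * qe e (usol e p) ^ 3)\<bar> \<le> \<eta>"
      using unif[OF bP \<eta>] unfolding b0 .
  next
    show "continuous_on UNIV (\<lambda>q. - (1 / 2) * (usol e q * qe e (usol e q) ^ 3))"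
      "periodic2 (\<lambda>q. - (1 / 2) * (usol e q * qe e (usol e q) ^ 3))"
      using PC_slice(2,3)[OF bP e] by (simp_all only: b0)
  qed
  then obtain v where v: "OO1 v" "\<And>p. v p = RR (\<lambda>q. ae e q * v q + (- (1/2)) * (usol e q * qe e (usol e q) ^ 3)) p"
    "\<And>\<eta>. \<eta> > 0 \<Longrightarrow> \<exists>\<delta>>0. \<forall>h p. 0 < \<bar>h\<bar> \<and> \<bar>h\<bar> < \<delta> \<longrightarrow> \<bar>w h p - v p\<bar> \<le> \<eta>" by blast
  have "((\<lambda>s. usol s p) has_real_derivative v p) (at e)" for p
  proof (rule has_derivative_from_quotients)
    show "\<exists>\<delta>>0. \<forall>h. 0 < \<bar>h\<bar> \<and> \<bar>h\<bar> < \<delta> \<longrightarrow> \<bar>(usol (e + h) p - usol e p) / h - v p\<bar> \<le> \<eta>" if "\<eta> > 0" for \<eta>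
      using v(3)[OF that] unfolding w_def by (metis mult.left_neutral times_divide_eq_left)
  qed
  then show ?thesis using v(1,2) by blast
qed

text \<open>Bootstrap: if the solution is of order k, so are the coefficient and the right-hand side
  of the equation for its parameter derivative, hence that derivative too; the spatial derivatives
  are averages of the order-k function u + f.\<close>

lemma Upar_PC: "PC I0 k Upar"
proof (induction k)
  case 0
  show ?case by (rule Upar_PC0)
next
  case (Suc k)
  have "\<exists>vv. \<forall>e\<in>I0. OO1 (vv e) \<and>
    (\<forall>p. vv e p = RR (\<lambda>q. ae e q * vv e q + (- (1/2)) * (usol e q * qe e (usol e q) ^ 3)) p) \<and>
    (\<forall>p. ((\<lambda>s. usol s p) has_real_derivative vv e p) (at e))"
    by (intro bchoice ballI usol_deriv_eps)
  then obtain vv where vv0: "\<forall>e\<in>I0. OO1 (vv e) \<and>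
    (\<forall>p. vv e p = RR (\<lambda>q. ae e q * vv e q + (- (1/2)) * (usol e q * qe e (usol e q) ^ 3)) p) \<and>
    (\<forall>p. ((\<lambda>s. usol s p) has_real_derivative vv e p) (at e))"
    by (elim exE)
  note vv = conjunct1[OF bspec[OF vv0]] spec[OF conjunct1[OF conjunct2[OF bspec[OF vv0]]]]
    spec[OF conjunct2[OF conjunct2[OF bspec[OF vv0]]]]
  define b where "b X = (- (1/2)) * (Upar X * qe (fst X) (Upar X) ^ 3)" for X
  define V where "V X = vv (fst X) (snd X)" for X
  have bk: "PC I0 k b" unfolding b_def by (intro PC_cmult PC_mult PC_power PC_qe open_I0 Suc.IH)
  have Vk: "PC I0 k V"
  proof (rule linearised_PC[OF Acoef_PC[OF Suc.IH] bk])
    show "OO0 (\<lambda>p. b (e, p))" if "e \<in> I0" for e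
      using PC_slice(2,3)[OF bk that] usol_basic(2)[OF that]
      by (auto simp: OO0_def b_def Upar_def odd_odd_def qe_minus)
    show "OO0 (\<lambda>p. V (e, p))" if "e \<in> I0" for e using OO1_imp_OO0[OF vv(1)[OF that]] by (simp add: V_def)
    show "V (e, p) = RR (\<lambda>q. ae e q * V (e, q) + b (e, q)) p" if "e \<in> I0" for e p
      unfolding V_def b_def Upar_def fst_conv snd_conv by (rule vv(2)[OF that])
  qed
  define g where "g X = Upar X + Upar X * qe (fst X) (Upar X)" for X
  have gk: "PC I0 k g" unfolding g_def by (intro PC_add PC_mult PC_qe open_I0 Suc.IH)
  have Ug: "(\<lambda>p. Upar (e, p)) = RR (\<lambda>q. g (e, q))" if "e \<in> I0" for e
    unfolding g_def Upar_def fst_conv snd_conv fe_eq[symmetric] using usol_fixpoint[OF that] by (rule ext)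
  have "C_k_on (I0 \<times> UNIV) Upar (Suc k)"
  proof (rule C_k_on_of_partials3[OF open_I0, where fe=V and fx="Kpar (\<lambda>w. fst (snd w)) g" and fy="Kpar (\<lambda>w. snd (snd w)) g"])
    fix e :: real assume e: "e \<in> I0"
    show "((\<lambda>s. Upar (s, p)) has_real_derivative V (e, p)) (at e)" for p using vv(3)[OF e] by (simp add: V_def Upar_def)
    note s = PC_slice(2,3)[OF gk e]
    show "((\<lambda>s. Upar (e, s, y)) has_real_derivative Kpar (\<lambda>w. fst (snd w)) g (e, x, y)) (at x)" for x y
      using RR_has_real_derivative_x[OF s, of y x] unfolding Ug[OF e, symmetric] by (simp add: Kpar_def)
    show "((\<lambda>s. Upar (e, x, s)) has_real_derivative Kpar (\<lambda>w. snd (snd w)) g (e, x, y)) (at y)" for x y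
      using RR_has_real_derivative_y[OF s, of x y] unfolding Ug[OF e, symmetric] by (simp add: Kpar_def)
  qed (use Vk Kpar_PC[OF open_I0 integrable_rmeas_z1 gk] Kpar_PC[OF open_I0 integrable_rmeas_z2 gk] in \<open>auto simp: PC_def\<close>)
  then show ?case using Suc.IH by (simp add: PC_def del: C_k_on.simps)
qed

subsection \<open>The inverse Laplacian on the torus\<close>

lemma torus_square_cbox: "torus_square = cbox (- 1/2, - 1/2) (1/2, 1/2)"
  by (auto simp: torus_square_def cbox_Pair_eq)

lemma integrable_torus_square:
  fixes f :: "real \<times> real \<Rightarrow> real"
  shows "continuous_on UNIV f \<Longrightarrow> f integrable_on torus_square"
  unfolding torus_square_cbox by (rule integrable_continuous) (rule continuous_on_subset, auto)

lemma integral_torus_x0: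
  fixes f :: "real \<times> real \<Rightarrow> real"
  assumes "continuous_on UNIV f" "\<And>y. integral {-1/2..1/2} (\<lambda>x. f (x, y)) = 0"
  shows "integral torus_square f = 0"
proof -
  have c: "continuous_on (cbox (- 1/2, - 1/2) (1/2, 1/2)) (\<lambda>(x, y). f (x, y))"
    using continuous_on_subset[OF assms(1)] by (simp add: case_prod_unfold)
  have "integral torus_square f = integral (cbox (-1/2) (1/2)) (\<lambda>x. integral (cbox (-1/2) (1/2)) (\<lambda>y. f (x, y)))"
    unfolding torus_square_cbox by (rule integral_prod_continuous) (rule continuous_on_subset[OF assms(1)], simp)
  also have "\<dots> = integral (cbox (-1/2) (1/2)) (\<lambda>y. integral (cbox (-1/2) (1/2)) (\<lambda>x. f (x, y)))"
    using integral_swap_continuous[OF c] by simp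
  also have "\<dots> = 0" using assms(2) by simp
  finally show ?thesis .
qed

lemma integral_torus_y0:
  fixes f :: "real \<times> real \<Rightarrow> real"
  assumes "continuous_on UNIV f" "\<And>x. integral {-1/2..1/2} (\<lambda>y. f (x, y)) = 0"
  shows "integral torus_square f = 0"
proof -
  have "integral torus_square f = integral (cbox (-1/2) (1/2)) (\<lambda>x. integral (cbox (-1/2) (1/2)) (\<lambda>y. f (x, y)))"
    unfolding torus_square_cbox by (rule integral_prod_continuous) (rule continuous_on_subset[OF assms(1)], simp)
  also have "\<dots> = 0" using assms(2) by simp
  finally show ?thesis .
qed

lemma periodic2_half: "periodic2 f \<Longrightarrow> f (1/2, y) = f (- 1/2, y)" "periodic2 f \<Longrightarrow> f (x, 1/2) = f (x, - 1/2)"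
  using periodic2_int[of f "- 1/2" 1 y 0] periodic2_int[of f x 0 "- 1/2" 1] by simp_all

lemma odd_odd_mean_zero:
  assumes "continuous_on UNIV f" "odd_odd f"
  shows "integral torus_square f = 0"
proof (rule integral_torus_x0[OF assms(1)])
  fix y :: real
  have "integral {-1/2..1/2} (\<lambda>x. f (- x, y)) = integral {-1/2..1/2} (\<lambda>x. f (x, y))"
    using Henstock_Kurzweil_Integration.integral_reflect_real[where a="-1/2" and b="1/2" and f="\<lambda>x. f (x, y)"] by simp
  then show "integral {-1/2..1/2} (\<lambda>x. f (x, y)) = 0" using assms(2) by (simp add: odd_odd_def)
qed

text \<open>Bridge from the classical equation to the distributional one. On every line the
  integrand is the derivative of a Wronskian expression whose end values agree by
  periodicity.\<close>

lemma green_identity: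
  assumes \<psi>: "C_k_on UNIV \<psi> 2" "periodic2 \<psi>" and \<phi>: "C_k_on UNIV \<phi> 2" "periodic2 \<phi>"
  shows "integral torus_square (\<lambda>p. \<psi> p * laplacian \<phi> p) = integral torus_square (\<lambda>p. laplacian \<psi> p * \<phi> p)"
proof -
  have D: "C_k_on UNIV (dx f) (Suc 0)" "C_k_on UNIV (dy f) (Suc 0)" "C_k_on UNIV f (Suc 0)"
    "periodic2 (dx f)" "periodic2 (dy f)"
    "continuous_on UNIV f" "continuous_on UNIV (dx f)" "continuous_on UNIV (dy f)" "continuous_on UNIV (dx (dx f))" "continuous_on UNIV (dy (dy f))"
    if f: "C_k_on UNIV f 2" "periodic2 f" for f
  proof -
    have c2: "C_k_on UNIV f (Suc (Suc 0))" using f(1) by (simp add: numeral_2_eq_2)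
    show c1: "C_k_on UNIV f (Suc 0)" by (rule C_k_on_SucD[OF c2])
    show x: "C_k_on UNIV (dx f) (Suc 0)" "C_k_on UNIV (dy f) (Suc 0)" using C_k_on_dx[OF c2] C_k_on_dy[OF c2] .
    show "periodic2 (dx f)" "periodic2 (dy f)"
      using periodic2_dx[OF C_k_on_differentiable[OF c1] f(2)] periodic2_dy[OF C_k_on_differentiable[OF c1] f(2)] .
    show "continuous_on UNIV f" "continuous_on UNIV (dx f)" "continuous_on UNIV (dy f)"
      using C_k_on_continuous[OF c1] C_k_on_continuous[OF x(1)] C_k_on_continuous[OF x(2)] .
    show "continuous_on UNIV (dx (dx f))" "continuous_on UNIV (dy (dy f))"
      using C_k_on_dx[OF x(1)] C_k_on_dy[OF x(2)] by simp_all
  qed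
  note P = D[OF \<psi>] and F = D[OF \<phi>]
  have X: "integral torus_square (\<lambda>p. \<psi> p * dx (dx \<phi>) p - dx (dx \<psi>) p * \<phi> p) = 0"
  proof (rule integral_torus_x0)
    show "continuous_on UNIV (\<lambda>p. \<psi> p * dx (dx \<phi>) p - dx (dx \<psi>) p * \<phi> p)" by (intro continuous_intros P F)
    fix y :: real
    let ?G = "\<lambda>x. \<psi> (x, y) * dx \<phi> (x, y) - dx \<psi> (x, y) * \<phi> (x, y)"
    have I: "((\<lambda>x. \<psi> (x, y) * dx (dx \<phi>) (x, y) - dx (dx \<psi>) (x, y) * \<phi> (x, y)) has_integral ?G (1/2) - ?G (- 1/2)) {-1/2..1/2}"
    proof (rule fundamental_theorem_of_calculus)
      show "(?G has_vector_derivative \<psi> (x, y) * dx (dx \<phi>) (x, y) - dx (dx \<psi>) (x, y) * \<phi> (x, y)) (at x within {-1/2..1/2})" for x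
        unfolding has_real_derivative_iff_has_vector_derivative[symmetric]
        by (rule has_field_derivative_at_within, rule DERIV_cong[OF DERIV_diff[OF
            DERIV_mult'[OF has_real_derivative_dx[OF C_k_on_differentiable[OF P(3)]] has_real_derivative_dx[OF C_k_on_differentiable[OF F(1)]]]
            DERIV_mult'[OF has_real_derivative_dx[OF C_k_on_differentiable[OF P(1)]] has_real_derivative_dx[OF C_k_on_differentiable[OF F(3)]]]]]) simp
    qed simp
    have Z: "?G (1/2) - ?G (- 1/2) = 0"
      unfolding periodic2_half(1)[OF \<psi>(2)] periodic2_half(1)[OF \<phi>(2)] periodic2_half(1)[OF P(4)] periodic2_half(1)[OF F(4)] by simp
    show "integral {-1/2..1/2} (\<lambda>x. \<psi> (x, y) * dx (dx \<phi>) (x, y) - dx (dx \<psi>) (x, y) * \<phi> (x, y)) = 0"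
      by (rule trans[OF integral_unique[OF I] Z])
  qed
  have Y: "integral torus_square (\<lambda>p. \<psi> p * dy (dy \<phi>) p - dy (dy \<psi>) p * \<phi> p) = 0"
  proof (rule integral_torus_y0)
    show "continuous_on UNIV (\<lambda>p. \<psi> p * dy (dy \<phi>) p - dy (dy \<psi>) p * \<phi> p)" by (intro continuous_intros P F)
    fix x :: real
    let ?G = "\<lambda>y. \<psi> (x, y) * dy \<phi> (x, y) - dy \<psi> (x, y) * \<phi> (x, y)"
    have I: "((\<lambda>y. \<psi> (x, y) * dy (dy \<phi>) (x, y) - dy (dy \<psi>) (x, y) * \<phi> (x, y)) has_integral ?G (1/2) - ?G (- 1/2)) {-1/2..1/2}"
    proof (rule fundamental_theorem_of_calculus)
      show "(?G has_vector_derivative \<psi> (x, y) * dy (dy \<phi>) (x, y) - dy (dy \<psi>) (x, y) * \<phi> (x, y)) (at y within {-1/2..1/2})" for y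
        unfolding has_real_derivative_iff_has_vector_derivative[symmetric]
        by (rule has_field_derivative_at_within, rule DERIV_cong[OF DERIV_diff[OF
            DERIV_mult'[OF has_real_derivative_dy[OF C_k_on_differentiable[OF P(3)]] has_real_derivative_dy[OF C_k_on_differentiable[OF F(2)]]]
            DERIV_mult'[OF has_real_derivative_dy[OF C_k_on_differentiable[OF P(2)]] has_real_derivative_dy[OF C_k_on_differentiable[OF F(3)]]]]]) simp
    qed simp
    have Z: "?G (1/2) - ?G (- 1/2) = 0"
      unfolding periodic2_half(2)[OF \<psi>(2)] periodic2_half(2)[OF \<phi>(2)] periodic2_half(2)[OF P(5)] periodic2_half(2)[OF F(5)] by simp
    show "integral {-1/2..1/2} (\<lambda>y. \<psi> (x, y) * dy (dy \<phi>) (x, y) - dy (dy \<psi>) (x, y) * \<phi> (x, y)) = 0"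
      by (rule trans[OF integral_unique[OF I] Z])
  qed
  have i: "(\<lambda>p. \<psi> p * dx (dx \<phi>) p - dx (dx \<psi>) p * \<phi> p) integrable_on torus_square"
    "(\<lambda>p. \<psi> p * dy (dy \<phi>) p - dy (dy \<psi>) p * \<phi> p) integrable_on torus_square"
    "(\<lambda>p. \<psi> p * laplacian \<phi> p) integrable_on torus_square" "(\<lambda>p. laplacian \<psi> p * \<phi> p) integrable_on torus_square"
    unfolding laplacian_def by (intro integrable_torus_square continuous_intros P F)+
  have "integral torus_square (\<lambda>p. \<psi> p * laplacian \<phi> p) - integral torus_square (\<lambda>p. laplacian \<psi> p * \<phi> p)
    = integral torus_square (\<lambda>p. \<psi> p * laplacian \<phi> p - laplacian \<psi> p * \<phi> p)"
    by (rule Henstock_Kurzweil_Integration.integral_diff[OF i(3,4), symmetric])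
  also have "\<dots> = integral torus_square (\<lambda>p. (\<psi> p * dx (dx \<phi>) p - dx (dx \<psi>) p * \<phi> p) + (\<psi> p * dy (dy \<phi>) p - dy (dy \<psi>) p * \<phi> p))"
    by (simp add: laplacian_def algebra_simps)
  also have "\<dots> = 0" using Henstock_Kurzweil_Integration.integral_add[OF i(1,2)] X Y by simp
  finally show ?thesis by simp
qed

section \<open>Test functions and uniqueness of the inverse Laplacian\<close>

lemma torus_smooth_C_k: "torus_smooth \<phi> \<Longrightarrow> C_k_on UNIV \<phi> k" "torus_smooth \<phi> \<Longrightarrow> periodic2 \<phi>"
  by (simp_all add: torus_smooth_def smooth_on_def)

lemma trig_poly_torus_smooth: "t \<in> trig_poly \<Longrightarrow> torus_smooth t"
  using trig_poly_C_k trig_poly_periodic by (auto simp: torus_smooth_def smooth_on_def)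

lemma laplacian_continuous:
  assumes "torus_smooth \<phi>"
  shows "continuous_on UNIV (laplacian \<phi>)"
proof -
  have c: "C_k_on UNIV \<phi> (Suc (Suc 0))" by (rule torus_smooth_C_k[OF assms])
  have "continuous_on UNIV (dx (dx \<phi>))" "continuous_on UNIV (dy (dy \<phi>))"
    using C_k_on_dx[OF C_k_on_dx[OF c]] C_k_on_dy[OF C_k_on_dy[OF c]] by simp_all
  then show ?thesis unfolding laplacian_def[abs_def] by (intro continuous_intros)
qed

lemma laplacian_wave:
  "laplacian (\<lambda>p. cos (2 * pi * (of_int m * fst p + of_int n * snd p) + \<theta>)) p =
    - (4 * pi\<^sup>2 * (of_int m ^ 2 + of_int n ^ 2)) * cos (2 * pi * (of_int m * fst p + of_int n * snd p) + \<theta>)"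
proof -
  let ?A = "\<lambda>p. 2 * pi * (of_int m * fst p + of_int n * snd p)"
  let ?w = "\<lambda>\<theta> p. cos (?A p + \<theta>)"
  have C: "C_k_on UNIV (\<lambda>p. c * ?w \<theta> p) (Suc 0)" for c \<theta> by (intro C_k_on_cmult open_UNIV C_k_on_wave)
  have X: "dx (\<lambda>p. c * ?w \<theta> p) = (\<lambda>p. (c * (2 * pi * of_int m)) * ?w (\<theta> + pi / 2) p)" for c \<theta>
  proof
    fix p :: "real \<times> real"
    have "dx (\<lambda>p. c * ?w \<theta> p) (fst p, snd p) = (c * (2 * pi * of_int m)) * ?w (\<theta> + pi / 2) p"
      by (rule dx_eqI[OF C_k_on_differentiable[OF C]])
        (auto intro!: derivative_eq_intros simp: cos_add sin_add algebra_simps)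
    then show "dx (\<lambda>p. c * ?w \<theta> p) p = (c * (2 * pi * of_int m)) * ?w (\<theta> + pi / 2) p" by simp
  qed
  have Y: "dy (\<lambda>p. c * ?w \<theta> p) = (\<lambda>p. (c * (2 * pi * of_int n)) * ?w (\<theta> + pi / 2) p)" for c \<theta>
  proof
    fix p :: "real \<times> real"
    have "dy (\<lambda>p. c * ?w \<theta> p) (fst p, snd p) = (c * (2 * pi * of_int n)) * ?w (\<theta> + pi / 2) p"
      by (rule dy_eqI[OF C_k_on_differentiable[OF C]])
        (auto intro!: derivative_eq_intros simp: cos_add sin_add algebra_simps)
    then show "dy (\<lambda>p. c * ?w \<theta> p) p = (c * (2 * pi * of_int n)) * ?w (\<theta> + pi / 2) p" by simp
  qed
  have "cos (t + (\<theta> + pi / 2 + pi / 2)) = - cos (t + \<theta>)" for t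
    using cos_periodic_pi[of "t + \<theta>"] by (simp add: add.assoc)
  then have "laplacian (\<lambda>p. 1 * ?w \<theta> p) p = - (4 * pi\<^sup>2 * (of_int m ^ 2 + of_int n ^ 2)) * ?w \<theta> p"
    unfolding laplacian_def X Y by (simp add: algebra_simps power2_eq_square)
  then show ?thesis by simp
qed

lemma periodic2_zero:
  assumes "periodic2 f" "\<And>p. p \<in> torus_square \<Longrightarrow> f p = (0::real)"
  shows "f p = 0"
proof -
  have w: "- 1/2 \<le> wrap t" "wrap t \<le> 1/2" for t unfolding wrap_def by linarith+
  have "f (wrap (fst p) + of_int \<lfloor>fst p + 1/2\<rfloor>, wrap (snd p) + of_int \<lfloor>snd p + 1/2\<rfloor>) = f (wrap (fst p), wrap (snd p))"
    by (rule periodic2_int[OF assms(1)])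
  also have "\<dots> = 0" using w by (intro assms(2)) (simp add: torus_square_def)
  finally show ?thesis by (simp add: wrap_def)
qed

text \<open>Every nonconstant wave is an eigenfunction with nonzero eigenvalue, so the weak equation
  makes the difference d orthogonal to it; the constants are covered by mean zero. Density of
  trigonometric polynomials then forces the square integral of d to vanish.\<close>

lemma is_inv_laplacian_unique:
  assumes "is_inv_laplacian g \<psi>" "is_inv_laplacian g \<psi>'"
  shows "\<psi> = \<psi>'"
proof -
  define d where "d p = \<psi> p - \<psi>' p" for p
  have c: "continuous_on UNIV \<psi>" "continuous_on UNIV \<psi>'" and p: "periodic2 \<psi>" "periodic2 \<psi>'"
    and m: "integral torus_square \<psi> = 0" "integral torus_square \<psi>' = 0"
    using assms by (auto simp: is_inv_laplacian_def)
  have dc: "continuous_on UNIV d" unfolding d_def by (intro continuous_intros c)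
  have dp: "periodic2 d" using p by (simp add: d_def periodic2_def)
  have d0: "integral torus_square d = 0"
    unfolding d_def[abs_def] using Henstock_Kurzweil_Integration.integral_diff[OF integrable_torus_square[OF c(1)] integrable_torus_square[OF c(2)]] m by simp
  have dl: "integral torus_square (\<lambda>p. d p * laplacian \<phi> p) = 0" if "torus_smooth \<phi>" for \<phi>
  proof -
    have "integral torus_square (\<lambda>p. \<psi> p * laplacian \<phi> p - \<psi>' p * laplacian \<phi> p)
      = integral torus_square (\<lambda>p. \<psi> p * laplacian \<phi> p) - integral torus_square (\<lambda>p. \<psi>' p * laplacian \<phi> p)"
      by (intro Henstock_Kurzweil_Integration.integral_diff integrable_torus_square continuous_intros c laplacian_continuous that)
    also have "\<dots> = 0" using assms that by (simp add: is_inv_laplacian_def)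
    finally show ?thesis by (simp add: d_def left_diff_distrib)
  qed
  have dt: "t \<in> trig_poly \<Longrightarrow> integral torus_square (\<lambda>p. d p * t p) = 0" for t
  proof (induction rule: trig_poly.induct)
    case (wave m n \<theta>)
    let ?w = "\<lambda>p. cos (2 * pi * (of_int m * fst p + of_int n * snd p) + \<theta>)"
    define l where "l = - (4 * pi\<^sup>2 * (real_of_int m ^ 2 + real_of_int n ^ 2))"
    show ?case
    proof (cases "l = 0")
      case True
      then have "real_of_int m ^ 2 + real_of_int n ^ 2 = 0" by (simp add: l_def)
      then have "m = 0 \<and> n = 0" by (simp add: sum_power2_eq_zero_iff)
      then show ?thesis using d0 by simp
    next
      case False
      have "integral torus_square (\<lambda>p. d p * (l * ?w p)) = 0"
        using dl[OF trig_poly_torus_smooth[OF trig_poly.wave[of m n \<theta>]]] unfolding laplacian_wave l_def .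
      then have "l * integral torus_square (\<lambda>p. d p * ?w p) = 0"
        by (simp only: mult.left_commute[of _ l] integral_mult_right)
      then show ?thesis using False by simp
    qed
  next
    case (add f g)
    have fc: "continuous_on UNIV f" "continuous_on UNIV g"
      using C_k_on_continuous[OF trig_poly_C_k[OF add.hyps(1), of 0]] C_k_on_continuous[OF trig_poly_C_k[OF add.hyps(2), of 0]] .
    have "integral torus_square (\<lambda>p. d p * f p + d p * g p) = integral torus_square (\<lambda>p. d p * f p) + integral torus_square (\<lambda>p. d p * g p)"
      by (intro Henstock_Kurzweil_Integration.integral_add integrable_torus_square continuous_intros dc fc)
    then show ?case using add.IH by (simp add: distrib_left)
  next
    case (scale f c)
    then show ?case by (simp only: mult.left_commute[of _ c] integral_mult_right mult_zero_right)
  qed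
  obtain B where B: "B \<ge> 0" "\<And>p. \<bar>d p\<bar> \<le> B" by (rule periodic2_bounded[OF dc dp]) blast
  \<comment> \<open>As d is orthogonal to the approximant t, its square integral equals that of d (d
    - t); the torus has area 1.\<close>
  have small: "integral torus_square (\<lambda>p. d p * d p) \<le> \<eta> * B" if pos: "\<eta> > 0" for \<eta>
  proof -
    obtain t where t: "t \<in> trig_poly" "\<And>p. \<bar>d p - t p\<bar> < \<eta>" by (rule trig_poly_dense[OF dc dp pos]) blast
    have tc: "continuous_on UNIV t" using C_k_on_continuous[OF trig_poly_C_k[OF t(1), of 0]] .
    have "integral torus_square (\<lambda>p. d p * d p) = integral torus_square (\<lambda>p. d p * (d p - t p))"
    proof -
      have "integral torus_square (\<lambda>p. d p * d p - d p * t p) = integral torus_square (\<lambda>p. d p * d p) - integral torus_square (\<lambda>p. d p * t p)"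
        by (intro Henstock_Kurzweil_Integration.integral_diff integrable_torus_square continuous_intros dc tc)
      then show ?thesis using dt[OF t(1)] by (simp add: right_diff_distrib)
    qed
    also have "\<dots> \<le> integral torus_square (\<lambda>p. \<eta> * B)"
    proof (rule integral_le)
      show "(\<lambda>p. d p * (d p - t p)) integrable_on torus_square" "(\<lambda>p. \<eta> * B) integrable_on torus_square"
        by (intro integrable_torus_square continuous_intros dc tc)+
      fix p
      have "d p * (d p - t p) \<le> \<bar>d p\<bar> * \<bar>d p - t p\<bar>" by (metis abs_ge_self abs_mult)
      also have "\<dots> \<le> B * \<eta>" using B t(2)[of p] by (intro mult_mono) auto
      finally show "d p * (d p - t p) \<le> \<eta> * B" by (simp add: mult.commute)
    qed
    also have "\<dots> = \<eta> * B" unfolding torus_square_cbox by (simp add: content_Pair)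
    finally show ?thesis .
  qed
  have "integral torus_square (\<lambda>p. d p * d p) \<le> 0"
  proof (rule field_le_epsilon)
    fix \<eta> :: real assume "\<eta> > 0"
    have "integral torus_square (\<lambda>p. d p * d p) \<le> (\<eta> / (B + 1)) * B" using B(1) \<open>\<eta> > 0\<close> by (intro small) auto
    also have "\<dots> \<le> 0 + \<eta>" using B(1) \<open>\<eta> > 0\<close> by (simp add: divide_simps)
    finally show "integral torus_square (\<lambda>p. d p * d p) \<le> 0 + \<eta>" .
  qed
  moreover have dd: "continuous_on UNIV (\<lambda>p. d p * d p)" by (intro continuous_intros dc)
  moreover have "integral torus_square (\<lambda>p. d p * d p) \<ge> 0"
    by (intro integral_nonneg integrable_torus_square dd) auto
  ultimately have I: "((\<lambda>p. d p * d p) has_integral 0) torus_square"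
    using integrable_integral[OF integrable_torus_square[OF dd]] by simp
  have ne: "box (- 1/2, - 1/2) (1/2, 1/2 :: real) \<noteq> ({} :: (real \<times> real) set)"
    by (auto simp: box_ne_empty Basis_prod_def)
  have "d p * d p = 0" if "p \<in> torus_square" for p
    by (rule has_integral_0_cbox_imp_0[OF continuous_on_subset[OF dd subset_UNIV] _ I[unfolded torus_square_cbox] ne
      that[unfolded torus_square_cbox]]) simp
  then have z: "d p = 0" if "p \<in> torus_square" for p using that by (simp only: mult_eq_0_iff disj_absorb)
  have "\<psi> p = \<psi>' p" for p using periodic2_zero[OF dp z, of p] by (simp add: d_def)
  then show ?thesis by (rule ext)
qed

lemma inv_laplacian_eqI: "is_inv_laplacian g \<psi> \<Longrightarrow> inv_laplacian g = \<psi>"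
  unfolding inv_laplacian_def by (rule the_equality) (auto intro: is_inv_laplacian_unique)

subsection \<open>The limit of vanishing regularisation\<close>

lemma usol_C_k: "e \<in> I0 \<Longrightarrow> C_k_on UNIV (usol e) k"
  using PC_slice(1)[OF Upar_PC, of e k] by (simp add: Upar_def)

lemma usol_laplacian:
  assumes e: "e \<in> I0"
  shows "laplacian (usol e) p = - fe e (usol e p)"
proof -
  let ?g = "\<lambda>q. usol e q + fe e (usol e q)"
  note o = OO1D[OF usol_rhs_OO1[OF e]]
  have c2: "C_k_on UNIV (usol e) (Suc (Suc 0))" by (rule usol_C_k[OF e])
  have ex: "dx (usol e) = RX ?g" "dy (usol e) = RY ?g" using usol_dx[OF e] usol_dy[OF e] by auto
  have "dx (RX ?g) p = RX (dx ?g) p" "dy (RY ?g) p = RY (dy ?g) p"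
    using dx_eqI[OF C_k_on_differentiable[OF C_k_on_dx[OF c2, unfolded ex]] resolvent_second_derivatives(3)[OF o(1,3)], of "fst p" "snd p"]
      dy_eqI[OF C_k_on_differentiable[OF C_k_on_dy[OF c2, unfolded ex]] resolvent_second_derivatives(4)[OF o(1,3)], of "fst p" "snd p"]
    by simp_all
  then have "laplacian (usol e) p = RR ?g p - ?g p"
    unfolding laplacian_def ex using resolvent_identity[OF o(1,3), of p] by simp
  then show ?thesis unfolding usol_fixpoint[OF e, symmetric] by simp
qed

lemma laplacian_minus:
  assumes "C_k_on UNIV f 2"
  shows "laplacian (\<lambda>p. - f p) p = - laplacian f p"
proof -
  have c2: "C_k_on UNIV f (Suc (Suc 0))" using assms by (simp add: numeral_2_eq_2)
  note c1 = C_k_on_SucD[OF c2]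
  have x: "dx (\<lambda>p. - g p) = (\<lambda>p. - dx g p)" "dy (\<lambda>p. - g p) = (\<lambda>p. - dy g p)" if g: "C_k_on UNIV g (Suc 0)" for g
  proof -
    note d = C_k_on_differentiable[OF g] C_k_on_differentiable[OF C_k_on_minus[OF open_UNIV g]]
    show "dx (\<lambda>p. - g p) = (\<lambda>p. - dx g p)" "dy (\<lambda>p. - g p) = (\<lambda>p. - dy g p)"
      using dx_eqI[OF d(2) DERIV_minus[OF has_real_derivative_dx[OF d(1)]]]
        dy_eqI[OF d(2) DERIV_minus[OF has_real_derivative_dy[OF d(1)]]] by auto
  qed
  show ?thesis unfolding laplacian_def
    by (simp add: x(1)[OF c1] x(2)[OF c1] x(1)[OF C_k_on_dx[OF c2]] x(2)[OF C_k_on_dy[OF c2]])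
qed

text \<open>A sequence decreasing to 0; the 40001 places the term with n = 0 strictly below the open
  endpoint of \<open>I0\<close>.\<close>

definition en :: "nat \<Rightarrow> real" where "en n = 1 / (40001 + real n)"

lemma en_I0: "en n \<in> I0"
  unfolding en_def I0_def by (simp add: divide_simps)

lemma en_mono: "m \<le> n \<Longrightarrow> en n \<le> en m"
  unfolding en_def by (intro divide_left_mono) auto

lemma en_tendsto: "en \<longlonglongrightarrow> 0"
  unfolding en_def by real_asymp

definition u0 :: "real \<times> real \<Rightarrow> real" where "u0 p = lim (\<lambda>n. usol (en n) p)"

lemma u0_tendsto: "(\<lambda>n. usol (en n) p) \<longlonglongrightarrow> u0 p"
proof -
  obtain q \<sigma> where q: "q \<in> quarter" "\<And>f. odd_odd f \<Longrightarrow> periodic2 f \<Longrightarrow> f p = \<sigma> * f q"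
    by (rule fold_quarter[of p]) blast
  have "incseq (\<lambda>n. usol (en n) q)"
    unfolding incseq_def using usol_antimono[OF en_I0 en_I0 en_mono q(1)] by blast
  moreover have "usol (en n) q \<le> 1/16" for n using usol_basic(3)[OF en_I0, of n q] by linarith
  ultimately obtain L where "(\<lambda>n. usol (en n) q) \<longlonglongrightarrow> L" using incseq_convergent[of "\<lambda>n. usol (en n) q" "1/16"] by metis
  then have "(\<lambda>n. \<sigma> * usol (en n) q) \<longlonglongrightarrow> \<sigma> * L" by (intro tendsto_intros)
  then have "(\<lambda>n. usol (en n) p) \<longlonglongrightarrow> \<sigma> * L"
    using q(2)[OF usol_basic(2,1)[OF en_I0]] by simp
  then show ?thesis unfolding u0_def using limI by metis
qed

lemma u0_basic: "periodic2 u0" "odd_odd u0" "\<bar>u0 p - u0 q\<bar> \<le> 4 * cX * dist p q"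
proof -
  note i = usol_basic(1,2)[OF en_I0]
  have "u0 (x + 1, y) = u0 (x, y)" "u0 (x, y + 1) = u0 (x, y)" for x y
    unfolding u0_def using i(1) by (simp_all add: periodic2_def)
  then show "periodic2 u0" by (simp add: periodic2_def)
  have "u0 (- x, y) = - u0 (x, y)" "u0 (x, - y) = - u0 (x, y)" for x y
    using i(2) LIMSEQ_unique[OF u0_tendsto[of "(- x, y)"]] LIMSEQ_unique[OF u0_tendsto[of "(x, - y)"]]
      tendsto_minus[OF u0_tendsto[of "(x, y)"]] by (simp_all add: odd_odd_def)
  then show "odd_odd u0" by (simp add: odd_odd_def)
  have "(\<lambda>n. \<bar>usol (en n) p - usol (en n) q\<bar>) \<longlonglongrightarrow> \<bar>u0 p - u0 q\<bar>"
    by (intro tendsto_intros u0_tendsto)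
  then show "\<bar>u0 p - u0 q\<bar> \<le> 4 * cX * dist p q"
    by (rule LIMSEQ_le_const2) (use usol_lipschitz[OF en_I0] in blast)
qed

lemma u0_continuous: "continuous_on UNIV u0"
proof -
  have "(4 * cX)-lipschitz_on UNIV u0"
    by (rule lipschitz_onI) (use u0_basic(3) cX_nonneg in \<open>auto simp: dist_real_def\<close>)
  then show ?thesis by (rule lipschitz_on_continuous_on)
qed

text \<open>\<open>en\<close> eventually falls below any given e, so the limit along this sequence
  dominates the whole family; convergence for all e \<rightarrow> 0 follows without
  subsequences.\<close>

lemma usol_le_u0:
  assumes e: "e \<in> I0" and q: "q \<in> quarter"
  shows "usol e q \<le> u0 q"
proof (rule LIMSEQ_le_const[OF u0_tendsto])
  have "\<forall>\<^sub>F n in sequentially. en n < e" using order_tendstoD(2)[OF en_tendsto I0D(1)[OF e]] .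
  then obtain N where N: "\<And>n. n \<ge> N \<Longrightarrow> en n < e" by (auto simp: eventually_sequentially)
  then have "usol e q \<le> usol (en n) q" if "n \<ge> N" for n
    using usol_antimono[OF en_I0 e _ q] that by (meson less_imp_le)
  then show "\<exists>N. \<forall>n\<ge>N. usol e q \<le> usol (en n) q" by blast
qed

text \<open>Dini's argument: the convergence is monotone on the compact quarter, hence uniform.\<close>
lemma usol_uniform:
  assumes "\<eta> > 0"
  obtains e1 where "e1 \<in> I0" "\<And>e p. e \<in> I0 \<Longrightarrow> e \<le> e1 \<Longrightarrow> \<bar>u0 p - usol e p\<bar> \<le> \<eta>"
proof -
  let ?U = "\<lambda>n. {p. u0 p - usol (en n) p < \<eta>}"
  have cpt: "compact quarter" unfolding quarter_def by (intro compact_Times) auto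
  have op: "open (?U n)" for n
    by (intro open_Collect_less continuous_intros u0_continuous usol_continuous en_I0)
  have cov: "quarter \<subseteq> (\<Union>n\<in>UNIV. ?U n)"
  proof
    fix p assume "p \<in> quarter"
    have "(\<lambda>n. u0 p - usol (en n) p) \<longlonglongrightarrow> u0 p - u0 p" by (intro tendsto_intros u0_tendsto)
    then have "\<forall>\<^sub>F n in sequentially. u0 p - usol (en n) p < \<eta>" using assms by (intro order_tendstoD) auto
    then show "p \<in> (\<Union>n\<in>UNIV. ?U n)" by (auto simp: eventually_sequentially)
  qed
  obtain D where D: "finite D" "quarter \<subseteq> (\<Union>n\<in>D. ?U n)"
    by (rule compactE_image[OF cpt op cov])
  \<comment> \<open>Inserting 0 keeps the maximum meaningful for an empty D. By monotonicity in e
    the single index N serves for the whole finite cover.\<close>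
  define N where "N = Max (insert 0 D)"
  have N: "n \<le> N" if "n \<in> D" for n using D(1) that by (auto simp: N_def)
  show thesis
  proof (rule that[of "en N"])
    fix e p assume e: "e \<in> I0" "e \<le> en N"
    show "\<bar>u0 p - usol e p\<bar> \<le> \<eta>"
    proof (rule abs_le_from_quarter)
      show "odd_odd (\<lambda>p. u0 p - usol e p)" "periodic2 (\<lambda>p. u0 p - usol e p)"
        using u0_basic(1,2) usol_basic(1,2)[OF e(1)] by (auto simp: odd_odd_def periodic2_def)
      fix q assume q: "q \<in> quarter"
      then obtain n where n: "n \<in> D" "u0 q - usol (en n) q < \<eta>" using D(2) by blast
      have "usol (en n) q \<le> usol e q"
        by (rule usol_antimono[OF e(1) en_I0 order_trans[OF e(2) en_mono[OF N[OF n(1)]]] q])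
      then show "\<bar>u0 q - usol e q\<bar> \<le> \<eta>" using usol_le_u0[OF e(1) q] n(2) by linarith
    qed
  qed (rule en_I0)
qed

text \<open>Inside the quarter the solutions stay above a positive value independent of e, so f is
  squeezed between its value there, which tends to 1, and 1. On the sides both expressions vanish,
  and the common sign carries the result to the plane.\<close>

lemma fe_usol_tendsto: "(\<lambda>n. fe (en n) (usol (en n) p)) \<longlonglongrightarrow> sgn (ss p)"
proof -
  obtain q \<sigma> where q: "q \<in> quarter" "\<bar>\<sigma>\<bar> = 1" "\<And>f. odd_odd f \<Longrightarrow> periodic2 f \<Longrightarrow> f p = \<sigma> * f q"
    by (rule fold_quarter[of p]) blast
  have ps: "ss p = \<sigma> * ss q" using q(3)[OF OO1D(4,3)[OF ss_OO1]] .
  have pf: "fe (en n) (usol (en n) p) = \<sigma> * fe (en n) (usol (en n) q)" for n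
    using q(3)[OF OO1D(4,3)[OF fe_OO1[OF I0D(1)[OF en_I0] usol_OO1[OF en_I0]]]] .
  have "(\<lambda>n. fe (en n) (usol (en n) q)) \<longlonglongrightarrow> sgn (ss q)"
  proof (cases "ss q = 0")
    case True
    have "fst q = 0 \<or> fst q = 1/2 \<or> snd q = 0 \<or> snd q = 1/2"
    proof (rule ccontr)
      assume "\<not> ?thesis"
      then have "0 < 2 * pi * fst q" "2 * pi * fst q < pi" "0 < 2 * pi * snd q" "2 * pi * snd q < pi"
        using q(1) by (auto simp: quarter_def mem_Times_iff)
      then have "ss q > 0" unfolding ss_def by (intro mult_pos_pos[OF sin_gt_zero sin_gt_zero])
      then show False using True by simp
    qed
    then have "usol (en n) (fst q, snd q) = 0" for n
      by (intro odd_odd_periodic_boundary usol_basic en_I0)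
    then show ?thesis using True by (simp add: fe_def)
  next
    case False
    then have s: "ss q > 0" using ss_nonneg[OF q(1)] by simp
    define t where "t = (1/200) * ss q"
    have t: "t > 0" using s by (simp add: t_def)
    have "(\<lambda>n. t / sqrt (en n + t\<^sup>2)) \<longlonglongrightarrow> t / sqrt (0 + t\<^sup>2)"
      using t by (intro tendsto_intros en_tendsto) simp
    then have l: "(\<lambda>n. fe (en n) t) \<longlonglongrightarrow> 1" using t by (simp add: fe_def)
    have "(\<lambda>n. fe (en n) (usol (en n) q)) \<longlonglongrightarrow> 1"
    proof (rule tendsto_sandwich[OF _ _ l tendsto_const])
      show "\<forall>\<^sub>F n in sequentially. fe (en n) t \<le> fe (en n) (usol (en n) q)"
        unfolding t_def by (intro always_eventually allI fe_mono I0D(1) en_I0 usol_basic(4) q(1))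
      show "\<forall>\<^sub>F n in sequentially. fe (en n) (usol (en n) q) \<le> 1"
        using fe_abs_le[OF I0D(1)[OF en_I0]] by (intro always_eventually allI) (metis abs_le_D1)
    qed
    then show ?thesis using s by simp
  qed
  then have "(\<lambda>n. \<sigma> * fe (en n) (usol (en n) q)) \<longlonglongrightarrow> \<sigma> * sgn (ss q)" by (intro tendsto_intros)
  moreover have "sgn (ss p) = \<sigma> * sgn (ss q)"
  proof -
    have "\<sigma> = 1 \<or> \<sigma> = - 1" using q(2) by linarith
    then show ?thesis unfolding ps by (auto simp: sgn_minus)
  qed
  ultimately show ?thesis by (simp add: pf)
qed

section \<open>Identification of the limit with the Bahouri-Chemin stream function\<close>

lemma usol_weak:
  assumes e: "e \<in> I0" and \<phi>: "torus_smooth \<phi>"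
  shows "integral torus_square (\<lambda>p. - usol e p * laplacian \<phi> p) = integral torus_square (\<lambda>p. fe e (usol e p) * \<phi> p)"
proof -
  have c: "C_k_on UNIV (\<lambda>p. - usol e p) 2" by (rule C_k_on_minus[OF open_UNIV usol_C_k[OF e]])
  have "integral torus_square (\<lambda>p. - usol e p * laplacian \<phi> p) = integral torus_square (\<lambda>p. laplacian (\<lambda>p. - usol e p) p * \<phi> p)"
    by (rule green_identity[OF c _ torus_smooth_C_k[OF \<phi>]]) (use usol_basic(1)[OF e] in \<open>simp add: periodic2_def\<close>)
  then show ?thesis by (simp add: laplacian_minus[OF usol_C_k[OF e]] usol_laplacian[OF e])
qed

text \<open>The excluded lines are those where the conventions differ: a factor of
  \<open>bc_vorticity\<close> is -1 there, whereas the sine vanishes.\<close>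

lemma bc_vorticity_eq_sgn:
  assumes "p \<in> torus_square" "fst p \<notin> {-1/2, 0, 1/2}" "snd p \<notin> {-1/2, 0, 1/2}"
  shows "bc_vorticity p = sgn (ss p)"
proof -
  have *: "sgnm (wrap t) = sgn (sin (2 * pi * t))" if t: "- 1/2 \<le> t" "t \<le> 1/2" "t \<notin> {-1/2, 0, 1/2}" for t
  proof -
    have "\<lfloor>t + 1/2\<rfloor> = 0" using t by (auto simp: floor_eq_iff)
    then have w: "wrap t = t" by (simp add: wrap_def)
    show ?thesis
    proof (cases "t > 0")
      case True
      have "2 * pi * t < pi" using t by auto
      then have "sin (2 * pi * t) > 0" using True by (intro sin_gt_zero) auto
      then show ?thesis using True by (simp add: w sgnm_def)
    next
      case False
      have "- t < 1/2" "0 < - t" using t False by auto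
      then have "2 * pi * (- t) < pi" "0 < - t" using mult_strict_left_mono[of "- t" "1/2" "2 * pi"] by simp_all
      then have "sin (2 * pi * (- t)) > 0"
        using mult_pos_pos[of "2 * pi" "- t"] by (intro sin_gt_zero) simp_all
      then show ?thesis using False by (simp add: w sgnm_def)
    qed
  qed
  show ?thesis using assms unfolding bc_vorticity_def ss_def sgn_mult
    by (auto simp: * torus_square_def mem_Times_iff)
qed

text \<open>Both sides of the weak equation pass to the limit by dominated convergence, as the
  solutions are bounded by 1/16 and f by 1. The pointwise limit of f differs from the vorticity at
  most on finitely many lines in the square, a negligible set.\<close>

lemma u0_is_inv_laplacian: "is_inv_laplacian bc_vorticity (\<lambda>p. - u0 p)"
  unfolding is_inv_laplacian_def
proof (intro conjI allI impI)
  show "periodic2 (\<lambda>p. - u0 p)" using u0_basic(1) by (simp add: periodic2_def)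
  show c: "continuous_on UNIV (\<lambda>p. - u0 p)" by (intro continuous_intros u0_continuous)
  show "integral torus_square (\<lambda>p. - u0 p) = 0"
    by (rule odd_odd_mean_zero[OF c]) (use u0_basic(2) in \<open>simp add: odd_odd_def\<close>)
  fix \<phi> assume \<phi>: "torus_smooth \<phi>"
  note cl = laplacian_continuous[OF \<phi>]
  have c\<phi>: "continuous_on UNIV \<phi>" using C_k_on_continuous[OF torus_smooth_C_k(1)[OF \<phi>, of 0]] .
  have "(\<lambda>n. integral torus_square (\<lambda>p. - usol (en n) p * laplacian \<phi> p)) \<longlonglongrightarrow> integral torus_square (\<lambda>p. - u0 p * laplacian \<phi> p)"
  proof (rule dominated_convergence(2)[where h="\<lambda>p. (1/16) * \<bar>laplacian \<phi> p\<bar>"])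
    show "(\<lambda>p. - usol (en n) p * laplacian \<phi> p) integrable_on torus_square" for n
      by (intro integrable_torus_square continuous_intros cl usol_continuous en_I0)
    show "(\<lambda>p. (1/16) * \<bar>laplacian \<phi> p\<bar>) integrable_on torus_square"
      by (intro integrable_torus_square continuous_intros cl)
    show "norm (- usol (en n) p * laplacian \<phi> p) \<le> (1/16) * \<bar>laplacian \<phi> p\<bar>" for n p
      using mult_right_mono[OF usol_basic(3)[OF en_I0, of n p], of "\<bar>laplacian \<phi> p\<bar>"] by (simp add: abs_mult)
    show "(\<lambda>n. - usol (en n) p * laplacian \<phi> p) \<longlonglongrightarrow> - u0 p * laplacian \<phi> p" for p
      by (intro tendsto_intros u0_tendsto)
  qed
  moreover have "(\<lambda>n. integral torus_square (\<lambda>p. fe (en n) (usol (en n) p) * \<phi> p)) \<longlonglongrightarrow> integral torus_square (\<lambda>p. sgn (ss p) * \<phi> p)"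
  proof (rule dominated_convergence(2)[where h="\<lambda>p. \<bar>\<phi> p\<bar>"])
    show "(\<lambda>p. fe (en n) (usol (en n) p) * \<phi> p) integrable_on torus_square" for n
      by (intro integrable_torus_square continuous_intros c\<phi> continuous_on_fe usol_continuous en_I0 I0D(1)[OF en_I0])
    show "(\<lambda>p. \<bar>\<phi> p\<bar>) integrable_on torus_square" by (intro integrable_torus_square continuous_intros c\<phi>)
    show "norm (fe (en n) (usol (en n) p) * \<phi> p) \<le> \<bar>\<phi> p\<bar>" for n p
      using mult_right_mono[OF fe_abs_le[OF I0D(1)[OF en_I0], of n "usol (en n) p"], of "\<bar>\<phi> p\<bar>"] by (simp add: abs_mult)
    show "(\<lambda>n. fe (en n) (usol (en n) p) * \<phi> p) \<longlonglongrightarrow> sgn (ss p) * \<phi> p" for p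
      by (intro tendsto_intros fe_usol_tendsto)
  qed
  ultimately have "integral torus_square (\<lambda>p. - u0 p * laplacian \<phi> p) = integral torus_square (\<lambda>p. sgn (ss p) * \<phi> p)"
    unfolding usol_weak[OF en_I0 \<phi>] by (rule LIMSEQ_unique)
  also have "\<dots> = integral torus_square (\<lambda>p. bc_vorticity p * \<phi> p)"
  proof (rule integral_spike)
    let ?N = "\<Union>c\<in>{-1/2, 0, 1/2}. {p :: real \<times> real. p \<bullet> (1, 0) = c} \<union> {p. p \<bullet> (0, 1) = c}"
    show "negligible ?N"
    proof -
      have "negligible ({p :: real \<times> real. p \<bullet> (1, 0) = c} \<union> {p. p \<bullet> (0, 1) = c})" for c
        by (intro negligible_Un negligible_standard_hyperplane) (auto simp: Basis_prod_def)
      then show ?thesis by (intro negligible_Union) blast+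
    qed
    show "bc_vorticity p * \<phi> p = sgn (ss p) * \<phi> p" if "p \<in> torus_square - ?N" for p
      using bc_vorticity_eq_sgn[of p] that by (cases p) auto
  qed
  finally show "integral torus_square (\<lambda>p. - u0 p * laplacian \<phi> p) = integral torus_square (\<lambda>p. bc_vorticity p * \<phi> p)" .
qed

lemma psi0_eq: "psi0 = (\<lambda>p. - u0 p)"
  unfolding psi0_def by (rule inv_laplacian_eqI[OF u0_is_inv_laplacian])

subsection \<open>Convergence of the gradients\<close>

lemma RY_holder:
  assumes "0 \<le> \<beta>" "\<beta> < 1"
  obtains C where "C \<ge> 0" "\<And>g B p q. C_k_on UNIV g (Suc 0) \<Longrightarrow> periodic2 g \<Longrightarrow> (\<And>q. \<bar>g q\<bar> \<le> B) \<Longrightarrow>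
     \<bar>RX g p - RX g q\<bar> \<le> C * B * dist p q powr \<beta> \<and> \<bar>RY g p - RY g q\<bar> \<le> C * B * dist p q powr \<beta>"
proof -
  obtain C where C: "C \<ge> 0" "\<And>g B p q. C_k_on UNIV g (Suc 0) \<Longrightarrow> periodic2 g \<Longrightarrow> (\<And>q. \<bar>g q\<bar> \<le> B) \<Longrightarrow>
     \<bar>RX g p - RX g q\<bar> \<le> C * B * dist p q powr \<beta>" by (rule RX_holder[OF assms]) blast
  show thesis
  proof (rule that[OF C(1)])
    fix g B p q assume g: "C_k_on UNIV g (Suc 0)" "periodic2 g" "\<And>q. \<bar>g q\<bar> \<le> B"
    let ?s = "\<lambda>q. g (snd q, fst q)"
    have "bounded_linear (\<lambda>q::real \<times> real. (snd q, fst q))"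
      by (intro bounded_linear_Pair bounded_linear_fst bounded_linear_snd)
    from C_k_on_affine[OF open_UNIV this _ g(1), of 0] have c: "C_k_on UNIV ?s (Suc 0)" by simp
    have p: "periodic2 ?s" using g(2) by (simp add: periodic2_def)
    note cg = C_k_on_continuous[OF g(1)]
    have "\<bar>RX ?s (snd p, fst p) - RX ?s (snd q, fst q)\<bar> \<le> C * B * dist (snd p, fst p) (snd q, fst q) powr \<beta>"
      by (rule C(2)[OF c p]) (rule g(3))
    moreover have "dist (snd p, fst p) (snd q, fst q) = dist p q"
      unfolding dist_prod_def by (simp add: add.commute)
    ultimately have "\<bar>RY g p - RY g q\<bar> \<le> C * B * dist p q powr \<beta>"
      using RX_swap[OF cg, of "snd p" "fst p"] RX_swap[OF cg, of "snd q" "fst q"] by simp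
    then show "\<bar>RX g p - RX g q\<bar> \<le> C * B * dist p q powr \<beta> \<and> \<bar>RY g p - RY g q\<bar> \<le> C * B * dist p q powr \<beta>"
      using C(2)[OF g] by blast
  qed
qed

text \<open>Some point within h of s has slope at most 2m/h by the mean value theorem; the Hoelder
  bound carries this to s. With the Hoelder constant fixed, uniform smallness of f thus forces
  uniform smallness of its derivative.\<close>

lemma interpolation:
  fixes f f' :: "real \<Rightarrow> real"
  assumes "\<And>s. (f has_real_derivative f' s) (at s)" "\<And>s. \<bar>f s\<bar> \<le> m"
    "\<And>s t. \<bar>f' s - f' t\<bar> \<le> H * \<bar>s - t\<bar> powr \<beta>" "h > 0" "H \<ge> 0" "\<beta> \<ge> 0"
  shows "\<bar>f' s\<bar> \<le> 2 * m / h + H * h powr \<beta>"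
proof -
  have "\<exists>z>s. z < s + h \<and> f (s + h) - f s = (s + h - s) * f' z"
    by (rule MVT2) (use assms(1,4) in auto)
  then obtain z where z: "s < z" "z < s + h" "f (s + h) - f s = h * f' z" by auto
  have "h * \<bar>f' z\<bar> = \<bar>f (s + h) - f s\<bar>" unfolding z(3) using assms(4) by (simp add: abs_mult)
  also have "\<dots> \<le> 2 * m" using assms(2)[of s] assms(2)[of "s + h"] by linarith
  finally have "h * \<bar>f' z\<bar> \<le> 2 * m" .
  then have "\<bar>f' z\<bar> \<le> 2 * m / h" using assms(4) by (simp add: field_simps)
  moreover have "\<bar>f' s - f' z\<bar> \<le> H * h powr \<beta>"
    using z assms by (intro order_trans[OF assms(3)] mult_left_mono powr_mono2) auto
  ultimately show ?thesis by linarith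
qed

text \<open>At distances at least h the quotient is controlled by the sup norm d, at smaller ones by
  the stronger exponent \<beta>. Choosing h first and d afterwards makes the sum small.\<close>

lemma holder_bound:
  assumes "0 \<le> \<alpha>" "\<alpha> < \<beta>" "h > 0" "H \<ge> 0" "p \<noteq> q" "\<And>p. \<bar>g p\<bar> \<le> d" "\<bar>g p - g q\<bar> \<le> H * dist p q powr \<beta>"
  shows "\<bar>g p - g q\<bar> / dist p q powr \<alpha> \<le> 2 * d / h powr \<alpha> + H * h powr (\<beta> - \<alpha>)"
proof -
  define t where "t = dist p q"
  have t: "t > 0" using assms(5) by (simp add: t_def)
  have d: "d \<ge> 0" using order_trans[OF abs_ge_zero assms(6)] by blast
  have ta: "t powr \<alpha> > 0" "h powr \<alpha> > 0" using t assms(3) by auto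
  show ?thesis
  proof (cases "t \<ge> h")
    case True
    have "\<bar>g p - g q\<bar> \<le> 2 * d" using assms(6)[of p] assms(6)[of q] by linarith
    then have "\<bar>g p - g q\<bar> / t powr \<alpha> \<le> 2 * d / h powr \<alpha>"
      using True assms(1,3) d by (intro frac_le powr_mono2) auto
    then show ?thesis using assms(4) by (simp add: t_def add_increasing2)
  next
    case False
    have "\<bar>g p - g q\<bar> / t powr \<alpha> \<le> H * t powr \<beta> / t powr \<alpha>"
      using assms(7) ta by (intro divide_right_mono) (auto simp: t_def)
    also have "\<dots> = H * t powr (\<beta> - \<alpha>)" by (simp add: powr_diff)
    also have "\<dots> \<le> H * h powr (\<beta> - \<alpha>)" using False t assms by (intro mult_left_mono powr_mono2) auto
    finally show ?thesis using d ta by (simp add: t_def add_increasing)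
  qed
qed

text \<open>H is independent of e because the function u + f under the averaging operators is
  bounded by 2 for all e, while its derivatives are not controlled uniformly.\<close>

lemma usol_gradient_holder:
  assumes "0 \<le> \<beta>" "\<beta> < 1"
  obtains H where "H \<ge> 0" "\<And>e p q. e \<in> I0 \<Longrightarrow>
    \<bar>dx (usol e) p - dx (usol e) q\<bar> \<le> H * dist p q powr \<beta> \<and> \<bar>dy (usol e) p - dy (usol e) q\<bar> \<le> H * dist p q powr \<beta>"
proof -
  obtain C where C: "C \<ge> 0" "\<And>g B p q. C_k_on UNIV g (Suc 0) \<Longrightarrow> periodic2 g \<Longrightarrow> (\<And>q. \<bar>g q\<bar> \<le> B) \<Longrightarrow>
     \<bar>RX g p - RX g q\<bar> \<le> C * B * dist p q powr \<beta> \<and> \<bar>RY g p - RY g q\<bar> \<le> C * B * dist p q powr \<beta>"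
    by (rule RY_holder[OF assms]) blast
  show thesis
  proof (rule that[of "C * 2"])
    show "\<bar>dx (usol e) p - dx (usol e) q\<bar> \<le> C * 2 * dist p q powr \<beta> \<and> \<bar>dy (usol e) p - dy (usol e) q\<bar> \<le> C * 2 * dist p q powr \<beta>"
      if e: "e \<in> I0" for e p q
      unfolding usol_dx[OF e] usol_dy[OF e]
      by (rule C(2)[OF OO1D(1,3)[OF usol_rhs_OO1[OF e]] usol_rhs_le[OF e]])
  qed (use C(1) in simp)
qed

lemma dist_Pair_same: "dist (s, y) (t, y) = \<bar>s - t\<bar>" "dist (x, s) (x, t) = \<bar>s - t\<bar>" for s t x y :: real
  by (simp_all add: dist_Pair_Pair dist_real_def)

lemma usol_gradient_cauchy:
  assumes "\<eta> > 0"
  obtains e1 where "e1 \<in> I0" "\<And>e e' p. e \<in> I0 \<Longrightarrow> e \<le> e1 \<Longrightarrow> e' \<in> I0 \<Longrightarrow> e' \<le> e1 \<Longrightarrow>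
    \<bar>dx (usol e) p - dx (usol e') p\<bar> \<le> \<eta> \<and> \<bar>dy (usol e) p - dy (usol e') p\<bar> \<le> \<eta>"
proof -
  obtain H where H: "H \<ge> 0" "\<And>e p q. e \<in> I0 \<Longrightarrow>
    \<bar>dx (usol e) p - dx (usol e) q\<bar> \<le> H * dist p q powr (1/2) \<and> \<bar>dy (usol e) p - dy (usol e) q\<bar> \<le> H * dist p q powr (1/2)"
    by (rule usol_gradient_holder[of "1/2"]) auto
  have "((\<lambda>h. 2 * H * h powr (1/2)) \<longlongrightarrow> 2 * H * 0 powr (1/2)) (at_right 0)"
    by (rule tendsto_intros | simp add: eventually_at_right_less eventually_mono[OF eventually_at_right_less])+
  then have "\<forall>\<^sub>F h in at_right 0. 2 * H * h powr (1/2) < \<eta> / 2"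
    using assms by (intro order_tendstoD(2)) auto
  then have "\<forall>\<^sub>F h in at_right (0::real). 2 * H * h powr (1/2) < \<eta> / 2 \<and> 0 < h"
    using eventually_at_right_less eventually_conj by blast
  then obtain h where h: "h > 0" "2 * H * h powr (1/2) < \<eta> / 2"
    using eventually_happens'[OF trivial_limit_at_right_real] by blast
  \<comment> \<open>h is fixed by the Hoelder term alone; then m is chosen so that 2m/h =
    \<eta>/2.\<close>
  define m where "m = \<eta> * h / 4"
  have m: "m > 0" using assms h by (simp add: m_def)
  obtain e1 where e1: "e1 \<in> I0" "\<And>e p. e \<in> I0 \<Longrightarrow> e \<le> e1 \<Longrightarrow> \<bar>u0 p - usol e p\<bar> \<le> m / 2"
    by (rule usol_uniform[of "m / 2"]) (use m in auto)
  show thesis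
  proof (rule that[OF e1(1)])
    fix e e' p assume e: "e \<in> I0" "e \<le> e1" "e' \<in> I0" "e' \<le> e1"
    have mm: "2 * m / h = \<eta> / 2" using h by (simp add: m_def)
    have b: "\<bar>usol e q - usol e' q\<bar> \<le> m" for q using e1(2)[OF e(1,2), of q] e1(2)[OF e(3,4), of q] by linarith
    have HH: "\<bar>(a - c) - (b - d)\<bar> \<le> 2 * H * t" if "\<bar>a - b\<bar> \<le> H * t" "\<bar>c - d\<bar> \<le> H * t" for a b c d t :: real
      using that by linarith
    note D = C_k_on_differentiable[OF OO1D(1)[OF usol_OO1[OF e(1)]]] C_k_on_differentiable[OF OO1D(1)[OF usol_OO1[OF e(3)]]]
    have "\<bar>dx (usol e) (fst p, snd p) - dx (usol e') (fst p, snd p)\<bar> \<le> 2 * m / h + 2 * H * h powr (1/2)"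
    proof (rule interpolation[where f="\<lambda>s. usol e (s, snd p) - usol e' (s, snd p)" and f'="\<lambda>s. dx (usol e) (s, snd p) - dx (usol e') (s, snd p)"])
      show "\<bar>(dx (usol e) (s, snd p) - dx (usol e') (s, snd p)) - (dx (usol e) (t, snd p) - dx (usol e') (t, snd p))\<bar> \<le> 2 * H * \<bar>s - t\<bar> powr (1/2)" for s t
        using H(2)[OF e(1), of "(s, snd p)" "(t, snd p)"] H(2)[OF e(3), of "(s, snd p)" "(t, snd p)"]
        unfolding dist_Pair_same by (intro HH) auto
    qed (use h H(1) b in \<open>auto intro!: DERIV_diff has_real_derivative_dx D\<close>)
    moreover have "\<bar>dy (usol e) (fst p, snd p) - dy (usol e') (fst p, snd p)\<bar> \<le> 2 * m / h + 2 * H * h powr (1/2)"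
    proof (rule interpolation[where f="\<lambda>s. usol e (fst p, s) - usol e' (fst p, s)" and f'="\<lambda>s. dy (usol e) (fst p, s) - dy (usol e') (fst p, s)"])
      show "\<bar>(dy (usol e) (fst p, s) - dy (usol e') (fst p, s)) - (dy (usol e) (fst p, t) - dy (usol e') (fst p, t))\<bar> \<le> 2 * H * \<bar>s - t\<bar> powr (1/2)" for s t
        using H(2)[OF e(1), of "(fst p, s)" "(fst p, t)"] H(2)[OF e(3), of "(fst p, s)" "(fst p, t)"]
        unfolding dist_Pair_same by (intro HH) auto
    qed (use h H(1) b in \<open>auto intro!: DERIV_diff has_real_derivative_dy D\<close>)
    ultimately show "\<bar>dx (usol e) p - dx (usol e') p\<bar> \<le> \<eta> \<and> \<bar>dy (usol e) p - dy (usol e') p\<bar> \<le> \<eta>"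
      using h(2) mm by simp
  qed
qed

lemma u0_gradient:
  obtains ux uy where
    "\<And>x y. ((\<lambda>s. u0 (s, y)) has_real_derivative ux (x, y)) (at x)"
    "\<And>x y. ((\<lambda>s. u0 (x, s)) has_real_derivative uy (x, y)) (at y)"
    "continuous_on UNIV ux" "continuous_on UNIV uy"
    "\<And>p. (\<lambda>n. dx (usol (en n)) p) \<longlonglongrightarrow> ux p" "\<And>p. (\<lambda>n. dy (usol (en n)) p) \<longlonglongrightarrow> uy p"
proof -
  have ev: "\<exists>N. \<forall>m\<ge>N. \<forall>n\<ge>N. \<forall>p. \<bar>dx (usol (en m)) p - dx (usol (en n)) p\<bar> \<le> \<eta> \<and> \<bar>dy (usol (en m)) p - dy (usol (en n)) p\<bar> \<le> \<eta>"
    if pos: "\<eta> > 0" for \<eta>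
  proof -
    obtain e1 where e1: "e1 \<in> I0" "\<And>e e' p. e \<in> I0 \<Longrightarrow> e \<le> e1 \<Longrightarrow> e' \<in> I0 \<Longrightarrow> e' \<le> e1 \<Longrightarrow>
      \<bar>dx (usol e) p - dx (usol e') p\<bar> \<le> \<eta> \<and> \<bar>dy (usol e) p - dy (usol e') p\<bar> \<le> \<eta>"
      by (rule usol_gradient_cauchy[OF pos]) blast
    have "\<forall>\<^sub>F n in sequentially. en n < e1" using order_tendstoD(2)[OF en_tendsto I0D(1)[OF e1(1)]] .
    then obtain N where "\<And>n. n \<ge> N \<Longrightarrow> en n < e1" by (auto simp: eventually_sequentially)
    then show ?thesis using e1(2)[OF en_I0 _ en_I0] by (meson less_imp_le)
  qed
  have main: "\<exists>ux. continuous_on UNIV ux \<and> (\<forall>p. (\<lambda>n. f n p) \<longlonglongrightarrow> ux p) \<and>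
      (\<forall>\<eta>>0. \<forall>\<^sub>F n in sequentially. \<forall>p. \<bar>f n p - ux p\<bar> \<le> \<eta>)"
    if f: "\<And>n. continuous_on UNIV (f n)" "\<And>\<eta>. \<eta> > 0 \<Longrightarrow> \<exists>N. \<forall>m\<ge>N. \<forall>n\<ge>N. \<forall>p. \<bar>f m p - f n p\<bar> \<le> \<eta>"
    for f :: "nat \<Rightarrow> real \<times> real \<Rightarrow> real"
  proof -
    have "uniformly_Cauchy_on UNIV f"
      unfolding uniformly_Cauchy_on_def
    proof (intro allI impI)
      fix \<eta> :: real assume "\<eta> > 0"
      then obtain N where N: "\<forall>m\<ge>N. \<forall>n\<ge>N. \<forall>p. \<bar>f m p - f n p\<bar> \<le> \<eta> / 2" using f(2)[of "\<eta> / 2"] half_gt_zero by blast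
      have "dist (f m x) (f n x) < \<eta>" if "m \<ge> N" "n \<ge> N" for m n x
      proof -
        have "\<bar>f m x - f n x\<bar> \<le> \<eta> / 2" using N that by blast
        then show ?thesis using \<open>\<eta> > 0\<close> by (simp add: dist_real_def)
      qed
      then show "\<exists>M. \<forall>x\<in>UNIV. \<forall>m\<ge>M. \<forall>n\<ge>M. dist (f m x) (f n x) < \<eta>"
        by blast
    qed
    then obtain ux where ux: "uniform_limit UNIV f ux sequentially"
      using Cauchy_uniformly_convergent unfolding uniformly_convergent_on_def by blast
    have "continuous_on UNIV ux"
      by (rule uniform_limit_theorem[OF _ ux]) (use f(1) in auto)
    moreover have "(\<lambda>n. f n p) \<longlonglongrightarrow> ux p" for p using tendsto_uniform_limitI[OF ux] by blast
    moreover have "\<forall>\<^sub>F n in sequentially. \<forall>p. \<bar>f n p - ux p\<bar> \<le> \<eta>" if "\<eta> > 0" for \<eta>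
      using uniform_limitD[OF ux that] by eventually_elim (auto simp: dist_real_def less_imp_le)
    ultimately show ?thesis by blast
  qed
  note c1 = OO1D(1)[OF usol_OO1[OF en_I0]]
  have c: "continuous_on UNIV (dx (usol (en n)))" "continuous_on UNIV (dy (usol (en n)))" for n
    using C_k_on_dx[OF c1] C_k_on_dy[OF c1] by simp_all
  obtain ux where ux: "continuous_on UNIV ux" "\<And>p. (\<lambda>n. dx (usol (en n)) p) \<longlonglongrightarrow> ux p"
    "\<And>\<eta>. \<eta> > 0 \<Longrightarrow> \<forall>\<^sub>F n in sequentially. \<forall>p. \<bar>dx (usol (en n)) p - ux p\<bar> \<le> \<eta>"
  proof -
    have "\<exists>N. \<forall>m\<ge>N. \<forall>n\<ge>N. \<forall>p. \<bar>dx (usol (en m)) p - dx (usol (en n)) p\<bar> \<le> \<eta>" if "\<eta> > 0" for \<eta>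
      using ev[OF that] by meson
    from main[of "\<lambda>n. dx (usol (en n))", OF c(1) this] show thesis using that by blast
  qed
  obtain uy where uy: "continuous_on UNIV uy" "\<And>p. (\<lambda>n. dy (usol (en n)) p) \<longlonglongrightarrow> uy p"
    "\<And>\<eta>. \<eta> > 0 \<Longrightarrow> \<forall>\<^sub>F n in sequentially. \<forall>p. \<bar>dy (usol (en n)) p - uy p\<bar> \<le> \<eta>"
  proof -
    have "\<exists>N. \<forall>m\<ge>N. \<forall>n\<ge>N. \<forall>p. \<bar>dy (usol (en m)) p - dy (usol (en n)) p\<bar> \<le> \<eta>" if "\<eta> > 0" for \<eta>
      using ev[OF that] by meson
    from main[of "\<lambda>n. dy (usol (en n))", OF c(2) this] show thesis using that by blast
  qed
  note D = C_k_on_differentiable[OF c1]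
  show thesis
  proof (rule that[OF _ _ ux(1) uy(1) ux(2) uy(2)])
    fix x y
    show "((\<lambda>s. u0 (s, y)) has_real_derivative ux (x, y)) (at x)"
    proof (rule has_real_derivative_limit[where F="\<lambda>n s. usol (en n) (s, y)" and F'="\<lambda>n s. dx (usol (en n)) (s, y)"])
      show "\<forall>\<^sub>F n in sequentially. \<forall>t. \<bar>dx (usol (en n)) (t, y) - ux (t, y)\<bar> \<le> \<eta>" if "\<eta> > 0" for \<eta>
        using ux(3)[OF that] by eventually_elim blast
    qed (rule has_real_derivative_dx[OF D] u0_tendsto)+
    show "((\<lambda>s. u0 (x, s)) has_real_derivative uy (x, y)) (at y)"
    proof (rule has_real_derivative_limit[where F="\<lambda>n s. usol (en n) (x, s)" and F'="\<lambda>n s. dy (usol (en n)) (x, s)"])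
      show "\<forall>\<^sub>F n in sequentially. \<forall>t. \<bar>dy (usol (en n)) (x, t) - uy (x, t)\<bar> \<le> \<eta>" if "\<eta> > 0" for \<eta>
        using uy(3)[OF that] by eventually_elim blast
    qed (rule has_real_derivative_dy[OF D] u0_tendsto)+
  qed
qed

subsection \<open>Convergence in the Hoelder norm\<close>

lemma u0_C1: "C_k_on UNIV u0 (Suc 0)"
  and usol_dx_tendsto: "(\<lambda>n. dx (usol (en n)) p) \<longlonglongrightarrow> dx u0 p"
  and usol_dy_tendsto: "(\<lambda>n. dy (usol (en n)) p) \<longlonglongrightarrow> dy u0 p"
proof -
  obtain ux uy where u:
    "\<And>x y. ((\<lambda>s. u0 (s, y)) has_real_derivative ux (x, y)) (at x)"
    "\<And>x y. ((\<lambda>s. u0 (x, s)) has_real_derivative uy (x, y)) (at y)"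
    "continuous_on UNIV ux" "continuous_on UNIV uy"
    "\<And>p. (\<lambda>n. dx (usol (en n)) p) \<longlonglongrightarrow> ux p" "\<And>p. (\<lambda>n. dy (usol (en n)) p) \<longlonglongrightarrow> uy p"
    by (rule u0_gradient) blast
  show c: "C_k_on UNIV u0 (Suc 0)" by (rule C_k_on_of_partials2[OF u(1,2)]) (use u(3,4) in simp_all)
  have "dx u0 (fst p, snd p) = ux (fst p, snd p)" by (rule dx_eqI[OF C_k_on_differentiable[OF c] u(1)])
  then show "(\<lambda>n. dx (usol (en n)) p) \<longlonglongrightarrow> dx u0 p" using u(5)[of p] by simp
  have "dy u0 (fst p, snd p) = uy (fst p, snd p)" by (rule dy_eqI[OF C_k_on_differentiable[OF c] u(2)])
  then show "(\<lambda>n. dy (usol (en n)) p) \<longlonglongrightarrow> dy u0 p" using u(6)[of p] by simp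
qed

lemma usol_C1: "e \<in> I0 \<Longrightarrow> C_k_on UNIV (usol e) (Suc 0)"
  by (rule OO1D(1)[OF usol_OO1])

lemma gradient_diff:
  assumes "C_k_on UNIV f (Suc 0)" "C_k_on UNIV g (Suc 0)"
  shows "dx (\<lambda>p. f p - g p) p = dx f p - dx g p" "dy (\<lambda>p. f p - g p) p = dy f p - dy g p"
proof -
  note d = C_k_on_differentiable[OF assms(1)] C_k_on_differentiable[OF assms(2)]
    C_k_on_differentiable[OF C_k_on_diff[OF open_UNIV assms]]
  show "dx (\<lambda>p. f p - g p) p = dx f p - dx g p"
    using dx_eqI[OF d(3) DERIV_diff[OF has_real_derivative_dx[OF d(1)] has_real_derivative_dx[OF d(2)]], of "fst p" "snd p"]
    by simp
  show "dy (\<lambda>p. f p - g p) p = dy f p - dy g p"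
    using dy_eqI[OF d(3) DERIV_diff[OF has_real_derivative_dy[OF d(1)] has_real_derivative_dy[OF d(2)]], of "fst p" "snd p"]
    by simp
qed

text \<open>The uniform constant of the regularised gradients passes to the pointwise limit, so
  differences with the limit obey the same estimate with twice the constant.\<close>

lemma u0_gradient_holder:
  assumes "\<And>e p q. e \<in> I0 \<Longrightarrow> \<bar>dx (usol e) p - dx (usol e) q\<bar> \<le> H * dist p q powr \<beta> \<and>
      \<bar>dy (usol e) p - dy (usol e) q\<bar> \<le> H * dist p q powr \<beta>"
  shows "\<bar>dx u0 p - dx u0 q\<bar> \<le> H * dist p q powr \<beta>" "\<bar>dy u0 p - dy u0 q\<bar> \<le> H * dist p q powr \<beta>"
proof -
  note a = assms[OF en_I0]
  show "\<bar>dx u0 p - dx u0 q\<bar> \<le> H * dist p q powr \<beta>"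
    by (rule LIMSEQ_le_const2[OF tendsto_rabs[OF tendsto_diff[OF usol_dx_tendsto usol_dx_tendsto]]]) (use a in blast)
  show "\<bar>dy u0 p - dy u0 q\<bar> \<le> H * dist p q powr \<beta>"
    by (rule LIMSEQ_le_const2[OF tendsto_rabs[OF tendsto_diff[OF usol_dy_tendsto usol_dy_tendsto]]]) (use a in blast)
qed

lemma usol_gradient_uniform:
  assumes pos: "\<eta> > 0"
  obtains e1 where "e1 \<in> I0" "\<And>e p. e \<in> I0 \<Longrightarrow> e \<le> e1 \<Longrightarrow>
    \<bar>dx u0 p - dx (usol e) p\<bar> \<le> \<eta> \<and> \<bar>dy u0 p - dy (usol e) p\<bar> \<le> \<eta>"
proof -
  obtain e1 where e1: "e1 \<in> I0" "\<And>e e' p. e \<in> I0 \<Longrightarrow> e \<le> e1 \<Longrightarrow> e' \<in> I0 \<Longrightarrow> e' \<le> e1 \<Longrightarrow>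
    \<bar>dx (usol e) p - dx (usol e') p\<bar> \<le> \<eta> \<and> \<bar>dy (usol e) p - dy (usol e') p\<bar> \<le> \<eta>"
    by (rule usol_gradient_cauchy[OF pos]) blast
  have "\<forall>\<^sub>F n in sequentially. en n < e1" using order_tendstoD(2)[OF en_tendsto I0D(1)[OF e1(1)]] .
  then obtain N where N: "\<And>n. n \<ge> N \<Longrightarrow> en n < e1" by (auto simp: eventually_sequentially)
  show thesis
  proof (rule that[OF e1(1)], rule conjI)
    fix e p assume e: "e \<in> I0" "e \<le> e1"
    note b = e1(2)[OF en_I0 less_imp_le[OF N] e]
    show "\<bar>dx u0 p - dx (usol e) p\<bar> \<le> \<eta>"
      by (rule LIMSEQ_le_const2[OF tendsto_rabs[OF tendsto_diff[OF usol_dx_tendsto tendsto_const]]]) (use b in blast)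
    show "\<bar>dy u0 p - dy (usol e) p\<bar> \<le> \<eta>"
      by (rule LIMSEQ_le_const2[OF tendsto_rabs[OF tendsto_diff[OF usol_dy_tendsto tendsto_const]]]) (use b in blast)
  qed
qed

lemma C1alpha_norm_le:
  assumes "C_k_on UNIV w (Suc 0)" "\<And>p. \<bar>w p\<bar> \<le> a" "\<And>p. \<bar>dx w p\<bar> \<le> a" "\<And>p. \<bar>dy w p\<bar> \<le> a"
    "\<And>p q. p \<noteq> q \<Longrightarrow> \<bar>dx w p - dx w q\<bar> / dist p q powr \<alpha> \<le> a"
    "\<And>p q. p \<noteq> q \<Longrightarrow> \<bar>dy w p - dy w q\<bar> / dist p q powr \<alpha> \<le> a"
  shows "C1alpha_norm \<alpha> w \<le> ereal (5 * a)"
proof -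
  have "C1alpha_norm \<alpha> w \<le> ereal a + ereal a + ereal a + ereal a + ereal a"
    unfolding C1alpha_norm_def One_nat_def if_P[OF assms(1)] holder_semi_def
    by (intro add_mono SUP_least) (use assms(2-) in auto)
  then show ?thesis by simp
qed

lemma C1alpha_norm_nonneg: "0 \<le> C1alpha_norm \<alpha> w"
proof -
  have "0 \<le> holder_semi \<alpha> g" for g
    unfolding holder_semi_def
    by (rule SUP_upper2[of "((0, 0), (1, 0))"]) auto
  moreover have "0 \<le> (SUP p. ereal \<bar>g p\<bar>)" for g :: "real \<times> real \<Rightarrow> real" by (rule SUP_upper2[of 0]) auto
  ultimately show ?thesis by (simp add: C1alpha_norm_def)
qed

lemma usol_C1alpha_tendsto:
  assumes \<alpha>: "0 \<le> \<alpha>" "\<alpha> < 1"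
  shows "((\<lambda>e. C1alpha_norm \<alpha> (\<lambda>p. u0 p - usol e p)) \<longlongrightarrow> 0) (at_right 0)"
proof -
  \<comment> \<open>Midway between \<alpha> and 1: below 1 the gradient estimate is available, and
    above \<alpha> the factor h^(\<beta> - \<alpha>) tends to 0.\<close>
  define \<beta> where "\<beta> = (1 + \<alpha>) / 2"
  have \<beta>: "0 \<le> \<beta>" "\<beta> < 1" "\<alpha> < \<beta>" using \<alpha> by (auto simp: \<beta>_def)
  obtain H where H: "H \<ge> 0" "\<And>e p q. e \<in> I0 \<Longrightarrow>
    \<bar>dx (usol e) p - dx (usol e) q\<bar> \<le> H * dist p q powr \<beta> \<and> \<bar>dy (usol e) p - dy (usol e) q\<bar> \<le> H * dist p q powr \<beta>"
    by (rule usol_gradient_holder[OF \<beta>(1,2)]) blast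
  have small: "\<forall>\<^sub>F e in at_right 0. C1alpha_norm \<alpha> (\<lambda>p. u0 p - usol e p) \<le> ereal (5 * \<eta>)" if \<eta>: "\<eta> > 0" for \<eta>
  proof -
    have "((\<lambda>h. 2 * H * h powr (\<beta> - \<alpha>)) \<longlongrightarrow> 2 * H * 0 powr (\<beta> - \<alpha>)) (at_right 0)"
      using \<beta>(3) eventually_mono[OF eventually_at_right_less[of "0::real"], of "\<lambda>h. 0 \<le> h"]
      by (intro tendsto_mult[OF tendsto_const tendsto_powr'[OF tendsto_ident_at tendsto_const]]) simp
    then have "\<forall>\<^sub>F h in at_right 0. 2 * H * h powr (\<beta> - \<alpha>) < \<eta> / 2"
      using \<eta> \<beta> by (intro order_tendstoD(2)) auto
    then have "\<forall>\<^sub>F h in at_right (0::real). 2 * H * h powr (\<beta> - \<alpha>) < \<eta> / 2 \<and> 0 < h"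
      using eventually_at_right_less eventually_conj by blast
    then obtain h where h: "h > 0" "2 * H * h powr (\<beta> - \<alpha>) < \<eta> / 2"
      using eventually_happens'[OF trivial_limit_at_right_real] by blast
    \<comment> \<open>The bound \<eta> serves the three sup norms; the second bound makes 2d /
      h^\<alpha> at most \<eta>/2, matching the half left by the choice of h.\<close>
    define d where "d = min \<eta> (\<eta> / 4 * h powr \<alpha>)"
    have d: "d > 0" "d \<le> \<eta>" using \<eta> h by (auto simp: d_def)
    have "2 * d / h powr \<alpha> \<le> 2 * (\<eta> / 4 * h powr \<alpha>) / h powr \<alpha>"
      using h by (intro divide_right_mono mult_left_mono) (auto simp: d_def)
    then have hd: "2 * d / h powr \<alpha> + 2 * H * h powr (\<beta> - \<alpha>) \<le> \<eta>" using h by simp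
    obtain e1 where e1: "e1 \<in> I0" "\<And>e p. e \<in> I0 \<Longrightarrow> e \<le> e1 \<Longrightarrow> \<bar>u0 p - usol e p\<bar> \<le> d"
      by (rule usol_uniform[OF d(1)]) blast
    obtain e2 where e2: "e2 \<in> I0" "\<And>e p. e \<in> I0 \<Longrightarrow> e \<le> e2 \<Longrightarrow>
        \<bar>dx u0 p - dx (usol e) p\<bar> \<le> d \<and> \<bar>dy u0 p - dy (usol e) p\<bar> \<le> d"
      by (rule usol_gradient_uniform[OF d(1)]) blast
    have "C1alpha_norm \<alpha> (\<lambda>p. u0 p - usol e p) \<le> ereal (5 * \<eta>)" if e: "0 < e" "e < min e1 e2" for e
    proof -
      have eI: "e \<in> I0" "e \<le> e1" "e \<le> e2" using e e1(1) by (auto simp: I0_def)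
      note w = gradient_diff[OF u0_C1 usol_C1[OF eI(1)]]
      have b: "\<bar>dx u0 p - dx (usol e) p\<bar> \<le> d" "\<bar>dy u0 p - dy (usol e) p\<bar> \<le> d" "\<bar>u0 p - usol e p\<bar> \<le> d" for p
        using e2(2)[OF eI(1,3)] e1(2)[OF eI(1,2)] by blast+
      have HH: "\<bar>(a - c) - (b - c')\<bar> \<le> 2 * H * t" if "\<bar>a - b\<bar> \<le> H * t" "\<bar>c - c'\<bar> \<le> H * t" for a b c c' t :: real
        using that by linarith
      note Hu = u0_gradient_holder[OF H(2)] and He = conjunct1[OF H(2)[OF eI(1)]] conjunct2[OF H(2)[OF eI(1)]]
      have H2: "2 * H \<ge> 0" using H(1) by simp
      show ?thesis
      proof (rule C1alpha_norm_le[OF C_k_on_diff[OF open_UNIV u0_C1 usol_C1[OF eI(1)]]], unfold w)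
        fix p q :: "real \<times> real"
        show "\<bar>u0 p - usol e p\<bar> \<le> \<eta>" "\<bar>dx u0 p - dx (usol e) p\<bar> \<le> \<eta>" "\<bar>dy u0 p - dy (usol e) p\<bar> \<le> \<eta>"
          using b[of p] d(2) by linarith+
        assume pq: "p \<noteq> q"
        show "\<bar>dx u0 p - dx (usol e) p - (dx u0 q - dx (usol e) q)\<bar> / dist p q powr \<alpha> \<le> \<eta>"
          using holder_bound[where g="\<lambda>p. dx u0 p - dx (usol e) p", OF \<alpha>(1) \<beta>(3) h(1) H2 pq b(1) HH[OF Hu(1) He(1)]] hd by linarith
        show "\<bar>dy u0 p - dy (usol e) p - (dy u0 q - dy (usol e) q)\<bar> / dist p q powr \<alpha> \<le> \<eta>"
          using holder_bound[where g="\<lambda>p. dy u0 p - dy (usol e) p", OF \<alpha>(1) \<beta>(3) h(1) H2 pq b(2) HH[OF Hu(2) He(2)]] hd by linarith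
      qed
    qed
    moreover have "0 < min e1 e2" using I0D(1)[OF e1(1)] I0D(1)[OF e2(1)] by simp
    ultimately show ?thesis unfolding eventually_at_right_field by blast
  qed
  show ?thesis
  proof (rule order_tendstoI)
    show "\<forall>\<^sub>F e in at_right 0. a < C1alpha_norm \<alpha> (\<lambda>p. u0 p - usol e p)" if "a < 0" for a
      by (rule always_eventually) (use that C1alpha_norm_nonneg less_le_trans in blast)
    show "\<forall>\<^sub>F e in at_right 0. C1alpha_norm \<alpha> (\<lambda>p. u0 p - usol e p) < a" if pos: "0 < a" for a
    proof -
      obtain r where r: "0 < ereal r" "ereal r < a" using ereal_dense2[OF pos] by blast
      then have "r / 5 > 0" by simp
      from small[OF this] show ?thesis by eventually_elim (use r(2) in \<open>simp add: le_less_trans\<close>)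
    qed
  qed
qed

theorem theorem1p1:
  shows "\<exists>\<epsilon>0::real. \<epsilon>0 > 0 \<and>
    (\<forall>\<alpha>::real. 0 \<le> \<alpha> \<and> \<alpha> < 1 \<longrightarrow>
      (\<exists>F :: real \<Rightarrow> real \<Rightarrow> real.
         (\<forall>\<epsilon>\<in>{0<..<\<epsilon>0}. smooth_on UNIV (F \<epsilon>) \<and> (\<forall>t. F \<epsilon> (-t) = - F \<epsilon> t)) \<and>
         (\<exists>\<psi> :: real \<Rightarrow> real \<times> real \<Rightarrow> real.
            (\<forall>\<epsilon>\<in>{0<..<\<epsilon>0}.
               torus_smooth (\<psi> \<epsilon>) \<and> odd_odd (\<psi> \<epsilon>) \<and>
               \<psi> \<epsilon> = inv_laplacian (\<lambda>p. F \<epsilon> (\<psi> \<epsilon> p)) \<and>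
               (\<forall>p. \<bar>laplacian (\<psi> \<epsilon>) p\<bar> \<le> 1)) \<and>
            smooth_on ({0<..<\<epsilon>0} \<times> UNIV) (\<lambda>(\<epsilon>, p). \<psi> \<epsilon> p) \<and>
            ((\<lambda>\<epsilon>. C1alpha_norm \<alpha> (\<lambda>p. \<psi> \<epsilon> p - psi0 p)) \<longlongrightarrow> 0) (at_right 0))))"
proof (rule exI[of _ "1/40000"], intro conjI allI impI, goal_cases)
  case 1
  show ?case by simp
next
  case (2 \<alpha>)
  have F: "smooth_on UNIV (\<lambda>t. - fe e t)" "- fe e (- t) = - (- fe e t)" if "e \<in> I0" for e t
    using C_k_on_minus[OF open_UNIV fe_C_k(2)[OF open_UNIV C_k_on_ident I0D(1)[OF that]]]
    by (auto simp: smooth_on_def fe_minus)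
  have P: "torus_smooth (\<lambda>p. - usol e p)" "odd_odd (\<lambda>p. - usol e p)"
      "(\<lambda>p. - usol e p) = inv_laplacian (\<lambda>p. - fe e (- usol e p))" "\<bar>laplacian (\<lambda>p. - usol e p) p\<bar> \<le> 1"
    if e: "e \<in> I0" for e p
  proof -
    show s: "torus_smooth (\<lambda>p. - usol e p)"
      using C_k_on_minus[OF open_UNIV usol_C_k[OF e]] usol_basic(1)[OF e]
      by (simp add: torus_smooth_def smooth_on_def periodic2_def)
    show o: "odd_odd (\<lambda>p. - usol e p)"
      using usol_basic(2)[OF e] by (simp add: odd_odd_def)
    have c: "continuous_on UNIV (\<lambda>p. - usol e p)" using torus_smooth_C_k(1)[OF s, of 0] by simp
    have "is_inv_laplacian (\<lambda>p. - fe e (- usol e p)) (\<lambda>p. - usol e p)"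
      unfolding is_inv_laplacian_def fe_minus minus_minus
      using torus_smooth_C_k(2)[OF s] c odd_odd_mean_zero[OF c o] usol_weak[OF e] by blast
    from inv_laplacian_eqI[OF this] show "(\<lambda>p. - usol e p) = inv_laplacian (\<lambda>p. - fe e (- usol e p))" by simp
    show "\<bar>laplacian (\<lambda>p. - usol e p) p\<bar> \<le> 1"
      unfolding laplacian_minus[OF usol_C_k[OF e]] usol_laplacian[OF e] using fe_abs_le[OF I0D(1)[OF e]] by simp
  qed
  have "C_k_on (I0 \<times> UNIV) (\<lambda>(\<epsilon>, p). - usol \<epsilon> p) k" for k
    using C_k_on_minus[OF open_param[OF open_I0], of Upar k] Upar_PC[of k]
    by (simp add: PC_def Upar_def split_def)
  then have S: "smooth_on (I0 \<times> UNIV) (\<lambda>(\<epsilon>, p). - usol \<epsilon> p)" by (simp add: smooth_on_def)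
  have T: "((\<lambda>\<epsilon>. C1alpha_norm \<alpha> (\<lambda>p. - usol \<epsilon> p - psi0 p)) \<longlongrightarrow> 0) (at_right 0)"
    using usol_C1alpha_tendsto[of \<alpha>] 2 by (simp add: psi0_eq add.commute)
  \<comment> \<open>The endpoint 1/40000 is that of \<open>I0\<close>. The minus signs return from u
    to \<psi> = -u, and the same family serves every \<alpha>.\<close>
  show ?case unfolding I0_def[symmetric]
    by (rule exI[of _ "\<lambda>e t. - fe e t"], rule conjI, use F in blast, rule exI[of _ "\<lambda>e p. - usol e p"])
       (intro conjI S T ballI allI P; assumption)
qed

end
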